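(* Let $U\in C^4([-1,1])$ be real-valued with $U(x)>U(-1)$ for all $x\in(-1,1]$ and $U'(-1)=1$. Then for every $\alpha_0>0$ and every $\varepsilon>0$ there exists $\beta_0>0$ such that for all $\beta\ge\beta_0$ and all $\alpha\in[0,\alpha_0]$ there exists $\lambda\in\mathbb{C}$ satisfying $$|\lambda-\lambda_0(\beta)-i\,U(-1)|\le\beta^{-1/2+\varepsilon}$$ for which $\operatorname{Ker}\mathcal{B}^{\mathfrak D}_{\lambda,\alpha,\beta}\neq\{0\}$.
   Context: For $\lambda\in\mathbb{C}$, $\alpha\ge0$, $\beta>0$, the Orr–Sommerfeld operator $\mathcal{B}^{\mathfrak D}_{\lambda,\alpha,\beta}$ is the operator in $L^2(-1,1)$ given by the differential expression $$\mathcal{B}_{\lambda,\alpha,\beta}=\Big(-\frac{d^2}{dx^2}+i\beta U-\beta\lambda\Big)\Big(\frac{d^2}{dx^2}-\alpha^2\Big)-i\beta U''$$ on the domain $\{u\in H^4(-1,1): u(\pm1)=u'(\pm1)=0\}$. For $\beta>0$, $\mathcal{L}^{(0)}_{0,\beta}$ is the operator $-\frac{d^2}{dx^2}+i\beta(1+x)$ in $L^2(-1,+\infty)$ with domain $$D(\mathcal{L}^{(0)}_{0,\beta})=\Big\{u\in H^2(-1,+\infty): \int_{-1}^{\infty}u\,dx=0,\ (1+x)u\in L^2(-1,\infty)\Big\}.$$ Let $\check\lambda_0(\beta)$ be the leftmost eigenvalue (the one with smallest real part) of $\mathcal{L}^{(0)}_{0,\beta}$, and set $\lambda_0(\beta)=\check\lambda_0(\beta)/\beta$.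 By homogeneity, $\lambda_0(\beta)=\beta^{-1/3}\lambda_0(1)$. *)

theory Defs
  imports "HOL-Analysis.Analysis"
begin

section \<open>Functions of class C^n on a subset of the line\<close>

text \<open>Derivatives are taken within \<open>S\<close>; at the endpoints of a closed interval they are the
  one-sided derivatives.\<close>

definition deriv_within :: "real set \<Rightarrow> (real \<Rightarrow> real) \<Rightarrow> real \<Rightarrow> real" where
  "deriv_within S f = (\<lambda>x. vector_derivative f (at x within S))"

definition C_class_on :: "nat \<Rightarrow> real set \<Rightarrow> (real \<Rightarrow> real) \<Rightarrow> bool" where
  "C_class_on n S f \<longleftrightarrow>
     (\<forall>k<n. (deriv_within S ^^ k) f differentiable_on S) \<and>
     continuous_on S ((deriv_within S ^^ n) f)"


section \<open>Square-integrable functions and Sobolev spaces\<close>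

text \<open>Elements of \<open>L\<^sup>2(S)\<close> are represented by functions on the whole line; only their values
  on \<open>S\<close>, up to null sets, are relevant.  Equality in \<open>L\<^sup>2(S)\<close> is \<open>ae_eq_on S\<close>.\<close>

definition ae_eq_on :: "real set \<Rightarrow> (real \<Rightarrow> complex) \<Rightarrow> (real \<Rightarrow> complex) \<Rightarrow> bool" where
  "ae_eq_on S u v \<longleftrightarrow> (AE x\<in>S in lebesgue. u x = v x)"

definition L2_on :: "real set \<Rightarrow> (real \<Rightarrow> complex) set" where
  "L2_on S = {u. set_borel_measurable lebesgue S u \<and>
                 set_integrable lebesgue S (\<lambda>x. (cmod (u x))\<^sup>2)}"

definition locally_integrable_on :: "real set \<Rightarrow> (real \<Rightarrow> complex) \<Rightarrow> bool" where
  "locally_integrable_on S u \<longleftrightarrow> (\<forall>K. compact K \<and> K \<subseteq> S \<longrightarrow> set_integrable lebesgue K u)"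

text \<open>By linearity it makes no difference that test functions are real-valued.\<close>

definition test_function_on :: "real set \<Rightarrow> (real \<Rightarrow> real) \<Rightarrow> bool" where
  "test_function_on S \<phi> \<longleftrightarrow>
     (\<forall>k x. (deriv ^^ k) \<phi> field_differentiable at x) \<and>
     (\<exists>K. compact K \<and> K \<subseteq> S \<and> (\<forall>x. x \<notin> K \<longrightarrow> \<phi> x = 0))"

definition is_weak_deriv ::
    "real set \<Rightarrow> nat \<Rightarrow> (real \<Rightarrow> complex) \<Rightarrow> (real \<Rightarrow> complex) \<Rightarrow> bool" where
  "is_weak_deriv S n u v \<longleftrightarrow>
     locally_integrable_on S u \<and> locally_integrable_on S v \<and>
     (\<forall>\<phi>. test_function_on S \<phi> \<longrightarrow>
        (LINT x:S|lebesgue. (deriv ^^ n) \<phi> x *\<^sub>R u x) =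
        (- 1) ^ n * (LINT x:S|lebesgue. \<phi> x *\<^sub>R v x))"

text \<open>Weak derivatives are unique only up to null sets: \<open>weak_deriv\<close> picks a representative.\<close>

definition weak_deriv :: "real set \<Rightarrow> nat \<Rightarrow> (real \<Rightarrow> complex) \<Rightarrow> real \<Rightarrow> complex" where
  "weak_deriv S n u = (SOME v. is_weak_deriv S n u v)"

definition sobolev_H :: "nat \<Rightarrow> real set \<Rightarrow> (real \<Rightarrow> complex) set" where
  "sobolev_H n S = {u \<in> L2_on S. \<forall>k\<le>n. \<exists>v\<in>L2_on S. is_weak_deriv S k u v}"

text \<open>The value of \<open>u\<close> at a point of the closure is that of its continuous representative.\<close>

definition has_boundary_value :: "real set \<Rightarrow> (real \<Rightarrow> complex) \<Rightarrow> real \<Rightarrow> complex \<Rightarrow> bool" where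
  "has_boundary_value S u p c \<longleftrightarrow>
     (\<exists>g. continuous_on (closure S) g \<and> ae_eq_on S u g \<and> g p = c)"


section \<open>Kernels and eigenvalues of operators in L2\<close>

text \<open>An operator in \<open>L\<^sup>2(S)\<close> is given by a domain \<open>D\<close> and an action \<open>A\<close> on representatives.\<close>

definition nontrivial_kernel ::
    "real set \<Rightarrow> (real \<Rightarrow> complex) set \<Rightarrow> ((real \<Rightarrow> complex) \<Rightarrow> real \<Rightarrow> complex) \<Rightarrow> bool" where
  "nontrivial_kernel S D A \<longleftrightarrow>
     (\<exists>u\<in>D. ae_eq_on S (A u) (\<lambda>x. 0) \<and> \<not> ae_eq_on S u (\<lambda>x. 0))"

definition is_eigenvalue ::
    "real set \<Rightarrow> (real \<Rightarrow> complex) set \<Rightarrow> ((real \<Rightarrow> complex) \<Rightarrow> real \<Rightarrow> complex) \<Rightarrow> complex \<Rightarrow> bool" where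
  "is_eigenvalue S D A \<mu> \<longleftrightarrow> nontrivial_kernel S D (\<lambda>u x. A u x - \<mu> * u x)"


section \<open>The Orr--Sommerfeld operator\<close>

definition OS_dom :: "(real \<Rightarrow> complex) set" where
  "OS_dom = {u \<in> sobolev_H 4 {-1<..<1}. \<forall>p\<in>{-1, 1}.
      has_boundary_value {-1<..<1} u p 0 \<and>
      has_boundary_value {-1<..<1} (weak_deriv {-1<..<1} 1 u) p 0}"

definition OS_op ::
    "(real \<Rightarrow> real) \<Rightarrow> complex \<Rightarrow> real \<Rightarrow> real \<Rightarrow> (real \<Rightarrow> complex) \<Rightarrow> real \<Rightarrow> complex" where
  "OS_op U \<Lambda> \<alpha> \<beta> u =
     (let w = (\<lambda>x. weak_deriv {-1<..<1} 2 u x - of_real (\<alpha>\<^sup>2) * u x)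
      in (\<lambda>x. - weak_deriv {-1<..<1} 2 w x
              + (\<i> * of_real \<beta> * of_real (U x) - of_real \<beta> * \<Lambda>) * w x
              - \<i> * of_real \<beta> * of_real ((deriv_within {-1..1} ^^ 2) U x) * u x))"


section \<open>The half-line model operator and its leftmost eigenvalue\<close>

text \<open>The integral in the domain converges absolutely, since \<open>u\<close> and \<open>(1 + x) u\<close> are both
  square-integrable.\<close>

definition L0_dom :: "(real \<Rightarrow> complex) set" where
  "L0_dom = {u \<in> sobolev_H 2 {-1<..}.
      (LINT x:{-1<..}|lebesgue. u x) = 0 \<and>
      (\<lambda>x. of_real (1 + x) * u x) \<in> L2_on {-1<..}}"

definition L0_op :: "real \<Rightarrow> (real \<Rightarrow> complex) \<Rightarrow> real \<Rightarrow> complex" where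
  "L0_op \<beta> u = (\<lambda>x. - weak_deriv {-1<..} 2 u x + \<i> * of_real \<beta> * of_real (1 + x) * u x)"

definition leftmost_eigenvalue :: "real \<Rightarrow> complex" where
  "leftmost_eigenvalue \<beta> = arg_min Re (is_eigenvalue {-1<..} L0_dom (L0_op \<beta>))"

definition lambda0 :: "real \<Rightarrow> complex" where
  "lambda0 \<beta> = leftmost_eigenvalue \<beta> / of_real \<beta>"

end

theory Submission
 imports Defs "HOL-Complex_Analysis.Complex_Analysis"
begin

text \<open>Put \<open>h = \<beta> powr (-1/3)\<close> and \<open>\<Lambda> = \<i> U(-1) + h nu\<close>.  On the half-line, a weak solution of the eigenvalue equation has constant
 Wronskians with two entire solutions of Airy's equation, and square-integrability leaves only the decaying one,
 \<open>tairy\<close>.  Hence the eigenvalues of the model operator are \<open>nu / h^2\<close>, where \<open>nu\<close> runs through the zeros of an entire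
 function \<open>eig_fun\<close> with derivative \<open>- tairy\<close>; these zeros exist and are simple, and only finitely many lie to the left of
 any vertical line.

 For the Orr--Sommerfeld equation write \<open>w = u'' - \<alpha>^2 u\<close> and shoot from the right: for \<open>nu\<close> near a leftmost zero there is one
 solution with \<open>u(-1) = u(1) = u'(1) = 0\<close> and \<open>w(-1) = 1\<close>.  Subtract from \<open>w\<close> an Airy layer at \<open>-1\<close> and an exponential
 layer of width \<open>\<beta> powr (-1/2)\<close> at \<open>1\<close>.  Energy estimates for the remainder, with weight \<open>1 / (V + h)\<close> where \<open>V = U - U(-1)\<close>,
 show that \<open>u'(-1) tairy nu / h = - \<i> eig_fun nu + O(\<beta> powr (-1/6) sqrt (ln \<beta>))\<close>.  As the zero of \<open>eig_fun\<close> is simple, Brouwer's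
 theorem yields \<open>nu\<close> at this distance from it with \<open>u'(-1) = 0\<close>, and multiplication by \<open>h\<close> gives the rate
 \<open>\<beta> powr (-1/2 + \<epsilon>)\<close>.\<close>

section \<open>Scorer and Airy functions\<close>

text \<open>Where the integral condition of the model operator comes from: with
  \<open>u 0 = u 2 = 0\<close> the moment of \<open>u''\<close> against \<open>2 - t\<close> equals
  \<open>-2 * u' 0\<close>, so \<open>u' 0 = 0\<close> asks, to leading order, that the vorticity
  layer of width \<open>h\<close> at the wall have mean zero, which is
  \<open>eig_fun nu = 0\<close>. The obstacle is the remainder. Its own energy identity leaves the
  term \<open>\<beta> * V'' * u\<close>, which only a bound on \<open>u'\<close> controls. That
  bound comes from the Rayleigh form of \<open>V + h\<close>; it is coercive because
  \<open>V\<close> is positive off the wall, and the shift by \<open>h\<close> keeps the weight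
  finite at the wall. The two bounds call each other, and they close because one turn of the loop
  gains the factor \<open>th^2 = \<beta> powr (-1/6)\<close>. The logarithm enters once, through the
  integral of \<open>1 / (t + h)\<close>. The eigenvalue that defines \<open>lambda0\<close> is one
  of possibly several with least real part, and the choice may differ from one
  \<open>\<beta>\<close> to another. The argument is therefore run at each member of the finite set
  of leftmost zeros, and the threshold is a minimum over that set.\<close>

text \<open>Up to the factor \<open>\<pi>\<close>, Scorer's function \<open>Hi\<close> and its derivatives.\<close>

definition scorer :: "nat \<Rightarrow> complex \<Rightarrow> complex" where
 "scorer k nu = (LINT \<tau>:{0<..}|lborel. of_real (\<tau>^k) * exp (nu * of_real \<tau> - of_real (\<tau>^3 / 3)))"

text \<open>The surplus \<open>2 * \<tau>\<close> is spent in two halves: one factor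
  \<open>exp \<tau>\<close> absorbs the power \<open>\<tau>^k\<close>, the other leaves the
  integrable majorant \<open>exp (- \<tau>)\<close>.\<close>

lemma scorer_exponent_bound:
 fixes R \<tau> :: real
 assumes "\<tau> \<ge> 0"
 shows "R * \<tau> - \<tau>^3 / 3 \<le> (R + 2)^2 + 1 - 2 * \<tau>"
proof -
 have "\<tau>^2 / 4 - \<tau>^3 / 3 \<le> 1"
 proof (cases "\<tau> \<le> 1")
  case True
  have "\<tau>^2 \<le> 1" using True assms by (simp add: power_le_one)
  moreover have "\<tau>^3 \<ge> 0" using assms by simp
  ultimately show ?thesis by linarith
 next
  case False
  then have "\<tau>^2 \<le> \<tau>^3" using power_increasing[of 2 3 \<tau>] by simp
  moreover have "\<tau>^2 \<ge> 0" by simp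
  ultimately show ?thesis by linarith
 qed
 moreover have "(R + 2) * \<tau> \<le> (R + 2)^2 + \<tau>^2 / 4"
  using zero_le_power2[of "(R + 2) - \<tau> / 2"] by (simp add: power2_eq_square algebra_simps)
 ultimately show ?thesis by (simp add: algebra_simps)
qed

lemma scorer_integrand_bound:
 assumes "\<tau> \<ge> 0" "Re nu \<le> R"
 shows "cmod (of_real (\<tau>^k) * exp (nu * of_real \<tau> - of_real (\<tau>^3 / 3)))
  \<le> fact k * exp ((R + 2)^2 + 1) * exp (- \<tau>)"
proof -
 have 1: "\<tau>^k \<le> fact k * exp \<tau>" using exp_ge_one_plus_x_over_n_power_n
 proof -
  have "summable (\<lambda>n. \<tau>^n /\<^sub>R fact n)" by (rule summable_exp_generic)
  then have "(\<Sum>n\<in>{k}. \<tau>^n /\<^sub>R fact n) \<le> (\<Sum>n. \<tau>^n /\<^sub>R fact n)"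
   by (intro sum_le_suminf) (use assms in auto)
  then have "\<tau>^k / fact k \<le> exp \<tau>" by (simp add: exp_def divide_inverse mult.commute)
  then show ?thesis by (simp add: field_simps)
 qed
 have "Re nu * \<tau> \<le> R * \<tau>" using assms by (simp add: mult_right_mono)
 then have "Re nu * \<tau> - \<tau>^3 / 3 \<le> (R + 2)^2 + 1 - 2 * \<tau>"
  using scorer_exponent_bound[OF assms(1), of R] by linarith
 then have 2: "exp (Re nu * \<tau> - \<tau>^3 / 3) \<le> exp ((R + 2)^2 + 1 - 2 * \<tau>)" by simp
 have "cmod (of_real (\<tau>^k) * exp (nu * of_real \<tau> - of_real (\<tau>^3 / 3)))
   = \<tau>^k * exp (Re nu * \<tau> - \<tau>^3 / 3)"
  using assms(1) by (simp add: norm_mult norm_power)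
 also have "\<dots> \<le> (fact k * exp \<tau>) * exp ((R + 2)^2 + 1 - 2 * \<tau>)"
  by (intro mult_mono 1 2) auto
 also have "\<dots> = fact k * exp ((R + 2)^2 + 1) * exp (- \<tau>)"
  by (simp add: exp_add[symmetric] exp_diff[symmetric] mult.assoc flip: exp_add)
 finally show ?thesis .
qed

lemma exp_minus_integral:
 "set_integrable lborel {0<..} (\<lambda>x::real. exp (- x))"
 "(LINT x:{0<..}|lborel. exp (- x)) = (1::real)"
proof -
 have lim0: "(((\<lambda>x. - exp (- x)) \<circ> real_of_ereal) \<longlongrightarrow> - 1) (at_right (ereal 0))"
  by (subst ereal_tendsto_simps1(2)) (auto intro!: tendsto_eq_intros)
 have lim1: "(((\<lambda>x. - exp (- x)) \<circ> real_of_ereal) \<longlongrightarrow> (0::real)) (at_left \<infinity>)"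
  unfolding ereal_tendsto_simps1 using tendsto_minus[OF exp_at_bot[THEN filterlim_compose, OF filterlim_uminus_at_bot_at_top]] by simp
 have d: "\<And>x. ereal 0 < ereal x \<Longrightarrow> ereal x < \<infinity> \<Longrightarrow> ((\<lambda>x. - exp (- x)) has_real_derivative exp (- x)) (at x)"
  by (auto intro!: derivative_eq_intros)
 have s: "set_integrable lborel (einterval (ereal 0) \<infinity>) (\<lambda>x::real. exp (- x))"
  by (rule interval_integral_FTC_nonneg(1)[OF _ d _ _ lim0 lim1]) auto
 have "(LBINT x=ereal 0..\<infinity>. exp (- x)) = 0 - (- (1::real))"
  by (rule interval_integral_FTC_nonneg(2)[OF _ d _ _ lim0 lim1]) auto
 then show "(LINT x:{0<..}|lborel. exp (- x)) = (1::real)"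
  by (simp add: interval_integral_to_infinity_eq)
 show "set_integrable lborel {0<..} (\<lambda>x::real. exp (- x))" using s by (simp add: einterval_def greaterThan_def)
qed

lemma scorer_integrable:
 "set_integrable lborel {0<..} (\<lambda>\<tau>. of_real (\<tau>^k) * exp (nu * of_real \<tau> - of_real (\<tau>^3 / 3)) :: complex)"
proof -
 have e: "integrable lborel (\<lambda>\<tau>. indicator {0<..} \<tau> *\<^sub>R (fact k * exp ((Re nu + 2)^2 + 1) * exp (- \<tau>)))"
  using exp_minus_integral(1) unfolding set_integrable_def
  by (subst mult_scaleR_right[symmetric]) (rule integrable_mult_right)
 show ?thesis unfolding set_integrable_def
 proof (rule Bochner_Integration.integrable_bound[OF e])
  show "(\<lambda>x. indicator {0<..} x *\<^sub>R (of_real (x^k) * exp (nu * of_real x - of_real (x^3 / 3)))) \<in> borel_measurable lborel"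
   by measurable
 next
  show "AE x in lborel. norm (indicator {0<..} x *\<^sub>R (of_real (x^k) * exp (nu * of_real x - of_real (x^3 / 3))))
     \<le> norm (indicat_real {0<..} x *\<^sub>R (fact k * exp ((Re nu + 2)^2 + 1) * exp (- x)))"
   using scorer_integrand_bound[of _ nu "Re nu" k]
   by (intro AE_I2) (auto simp: indicator_def abs_mult)
 qed
qed

lemma set_integral_exp_bound:
 fixes f :: "real \<Rightarrow> complex"
 assumes "set_integrable lborel {0<..} f" "\<And>x. x > 0 \<Longrightarrow> cmod (f x) \<le> C * exp (- x)"
 shows "cmod (LINT x:{0<..}|lborel. f x) \<le> C"
proof -
 have "cmod (LINT x:{0<..}|lborel. f x) \<le> (LINT x:{0<..}|lborel. cmod (f x))"
  using assms(1) by (rule set_integral_norm_bound)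
 also have "\<dots> \<le> (LINT x:{0<..}|lborel. C * exp (- x))"
 proof (rule set_integral_mono)
  show "set_integrable lborel {0<..} (\<lambda>x. cmod (f x))"
   using assms(1) by (rule set_integrable_norm)
  show "set_integrable lborel {0<..} (\<lambda>x. C * exp (- x))"
   using exp_minus_integral(1) by simp
 qed (use assms(2) in auto)
 also have "\<dots> = C" using exp_minus_integral(2) by simp
 finally show ?thesis .
qed

text \<open>The bound depends on \<open>nu\<close> only through an upper bound for its real part.
  This uniformity on left half-planes replaces asymptotic expansions in everything that
  follows.\<close>

lemma scorer_bound:
 assumes "Re nu \<le> R"
 shows "cmod (scorer k nu) \<le> fact k * exp ((R + 2)^2 + 1)" unfolding scorer_def
 by (rule set_integral_exp_bound[OF scorer_integrable scorer_integrand_bound]) (use assms in auto)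

lemma cmod_exp_Taylor1: "cmod (exp z - 1 - z) \<le> (cmod z)^2 * exp (cmod z)"
proof -
 have "cmod (exp z - (\<Sum>k\<le>1. z^k / fact k)) \<le> exp \<bar>Re z\<bar> * (cmod z)^Suc 1 / fact 1"
  by (rule Taylor_exp)
 also have "\<dots> \<le> exp (cmod z) * (cmod z)^2"
  by (auto simp: power2_eq_square intro!: mult_right_mono abs_Re_le_cmod)
 finally show ?thesis by (simp add: mult.commute diff_diff_eq algebra_simps)
qed

text \<open>Differentiation under the integral with an explicit remainder: the second-order Taylor
  remainder of \<open>exp (\<delta> * \<tau>)\<close> is dominated by the integrand of
  \<open>scorer (k + 2)\<close> at \<open>nu + cmod \<delta>\<close>, so the error is
  \<open>O((cmod \<delta>)^2)\<close>.\<close>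

lemma scorer_has_field_derivative: "(scorer k has_field_derivative scorer (Suc k) nu) (at nu)"
proof -
 define C where "C = fact (k + 2) * exp ((Re nu + 1 + 2)^2 + 1)"
 have est: "cmod (scorer k (nu + \<delta>) - scorer k nu - \<delta> * scorer (Suc k) nu) \<le> C * (cmod \<delta>)^2"
  if "cmod \<delta> \<le> 1" for \<delta>
 proof -
  let ?f = "\<lambda>k nu \<tau>. of_real (\<tau>^k) * exp (nu * of_real \<tau> - of_real (\<tau>^3 / 3)) :: complex"
  let ?F = "\<lambda>\<tau>. ?f k (nu + \<delta>) \<tau> - ?f k nu \<tau> - \<delta> * ?f (Suc k) nu \<tau>"
  have i: "set_integrable lborel {0<..} (\<lambda>\<tau>. \<delta> * ?f (Suc k) nu \<tau>)"
   by (intro set_integrable_mult_right scorer_integrable)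
  have "scorer k (nu + \<delta>) - scorer k nu - \<delta> * scorer (Suc k) nu = (LINT \<tau>:{0<..}|lborel. ?F \<tau>)"
   unfolding scorer_def using scorer_integrable i
   by (simp add: set_integral_diff set_integral_mult_right del: of_real_power power_Suc)
  moreover have "cmod (LINT \<tau>:{0<..}|lborel. ?F \<tau>) \<le> (cmod \<delta>)^2 * C"
  proof (rule set_integral_exp_bound)
   show "set_integrable lborel {0<..} ?F" using i scorer_integrable by (intro set_integral_diff) auto
   fix \<tau> :: real assume \<tau>: "\<tau> > 0"
   have "?F \<tau> = ?f k nu \<tau> * (exp (\<delta> * of_real \<tau>) - 1 - \<delta> * of_real \<tau>)"
   proof -
    have "exp ((nu + \<delta>) * of_real \<tau> - of_real (\<tau>^3 / 3))
     = exp (nu * of_real \<tau> - of_real (\<tau>^3 / 3)) * exp (\<delta> * of_real \<tau>)"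
     by (simp add: exp_add[symmetric] algebra_simps)
    then show ?thesis by (simp only:) (simp add: algebra_simps)
   qed
   then have "cmod (?F \<tau>) = cmod (?f k nu \<tau>) * cmod (exp (\<delta> * of_real \<tau>) - 1 - \<delta> * of_real \<tau>)"
    by (simp add: norm_mult)
   also have "\<dots> \<le> cmod (?f k nu \<tau>) * ((cmod \<delta> * \<tau>)^2 * exp (cmod \<delta> * \<tau>))"
    using cmod_exp_Taylor1[of "\<delta> * of_real \<tau>"] \<tau> by (intro mult_left_mono) (auto simp: norm_mult)
   also have "\<dots> = (cmod \<delta>)^2 * cmod (?f (k + 2) (nu + of_real (cmod \<delta>)) \<tau>)"
   proof -
    have "exp ((nu + of_real (cmod \<delta>)) * of_real \<tau> - of_real (\<tau>^3 / 3))
     = exp (nu * of_real \<tau> - of_real (\<tau>^3 / 3)) * of_real (exp (cmod \<delta> * \<tau>))"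
     by (simp add: exp_add[symmetric] exp_of_real[symmetric] algebra_simps)
    then have "?f (k + 2) (nu + of_real (cmod \<delta>)) \<tau> = ?f k nu \<tau> * of_real (\<tau>^2 * exp (cmod \<delta> * \<tau>))"
     by (simp only:) (simp add: power_add algebra_simps power2_eq_square)
    then have "cmod (?f (k + 2) (nu + of_real (cmod \<delta>)) \<tau>) = cmod (?f k nu \<tau>) * (\<tau>^2 * exp (cmod \<delta> * \<tau>))"
     by (simp only: norm_mult norm_of_real) simp
    then show ?thesis by (simp only: power_mult_distrib) simp
   qed
   also have "\<dots> \<le> (cmod \<delta>)^2 * (fact (k + 2) * exp ((Re nu + 1 + 2)^2 + 1) * exp (- \<tau>))"
    by (intro mult_left_mono scorer_integrand_bound) (use \<tau> that in auto)
   finally show "cmod (?F \<tau>) \<le> (cmod \<delta>)^2 * C * exp (- \<tau>)" by (simp add: C_def mult.assoc)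
  qed
  ultimately show ?thesis by (simp add: mult.commute)
 qed
 have C0: "C \<ge> 0" by (simp add: C_def)
 show ?thesis unfolding has_field_derivative_iff
 proof (rule LIM_I)
  fix r :: real assume r: "r > 0"
  show "\<exists>s>0. \<forall>x. x \<noteq> nu \<and> norm (x - nu) < s \<longrightarrow>
    norm ((scorer k x - scorer k nu) / (x - nu) - scorer (Suc k) nu) < r"
  proof (intro exI conjI allI impI)
   show "min 1 (r / (C + 1)) > 0" using r C0 by simp
   fix x assume x: "x \<noteq> nu \<and> norm (x - nu) < min 1 (r / (C + 1))"
   then have n: "cmod (x - nu) > 0" "cmod (x - nu) \<le> 1" "cmod (x - nu) * (C + 1) < r"
    using C0 by (auto simp: field_simps)
   have "scorer (Suc k) nu - (scorer k x - scorer k nu) / (x - nu)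
     = - (scorer k (nu + (x - nu)) - scorer k nu - (x - nu) * scorer (Suc k) nu) / (x - nu)"
    using x by (simp add: field_simps)
   then have "cmod (scorer (Suc k) nu - (scorer k x - scorer k nu) / (x - nu))
     \<le> C * (cmod (x - nu))^2 / cmod (x - nu)"
    using divide_right_mono[OF est[OF n(2)], of "cmod (x - nu)"]
    by (simp only: norm_divide norm_minus_cancel) simp
   also have "\<dots> = C * cmod (x - nu)" using n(1) by (simp add: power2_eq_square)
   also have "\<dots> < r"
   proof -
    have "cmod (x - nu) + C * cmod (x - nu) < r" using n(3) by (simp add: algebra_simps)
    then show ?thesis using n(1) by linarith
   qed
   finally show "norm ((scorer k x - scorer k nu) / (x - nu) - scorer (Suc k) nu) < r" by (simp only: norm_minus_commute)
  qed
 qed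
qed

text \<open>The integrand of \<open>nu * scorer 0 nu - scorer 2 nu\<close> is the derivative of
  \<open>exp (nu * \<tau> - \<tau>^3 / 3)\<close>; its boundary value at \<open>\<tau> = 0\<close>
  is the inhomogeneity 1.\<close>

lemma scorer_ode: "scorer 2 nu = nu * scorer 0 nu + 1"
proof -
 let ?F = "\<lambda>\<tau>::real. exp (nu * of_real \<tau> - of_real (\<tau>^3 / 3)) :: complex"
 let ?f = "\<lambda>\<tau>::real. (nu * (of_real (\<tau>^0) * ?F \<tau>) - of_real (\<tau>^2) * ?F \<tau>)"
 have int: "set_integrable lborel {0<..} ?f"
  by (intro set_integral_diff set_integrable_mult_right scorer_integrable)
 have "(LBINT x=ereal 0..\<infinity>. ?f x) = 0 - 1"
 proof (rule interval_integral_FTC_integrable[where F = ?F])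
  show "(?F has_vector_derivative ?f x) (at x)" for x
  proof -
   have c: "((\<lambda>z. z^3 / 3) has_field_derivative z^2) (at z)" for z :: complex
    using DERIV_cdivide[OF DERIV_power[OF DERIV_ident, of 3 z UNIV], of 3] by simp
   have "((\<lambda>z. exp (nu * z - z^3 / 3)) has_field_derivative ?f x) (at (complex_of_real x))"
    by (rule DERIV_cong[OF DERIV_chain2[OF DERIV_exp DERIV_diff[OF DERIV_cmult_Id c]]])
     (simp add: algebra_simps)
   from has_vector_derivative_real_field[OF this] show ?thesis by simp
  qed
  show "isCont ?f x" for x by (intro continuous_intros) auto
  show "set_integrable lborel (einterval (ereal 0) \<infinity>) ?f" using int by (simp add: einterval_def greaterThan_def)
  show "((?F \<circ> real_of_ereal) \<longlongrightarrow> 1) (at_right (ereal 0))"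
  proof (subst ereal_tendsto_simps1(2))
   have "isCont ?F 0" by (intro continuous_intros) auto
   then show "(?F \<longlongrightarrow> 1) (at_right 0)" by (simp add: isCont_def filterlim_at_split)
  qed
  have "(?F \<longlongrightarrow> 0) at_top"
  proof (rule Lim_null_comparison)
   show "\<forall>\<^sub>F x in at_top. norm (?F x) \<le> exp ((Re nu + 2)^2 + 1) * exp (- x)"
    using eventually_ge_at_top[of 0]
    by eventually_elim (use scorer_integrand_bound[of _ nu "Re nu" 0] in auto)
   show "((\<lambda>x::real. exp ((Re nu + 2)^2 + 1) * exp (- x)) \<longlongrightarrow> 0) at_top"
    by (rule tendsto_mult_right_zero) (rule exp_at_bot[THEN filterlim_compose, OF filterlim_uminus_at_bot_at_top])
  qed
  then show "((?F \<circ> real_of_ereal) \<longlongrightarrow> 0) (at_left \<infinity>)" unfolding ereal_tendsto_simps1 .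
 qed auto
 then have "(LINT x:{0<..}|lborel. ?f x) = - 1" by (simp add: interval_integral_to_infinity_eq)
 moreover have "(LINT x:{0<..}|lborel. ?f x) = nu * scorer 0 nu - scorer 2 nu"
  unfolding scorer_def using scorer_integrable[of 0 nu] scorer_integrable[of 2 nu]
  by (simp add: set_integral_diff set_integral_mult_right)
 ultimately show ?thesis by (simp add: algebra_simps)
qed

section \<open>Exponential decay of bounded solutions of Airy-type equations on a ray\<close>

lemma vector_mvt_bound:
 fixes f :: "real \<Rightarrow> 'a::real_normed_vector"
 assumes "a \<le> b" and "\<And>x. a \<le> x \<Longrightarrow> x \<le> b \<Longrightarrow> (f has_vector_derivative f' x) (at x within {a..b})"
  and "\<And>x. a \<le> x \<Longrightarrow> x \<le> b \<Longrightarrow> norm (f' x) \<le> B"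
 shows "norm (f b - f a) \<le> B * (b - a)"
proof -
 have "norm (f b - f a) \<le> B * norm (b - a)"
 proof (rule differentiable_bound[of "{a..b}" f "\<lambda>x h. h *\<^sub>R f' x" B b a])
  fix x assume x: "x \<in> {a..b}"
  then show "(f has_derivative (\<lambda>h. h *\<^sub>R f' x)) (at x within {a..b})"
   using assms(2)[of x] by (simp add: has_vector_derivative_def)
  have "norm (h *\<^sub>R f' x) \<le> B * norm h" for h
   using mult_left_mono[OF assms(3)[of x], of "\<bar>h\<bar>"] x by (simp add: mult.commute)
  moreover have "0 \<le> B" using assms(3)[of x] x norm_ge_zero[of "f' x"] by (meson atLeastAtMost_iff order_trans)
  ultimately show "onorm (\<lambda>h. h *\<^sub>R f' x) \<le> B" by (intro onorm_bound)
 qed (use assms in auto)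
 then show ?thesis using assms(1) by simp
qed

lemma Re_form_has_derivative:
 fixes u v :: "real \<Rightarrow> complex"
 assumes "(u has_vector_derivative u') (at s within S)" "(v has_vector_derivative v') (at s within S)"
 shows "((\<lambda>s. Re (e * (cnj (u s) * v s))) has_real_derivative Re (e * (cnj u' * v s + cnj (u s) * v'))) (at s within S)"
proof -
 have 1: "((\<lambda>s. cnj (u s)) has_vector_derivative cnj u') (at s within S)"
  using has_vector_derivative_cnj[OF assms(1)] .
 have 2: "((\<lambda>s. e * (cnj (u s) * v s)) has_vector_derivative e * (cnj (u s) * v' + cnj u' * v s)) (at s within S)"
  by (intro has_vector_derivative_mult_right has_vector_derivative_mult 1 assms)
 have "((\<lambda>s. Re (e * (cnj (u s) * v s))) has_vector_derivative Re (e * (cnj (u s) * v' + cnj u' * v s))) (at s within S)"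
  by (rule bounded_linear.has_vector_derivative[OF bounded_linear_Re 2])
 then show ?thesis unfolding has_real_derivative_iff_has_vector_derivative by (simp add: add.commute)
qed

lemma norm_square_has_derivative:
 fixes u :: "real \<Rightarrow> complex"
 assumes "(u has_vector_derivative u') (at s within S)"
 shows "((\<lambda>s. (cmod (u s))^2) has_real_derivative 2 * Re (cnj (u s) * u')) (at s within S)"
proof -
 have eq: "(cmod z)^2 = Re (1 * (cnj z * z))" for z
  by (simp only: mult_1_left complex_norm_square[symmetric] mult.commute[of "cnj z"] Re_complex_of_real)
 have "Re (1 * (cnj u' * u s + cnj (u s) * u')) = 2 * Re (cnj (u s) * u')" by (simp add: algebra_simps)
 then show ?thesis using Re_form_has_derivative[OF assms assms, of 1] by (simp only: eq)
qed

lemma Re_cnj_mult_le: "\<bar>Re (e * (cnj a * b))\<bar> \<le> cmod e * (cmod a * cmod b)"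
 using abs_Re_le_cmod[of "e * (cnj a * b)"] by (simp add: norm_mult)

text \<open>The multiplier \<open>e\<close> rotates the equation: real part 1 keeps the square of
  the derivative, while its argument is chosen so that the potential \<open>p\<close> acquires a
  positive real part.\<close>

lemma airy_form_lower_bound:
 fixes a b e p :: complex and L :: real
 assumes "Re e = 1" "Re (e * p) \<ge> L"
 shows "Re (e * (cnj b * b + cnj a * (p * a))) \<ge> (cmod b)^2 + L * (cmod a)^2"
proof -
 have "e * (cnj b * b + cnj a * (p * a)) = of_real ((cmod b)^2) * e + of_real ((cmod a)^2) * (e * p)"
  by (simp only: complex_norm_square algebra_simps)
 then have "Re (e * (cnj b * b + cnj a * (p * a))) = (cmod b)^2 * Re e + (cmod a)^2 * Re (e * p)"
  by (simp only: plus_complex.simps Re_complex_of_real times_complex.simps Im_complex_of_real mult_zero_left diff_zero)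
 moreover have "(cmod a)^2 * Re (e * p) \<ge> (cmod a)^2 * L" using assms(2) by (intro mult_left_mono) auto
 ultimately show ?thesis using assms(1) by (simp add: mult.commute)
qed

text \<open>\<open>2 * Q + 36\<close> is the distance beyond which the rotated potential has real
  part at least 36. There the solution decays at rate 3; the factor \<open>3 + Q\<close> and the
  weaker rate 2 of the statement pay for the derivative.\<close>

definition airy_decay_const :: "real \<Rightarrow> real \<Rightarrow> real" where
 "airy_decay_const M Q = 2 * M * exp (3 * (2 * Q + 36)) * (3 + Q)"

text \<open>For \<open>J = Re (e * (cnj u * v))\<close> the choice of 36 gives
  \<open>J' \<ge> 6 * \<bar>J\<bar>\<close> beyond \<open>S\<close>. A positive value of
  \<open>J\<close> would force unbounded growth, so \<open>J \<le> 0\<close> and \<open>- J\<close>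
  decays like \<open>exp (- 6 * s)\<close>. Finally \<open>(cmod u)^2 \<le> - J\<close>, which is
  rate 3 for \<open>u\<close>.\<close>

lemma airy_type_decay:
 fixes u v :: "real \<Rightarrow> complex" and c e q :: complex and M Q :: real
 assumes du: "\<And>s. s \<ge> 0 \<Longrightarrow> (u has_vector_derivative v s) (at s)"
  and dv: "\<And>s. s \<ge> 0 \<Longrightarrow> (v has_vector_derivative (c * of_real s + q) * u s) (at s)"
  and e: "Re e = 1" "cmod e \<le> 2" "Re (e * c) = 1" "cmod c \<le> 1"
  and q: "cmod q \<le> Q"
  and b: "\<And>s. s \<ge> 0 \<Longrightarrow> cmod (u s) \<le> M" "\<And>s. s \<ge> 0 \<Longrightarrow> cmod (v s) \<le> M"
  and s0: "s \<ge> 0"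
 shows airy_type_decay_fun: "cmod (u s) \<le> airy_decay_const M Q * exp (- (2 * s))"
  and airy_type_decay_deriv: "cmod (v s) \<le> airy_decay_const M Q * exp (- (2 * s))"
  and airy_type_decay_sign: "s \<ge> 2 * Q + 36 \<Longrightarrow> Re (e * (cnj (u s) * v s)) \<le> 0"
proof -
 define S where "S = 2 * Q + 36"
 have Q0: "Q \<ge> 0" using q norm_ge_zero[of q] by linarith
 have M0: "M \<ge> 0" using b(1)[of 0] norm_ge_zero[of "u 0"] by linarith
 have S0: "S \<ge> 36" using Q0 by (simp add: S_def)
 define J where "J s = Re (e * (cnj (u s) * v s))" for s
 define J' where "J' s = Re (e * (cnj (v s) * v s + cnj (u s) * ((c * of_real s + q) * u s)))" for s
 have dJ: "(J has_real_derivative J' s) (at s)" if "s \<ge> 0" for s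
  unfolding J_def[abs_def] J'_def using du[OF that] dv[OF that] by (rule Re_form_has_derivative)
 have J'lb: "J' s \<ge> (cmod (v s))^2 + 36 * (cmod (u s))^2" if "s \<ge> S" for s
 proof -
  have "Re (e * (c * of_real s + q)) = s * Re (e * c) + Re (e * q)" by (simp add: algebra_simps)
  moreover have "\<bar>Re (e * q)\<bar> \<le> 2 * Q"
   using abs_Re_le_cmod[of "e * q"] mult_mono[OF e(2) q] by (simp add: norm_mult)
  ultimately have "Re (e * (c * of_real s + q)) \<ge> 36" using that e(3) by (simp add: S_def)
  then show ?thesis unfolding J'_def by (rule airy_form_lower_bound[OF e(1)])
 qed
 have Jab: "\<bar>J s\<bar> \<le> 2 * (cmod (u s) * cmod (v s))" for s
  unfolding J_def using Re_cnj_mult_le[of e "u s" "v s"] mult_right_mono[OF e(2), of "cmod (u s) * cmod (v s)"] by simp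
 have am: "12 * (cmod (u s) * cmod (v s)) \<le> (cmod (v s))^2 + 36 * (cmod (u s))^2" for s
  using zero_le_power2[of "cmod (v s) - 6 * cmod (u s)"] by (simp add: power2_eq_square algebra_simps)
 have J'J: "J' s \<ge> 6 * \<bar>J s\<bar>" if "s \<ge> S" for s using J'lb[OF that] Jab[of s] am[of s] by linarith
 have Jbd: "\<bar>J s\<bar> \<le> 2 * (M * M)" if "s \<ge> 0" for s
  using Jab[of s] mult_mono[OF b(1)[OF that] b(2)[OF that]] M0 by simp
 have Jmono: "J s \<le> J t" if "S \<le> s" "s \<le> t" for s t
 proof (rule DERIV_nonneg_imp_nondecreasing[OF that(2)])
  fix x assume "s \<le> x" "x \<le> t"
  then have "(J has_real_derivative J' x) (at x)" "J' x \<ge> 0" using dJ[of x] J'J[of x] that S0 by auto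
  then show "\<exists>y. (J has_real_derivative y) (at x) \<and> 0 \<le> y" by blast
 qed
 \<comment> \<open>A uniform positive lower bound on \<open>J'\<close> contradicts the boundedness
   of \<open>J\<close>. Both uses below produce such a bound from a single bad point.\<close>
 have grow: False if h: "s1 \<ge> S" "\<eta> > 0" "\<And>s. s \<ge> s1 \<Longrightarrow> J' s \<ge> \<eta>" for s1 \<eta>
 proof -
  define T where "T = s1 + (4 * (M * M) + 1) / \<eta>"
  have T: "T \<ge> s1" using h M0 by (simp add: T_def)
  have "J s1 - \<eta> * s1 \<le> J T - \<eta> * T"
  proof (rule DERIV_nonneg_imp_nondecreasing[OF T])
   fix x assume x: "s1 \<le> x" "x \<le> T"
   then have "((\<lambda>s. J s - \<eta> * s) has_real_derivative J' x - \<eta>) (at x)"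
    using S0 h by (auto intro!: derivative_eq_intros dJ)
   then show "\<exists>y. ((\<lambda>s. J s - \<eta> * s) has_real_derivative y) (at x) \<and> 0 \<le> y"
    using h(3)[OF x(1)] by (intro exI[of _ "J' x - \<eta>"]) auto
  qed
  moreover have "\<eta> * T = \<eta> * s1 + (4 * (M * M) + 1)" using h(2) by (simp add: T_def field_simps)
  ultimately have "J T \<ge> J s1 + (4 * (M * M) + 1)" by simp
  then show False using Jbd[of T] Jbd[of s1] T S0 h(1) by (auto simp: abs_le_iff)
 qed
 have Jneg: "J s \<le> 0" if "s \<ge> S" for s
 proof (rule ccontr)
  assume "\<not> J s \<le> 0"
  then have p: "J s > 0" by simp
  show False
  proof (rule grow[OF that, of "6 * J s"])
   show "J' t \<ge> 6 * J s" if "t \<ge> s" for t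
    using J'J[of t] Jmono[of s t] that \<open>s \<ge> S\<close> by auto
  qed (use p in auto)
 qed
 have Jexp: "- J s \<le> 2 * (M * M) * exp (6 * (S - s))" if "s \<ge> S" for s
 proof -
  have "J S * exp (6 * S) \<le> J s * exp (6 * s)"
  proof (rule DERIV_nonneg_imp_nondecreasing[OF that])
   fix x assume x: "S \<le> x" "x \<le> s"
   have "((\<lambda>s. J s * exp (6 * s)) has_real_derivative (J' x + 6 * J x) * exp (6 * x)) (at x)"
    using x S0 by (auto intro!: derivative_eq_intros dJ simp: algebra_simps)
   moreover have "(J' x + 6 * J x) * exp (6 * x) \<ge> 0" using J'J[OF x(1)] by (intro mult_nonneg_nonneg) auto
   ultimately show "\<exists>y. ((\<lambda>s. J s * exp (6 * s)) has_real_derivative y) (at x) \<and> 0 \<le> y" by blast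
  qed
  moreover have "- (2 * (M * M)) * exp (6 * S) \<le> J S * exp (6 * S)"
   using Jbd[of S] S0 by (intro mult_right_mono) auto
  ultimately have "- J s * exp (6 * s) \<le> 2 * (M * M) * exp (6 * S)"
   by (simp only: mult_minus_left)
  then have "- J s \<le> 2 * (M * M) * exp (6 * S) / exp (6 * s)" by (simp add: field_simps)
  then show ?thesis by (simp add: exp_diff right_diff_distrib)
 qed
 \<comment> \<open>\<open>(cmod u)^2 + J\<close> is nondecreasing as well. If it were positive at
   \<open>s\<close>, then \<open>J \<le> 0\<close> would keep \<open>(cmod u)^2\<close> above a
   constant, and \<open>J'\<close> would be bounded below for ever.\<close>
 have uJ: "(cmod (u s))^2 \<le> - J s" if "s \<ge> S" for s
 proof (rule ccontr)
  assume n: "\<not> (cmod (u s))^2 \<le> - J s"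
  define \<eta> where "\<eta> = (cmod (u s))^2 + J s"
  have \<eta>: "\<eta> > 0" using n by (simp add: \<eta>_def)
  have lb: "(cmod (u t))^2 + J t \<ge> \<eta>" if t: "t \<ge> s" for t unfolding \<eta>_def
  proof (rule DERIV_nonneg_imp_nondecreasing[OF t])
   fix x assume x: "s \<le> x" "x \<le> t"
   have "((\<lambda>s. (cmod (u s))^2 + J s) has_real_derivative (2 * Re (cnj (u x) * v x) + J' x)) (at x)"
    using x that S0 \<open>s \<ge> S\<close> by (intro DERIV_add norm_square_has_derivative du dJ) auto
   moreover have "2 * Re (cnj (u x) * v x) + J' x \<ge> 0"
   proof -
    have "\<bar>Re (cnj (u x) * v x)\<bar> \<le> cmod (u x) * cmod (v x)"
     using Re_cnj_mult_le[of 1 "u x" "v x"] by simp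
    moreover have "cmod (u x) * cmod (v x) \<ge> 0" by simp
    moreover have "J' x \<ge> (cmod (v x))^2 + 36 * (cmod (u x))^2" using x \<open>s \<ge> S\<close> by (intro J'lb) auto
    ultimately show ?thesis using am[of x] by linarith
   qed
   ultimately show "\<exists>y. ((\<lambda>s. (cmod (u s))^2 + J s) has_real_derivative y) (at x) \<and> 0 \<le> y" by blast
  qed
  show False
  proof (rule grow[OF that, of "36 * \<eta>"])
   fix t assume t: "t \<ge> s"
   have "(cmod (u t))^2 \<ge> \<eta>" using lb[OF t] Jneg[of t] t that by auto
   moreover have "(cmod (v t))^2 \<ge> 0" by simp
   ultimately show "J' t \<ge> 36 * \<eta>" using J'lb[of t] t that by linarith
  qed (use \<eta> in auto)
 qed
 define K where "K = 2 * M * exp (3 * S)"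
 have K0: "K \<ge> 0" using M0 by (simp add: K_def)
 have ub: "cmod (u s) \<le> K * exp (- (3 * s))" if "s \<ge> 0" for s
 proof (cases "s \<ge> S")
  case True
  have "(cmod (u s))^2 \<le> 2 * (M * M) * exp (6 * (S - s))" using uJ[OF True] Jexp[OF True] by linarith
  also have "\<dots> \<le> 4 * (M * M) * exp (6 * (S - s))" using M0 by (intro mult_right_mono) auto
  also have "\<dots> = (2 * M * exp (3 * (S - s)))^2"
   by (simp add: power2_eq_square exp_add[symmetric] algebra_simps)
  finally have "cmod (u s) \<le> 2 * M * exp (3 * (S - s))" by (rule power2_le_imp_le) (use M0 in auto)
  then show ?thesis by (simp add: K_def exp_diff exp_minus right_diff_distrib field_simps)
 next
  case False
  have "cmod (u s) \<le> M * 1" using b(1)[OF that] by simp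
  also have "\<dots> \<le> M * (2 * exp (3 * (S - s)))"
  proof (intro mult_left_mono)
   have "exp (3 * (S - s)) \<ge> 1" using False by simp
   then show "1 \<le> 2 * exp (3 * (S - s))" by linarith
  qed (use M0 in auto)
  finally show ?thesis by (simp add: K_def exp_diff exp_minus right_diff_distrib field_simps)
 qed
 have ac: "airy_decay_const M Q = K * (3 + Q)" by (simp add: airy_decay_const_def K_def S_def)
 have ex: "(1 + s) * exp (- (3 * s)) \<le> exp (- (2 * s))"
 proof -
  have "(1 + s) * exp (- (3 * s)) \<le> exp s * exp (- (3 * s))" by (intro mult_right_mono exp_ge_add_one_self) auto
  then show ?thesis by (simp add: exp_add[symmetric])
 qed
 have "1 \<le> (3 + Q) * (1 + s)" using s0 Q0 mult_mono[of 1 "3 + Q" 1 "1 + s"] by simp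
 then have "K * exp (- (3 * s)) * 1 \<le> K * exp (- (3 * s)) * ((3 + Q) * (1 + s))"
  using K0 by (intro mult_left_mono) auto
 moreover have fin: "K * exp (- (3 * s)) * ((3 + Q) * (1 + s)) \<le> K * (3 + Q) * exp (- (2 * s))"
  using mult_left_mono[OF ex, of "K * (3 + Q)"] K0 Q0 by (simp add: algebra_simps)
 ultimately show "cmod (u s) \<le> airy_decay_const M Q * exp (- (2 * s))"
  using ub[OF s0] unfolding ac by linarith
 define B where "B = (s + 1 + Q) * (K * exp (- (3 * s)))"
 \<comment> \<open>The derivative is recovered from \<open>u (s + 1) - u s\<close> and from the
   oscillation of \<open>v\<close> over one unit, which the equation bounds by the potential times
   \<open>u\<close>.\<close>
 have vd: "cmod (v x - v s) \<le> B" if x: "s \<le> x" "x \<le> s + 1" for x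
 proof -
  have "cmod (v x - v s) \<le> B * (x - s)"
  proof (rule vector_mvt_bound[OF x(1)])
   fix y assume y: "s \<le> y" "y \<le> x"
   show "(v has_vector_derivative (c * of_real y + q) * u y) (at y within {s..x})"
    by (rule has_vector_derivative_at_within, rule dv) (use y s0 in auto)
   have "cmod (c * of_real y + q) \<le> s + 1 + Q"
   proof -
    have "cmod c * \<bar>y\<bar> \<le> 1 * (s + 1)" by (intro mult_mono e(4)) (use y x s0 in auto)
    then have "cmod (c * of_real y) \<le> s + 1" by (simp add: norm_mult)
    then show ?thesis using norm_triangle_ineq[of "c * of_real y" q] q by linarith
   qed
   moreover have "cmod (u y) \<le> K * exp (- (3 * s))"
   proof -
    have "K * exp (- (3 * y)) \<le> K * exp (- (3 * s))" using y K0 by (intro mult_left_mono) auto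
    then show ?thesis using ub[of y] y s0 by linarith
   qed
   ultimately show "cmod ((c * of_real y + q) * u y) \<le> B"
    unfolding B_def norm_mult by (intro mult_mono) (use s0 Q0 in auto)
  qed
  also have "\<dots> \<le> B * 1" using x K0 Q0 s0 by (intro mult_left_mono) (auto simp: B_def)
  finally show ?thesis by simp
 qed
 have "cmod (u (s + 1) - u s - (s + 1 - s) *\<^sub>R v s) \<le> norm (s + 1 - s) * B"
 proof (rule vector_differentiable_bound_linearization[where S = "{s..s+1}" and f' = v])
  show "(u has_vector_derivative v x) (at x within {s..s + 1})" if "x \<in> {s..s + 1}" for x
   by (rule has_vector_derivative_at_within, rule du) (use that s0 in auto)
  show "closed_segment s (s + 1) \<subseteq> {s..s + 1}" by (simp add: closed_segment_eq_real_ivl)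
 qed (use vd in auto)
 then have "cmod (u (s + 1) - u s - v s) \<le> B" by simp
 moreover have "cmod (v s) \<le> cmod (u (s + 1) - u s - v s) + cmod (u (s + 1)) + cmod (u s)"
  using norm_triangle_ineq4[of "u (s + 1) - u s" "u (s + 1) - u s - v s"] norm_triangle_ineq4[of "u (s + 1)" "u s"]
  by (simp add: algebra_simps)
 moreover have "cmod (u (s + 1)) \<le> K * exp (- (3 * s))"
 proof -
  have "K * exp (- (3 * (s + 1))) \<le> K * exp (- (3 * s))" using K0 by (intro mult_left_mono) auto
  then show ?thesis using ub[of "s + 1"] s0 by linarith
 qed
 ultimately have "cmod (v s) \<le> B + K * exp (- (3 * s)) + K * exp (- (3 * s))" using ub[OF s0] by linarith
 also have "\<dots> = K * exp (- (3 * s)) * (3 + Q + s)" by (simp add: B_def algebra_simps)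
 also have "\<dots> \<le> K * exp (- (3 * s)) * ((3 + Q) * (1 + s))"
 proof (rule mult_left_mono)
  have "(3 + Q) * (1 + s) = 3 + Q + s + (2 + Q) * s" by (simp add: algebra_simps)
  moreover have "(2 + Q) * s \<ge> 0" using s0 Q0 by simp
  ultimately show "3 + Q + s \<le> (3 + Q) * (1 + s)" by linarith
 qed (use K0 in auto)
 also have "\<dots> \<le> airy_decay_const M Q * exp (- (2 * s))" using fin unfolding ac .
 finally show "cmod (v s) \<le> airy_decay_const M Q * exp (- (2 * s))" .
 show "Re (e * (cnj (u s) * v s)) \<le> 0" if "s \<ge> 2 * Q + 36"
  using Jneg[of s] that by (simp add: J_def S_def)
qed

section \<open>Airy functions as differences of rotated Scorer functions\<close>

definition om :: complex where "om = Complex (- 1 / 2) (sqrt 3 / 2)"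

lemma om_simps: "Re om = - 1 / 2" "Im om = sqrt 3 / 2"
 and om2: "om^2 = Complex (- 1 / 2) (- sqrt 3 / 2)"
 and om3: "om^3 = 1"
 and cnj_om: "cnj om = om^2"
proof -
 show "Re om = - 1 / 2" "Im om = sqrt 3 / 2" by (simp_all add: om_def)
 show o2: "om^2 = Complex (- 1 / 2) (- sqrt 3 / 2)"
  by (simp add: om_def power2_eq_square complex_eq_iff field_simps)
 show "cnj om = om^2" unfolding o2 by (simp add: om_def complex_eq_iff)
 have "om^3 = om^2 * om" by (simp add: power3_eq_cube power2_eq_square)
 also have "\<dots> = 1" unfolding o2 by (simp add: om_def complex_eq_iff field_simps)
 finally show "om^3 = 1" .
qed

lemma om6: "om^6 = 1"
proof -
 have "om^6 = (om^3)^2" by (simp only: power_mult[symmetric]) simp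
 then show ?thesis by (simp add: om3)
qed

lemma om2_simps: "Re (om^2) = - 1 / 2" "Im (om^2) = - sqrt 3 / 2" "(om^2)^3 = 1" "cmod om = 1" "cmod (om^2) = 1"
proof -
 show "Re (om^2) = - 1 / 2" "Im (om^2) = - sqrt 3 / 2" by (simp_all add: om2)
 show "(om^2)^3 = 1" by (metis om3 power_mult mult.commute power_one)
 show n: "cmod om = 1" by (simp add: om_def cmod_def power_divide)
 then show "cmod (om^2) = 1" by (simp add: norm_power)
qed

text \<open>For a cube root of unity \<open>r\<close>, rotation by \<open>r\<close> maps solutions
  of \<open>y'' = nu * y + 1\<close> to solutions of the same equation; \<open>om\<close> is the
  primitive root in the upper half-plane.\<close>

definition rscorer :: "complex \<Rightarrow> complex \<Rightarrow> complex" where "rscorer r nu = r * scorer 0 (r * nu)"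
definition rscorer' :: "complex \<Rightarrow> complex \<Rightarrow> complex" where "rscorer' r nu = r^2 * scorer 1 (r * nu)"

lemma rscorer_deriv: "(rscorer r has_field_derivative rscorer' r nu) (at nu)"
proof -
 have "((\<lambda>nu. r * scorer 0 (r * nu)) has_field_derivative r * (scorer (Suc 0) (r * nu) * r)) (at nu)"
  by (intro DERIV_cmult DERIV_chain2[OF scorer_has_field_derivative] DERIV_cmult_Id)
 then show ?thesis by (simp add: rscorer_def[abs_def] rscorer'_def power2_eq_square algebra_simps)
qed

lemma rscorer'_deriv:
 assumes "r^3 = 1"
 shows "(rscorer' r has_field_derivative nu * rscorer r nu + 1) (at nu)"
proof -
 have "((\<lambda>nu. r^2 * scorer 1 (r * nu)) has_field_derivative r^2 * (scorer (Suc 1) (r * nu) * r)) (at nu)"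
  by (intro DERIV_cmult DERIV_chain2[OF scorer_has_field_derivative] DERIV_cmult_Id)
 moreover have "r^2 * (scorer (Suc 1) (r * nu) * r) = r^3 * scorer 2 (r * nu)"
  by (simp add: power3_eq_cube power2_eq_square numeral_2_eq_2)
 ultimately show ?thesis
  using assms by (simp add: rscorer'_def[abs_def] rscorer_def scorer_ode algebra_simps)
qed

lemma rscorer_bound:
 assumes "Re (r * nu) \<le> R" "cmod r = 1"
 shows "cmod (rscorer r nu) \<le> exp ((R + 2)^2 + 1)" "cmod (rscorer' r nu) \<le> exp ((R + 2)^2 + 1)"
 using scorer_bound[OF assms(1), of 0] scorer_bound[OF assms(1), of 1] assms(2)
 by (simp_all add: rscorer_def rscorer'_def norm_mult norm_power)

text \<open>In the difference of two rotated Scorer functions the inhomogeneities cancel, which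
  leaves Airy's equation. The choice of the two roots decides in which direction the solution
  decays.\<close>

definition airy :: "complex \<Rightarrow> complex \<Rightarrow> complex \<Rightarrow> complex" where "airy r r' nu = rscorer r nu - rscorer r' nu"
definition airy' :: "complex \<Rightarrow> complex \<Rightarrow> complex \<Rightarrow> complex" where "airy' r r' nu = rscorer' r nu - rscorer' r' nu"

lemma airy_deriv: "(airy r r' has_field_derivative airy' r r' nu) (at nu)"
 unfolding airy_def[abs_def] airy'_def by (intro DERIV_diff rscorer_deriv)

lemma airy'_deriv:
 assumes "r^3 = 1" "r'^3 = 1"
 shows "(airy' r r' has_field_derivative nu * airy r r' nu) (at nu)"
 using DERIV_diff[OF rscorer'_deriv[OF assms(1)] rscorer'_deriv[OF assms(2)], of nu]
 by (simp add: airy_def airy'_def[abs_def] algebra_simps)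

lemma DERIV_along_line:
 assumes "(f has_field_derivative f') (at (z + d * of_real s))"
 shows "((\<lambda>s. f (z + d * of_real s)) has_vector_derivative d * f') (at s within T)"
proof -
 have "((\<lambda>s. of_real s :: complex) has_vector_derivative 1) (at s)"
  by (rule bounded_linear.has_vector_derivative[OF bounded_linear_of_real, of "\<lambda>s. s" 1, simplified])
 then have "((\<lambda>s. z + d * of_real s) has_vector_derivative d) (at s)"
  by (auto intro!: derivative_eq_intros has_vector_derivative_mult_right[of _ 1 _ d, simplified] has_vector_derivative_add_const)
 from field_vector_diff_chain_at[OF this, of f f'] assms show ?thesis
  by (auto simp: o_def intro: has_vector_derivative_at_within)
qed

text \<open>When \<open>r * d\<close> and \<open>r' * d\<close> lie in the closed left half-plane,
  both Scorer functions are bounded along \<open>nu + d * s\<close>. The potential along this ray is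
  \<open>d^3 * s + d^2 * nu\<close>, hence the condition on \<open>e * d^3\<close>.\<close>

lemma airy_decay:
 assumes r: "r^3 = 1" "r'^3 = 1" "cmod r = 1" "cmod r' = 1"
  and d: "cmod d = 1" "Re (r * d) \<le> 0" "Re (r' * d) \<le> 0"
  and e: "Re e = 1" "cmod e \<le> 2" "Re (e * d^3) = 1"
  and R: "cmod nu \<le> R" and s: "s \<ge> 0"
 shows "cmod (airy r r' (nu + d * of_real s)) \<le> airy_decay_const (2 * exp ((R + 2)^2 + 1)) R * exp (- (2 * s))"
  "cmod (airy' r r' (nu + d * of_real s)) \<le> airy_decay_const (2 * exp ((R + 2)^2 + 1)) R * exp (- (2 * s))"
proof -
 let ?u = "\<lambda>s. airy r r' (nu + d * of_real s)" and ?v = "\<lambda>s. d * airy' r r' (nu + d * of_real s)"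
 let ?M = "2 * exp ((R + 2)^2 + 1)"
 have Rr: "Re (k * (nu + d * of_real s)) \<le> R" if "cmod k = 1" "Re (k * d) \<le> 0" "s \<ge> 0" for k s
 proof -
  have "Re (k * (nu + d * of_real s)) = Re (k * nu) + s * Re (k * d)" by (simp add: algebra_simps)
  moreover have "Re (k * nu) \<le> R"
   using complex_Re_le_cmod[of "k * nu"] R that(1) by (simp add: norm_mult)
  moreover have "s * Re (k * d) \<le> 0" using that by (simp add: mult_nonneg_nonpos)
  ultimately show ?thesis by linarith
 qed
 have b: "cmod (?u s) \<le> ?M" "cmod (airy' r r' (nu + d * of_real s)) \<le> ?M" if "s \<ge> 0" for s
  unfolding airy_def airy'_def
  using rscorer_bound[OF Rr[OF r(3) d(2) that] r(3)] rscorer_bound[OF Rr[OF r(4) d(3) that] r(4)]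
  by (smt (verit) norm_triangle_ineq4)+
 have du: "(?u has_vector_derivative ?v s) (at s)" for s
  by (rule DERIV_along_line) (rule airy_deriv)
 have "(?v has_vector_derivative d * (d * ((nu + d * of_real s) * airy r r' (nu + d * of_real s)))) (at s)" for s
  by (intro has_vector_derivative_mult_right DERIV_along_line airy'_deriv r)
 then have dv: "(?v has_vector_derivative (d^3 * of_real s + d^2 * nu) * ?u s) (at s)" for s
  by (simp add: power3_eq_cube power2_eq_square algebra_simps)
 have b2: "cmod (?v s) \<le> ?M" if "s \<ge> 0" for s using b(2)[OF that] d(1) by (simp add: norm_mult)
 have q: "cmod (d^2 * nu) \<le> R" using R d(1) by (simp add: norm_mult norm_power)
 have c1: "cmod (d^3) \<le> 1" using d(1) by (simp add: norm_power)
 show "cmod (?u s) \<le> airy_decay_const ?M R * exp (- (2 * s))"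
  using airy_type_decay_fun[OF du dv e c1 q b(1) b2 s] by simp
 have "cmod (?v s) \<le> airy_decay_const ?M R * exp (- (2 * s))"
  using airy_type_decay_deriv[OF du dv e c1 q b(1) b2 s] by simp
 then show "cmod (airy' r r' (nu + d * of_real s)) \<le> airy_decay_const ?M R * exp (- (2 * s))"
  using d(1) by (simp add: norm_mult)
qed

text \<open>\<open>tairy nu\<close> is a constant multiple of \<open>Ai (om * nu)\<close>, hence decays in the direction \<open>-\<i>\<close>, and \<open>eig_fun\<close> is
 the antiderivative of \<open>- tairy\<close> that vanishes at \<open>-\<i>\<infinity>\<close>.  So \<open>eig_fun nu = 0\<close> says that \<open>tairy (nu - \<i> * s)\<close>
 has integral zero over \<open>s > 0\<close>.\<close>

definition tairy :: "complex \<Rightarrow> complex" where "tairy = airy 1 (om^2)"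
definition tairy' :: "complex \<Rightarrow> complex" where "tairy' = airy' 1 (om^2)"
definition eig_fun :: "complex \<Rightarrow> complex" where "eig_fun nu = tairy' nu * scorer 0 nu - tairy nu * scorer 1 nu"

lemma tairy_deriv: "(tairy has_field_derivative tairy' nu) (at nu)"
 unfolding tairy_def tairy'_def by (rule airy_deriv)
lemma tairy'_deriv: "(tairy' has_field_derivative nu * tairy nu) (at nu)"
 unfolding tairy_def tairy'_def by (rule airy'_deriv) (simp_all add: om6)

text \<open>\<open>eig_fun\<close> is the Wronskian of a solution of Airy's equation with a solution
  of \<open>y'' = nu * y + 1\<close>, so all products cancel in its derivative except the one with
  the inhomogeneity. This gives the antiderivative of \<open>tairy\<close> in closed form.\<close>

lemma eig_fun_deriv: "(eig_fun has_field_derivative - tairy nu) (at nu)"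
proof -
 have "(eig_fun has_field_derivative
   (nu * tairy nu) * scorer 0 nu + scorer (Suc 0) nu * tairy' nu - (tairy' nu * scorer 1 nu + scorer (Suc 1) nu * tairy nu)) (at nu)"
  unfolding eig_fun_def[abs_def]
  by (intro DERIV_diff DERIV_mult tairy'_deriv tairy_deriv scorer_has_field_derivative)
 then show ?thesis using scorer_ode[of nu] by (simp add: numeral_2_eq_2 algebra_simps)
qed

definition tdecay :: "real \<Rightarrow> real" where "tdecay R = airy_decay_const (2 * exp ((R + 2)^2 + 1)) R"

lemma tairy_decay:
 assumes "cmod nu \<le> R" "s \<ge> 0"
 shows "cmod (tairy (nu - \<i> * of_real s)) \<le> tdecay R * exp (- (2 * s))"
  "cmod (tairy' (nu - \<i> * of_real s)) \<le> tdecay R * exp (- (2 * s))"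
proof -
 have e: "cmod (1 - \<i>) \<le> 2" using norm_triangle_ineq4[of 1 \<i>] by simp
 have i3: "(- \<i>)^3 = \<i>" by (simp add: power3_eq_cube)
 show "cmod (tairy (nu - \<i> * of_real s)) \<le> tdecay R * exp (- (2 * s))"
  "cmod (tairy' (nu - \<i> * of_real s)) \<le> tdecay R * exp (- (2 * s))"
  using airy_decay[of 1 "om^2" "- \<i>" "1 - \<i>" nu R s] e assms
  by (simp_all add: om2_simps om6 i3 tairy_def tairy'_def tdecay_def)
qed

lemma eig_fun_decay:
 assumes "cmod nu \<le> R" "s \<ge> 0"
 shows "cmod (eig_fun (nu - \<i> * of_real s)) \<le> 2 * tdecay R * exp ((R + 2)^2 + 1) * exp (- (2 * s))"
proof -
 have R: "Re (nu - \<i> * of_real s) \<le> R" using complex_Re_le_cmod[of nu] assms(1) by simp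
 let ?z = "nu - \<i> * of_real s" and ?E = "tdecay R * exp (- (2 * s))" and ?S = "exp ((R + 2)^2 + 1)"
 have s: "cmod (scorer 0 ?z) \<le> ?S" "cmod (scorer 1 ?z) \<le> ?S"
  using scorer_bound[OF R, of 0] scorer_bound[OF R, of 1] by simp_all
 have E0: "?E \<ge> 0" using tairy_decay(1)[OF assms] norm_ge_zero order_trans by blast
 have "cmod (eig_fun ?z) \<le> cmod (tairy' ?z) * cmod (scorer 0 ?z) + cmod (tairy ?z) * cmod (scorer 1 ?z)"
  unfolding eig_fun_def using norm_triangle_ineq4 by (metis norm_mult)
 also have "\<dots> \<le> ?E * ?S + ?E * ?S"
  by (intro add_mono mult_mono s tairy_decay assms E0) auto
 finally show ?thesis by (simp add: algebra_simps)
qed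

text \<open>The companion \<open>airy 1 om\<close> is the solution that decays in the direction
  \<open>\<i>\<close>. The Wronskian is constant, and at 0 it is a product of two positive Scorer
  values with a number of imaginary part \<open>3 * sqrt 3\<close>.\<close>

lemma tairy_wronskian:
 "\<exists>w. w \<noteq> 0 \<and> (\<forall>nu. tairy nu * airy' 1 om nu - tairy' nu * airy 1 om nu = w)"
proof -
 define W where "W nu = tairy nu * airy' 1 om nu - tairy' nu * airy 1 om nu" for nu
 have "(W has_field_derivative (tairy' nu * airy' 1 om nu + nu * airy 1 om nu * tairy nu
   - (nu * tairy nu * airy 1 om nu + airy' 1 om nu * tairy' nu))) (at nu)" for nu
  unfolding W_def[abs_def] by (intro DERIV_diff DERIV_mult tairy_deriv tairy'_deriv airy_deriv airy'_deriv) (simp_all add: om3)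
 then have "(W has_field_derivative 0) (at nu)" for nu by (simp add: algebra_simps)
 then have "\<exists>c. \<forall>x\<in>UNIV. W x = c" by (intro has_field_derivative_zero_constant) auto
 then have const: "W nu = W 0" for nu by auto
 have real: "\<exists>m>0. scorer k 0 = of_real m" for k
 proof -
  let ?f = "\<lambda>\<tau>::real. \<tau>^k * exp (- (\<tau>^3 / 3))"
  have i: "set_integrable lborel {0<..} (\<lambda>\<tau>. ?f \<tau>)"
  proof -
   have "set_integrable lborel {0<..} (\<lambda>\<tau>. Re (of_real (\<tau>^k) * exp (0 * of_real \<tau> - of_real (\<tau>^3 / 3))))"
    using scorer_integrable[of k 0] unfolding set_integrable_def by (auto dest: integrable_Re)
   moreover have "Re (of_real (\<tau>^k) * exp (0 * of_real \<tau> - of_real (\<tau>^3 / 3))) = ?f \<tau>" for \<tau>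
    by (simp add: Re_exp del: of_real_power)
   ultimately show ?thesis by (simp only:)
  qed
  have "scorer k 0 = (LINT \<tau>:{0<..}|lborel. of_real (?f \<tau>))"
   unfolding scorer_def by (simp add: exp_of_real[symmetric])
  also have "\<dots> = of_real (LINT \<tau>:{0<..}|lborel. ?f \<tau>)"
   by (rule set_integral_complex_of_real)
  finally have eq: "scorer k 0 = of_real (LINT \<tau>:{0<..}|lborel. ?f \<tau>)" .
  have "(LINT \<tau>:{0<..}|lborel. ?f \<tau>) > 0"
  proof -
   have c: "set_integrable lborel {1..2} (\<lambda>\<tau>::real. exp (- (8 / 3)) :: real)" by (simp add: set_integrable_def)
   have "0 < exp (- (8 / 3) :: real)" by simp
   also have "\<dots> = (LINT \<tau>:{1..2::real}|lborel. exp (- (8 / 3) :: real))" by (simp add: set_lebesgue_integral_def)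
   also have "\<dots> \<le> (LINT \<tau>:{0<..}|lborel. ?f \<tau>)"
    unfolding set_lebesgue_integral_def
   proof (rule integral_mono)
    show "integrable lborel (\<lambda>x. indicat_real {1..2::real} x *\<^sub>R exp (- (8 / 3) :: real))" using c by (simp add: set_integrable_def)
    show "integrable lborel (\<lambda>\<tau>. indicat_real {0<..} \<tau> *\<^sub>R (?f \<tau>))" using i by (simp add: set_integrable_def)
    fix x :: real
    have "exp (- (8 / 3)) \<le> x^k * exp (- (x^3 / 3))" if "1 \<le> x" "x \<le> 2"
    proof -
     have "x^3 \<le> 2^3" using that by (intro power_mono) auto
     then have "1 * exp (- (8 / 3)) \<le> x^k * exp (- (x^3 / 3))"
      using that by (intro mult_mono) auto
     then show ?thesis by simp
    qed
    then show "indicat_real {1..2::real} x *\<^sub>R exp (- (8 / 3)) \<le> indicat_real {0<..} x *\<^sub>R (x^k * exp (- (x^3 / 3)))"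
     by (auto simp: indicator_def)
   qed
   finally show ?thesis .
  qed
  with eq show ?thesis by blast
 qed
 obtain m0 where m0: "m0 > 0" "scorer 0 0 = of_real m0" using real by blast
 obtain m1 where m1: "m1 > 0" "scorer 1 0 = of_real m1" using real by blast
 have om4: "(om^2)^2 = om" using om3 by (metis mult.right_neutral numeral_Bit0 power_add power2_eq_square power3_eq_cube mult.assoc mult.commute)
 have om4': "om^4 = om" using om4 by (simp add: power_mult[symmetric])
 have "W 0 = of_real m0 * of_real m1 * ((1 - om^2) * (1 - om^2) - (1 - om) * (1 - om))"
  by (simp add: W_def tairy_def tairy'_def airy_def airy'_def rscorer_def rscorer'_def m0 m1 om4 om4' algebra_simps del: One_nat_def)
 moreover have "(1 - om^2) * (1 - om^2) - (1 - om) * (1 - om) \<noteq> 0"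
 proof -
  have "Im ((1 - om^2) * (1 - om^2) - (1 - om) * (1 - om)) = 3 * sqrt 3"
   by (simp add: om2_simps om_simps)
  then show ?thesis by force
 qed
 ultimately have "W 0 \<noteq> 0" using m0 m1 by simp
 then show ?thesis using const by (auto simp: W_def intro!: exI[of _ "W 0"])
qed

lemma tairy_nontrivial: "tairy nu \<noteq> 0 \<or> tairy' nu \<noteq> 0"
proof -
 obtain w where "w \<noteq> 0" "\<And>nu. tairy nu * airy' 1 om nu - tairy' nu * airy 1 om nu = w"
  using tairy_wronskian by blast
 from this(2)[of nu] this(1) show ?thesis by auto
qed

section \<open>Zeros of the eigenvalue function\<close>

text \<open>Monotone functions that start nonnegative and end at 0 are constant. Energy functionals
  whose derivative is a square thereby force the squared quantity to vanish.\<close>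

lemma mono_null:
 fixes f f' :: "real \<Rightarrow> real"
 assumes d: "\<And>s. s \<ge> 0 \<Longrightarrow> (f has_real_derivative f' s) (at s)"
  and p: "\<And>s. s \<ge> 0 \<Longrightarrow> f' s \<ge> 0" and f0: "f 0 \<ge> 0" and lim: "(f \<longlongrightarrow> 0) at_top" and s: "s > 0"
 shows "f' s = 0"
proof -
 have mono: "f s \<le> f t" if "0 \<le> s" "s \<le> t" for s t
  by (rule DERIV_nonneg_imp_nondecreasing[OF that(2)]) (meson d p that order_trans)
 have z: "f s = 0" if "s \<ge> 0" for s
 proof (rule antisym)
  show "f s \<le> 0"
   by (rule tendsto_lowerbound[OF lim]) (use mono[OF that] in \<open>auto intro: eventually_mono[OF eventually_ge_at_top[of s]]\<close>)
  show "f s \<ge> 0" using mono[of 0 s] that f0 by simp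
 qed
 have "((\<lambda>_. 0) has_real_derivative f' s) (at s)"
  by (rule has_field_derivative_transform_within_open[OF d[of s], of "{0<..}"]) (use s z in auto)
 then show ?thesis using DERIV_unique[OF _ DERIV_const] by blast
qed

lemma null_at_top_if_bounded:
 fixes f :: "real \<Rightarrow> 'a::real_normed_vector"
 assumes "\<And>s. s \<ge> 0 \<Longrightarrow> norm (f s) \<le> g s" and "(g \<longlongrightarrow> 0) at_top"
 shows "(f \<longlongrightarrow> 0) at_top"
 by (rule Lim_null_comparison[OF eventually_mono[OF eventually_ge_at_top[of 0] assms(1)] assms(2)])

lemma scorer_cnj: "scorer k (cnj nu) = cnj (scorer k nu)"
proof -
 have "cnj (scorer k nu) = (LINT \<tau>:{0<..}|lborel. cnj (of_real (\<tau>^k) * exp (nu * of_real \<tau> - of_real (\<tau>^3 / 3))))"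
  unfolding scorer_def set_lebesgue_integral_def by (subst Bochner_Integration.integral_cnj[symmetric]) simp
 then show ?thesis unfolding scorer_def by (simp add: exp_cnj)
qed

lemma tairy_bound: "cmod (tairy nu) \<le> 2 * exp ((cmod nu + 2)^2 + 1)" "cmod (tairy' nu) \<le> 2 * exp ((cmod nu + 2)^2 + 1)"
proof -
 have 1: "Re (1 * nu) \<le> cmod nu" using complex_Re_le_cmod[of nu] by simp
 have 2: "Re (om^2 * nu) \<le> cmod nu" using complex_Re_le_cmod[of "om^2 * nu"] by (simp add: norm_mult om2_simps)
 show "cmod (tairy nu) \<le> 2 * exp ((cmod nu + 2)^2 + 1)" "cmod (tairy' nu) \<le> 2 * exp ((cmod nu + 2)^2 + 1)"
  unfolding tairy_def tairy'_def airy_def airy'_def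
  using rscorer_bound[OF 1] rscorer_bound[OF 2] norm_triangle_ineq4[of "rscorer 1 nu" "rscorer (om^2) nu"]
   norm_triangle_ineq4[of "rscorer' 1 nu" "rscorer' (om^2) nu"] by (auto simp: om2_simps)
qed

text \<open>If \<open>tairy nu = 0\<close> as well, then self-adjointness on the ray from \<open>nu\<close> in the direction \<open>om^2\<close> forces \<open>om * nu\<close>
 to be real; there \<open>eig_fun\<close> is purely imaginary and the functional \<open>P\<close> below is monotone and vanishes at both ends.\<close>

lemma eig_fun_simple:
 assumes z: "eig_fun nu = 0"
 shows "tairy nu \<noteq> 0"
proof
 assume A0: "tairy nu = 0"
 define R where "R = cmod nu"
 define U where "U s = tairy (nu + om^2 * of_real s)" for s
 define V where "V s = om^2 * tairy' (nu + om^2 * of_real s)" for s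
 define f where "f s = eig_fun (nu + om^2 * of_real s)" for s
 have om4: "om^4 = om" using om3 by (simp add: eval_nat_numeral)
 have dU: "(U has_vector_derivative V s) (at s)" for s
  unfolding U_def V_def by (rule DERIV_along_line) (rule tairy_deriv)
 have "(V has_vector_derivative om^2 * (om^2 * ((nu + om^2 * of_real s) * tairy (nu + om^2 * of_real s)))) (at s)" for s
  unfolding V_def by (intro has_vector_derivative_mult_right DERIV_along_line tairy'_deriv)
 \<comment> \<open>On this ray Airy's equation becomes \<open>U'' = (om * nu + s) * U\<close>, an
   equation on a real half-line whose potential is real up to the constant
   \<open>Im (om * nu)\<close>.\<close>
 moreover have "om^2 * (om^2 * ((nu + om^2 * of_real s) * tairy (nu + om^2 * of_real s))) = (om * nu + of_real s) * U s" for s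
 proof -
  have "om^2 * (om^2 * ((nu + om^2 * of_real s) * t)) = (om^4 * nu + om^6 * of_real s) * t" for t
   by (simp add: algebra_simps eval_nat_numeral)
  then show ?thesis by (simp add: om4 om6 U_def)
 qed
 ultimately have dV: "(V has_vector_derivative (om * nu + of_real s) * U s) (at s)" for s by simp
 have df: "(f has_vector_derivative - (om^2 * U s)) (at s)" for s
  using DERIV_along_line[OF eig_fun_deriv, of nu "om^2" s UNIV] by (simp add: f_def[abs_def] U_def)
 define D where "D = airy_decay_const (2 * exp ((R + 2)^2 + 1)) R"
 have oo: "om^2 * om^2 = om" using om4 by (simp add: power_add[symmetric])
 have dec: "cmod (U s) \<le> D * exp (- (2 * s))" "cmod (tairy' (nu + om^2 * of_real s)) \<le> D * exp (- (2 * s))" if "s \<ge> 0" for s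
  using airy_decay[of 1 "om^2" "om^2" 1 nu R s] that
  by (simp_all add: om2_simps om6 om4 oo om_simps U_def D_def tairy_def tairy'_def R_def)
 then have decV: "cmod (V s) \<le> D * exp (- (2 * s))" if "s \<ge> 0" for s
  using that by (simp add: V_def norm_mult om2_simps)
 have D0: "D \<ge> 0" using dec(1)[of 0] order_trans[OF norm_ge_zero, of "U 0" D] by simp
 define E where "E = exp ((R + 2)^2 + 1)"
 have decf: "cmod (f s) \<le> 2 * D * E * exp (- (2 * s))" if s: "s \<ge> 0" for s
 proof -
  let ?z = "nu + om^2 * of_real s"
  have "Re ?z = Re nu - s / 2" by (simp add: om2_simps)
  then have Rz: "Re ?z \<le> R" using complex_Re_le_cmod[of nu] s by (simp add: R_def)
  have "cmod (f s) \<le> cmod (tairy' ?z) * cmod (scorer 0 ?z) + cmod (tairy ?z) * cmod (scorer 1 ?z)"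
   unfolding f_def eig_fun_def using norm_triangle_ineq4 by (metis norm_mult)
  also have "\<dots> \<le> D * exp (- (2 * s)) * E + D * exp (- (2 * s)) * E"
   using scorer_bound[OF Rz, of 0] scorer_bound[OF Rz, of 1] dec[OF s] D0
   by (intro add_mono mult_mono) (auto simp: E_def U_def)
  finally show ?thesis by (simp add: algebra_simps)
 qed
 have Unz: "\<not> (\<forall>s>0. U s = 0)"
 proof
  assume h: "\<forall>s>0. U s = 0"
  have "((\<lambda>_. 0) has_vector_derivative V 1) (at 1)"
   by (rule has_vector_derivative_transform_within_open[OF dU[of 1], of "{0<..}"]) (use h in auto)
  then have "V 1 = 0" using vector_derivative_unique_at has_vector_derivative_const by blast
  then have "tairy' (nu + om^2 * of_real 1) = 0" using om3 by (auto simp: V_def)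
  moreover have "tairy (nu + om^2 * of_real 1) = 0" using h unfolding U_def by (metis zero_less_one)
  ultimately show False using tairy_nontrivial by blast
 qed
 have real: "Im (om * nu) = 0"
 proof (rule ccontr)
  assume k: "Im (om * nu) \<noteq> 0"
  define \<sigma> :: real where "\<sigma> = sgn (Im (om * nu))"
  define K where "K s = Re ((- \<i> * of_real \<sigma>) * (cnj (U s) * V s))" for s
  have dK: "(K has_real_derivative \<bar>Im (om * nu)\<bar> * (cmod (U s))^2) (at s)" for s
  proof -
   have "(K has_real_derivative Re ((- \<i> * of_real \<sigma>) * (cnj (V s) * V s + cnj (U s) * ((om * nu + of_real s) * U s)))) (at s)"
    unfolding K_def[abs_def] by (rule Re_form_has_derivative[OF dU dV])
   moreover have "Re ((- \<i> * of_real \<sigma>) * (cnj (V s) * V s + cnj (U s) * ((om * nu + of_real s) * U s))) = \<bar>Im (om * nu)\<bar> * (cmod (U s))^2"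
   proof -
    have "(- \<i> * of_real \<sigma>) * (cnj (V s) * V s + cnj (U s) * ((om * nu + of_real s) * U s))
     = - \<i> * of_real (\<sigma> * (cmod (V s))^2) - \<i> * ((om * nu + of_real s) * of_real (\<sigma> * (cmod (U s))^2))"
     by (simp only: of_real_mult complex_norm_square) (simp only: algebra_simps mult_minus_left mult_minus_right minus_mult_left[symmetric] minus_mult_right[symmetric], simp)
    moreover have "Re (- \<i> * of_real a - \<i> * ((z + of_real s) * of_real b)) = Im z * b" for a b and z :: complex
     by (simp add: algebra_simps)
    ultimately have "Re ((- \<i> * of_real \<sigma>) * (cnj (V s) * V s + cnj (U s) * ((om * nu + of_real s) * U s)))
     = Im (om * nu) * (\<sigma> * (cmod (U s))^2)" by (simp only:)
    then show ?thesis by (simp only: \<sigma>_def abs_sgn mult.assoc)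
   qed
   ultimately show ?thesis by simp
  qed
  have "(K \<longlongrightarrow> 0) at_top"
  proof (rule null_at_top_if_bounded)
   fix s :: real assume s: "s \<ge> 0"
   have "cmod (- \<i> * of_real \<sigma>) \<le> 1" by (simp add: norm_mult \<sigma>_def sgn_if)
   then have "\<bar>K s\<bar> \<le> 1 * (cmod (U s) * cmod (V s))"
    unfolding K_def by (intro order_trans[OF Re_cnj_mult_le] mult_right_mono) auto
   also have "\<dots> \<le> 1 * ((D * exp (- (2 * s))) * (D * exp (- (2 * s))))"
    using D0 by (intro mult_mono decV dec s) auto
   finally show "norm (K s) \<le> 1 * ((D * exp (- (2 * s))) * (D * exp (- (2 * s))))" by simp
  qed real_asymp
  moreover have "K 0 = 0" using A0 by (simp add: K_def U_def)
  ultimately have "\<bar>Im (om * nu)\<bar> * (cmod (U s))^2 = 0" if "s > 0" for s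
   by (intro mono_null[OF dK _ _ _ that]) auto
  then have "U s = 0" if "s > 0" for s
   using that k by (metis abs_eq_0 mult_eq_0_iff norm_eq_zero zero_eq_power2)
  then show False using Unz by blast
 qed
 define x where "x = Re (om * nu)"
 have xv: "om * nu = of_real x" using real by (simp add: x_def complex_eq_iff)
 have nu: "nu + om^2 * of_real s = om^2 * of_real (x + s)" for s
 proof -
  have "om^2 * (om * nu) = om^3 * nu" by (simp add: power3_eq_cube power2_eq_square)
  then show ?thesis using xv om3 by (simp add: algebra_simps)
 qed
 \<comment> \<open>Now \<open>om * nu = x\<close> is real, so the two rotated Scorer terms in
   \<open>om^2 * U s\<close> are complex conjugates of each other with opposite signs.\<close>
 have ReU: "Re (om^2 * U s) = 0" for s
 proof -
  let ?p = "om * scorer 0 (om * of_real (x + s))"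
  have "cnj ?p = om^2 * scorer 0 (om^2 * of_real (x + s))"
   by (simp only: complex_cnj_mult cnj_om scorer_cnj[symmetric] complex_cnj_complex_of_real)
  moreover have "om^2 * U s = om^2 * scorer 0 (om^2 * of_real (x + s)) - ?p"
  proof -
   have "om^2 * (om^2 * of_real (x + s)) = om * of_real (x + s)" using oo by (simp add: mult.assoc[symmetric])
   then have "U s = scorer 0 (om^2 * of_real (x + s)) - om^2 * scorer 0 (om * of_real (x + s))"
    unfolding U_def nu tairy_def airy_def rscorer_def by (simp add: om4)
   then show ?thesis by (simp only: right_diff_distrib mult.assoc[symmetric] oo)
  qed
  ultimately have "om^2 * U s = cnj ?p - ?p" by simp
  then show ?thesis by simp
 qed
 have Ref: "Re (f s) = 0" if "s \<ge> 0" for s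
 proof -
  have d: "((\<lambda>s. Re (f s)) has_real_derivative 0) (at s)" for s
   using bounded_linear.has_vector_derivative[OF bounded_linear_Re df[of s]] ReU
   by (simp add: has_real_derivative_iff_has_vector_derivative)
  have c: "Re (f s) = Re (f t)" for t using DERIV_isconst_all[of "\<lambda>s. Re (f s)"] d by blast
  have "((\<lambda>t. Re (f t)) \<longlongrightarrow> 0) at_top"
  proof (rule null_at_top_if_bounded)
   show "norm (Re (f t)) \<le> 2 * D * E * exp (- (2 * t))" if "t \<ge> 0" for t
    using abs_Re_le_cmod[of "f t"] decf[OF that] by simp
  qed real_asymp
  moreover have "(\<lambda>t. Re (f t)) = (\<lambda>t. Re (f s))" using c by metis
  ultimately show ?thesis by (simp add: tendsto_const_iff)
 qed
 define \<rho> where "\<rho> s = Im (f s)" for s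
 define p where "p s = - Im (om^2 * U s)" for s
 define w where "w s = - Im (om^2 * V s)" for s
 have d\<rho>: "(\<rho> has_real_derivative p s) (at s)" for s
  using bounded_linear.has_vector_derivative[OF bounded_linear_Im df[of s]]
  unfolding \<rho>_def[abs_def] p_def by (simp add: has_real_derivative_iff_has_vector_derivative)
 have dp: "(p has_real_derivative w s) (at s)" for s
  using bounded_linear.has_vector_derivative[OF bounded_linear_Im has_vector_derivative_minus[OF has_vector_derivative_mult_right[OF dU[of s], of "om^2"]]]
  unfolding p_def[abs_def] w_def by (simp add: has_real_derivative_iff_has_vector_derivative)
 have dw: "(w has_real_derivative (x + s) * p s) (at s)" for s
 proof -
  have eq: "Im (- (om^2 * ((om * nu + of_real s) * U s))) = (x + s) * p s"
  proof -
   have "om^2 * ((om * nu + of_real s) * U s) = of_real (x + s) * (om^2 * U s)" by (simp add: xv)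
   moreover have "Im (- (of_real r * z)) = r * - Im z" for r z by simp
   ultimately show ?thesis by (simp only: p_def)
  qed
  show ?thesis
   using bounded_linear.has_vector_derivative[OF bounded_linear_Im has_vector_derivative_minus[OF has_vector_derivative_mult_right[OF dV[of s], of "om^2"]]]
   unfolding w_def[abs_def] eq[symmetric] by (simp add: has_real_derivative_iff_has_vector_derivative)
 qed
 \<comment> \<open>\<open>\<rho>\<close> satisfies \<open>\<rho>''' = (x + s) * \<rho>'\<close>.
   Multiplication by \<open>\<rho>\<close> and integration by parts yield this primitive of
   \<open>\<rho>^2 / 2\<close>. It vanishes at \<open>s = 0\<close> because \<open>\<rho>\<close>
   and \<open>p\<close> do, that is, because \<open>eig_fun nu\<close> and \<open>tairy nu\<close>
   are both assumed to be 0.\<close>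
 define P where "P s = (p s)^2 / 2 + (x + s) * (\<rho> s)^2 / 2 - \<rho> s * w s" for s
 have dP: "(P has_real_derivative (\<rho> s)^2 / 2) (at s)" for s unfolding P_def[abs_def]
  by (rule derivative_eq_intros d\<rho> dp dw refl | simp)+ (simp add: power2_eq_square field_simps)
 define C where "C = D + 2 * D * E"
 have C0: "C \<ge> 0" using D0 by (simp add: C_def E_def)
 have DC: "D \<le> C" "2 * D * E \<le> C" using D0 by (auto simp: C_def E_def)
 have b: "\<bar>\<rho> s\<bar> \<le> C * exp (- (2 * s))" "\<bar>p s\<bar> \<le> C * exp (- (2 * s))" "\<bar>w s\<bar> \<le> C * exp (- (2 * s))" if s: "s \<ge> 0" for s
 proof -
  have m: "D * exp (- (2 * s)) \<le> C * exp (- (2 * s))" "2 * D * E * exp (- (2 * s)) \<le> C * exp (- (2 * s))"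
   using DC by (auto intro!: mult_right_mono)
  have n: "cmod (om^2 * z) = cmod z" for z by (simp add: norm_mult om2_simps)
  show "\<bar>\<rho> s\<bar> \<le> C * exp (- (2 * s))" using decf[OF s] m abs_Im_le_cmod[of "f s"] unfolding \<rho>_def by linarith
  show "\<bar>p s\<bar> \<le> C * exp (- (2 * s))" using dec(1)[OF s] m abs_Im_le_cmod[of "om^2 * U s"]
   unfolding p_def n abs_minus_cancel by linarith
  show "\<bar>w s\<bar> \<le> C * exp (- (2 * s))" using decV[OF s] m abs_Im_le_cmod[of "om^2 * V s"]
   unfolding w_def n abs_minus_cancel by linarith
 qed
 have "(P \<longlongrightarrow> 0) at_top"
 proof (rule null_at_top_if_bounded)
  fix s :: real assume s: "s \<ge> 0"
  let ?T = "C * exp (- (2 * s))"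
  have T0: "?T \<ge> 0" using C0 by simp
  note bb = b[OF s]
  have 1: "(p s)^2 \<le> ?T * ?T" "(\<rho> s)^2 \<le> ?T * ?T" "\<bar>\<rho> s * w s\<bar> \<le> ?T * ?T"
   using power_mono[OF bb(2), of 2] power_mono[OF bb(1), of 2] mult_mono[OF bb(1,3) T0]
   by (simp_all add: abs_mult power2_eq_square)
  have "\<bar>(x + s) * (\<rho> s)^2\<bar> \<le> (\<bar>x\<bar> + s) * (?T * ?T)"
   unfolding abs_mult using 1 s by (intro mult_mono) auto
  then show "norm (P s) \<le> (?T * ?T) / 2 + (\<bar>x\<bar> + s) * (?T * ?T) / 2 + ?T * ?T"
   unfolding P_def real_norm_def using 1 zero_le_power2[of "p s"] by linarith
 qed real_asymp
 moreover have "P 0 = 0" using z A0 by (simp add: P_def \<rho>_def p_def f_def U_def)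
 ultimately have "(\<rho> s)^2 / 2 = 0" if "s > 0" for s by (intro mono_null[OF dP _ _ _ that]) auto
 then have f0: "f s = 0" if "s > 0" for s using that Ref[of s] by (simp add: \<rho>_def complex_eq_iff)
 have "U s = 0" if "s > 0" for s
 proof -
  have "((\<lambda>_. 0) has_vector_derivative - (om^2 * U s)) (at s)"
   by (rule has_vector_derivative_transform_within_open[OF df[of s], of "{0<..}"]) (use f0 that in auto)
  then have "- (om^2 * U s) = 0" using vector_derivative_unique_at has_vector_derivative_const by blast
  then show ?thesis using om3 by auto
 qed
 then show False using Unz by blast
qed

section \<open>Zeros of the eigenvalue function stay bounded in left half-planes\<close>

lemma scorer3: "scorer 3 nu = nu * scorer 1 nu + scorer 0 nu"
proof -
 have "(scorer 2 has_field_derivative scorer 3 nu) (at nu)"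
  using scorer_has_field_derivative[of 2 nu] by (simp add: numeral_3_eq_3 numeral_2_eq_2)
 moreover have "((\<lambda>nu. nu * scorer 0 nu + 1) has_field_derivative (1 * scorer 0 nu + scorer (Suc 0) nu * nu + 0)) (at nu)"
  by (intro DERIV_add DERIV_mult DERIV_ident DERIV_const scorer_has_field_derivative)
 moreover have "scorer 2 = (\<lambda>nu. nu * scorer 0 nu + 1)" using scorer_ode by auto
 ultimately show ?thesis using DERIV_unique by (fastforce simp: mult.commute)
qed

lemma scorer4: "scorer 4 nu = nu * scorer 2 nu + 2 * scorer 1 nu"
proof -
 have "(scorer 3 has_field_derivative scorer 4 nu) (at nu)"
  using scorer_has_field_derivative[of 3 nu] by (simp add: eval_nat_numeral)
 moreover have "((\<lambda>nu. nu * scorer 1 nu + scorer 0 nu) has_field_derivative (1 * scorer 1 nu + scorer (Suc 1) nu * nu + scorer (Suc 0) nu)) (at nu)"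
  by (intro DERIV_add DERIV_mult DERIV_ident scorer_has_field_derivative)
 moreover have "scorer 3 = (\<lambda>nu. nu * scorer 1 nu + scorer 0 nu)" using scorer3 by auto
 ultimately have "scorer 4 nu = 1 * scorer 1 nu + scorer (Suc 1) nu * nu + scorer (Suc 0) nu"
  using DERIV_unique by metis
 then show ?thesis by (simp add: numeral_2_eq_2 algebra_simps)
qed

lemma scorer5: "scorer 5 nu = nu * scorer 3 nu + 3 * scorer 2 nu"
proof -
 have "(scorer 4 has_field_derivative scorer 5 nu) (at nu)"
  using scorer_has_field_derivative[of 4 nu] by (simp add: eval_nat_numeral)
 moreover have "((\<lambda>nu. nu * scorer 2 nu + 2 * scorer 1 nu) has_field_derivative (1 * scorer 2 nu + scorer (Suc 2) nu * nu + 2 * scorer (Suc 1) nu)) (at nu)"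
  by (intro DERIV_add DERIV_mult DERIV_ident DERIV_cmult scorer_has_field_derivative)
 moreover have "scorer 4 = (\<lambda>nu. nu * scorer 2 nu + 2 * scorer 1 nu)" using scorer4 by auto
 ultimately have "scorer 5 nu = 1 * scorer 2 nu + scorer (Suc 2) nu * nu + 2 * scorer (Suc 1) nu"
  using DERIV_unique by metis
 then show ?thesis by (simp add: eval_nat_numeral algebra_simps)
qed

text \<open>In a left half-plane \<open>scorer 0\<close> behaves like \<open>- 1 / nu\<close> and
  \<open>scorer 1\<close> is of smaller order. Both follow from the boundedness of the first six
  Scorer functions: the recurrences for orders 4 and 5 show that orders 2 and 3 are
  \<open>O(1 / cmod nu)\<close>, and then \<open>nu * scorer 0 = scorer 2 - 1\<close> and
  \<open>nu * scorer 1 = scorer 3 - scorer 0\<close>.\<close>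

lemma scorer_ratio:
 "\<exists>N\<ge>1. \<forall>nu. Re nu \<le> R \<longrightarrow> cmod nu \<ge> N \<longrightarrow> scorer 0 nu \<noteq> 0 \<and> 4 * cmod (scorer 1 nu) \<le> cmod (scorer 0 nu)"
proof -
 define B where "B = 120 * exp ((R + 2)^2 + 1)"
 have B1: "B \<ge> 1"
 proof -
  have "1 \<le> exp ((R + 2)^2 + 1)" by simp
  then show ?thesis unfolding B_def by linarith
 qed
 define C where "C = 5 * B + 1"
 have bd: "cmod (scorer k nu) \<le> B" if "Re nu \<le> R" "k \<le> 5" for k nu
 proof -
  have "(fact k :: real) \<le> fact 5" using that by (intro fact_mono) auto
  then have "fact k * exp ((R + 2)^2 + 1) \<le> B" by (simp add: B_def fact_numeral)
  then show ?thesis using scorer_bound[OF that(1), of k] by linarith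
 qed
 have main: "scorer 0 nu \<noteq> 0 \<and> 4 * cmod (scorer 1 nu) \<le> cmod (scorer 0 nu)" if h: "Re nu \<le> R" "cmod nu \<ge> 16 * C" for nu
 proof -
  have n: "cmod nu \<ge> 16 * C" "cmod nu > 0" using h B1 by (auto simp: C_def)
  have c: "cmod (scorer 0 nu) \<le> C / cmod nu" "cmod (scorer 2 nu) \<le> C / cmod nu" "cmod (scorer 3 nu) \<le> C / cmod nu"
  proof -
   have "cmod (nu * scorer 0 nu) \<le> C" using norm_triangle_ineq4[of "scorer 2 nu" 1] bd[OF h(1), of 2] B1
    unfolding scorer_ode[of nu] by (simp add: C_def)
   then show "cmod (scorer 0 nu) \<le> C / cmod nu" using n by (simp add: norm_mult field_simps)
   have "cmod (nu * scorer 2 nu) \<le> C" using norm_triangle_ineq4[of "scorer 4 nu" "2 * scorer 1 nu"] bd[OF h(1), of 4] bd[OF h(1), of 1] B1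
    unfolding scorer4[of nu] by (simp add: C_def norm_mult)
   then show "cmod (scorer 2 nu) \<le> C / cmod nu" using n by (simp add: norm_mult field_simps)
   have "cmod (nu * scorer 3 nu) \<le> C" using norm_triangle_ineq4[of "scorer 5 nu" "3 * scorer 2 nu"] bd[OF h(1), of 5] bd[OF h(1), of 2] B1
    unfolding scorer5[of nu] by (simp add: C_def norm_mult)
   then show "cmod (scorer 3 nu) \<le> C / cmod nu" using n by (simp add: norm_mult field_simps)
  qed
  have C_n: "C / cmod nu \<le> 1 / 16" using n by (simp add: field_simps)
  have "1 \<le> cmod (scorer 2 nu) + cmod (nu * scorer 0 nu)"
   using norm_triangle_ineq4[of "scorer 2 nu" "nu * scorer 0 nu"] scorer_ode[of nu] by simp
  then have h0: "cmod nu * cmod (scorer 0 nu) \<ge> 1 / 2" using c(2) C_n unfolding norm_mult by linarith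
  have "cmod (nu * scorer 1 nu) \<le> cmod (scorer 3 nu) + cmod (scorer 0 nu)"
   using norm_triangle_ineq4[of "scorer 3 nu" "scorer 0 nu"] scorer3[of nu] by simp
  then have "cmod nu * cmod (scorer 1 nu) \<le> 1 / 8" using c C_n unfolding norm_mult by linarith
  then have "cmod nu * (4 * cmod (scorer 1 nu)) \<le> cmod nu * cmod (scorer 0 nu)" using h0 by simp
  then have "4 * cmod (scorer 1 nu) \<le> cmod (scorer 0 nu)" using n(2) by simp
  moreover have "scorer 0 nu \<noteq> 0" using h0 by auto
  ultimately show ?thesis by blast
 qed
 show ?thesis by (rule exI[of _ "16 * C"]) (use main B1 in \<open>auto simp: C_def\<close>)
qed

lemma tairy_along_line:
 shows "((\<lambda>s. tairy (nu - \<i> * of_real s)) has_vector_derivative - \<i> * tairy' (nu - \<i> * of_real s)) (at s within T)"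
  and "((\<lambda>s. - \<i> * tairy' (nu - \<i> * of_real s)) has_vector_derivative (\<i> * of_real s - nu) * tairy (nu - \<i> * of_real s)) (at s within T)"
  and "((\<lambda>s. \<i> * (- eig_fun (nu - \<i> * of_real s))) has_vector_derivative tairy (nu - \<i> * of_real s)) (at s within T)"
proof -
 show "((\<lambda>s. tairy (nu - \<i> * of_real s)) has_vector_derivative - \<i> * tairy' (nu - \<i> * of_real s)) (at s within T)"
  using DERIV_along_line[OF tairy_deriv, of nu "- \<i>" s T] by simp
 have "((\<lambda>s. tairy' (nu - \<i> * of_real s)) has_vector_derivative - \<i> * ((nu - \<i> * of_real s) * tairy (nu - \<i> * of_real s))) (at s within T)"
  using DERIV_along_line[OF tairy'_deriv, of nu "- \<i>" s T] by simp
 from has_vector_derivative_mult_right[OF this, of "- \<i>"]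
 show "((\<lambda>s. - \<i> * tairy' (nu - \<i> * of_real s)) has_vector_derivative (\<i> * of_real s - nu) * tairy (nu - \<i> * of_real s)) (at s within T)"
  by (simp add: algebra_simps)
 have "((\<lambda>s. eig_fun (nu - \<i> * of_real s)) has_vector_derivative - \<i> * - tairy (nu - \<i> * of_real s)) (at s within T)"
  using DERIV_along_line[OF eig_fun_deriv, of nu "- \<i>" s T] by simp
 from has_vector_derivative_mult_right[OF this, of "- \<i>"]
 show "((\<lambda>s. \<i> * (- eig_fun (nu - \<i> * of_real s))) has_vector_derivative tairy (nu - \<i> * of_real s)) (at s within T)"
  by (simp add: algebra_simps)
qed

text \<open>The added square makes the functional positive wherever the slope is small against the
  value. In the derivative it costs \<open>2 * cmod u * cmod v\<close>, which is why the potential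
  must have real part at least 1 rather than 0.\<close>

lemma form_plus_square_mono:
 fixes u v :: "real \<Rightarrow> complex"
 assumes "(u has_vector_derivative v s) (at s)" "(v has_vector_derivative p * u s) (at s)"
  and "Re e = 1" "Re (e * p) \<ge> 1"
 shows "\<exists>y. ((\<lambda>s. Re (e * (cnj (u s) * v s)) + (cmod (u s))^2) has_real_derivative y) (at s) \<and> 0 \<le> y"
proof (intro exI conjI)
 show "((\<lambda>s. Re (e * (cnj (u s) * v s)) + (cmod (u s))^2) has_real_derivative
   Re (e * (cnj (v s) * v s + cnj (u s) * (p * u s))) + 2 * Re (cnj (u s) * v s)) (at s)"
  by (intro DERIV_add Re_form_has_derivative norm_square_has_derivative assms)
 have "Re (e * (cnj (v s) * v s + cnj (u s) * (p * u s))) \<ge> (cmod (v s))^2 + 1 * (cmod (u s))^2"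
  by (rule airy_form_lower_bound) (use assms in auto)
 moreover have "\<bar>Re (cnj (u s) * v s)\<bar> \<le> cmod (u s) * cmod (v s)"
  using Re_cnj_mult_le[of 1 "u s" "v s"] by simp
 moreover have "2 * (cmod (u s) * cmod (v s)) \<le> (cmod (v s))^2 + (cmod (u s))^2"
  using zero_le_power2[of "cmod (v s) - cmod (u s)"] by (simp add: power2_eq_square algebra_simps)
 ultimately show "0 \<le> Re (e * (cnj (v s) * v s + cnj (u s) * (p * u s))) + 2 * Re (cnj (u s) * v s)" by linarith
qed

text \<open>With the slope at most a quarter of the value, the functional starts at no less than
  \<open>5 / 8\<close> of \<open>(cmod (tairy nu))^2\<close>. It is nondecreasing along the ray and
  tends to 0, so the value itself is 0.\<close>

lemma tairy_slope_right:
 assumes e: "Re e = 1" "cmod e \<le> 3 / 2" "\<And>s. s \<ge> 0 \<Longrightarrow> Re (e * (\<i> * of_real s - nu)) \<ge> 1"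
  and "4 * cmod (tairy' nu) \<le> cmod (tairy nu)"
 shows "tairy nu = 0"
proof -
 let ?u = "\<lambda>s. tairy (nu - \<i> * of_real s)" and ?v = "\<lambda>s. - \<i> * tairy' (nu - \<i> * of_real s)"
 define F where "F s = Re (e * (cnj (?u s) * ?v s)) + (cmod (?u s))^2" for s
 have mono: "F 0 \<le> F s" if "s \<ge> 0" for s unfolding F_def
 proof (rule DERIV_nonneg_imp_nondecreasing[OF that])
  fix x :: real assume "0 \<le> x" "x \<le> s"
  then show "\<exists>y. ((\<lambda>s. Re (e * (cnj (?u s) * ?v s)) + (cmod (?u s))^2) has_real_derivative y) (at x) \<and> 0 \<le> y"
   by (intro form_plus_square_mono[OF tairy_along_line(1,2)] e)
 qed
 define D where "D = tdecay (cmod nu)"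
 have dec: "cmod (?u s) \<le> D * exp (- (2 * s))" "cmod (?v s) \<le> D * exp (- (2 * s))" if "s \<ge> 0" for s
  using tairy_decay[OF order_refl that, of nu] by (simp_all add: D_def norm_mult)
 have D0: "D \<ge> 0" using dec(1)[of 0] order_trans[OF norm_ge_zero, of "?u 0" D] by simp
 have "(F \<longlongrightarrow> 0) at_top"
 proof (rule null_at_top_if_bounded)
  fix s :: real assume s: "s \<ge> 0"
  let ?T = "D * exp (- (2 * s))"
  note dd = dec[OF s]
  have "\<bar>Re (e * (cnj (?u s) * ?v s))\<bar> \<le> cmod e * (cmod (?u s) * cmod (?v s))" by (rule Re_cnj_mult_le)
  also have "\<dots> \<le> 3 / 2 * (?T * ?T)" by (intro mult_mono e(2) dd) (use D0 in auto)
  finally have 1: "\<bar>Re (e * (cnj (?u s) * ?v s))\<bar> \<le> 3 / 2 * (?T * ?T)" .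
  have "(cmod (?u s))^2 \<le> ?T * ?T" using power_mono[OF dd(1), of 2] by (simp add: power2_eq_square)
  then show "norm (F s) \<le> 3 * (?T * ?T)"
   unfolding F_def real_norm_def using 1 zero_le_power2[of "cmod (?u s)"] zero_le_square[of ?T] by linarith
 qed real_asymp
 then have "F 0 \<le> 0"
  by (rule tendsto_lowerbound) (use mono in \<open>auto intro: eventually_mono[OF eventually_ge_at_top[of 0]]\<close>)
 then have "(cmod (tairy nu))^2 \<le> - Re (e * (cnj (?u 0) * ?v 0))" by (simp add: F_def)
 also have "\<dots> \<le> cmod e * (cmod (?u 0) * cmod (?v 0))" using Re_cnj_mult_le[of e "?u 0" "?v 0"] by linarith
 also have "\<dots> \<le> 3 / 2 * (cmod (tairy nu) * (cmod (tairy nu) / 4))"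
  by (intro mult_mono e(2)) (use assms(4) in \<open>auto simp: norm_mult\<close>)
 finally have "(cmod (tairy nu))^2 \<le> 3 / 8 * (cmod (tairy nu))^2" by (simp add: power2_eq_square)
 then have "(cmod (tairy nu))^2 \<le> 0" by simp
 then show ?thesis by simp
qed

text \<open>At a zero \<open>tairy' / tairy = scorer 1 / scorer 0\<close>, which is small far out,
  while \<open>tairy\<close> does not vanish there. To the left of real part -1, and below imaginary
  part \<open>- Q - 1\<close> after rotation by \<open>1 - \<i>\<close>, the potential is positive
  along the whole descending ray, which \<open>tairy_slope_right\<close> excludes. The remaining
  half-strip extends upwards and is excluded by the Wronskian with the companion.\<close>

lemma eig_fun_zeros_bounded: "\<exists>N. \<forall>nu. Re nu \<le> R \<longrightarrow> eig_fun nu = 0 \<longrightarrow> cmod nu \<le> N"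
proof -
 define Q where "Q = max R 0"
 have Q: "Q \<ge> 0" "R \<le> Q" by (auto simp: Q_def)
 obtain N where N: "N \<ge> 1" "\<And>nu. Re nu \<le> Q \<Longrightarrow> cmod nu \<ge> N \<Longrightarrow> scorer 0 nu \<noteq> 0 \<and> 4 * cmod (scorer 1 nu) \<le> cmod (scorer 0 nu)"
  using scorer_ratio[of Q] by blast
 obtain w where w: "w \<noteq> 0" "\<And>nu. tairy nu * airy' 1 om nu - tairy' nu * airy 1 om nu = w"
  using tairy_wronskian by blast
 define M where "M = 2 * exp ((2 * Q + 4 + 2)^2 + 1)"
 define D where "D = tdecay (Q + 1)"
 define Y where "Y = 4 * M * D / cmod w"
 have M0: "M > 0" by (simp add: M_def)
 show ?thesis
 proof (intro exI allI impI)
  fix nu assume re: "Re nu \<le> R" and z: "eig_fun nu = 0"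
  show "cmod nu \<le> N + (Q + 1) + (Q + 3) + \<bar>Y\<bar>"
  proof (rule ccontr)
   assume big: "\<not> ?thesis"
   then have nN: "cmod nu \<ge> N" using Q by auto
   have r: "scorer 0 nu \<noteq> 0" "4 * cmod (scorer 1 nu) \<le> cmod (scorer 0 nu)" using N(2)[OF _ nN] re Q by auto
   have sl: "4 * cmod (tairy' nu) \<le> cmod (tairy nu)"
   proof -
    have "tairy' nu * scorer 0 nu = tairy nu * scorer 1 nu" using z by (simp add: eig_fun_def)
    then have "cmod (tairy' nu) * cmod (scorer 0 nu) = cmod (tairy nu) * cmod (scorer 1 nu)" by (metis norm_mult)
    then have "4 * cmod (tairy' nu) * cmod (scorer 0 nu) = cmod (tairy nu) * (4 * cmod (scorer 1 nu))" by simp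
    also have "\<dots> \<le> cmod (tairy nu) * cmod (scorer 0 nu)" using r by (intro mult_left_mono) auto
    finally show ?thesis using r(1) by simp
   qed
   have nz: "tairy nu \<noteq> 0" using z by (rule eig_fun_simple)
   have im1: "cmod (1 - \<i>) \<le> 3 / 2" "cmod (1 + \<i>) \<le> 3 / 2"
   proof -
    have "sqrt 2 \<le> 3 / 2" by (rule real_le_lsqrt) (auto simp: power2_eq_square)
    then show "cmod (1 - \<i>) \<le> 3 / 2" "cmod (1 + \<i>) \<le> 3 / 2" by (simp_all add: cmod_def)
   qed
   have re1: "Re nu > - 1"
   proof (rule ccontr)
    assume "\<not> Re nu > - 1"
    then have "tairy nu = 0" by (intro tairy_slope_right[of 1] sl) auto
    then show False using nz by blast
   qed
   have im: "Im nu > - Q - 1"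
   proof (rule ccontr)
    assume "\<not> Im nu > - Q - 1"
    then have "tairy nu = 0" using re Q im1 by (intro tairy_slope_right[of "1 - \<i>"] sl) (auto simp: algebra_simps)
    then show False using nz by blast
   qed
   have nab: "cmod nu \<le> \<bar>Re nu\<bar> + \<bar>Im nu\<bar>" by (rule cmod_le)
   have aRe: "\<bar>Re nu\<bar> \<le> Q + 1" using re re1 Q by auto
   have y: "Im nu > Q + 3 + \<bar>Y\<bar>" using big nab aRe im N(1) Q by linarith
   define y0 where "y0 = Im nu"
   define \<tau> :: complex where "\<tau> = of_real (Re nu)"
   let ?u = "\<lambda>s. tairy (\<tau> - \<i> * of_real s)" and ?v = "\<lambda>s. - \<i> * tairy' (\<tau> - \<i> * of_real s)"
   \<comment> \<open>The parameter \<open>s\<close> decreases upwards: \<open>nu\<close> sits at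
     \<open>- y0\<close>. With the multiplier \<open>1 + \<i>\<close> the potential is positive down
     to the fixed height \<open>Q + 3\<close>, so monotonicity bounds \<open>tairy nu\<close> by
     values at that height, independently of \<open>y0\<close>.\<close>
   define F where "F s = Re ((1 + \<i>) * (cnj (?u s) * ?v s)) + (cmod (?u s))^2" for s
   have nu: "\<tau> - \<i> * of_real (- y0) = nu" by (simp add: \<tau>_def y0_def complex_eq_iff)
   have "F (- y0) \<le> F (- (Q + 3))"
   proof (rule DERIV_nonneg_imp_nondecreasing[where f = F])
    show "- y0 \<le> - (Q + 3)" using y by (simp add: y0_def)
    fix x assume x: "- y0 \<le> x" "x \<le> - (Q + 3)"
    show "\<exists>y. (F has_real_derivative y) (at x) \<and> 0 \<le> y" unfolding F_def[abs_def]
     by (intro form_plus_square_mono[OF tairy_along_line(1,2)]) (use x re Q in \<open>auto simp: \<tau>_def algebra_simps\<close>)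
   qed
   moreover have "F (- y0) \<ge> (cmod (tairy nu))^2 / 2"
   proof -
    have "\<bar>Re ((1 + \<i>) * (cnj (?u (- y0)) * ?v (- y0)))\<bar> \<le> cmod (1 + \<i>) * (cmod (?u (- y0)) * cmod (?v (- y0)))"
     by (rule Re_cnj_mult_le)
    also have "\<dots> \<le> 3 / 2 * (cmod (tairy nu) * (cmod (tairy nu) / 4))"
     unfolding nu by (intro mult_mono im1) (use sl in \<open>auto simp: norm_mult\<close>)
    finally have 1: "\<bar>Re ((1 + \<i>) * (cnj (?u (- y0)) * ?v (- y0)))\<bar> \<le> 3 / 2 * (cmod (tairy nu) * (cmod (tairy nu) / 4))" .
    show ?thesis using 1[unfolded nu] zero_le_square[of "cmod (tairy nu)"] unfolding F_def nu power2_eq_square by (simp only: abs_le_iff) linarith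
   qed
   moreover have "F (- (Q + 3)) \<le> 3 * (M * M)"
   proof -
    let ?z = "\<tau> - \<i> * of_real (- (Q + 3))"
    have "cmod ?z \<le> 2 * Q + 4"
    proof -
     have "cmod ?z \<le> cmod \<tau> + cmod (\<i> * of_real (- (Q + 3)))" by (rule norm_triangle_ineq4)
     also have "\<dots> \<le> Q + 1 + (Q + 3)" using aRe Q by (intro add_mono) (simp_all add: \<tau>_def norm_mult del: of_real_minus of_real_add of_real_diff minus_add_distrib)
     finally show ?thesis by simp
    qed
    then have "exp ((cmod ?z + 2)^2 + 1) \<le> exp ((2 * Q + 4 + 2)^2 + 1)"
     by (auto intro!: power_mono)
    then have MM: "cmod (tairy ?z) \<le> M" "cmod (tairy' ?z) \<le> M"
     using tairy_bound[of ?z] unfolding M_def by linarith+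
    have "Re ((1 + \<i>) * (cnj (?u (- (Q + 3))) * ?v (- (Q + 3)))) \<le> cmod (1 + \<i>) * (cmod (?u (- (Q + 3))) * cmod (?v (- (Q + 3))))"
     using Re_cnj_mult_le abs_le_D1 by blast
    also have "\<dots> \<le> 3 / 2 * (M * M)"
     by (intro mult_mono im1) (use MM M0 in \<open>auto simp: norm_mult simp del: of_real_minus of_real_add of_real_diff minus_add_distrib\<close>)
    finally have 1: "Re ((1 + \<i>) * (cnj (?u (- (Q + 3))) * ?v (- (Q + 3)))) \<le> 3 / 2 * (M * M)" .
    have "(cmod (?u (- (Q + 3))))^2 \<le> M * M"
     using power_mono[OF MM(1), of 2] by (simp only: power2_eq_square norm_ge_zero)
    then show ?thesis using 1 M0 mult_pos_pos[OF M0 M0] unfolding F_def by linarith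
   qed
   ultimately have "(cmod (tairy nu))^2 \<le> 6 * (M * M)" by linarith
   also have "\<dots> \<le> (3 * M)^2" using M0 by (simp add: power2_eq_square)
   finally have uM: "cmod (tairy nu) \<le> 3 * M" by (rule power2_le_imp_le) (use M0 in auto)
   have B: "cmod (airy 1 om (\<tau> + \<i> * of_real y0)) \<le> D * exp (- (2 * y0))" "cmod (airy' 1 om (\<tau> + \<i> * of_real y0)) \<le> D * exp (- (2 * y0))"
   proof -
    have i3: "\<i>^3 = - \<i>" by (simp add: power3_eq_cube)
    have "cmod \<tau> \<le> Q + 1" using aRe by (simp add: \<tau>_def)
    moreover have "y0 \<ge> 0" using y Q by (simp add: y0_def)
    moreover have "cmod (1 + \<i>) \<le> 2" using im1 by linarith
    ultimately show "cmod (airy 1 om (\<tau> + \<i> * of_real y0)) \<le> D * exp (- (2 * y0))" "cmod (airy' 1 om (\<tau> + \<i> * of_real y0)) \<le> D * exp (- (2 * y0))"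
     using airy_decay[of 1 om \<i> "1 + \<i>" \<tau> "Q + 1" y0]
     by (simp_all add: om3 om2_simps om_simps i3 D_def tdecay_def)
   qed
   have D0: "D \<ge> 0"
   proof (rule ccontr)
    assume "\<not> D \<ge> 0"
    then have "D * exp (- (2 * y0)) < 0" by (simp add: mult_neg_pos)
    then show False using B(1) norm_ge_zero by (smt (verit))
   qed
   have nu': "\<tau> + \<i> * of_real y0 = nu" by (simp add: \<tau>_def y0_def complex_eq_iff)
   \<comment> \<open>\<open>tairy\<close> and its derivative are bounded at \<open>nu\<close>,
     whereas the companion is of size \<open>exp (- (2 * y0))\<close>; the fixed nonzero constant
     \<open>w\<close> therefore bounds \<open>y0\<close>.\<close>
   have "cmod w \<le> cmod (tairy nu) * cmod (airy' 1 om nu) + cmod (tairy' nu) * cmod (airy 1 om nu)"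
    unfolding w(2)[of nu, symmetric] using norm_triangle_ineq4 by (metis norm_mult)
   also have "\<dots> \<le> (3 * M) * (D * exp (- (2 * y0))) + M * (D * exp (- (2 * y0)))"
    by (intro add_mono mult_mono) (use B[unfolded nu'] uM sl M0 D0 in auto)
   also have "\<dots> = 4 * M * D * exp (- (2 * y0))" by (simp add: algebra_simps)
   finally have "cmod w * exp (2 * y0) \<le> 4 * M * D" by (simp add: exp_minus field_simps)
   then have "exp (2 * y0) \<le> Y" using w(1) by (simp add: Y_def field_simps)
   moreover have "exp (2 * y0) \<ge> 1 + 2 * y0" by (rule exp_ge_add_one_self)
   ultimately show False using y Q unfolding y0_def by linarith
  qed
 qed
qed

section \<open>Existence of a zero, from the order of growth\<close>

lemma quadratic_Re_bound_imp_quadratic: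
 assumes hol: "f holomorphic_on UNIV" and f0: "f 0 = 0" and C: "C > 0"
  and bd: "\<And>z. Re (f z) < C * (1 + cmod z)^2"
 obtains c1 c2 where "\<And>z. f z = c1 * z + c2 * z^2"
proof -
 have half: "cmod (f z) \<le> 2 * (C * (1 + 2 * cmod z)^2)" if "z \<noteq> 0" for z
 proof -
  define \<rho> where "\<rho> = 2 * cmod z"
  define M where "M = C * (1 + \<rho>)^2"
  have \<rho>: "\<rho> > 0" using that by (simp add: \<rho>_def)
  have M: "M > 0" using C \<rho> by (simp add: M_def)
  \<comment> \<open>Borel-Caratheodory argument: \<open>w / (2 * M - w)\<close> maps the half-plane
    \<open>Re w < M\<close> into the unit disc, so Schwarz's lemma bounds \<open>f\<close> at half
    the radius \<open>\<rho>\<close>, that is at \<open>z\<close>.\<close>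
  define F where "F \<zeta> = f (of_real \<rho> * \<zeta>) / (of_real (2 * M) - f (of_real \<rho> * \<zeta>))" for \<zeta>
  have Re: "Re (f (of_real \<rho> * \<zeta>)) < M" if "cmod \<zeta> < 1" for \<zeta>
  proof -
   have "cmod (of_real \<rho> * \<zeta>) \<le> \<rho>" using that \<rho> by (simp add: norm_mult)
   then have "C * (1 + cmod (of_real \<rho> * \<zeta>))^2 \<le> M"
    unfolding M_def using C by (intro mult_left_mono power_mono) auto
   then show ?thesis using bd[of "of_real \<rho> * \<zeta>"] by linarith
  qed
  have lt: "cmod w < cmod (of_real (2 * M) - w)" if "Re w < M" for w
  proof -
   have "(cmod (of_real (2 * M) - w))^2 - (cmod w)^2 = 4 * M * (M - Re w)"
    unfolding cmod_power2 by (simp add: power2_eq_square algebra_simps)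
   moreover have "4 * M * (M - Re w) > 0" using M that by simp
   ultimately have "(cmod w)^2 < (cmod (of_real (2 * M) - w))^2" by linarith
   then show ?thesis by (rule power2_less_imp_less) simp
  qed
  have nz: "of_real (2 * M) - f (of_real \<rho> * \<zeta>) \<noteq> 0" if "cmod \<zeta> < 1" for \<zeta>
   using lt[OF Re[OF that]] by auto
  have "cmod (F \<xi>) \<le> cmod \<xi>" if "cmod \<xi> < 1" for \<xi>
  proof (rule Schwarz_Lemma(1)[of F])
   have "(\<lambda>\<zeta>. f (of_real \<rho> * \<zeta>)) holomorphic_on ball 0 1"
    by (rule holomorphic_on_compose_gen[OF _ hol, unfolded o_def]) (auto intro!: holomorphic_intros)
   then show "F holomorphic_on ball 0 1"
    unfolding F_def[abs_def] using nz by (auto intro!: holomorphic_intros)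
   show "F 0 = 0" using f0 by (simp add: F_def)
   show "cmod (F \<zeta>) < 1" if "cmod \<zeta> < 1" for \<zeta>
    using lt[OF Re[OF that]] nz[OF that] by (simp add: F_def norm_divide divide_less_eq)
  qed (use that in auto)
  from this[of "z / of_real \<rho>"] have h: "cmod (F (z / of_real \<rho>)) \<le> 1 / 2"
   using that by (simp add: \<rho>_def norm_divide norm_mult)
  have zz: "of_real \<rho> * (z / of_real \<rho>) = z" using \<rho> by simp
  have "cmod (z / of_real \<rho>) < 1" using that by (simp add: \<rho>_def norm_divide norm_mult)
  note nz' = nz[OF this, unfolded zz]
  have "cmod (f z) \<le> 1 / 2 * cmod (of_real (2 * M) - f z)"
   using h nz' unfolding F_def zz norm_divide by (simp add: field_simps)
  also have "\<dots> \<le> 1 / 2 * (2 * M + cmod (f z))"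
   using norm_triangle_ineq4[of "of_real (2 * M)" "f z"] M by simp
  finally show ?thesis by (simp add: M_def \<rho>_def)
 qed
 have "f z = (\<Sum>k\<le>2. (deriv ^^ k) f 0 / fact k * z^k)" for z
 proof (rule Liouville_polynomial[OF hol, of 1 "18 * C"])
  fix z assume z: "1 \<le> cmod z"
  have "(1 + 2 * cmod z)^2 \<le> (3 * cmod z)^2" using z by (intro power_mono) auto
  then have "2 * (C * (1 + 2 * cmod z)^2) \<le> 2 * (C * (3 * cmod z)^2)" using C by simp
  moreover have "2 * (C * (3 * cmod z)^2) = 18 * C * cmod z^2" by (simp add: power2_eq_square)
  moreover have "z \<noteq> 0" using z by auto
  ultimately show "cmod (f z) \<le> 18 * C * cmod z^2" using half[of z] by linarith
 qed
 then have "f z = deriv f 0 * z + (deriv ^^ 2) f 0 / 2 * z^2" for z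
  using f0 by (simp add: numeral_2_eq_2)
 then show thesis by (rule that)
qed

lemma eig_fun_growth: "cmod (eig_fun nu) \<le> exp (6 + 2 * (cmod nu + 2)^2)"
proof -
 let ?S = "exp ((cmod nu + 2)^2 + 1)"
 have s: "cmod (scorer 0 nu) \<le> ?S" "cmod (scorer 1 nu) \<le> ?S"
  using scorer_bound[OF complex_Re_le_cmod, of 0] scorer_bound[OF complex_Re_le_cmod, of 1] by simp_all
 have "cmod (eig_fun nu) \<le> cmod (tairy' nu) * cmod (scorer 0 nu) + cmod (tairy nu) * cmod (scorer 1 nu)"
  unfolding eig_fun_def using norm_triangle_ineq4 by (metis norm_mult)
 also have "\<dots> \<le> (2 * ?S) * ?S + (2 * ?S) * ?S"
  by (intro add_mono mult_mono s tairy_bound) auto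
 also have "\<dots> = 4 * exp (2 + 2 * (cmod nu + 2)^2)" by (simp add: exp_add[symmetric] algebra_simps)
 also have "\<dots> \<le> exp 4 * exp (2 + 2 * (cmod nu + 2)^2)"
 proof (rule mult_right_mono)
  show "(4::real) \<le> exp 4" using exp_ge_add_one_self[of "4::real"] by simp
 qed auto
 also have "\<dots> = exp (6 + 2 * (cmod nu + 2)^2)" by (simp add: exp_add[symmetric])
 finally show ?thesis .
qed

lemma eig_fun_holomorphic: "eig_fun holomorphic_on S"
 using eig_fun_deriv by (auto simp: holomorphic_on_def field_differentiable_def intro: has_field_derivative_at_within)

lemma tairy_not_identically_zero: "\<exists>nu. tairy nu \<noteq> 0"
proof (rule ccontr)
 assume "\<nexists>nu. tairy nu \<noteq> 0"
 then have z: "tairy = (\<lambda>_. 0)" by auto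
 have "tairy' 0 = 0" using tairy_deriv[of 0] DERIV_unique[OF _ DERIV_const[of 0]] unfolding z by blast
 moreover have "tairy 0 = 0" using z by metis
 ultimately show False using tairy_nontrivial[of 0] by blast
qed

text \<open>A zero-free \<open>eig_fun\<close> would be the exponential of a polynomial of degree at most two, which contradicts
 the equation satisfied by its derivative.\<close>

lemma eig_fun_has_zero: "\<exists>nu. eig_fun nu = 0"
proof (rule ccontr)
 assume "\<nexists>nu. eig_fun nu = 0"
 then have nz: "\<And>nu. eig_fun nu \<noteq> 0" by auto
 obtain q where q: "q holomorphic_on UNIV" "\<And>z. exp (q z) = eig_fun z"
  using holomorphic_logarithm_exists[of UNIV eig_fun 0] eig_fun_holomorphic nz by auto
 define C where "C = 23 + cmod (q 0)"
 have "Re (q z - q 0) < C * (1 + cmod z)^2" for z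
 proof -
  have "exp (Re (q z)) \<le> exp (6 + 2 * (cmod z + 2)^2)"
   using eig_fun_growth[of z] q(2)[of z] by (metis norm_exp_eq_Re)
  then have "Re (q z) \<le> 6 + 2 * (cmod z + 2)^2" by simp
  moreover have "- Re (q 0) \<le> cmod (q 0)" using abs_Re_le_cmod[of "q 0"] by linarith
  moreover have "(cmod z + 2)^2 \<le> (2 * (1 + cmod z))^2" by (intro power_mono) auto
  moreover have "(2 * (1 + cmod z))^2 = 4 * (1 + cmod z)^2" by (simp add: power2_eq_square algebra_simps)
  moreover have "1 \<le> (1 + cmod z)^2" using power_mono[of 1 "1 + cmod z" 2] by simp
  moreover have "C * (1 + cmod z)^2 = 23 * (1 + cmod z)^2 + cmod (q 0) * (1 + cmod z)^2" by (simp add: C_def algebra_simps)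
  moreover have "cmod (q 0) * 1 \<le> cmod (q 0) * (1 + cmod z)^2" using power_mono[of 1 "1 + cmod z" 2] by (intro mult_left_mono) auto
  ultimately show ?thesis unfolding minus_complex.simps mult_1_right by linarith
 qed
 moreover have "(\<lambda>z. q z - q 0) holomorphic_on UNIV" using q(1) by (intro holomorphic_intros)
 moreover have "C > 0" by (simp add: C_def add_pos_nonneg)
 ultimately obtain c1 c2 where c: "\<And>z. q z - q 0 = c1 * z + c2 * z^2"
  using quadratic_Re_bound_imp_quadratic[of "\<lambda>z. q z - q 0" C] by auto
 have q': "q = (\<lambda>z. q 0 + c1 * z + c2 * z^2)"
 proof
  fix z
  have "q z = q 0 + (q z - q 0)" by simp
  also have "\<dots> = q 0 + c1 * z + c2 * z^2" unfolding c by (simp only: add.assoc)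
  finally show "q z = q 0 + c1 * z + c2 * z^2" .
 qed
 define P where "P z = c1 + 2 * c2 * z" for z
 have dq: "(q has_field_derivative P z) (at z)" for z
  by (subst q') (auto intro!: derivative_eq_intros simp: P_def)
 have dE: "((\<lambda>z. exp (q z)) has_field_derivative exp (q z) * P z) (at z)" for z
  using DERIV_chain2[OF DERIV_exp dq[of z]] .
 have dP: "(P has_field_derivative 2 * c2) (at z)" for z
  unfolding P_def[abs_def] by (auto intro!: derivative_eq_intros)
 have E: "eig_fun = (\<lambda>z. exp (q z))" using q(2) by auto
 have t: "tairy z = - (exp (q z) * P z)" for z
 proof -
  have "- tairy z = exp (q z) * P z"
   by (rule DERIV_unique[OF _ dE]) (use eig_fun_deriv[of z] in \<open>simp only: E\<close>)
  then show ?thesis by (simp only: minus_equation_iff[of "tairy z"])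
 qed
 have "(tairy has_field_derivative - (exp (q z) * P z * P z + 2 * c2 * exp (q z))) (at z)" for z
  unfolding t[abs_def] by (intro DERIV_minus DERIV_mult dE dP)
 then have t': "tairy' z = - (exp (q z) * P z * P z + 2 * c2 * exp (q z))" for z
  using DERIV_unique[OF tairy_deriv] by blast
 have "(tairy' has_field_derivative - (((exp (q z) * P z) * P z + 2 * c2 * exp (q z)) * P z + 2 * c2 * (exp (q z) * P z)
   + (2 * c2) * (exp (q z) * P z))) (at z)" for z
  unfolding t'[abs_def] by (intro DERIV_minus DERIV_add DERIV_mult DERIV_cmult dE dP)
 then have k: "z * tairy z = - (((exp (q z) * P z) * P z + 2 * c2 * exp (q z)) * P z + 2 * c2 * (exp (q z) * P z)
   + (2 * c2) * (exp (q z) * P z))" for z by (rule DERIV_unique[OF tairy'_deriv])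
 \<comment> \<open>Inserting \<open>tairy = - P * exp q\<close> into Airy's equation and cancelling
   the exponential leaves a polynomial identity. The second factor has coefficients
   \<open>4 * c2 * c2\<close> and \<open>4 * c1 * c2 - 1\<close>, which cannot both vanish, so the
   first factor \<open>P\<close> is zero.\<close>
 have "P z * (P z * P z + 6 * c2 - z) = 0" for z
 proof -
  have "z * - (e * p) = - (((e * p) * p + 2 * c2 * e) * p + 2 * c2 * (e * p) + (2 * c2) * (e * p))
   \<Longrightarrow> e * (p * (p * p + 6 * c2 - z)) = 0" for e p
  proof -
   assume h: "z * - (e * p) = - (((e * p) * p + 2 * c2 * e) * p + 2 * c2 * (e * p) + (2 * c2) * (e * p))"
   have "e * (p * (p * p + 6 * c2 - z)) = z * - (e * p) + (((e * p) * p + 2 * c2 * e) * p + 2 * c2 * (e * p) + (2 * c2) * (e * p))"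
    by (simp only: ring_distribs mult_minus_right) (simp add: mult_ac)
   then show ?thesis unfolding h by simp
  qed
  from this[OF k[of z, unfolded t]] show ?thesis by simp
 qed
 moreover have "poly ([:c1, 2 * c2:] * ([:c1, 2 * c2:] * [:c1, 2 * c2:] + [:6 * c2:] - [:0, 1:])) z = P z * (P z * P z + 6 * c2 - z)" for z
  by (simp add: P_def algebra_simps)
 ultimately have "[:c1, 2 * c2:] * ([:c1, 2 * c2:] * [:c1, 2 * c2:] + [:6 * c2:] - [:0, 1:]) = 0"
  by (subst poly_all_0_iff_0[symmetric]) (simp only: simp_thms)
 then have "[:c1, 2 * c2:] = 0 \<or> [:c1, 2 * c2:] * [:c1, 2 * c2:] + [:6 * c2:] - [:0, 1:] = 0"
  using mult_eq_0_iff by blast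
 moreover have "[:c1, 2 * c2:] * [:c1, 2 * c2:] + [:6 * c2:] - [:0, 1:] = [:c1 * c1 + 6 * c2, 4 * (c1 * c2) - 1, 4 * (c2 * c2):]"
  by simp
 ultimately have "c1 = 0 \<and> c2 = 0" by auto
 then have "P z = 0" for z by (simp add: P_def)
 then have "tairy z = 0" for z by (simp add: t)
 then show False using tairy_not_identically_zero by blast
qed

lemma finite_eig_fun_zeros: "finite {nu. eig_fun nu = 0 \<and> Re nu \<le> R}"
proof -
 obtain N where N: "\<And>nu. Re nu \<le> R \<Longrightarrow> eig_fun nu = 0 \<Longrightarrow> cmod nu \<le> N"
  using eig_fun_zeros_bounded by blast
 have "\<not> eig_fun constant_on UNIV"
 proof
  assume "eig_fun constant_on UNIV"
  then obtain c where c: "eig_fun = (\<lambda>_. c)" by (auto simp: constant_on_def)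
  have "tairy nu = 0" for nu
   using DERIV_unique[OF eig_fun_deriv[of nu, unfolded c] DERIV_const] by simp
  then show False using tairy_not_identically_zero by blast
 qed
 then have "finite {nu\<in>cball 0 N. eig_fun nu = 0}"
  by (intro holomorphic_compact_finite_zeros[of _ UNIV] eig_fun_holomorphic) auto
 then show ?thesis by (rule rev_finite_subset) (use N in auto)
qed

lemma eig_fun_leftmost_zero: "\<exists>nu. eig_fun nu = 0 \<and> (\<forall>\<mu>. eig_fun \<mu> = 0 \<longrightarrow> Re nu \<le> Re \<mu>)"
proof -
 obtain nu0 where 0: "eig_fun nu0 = 0" using eig_fun_has_zero by blast
 let ?Z = "{nu. eig_fun nu = 0 \<and> Re nu \<le> Re nu0}"
 have fin: "finite ?Z" by (rule finite_eig_fun_zeros)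
 have ne: "?Z \<noteq> {}" using 0 by auto
 obtain nu where "nu \<in> ?Z" "\<And>\<mu>. \<mu> \<in> ?Z \<Longrightarrow> Re nu \<le> Re \<mu>"
  using ex_is_arg_min_if_finite[OF fin ne, of Re] by (auto simp: is_arg_min_linorder)
 then show ?thesis by (intro exI[of _ nu]) (force)
qed

section \<open>Linear differential equations\<close>

lemma gronwall:
 fixes f :: "real \<Rightarrow> real"
 assumes cont: "continuous_on {0..T} f" and b: "b \<ge> 0"
  and le: "\<And>t. t \<in> {0..T} \<Longrightarrow> f t \<le> a + b * integral {0..t} f" and t: "t \<in> {0..T}"
 shows "f t \<le> a * exp (b * t)"
proof -
 define F where "F t = (a + b * integral {0..t} f) * exp (- (b * t))" for t
 have "F t \<le> F 0"
 proof (rule DERIV_nonpos_imp_decreasing_open[of 0 t F])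
  show "0 \<le> t" using t by simp
  fix x assume x: "0 < x" "x < t"
  have "((\<lambda>t. integral {0..t} f) has_real_derivative f x) (at x within {0..T})"
   using integral_has_real_derivative[OF cont, of x] x t by simp
  then have d: "((\<lambda>t. integral {0..t} f) has_real_derivative f x) (at x)"
   using x t by (simp add: at_within_Icc_at)
  have "(F has_real_derivative (b * f x - b * (a + b * integral {0..x} f)) * exp (- (b * x))) (at x)"
   unfolding F_def[abs_def] by (rule derivative_eq_intros d refl | simp)+ (simp add: algebra_simps)
  moreover have "(b * f x - b * (a + b * integral {0..x} f)) * exp (- (b * x)) \<le> 0"
   using le[of x] x t b mult_left_mono[of "f x" "a + b * integral {0..x} f" b] by (intro mult_nonpos_nonneg) auto
  ultimately show "\<exists>y. (F has_real_derivative y) (at x) \<and> y \<le> 0" by blast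
 next
  have "continuous_on {0..T} (\<lambda>t. integral {0..t} f)"
   by (rule indefinite_integral_continuous_1) (rule integrable_continuous_real[OF cont])
  then have "continuous_on {0..t} (\<lambda>t. integral {0..t} f)" by (rule continuous_on_subset) (use t in auto)
  then show "continuous_on {0..t} F" unfolding F_def by (intro continuous_intros)
 qed
 then have "(a + b * integral {0..t} f) * exp (- (b * t)) \<le> a" by (simp add: F_def)
 then have "a + b * integral {0..t} f \<le> a * exp (b * t)" by (simp add: exp_minus field_simps)
 then show ?thesis using le[OF t] by linarith
qed

lemma integral_exp_scale:
 fixes c :: real
 assumes "c > 0" "t \<ge> 0"
 shows "((\<lambda>s. exp (c * s)) has_integral (exp (c * t) - 1) / c) {0..t}"
proof -
 have "((\<lambda>s. exp (c * s)) has_integral (exp (c * t) / c - exp (c * 0) / c)) {0..t}"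
  by (rule fundamental_theorem_of_calculus[OF assms(2)])
   (use assms(1) in \<open>auto intro!: derivative_eq_intros simp: has_real_derivative_iff_has_vector_derivative[symmetric]\<close>)
 then show ?thesis by (simp add: diff_divide_distrib)
qed

text \<open>Picard iteration for \<open>z t = exp (- (c * t)) *\<^sub>R y t\<close>. The weight with
  \<open>c = 2 * (\<bar>L\<bar> + 1)\<close> makes the integral operator a contraction with constant
  1/2 on the whole interval at once, so no short-time solutions have to be glued.\<close>

lemma lipschitz_ode_solution:
 fixes A :: "real \<Rightarrow> 'a::banach \<Rightarrow> 'a"
 assumes T: "T > 0"
  and cont: "\<And>y. continuous_on {0..T} y \<Longrightarrow> continuous_on {0..T} (\<lambda>t. A t (y t))"
  and Lnn: "L \<ge> 0" and lip: "\<And>t x y. t \<in> {0..T} \<Longrightarrow> norm (A t x - A t y) \<le> L * norm (x - y)"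
 obtains y where "y 0 = y0" "\<And>t. t \<in> {0..T} \<Longrightarrow> (y has_vector_derivative A t (y t)) (at t within {0..T})"
proof -
 define c where "c = 2 * (\<bar>L\<bar> + 1)"
 have c: "c > 0" "2 * L \<le> c" by (auto simp: c_def)
 define \<Phi> where "\<Phi> z t = exp (- (c * t)) *\<^sub>R (y0 + integral {0..t} (\<lambda>s. A s (exp (c * s) *\<^sub>R z s)))" for z t
 \<comment> \<open>The fixed point is sought among bounded continuous functions on the line;
   evaluation at the clamped time extends an iterate from the interval to such a function.\<close>
 define cl where "cl t = max 0 (min T t)" for t
 have cl: "cl t \<in> {0..T}" "t \<in> {0..T} \<Longrightarrow> cl t = t" for t using T by (auto simp: cl_def)
 have contA: "continuous_on {0..T} (\<lambda>s. A s (exp (c * s) *\<^sub>R z s))" if "continuous_on {0..T} z" for z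
  by (intro cont continuous_intros that)
 have cont\<Phi>: "continuous_on {0..T} (\<Phi> z)" if "continuous_on {0..T} z" for z
  unfolding \<Phi>_def
  by (intro continuous_intros indefinite_integral_continuous_1 integrable_continuous_real contA that)
 have bc: "(\<lambda>t. \<Phi> (apply_bcontfun z) (cl t)) \<in> bcontfun" for z
 proof -
  have cz: "continuous_on {0..T} (\<Phi> (apply_bcontfun z))" by (rule cont\<Phi>) simp
  have "continuous_on UNIV (\<lambda>t. \<Phi> (apply_bcontfun z) (cl t))"
   by (rule continuous_on_compose2[OF cz]) (use cl in \<open>auto simp: cl_def intro!: continuous_intros\<close>)
  moreover have "bounded (range (\<lambda>t. \<Phi> (apply_bcontfun z) (cl t)))"
  proof (rule bounded_subset)
   show "bounded (\<Phi> (apply_bcontfun z) ` {0..T})"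
    by (intro compact_imp_bounded compact_continuous_image cz) auto
  qed (use cl in auto)
  ultimately show ?thesis by (simp add: bcontfun_def)
 qed
 define \<Psi> where "\<Psi> z = Bcontfun (\<lambda>t. \<Phi> (apply_bcontfun z) (cl t))" for z
 have \<Psi>: "apply_bcontfun (\<Psi> z) t = \<Phi> (apply_bcontfun z) (cl t)" for z t
  unfolding \<Psi>_def by (simp add: Bcontfun_inverse[OF bc])
 have contr: "dist (\<Psi> z) (\<Psi> w) \<le> 1 / 2 * dist z w" for z w
 proof (rule dist_bound)
  fix t0
  define t where "t = cl t0"
  have t: "t \<in> {0..T}" using cl by (simp add: t_def)
  let ?f = "\<lambda>z s. A s (exp (c * s) *\<^sub>R apply_bcontfun z s)"
  have int: "?f z integrable_on {0..t}" for z
   by (rule integrable_continuous_real, rule continuous_on_subset[OF contA]) (use t in \<open>auto intro!: continuous_intros\<close>)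
  have "dist (apply_bcontfun (\<Psi> z) t0) (apply_bcontfun (\<Psi> w) t0)
    = exp (- (c * t)) * norm (integral {0..t} (\<lambda>s. ?f z s - ?f w s))"
   unfolding \<Psi> t_def[symmetric] \<Phi>_def dist_norm
   by (simp add: Henstock_Kurzweil_Integration.integral_diff[OF int int] flip: scaleR_diff_right)
  also have "norm (integral {0..t} (\<lambda>s. ?f z s - ?f w s)) \<le> integral {0..t} (\<lambda>s. L * exp (c * s) * dist z w)"
  proof (rule integral_norm_bound_integral)
   show "(\<lambda>s. ?f z s - ?f w s) integrable_on {0..t}" by (intro integrable_diff int)
   show "(\<lambda>s. L * exp (c * s) * dist z w) integrable_on {0..t}"
    by (intro integrable_continuous_real continuous_intros)
   fix s assume s: "s \<in> {0..t}"
   have "norm (?f z s - ?f w s) \<le> L * norm (exp (c * s) *\<^sub>R apply_bcontfun z s - exp (c * s) *\<^sub>R apply_bcontfun w s)"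
    by (rule lip) (use s t in auto)
   also have "\<dots> = L * (exp (c * s) * dist (apply_bcontfun z s) (apply_bcontfun w s))"
    by (simp add: dist_norm flip: scaleR_diff_right)
   also have "\<dots> \<le> L * (exp (c * s) * dist z w)"
   proof (rule mult_left_mono)
    show "exp (c * s) * dist (apply_bcontfun z s) (apply_bcontfun w s) \<le> exp (c * s) * dist z w"
     by (intro mult_left_mono dist_bounded) auto
    show "0 \<le> L" using Lnn by simp
   qed
   finally show "norm (?f z s - ?f w s) \<le> L * exp (c * s) * dist z w" by simp
  qed
  also have "integral {0..t} (\<lambda>s. L * exp (c * s) * dist z w) = L * dist z w * ((exp (c * t) - 1) / c)"
  proof -
   have "integral {0..t} (\<lambda>s. L * exp (c * s) * dist z w) = integral {0..t} (\<lambda>s. (L * dist z w) * exp (c * s))"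
    by (simp add: algebra_simps)
   then show ?thesis using integral_unique[OF integral_exp_scale[of c t]] c t by simp
  qed
  finally have "dist (apply_bcontfun (\<Psi> z) t0) (apply_bcontfun (\<Psi> w) t0) \<le> exp (- (c * t)) * (L * dist z w * ((exp (c * t) - 1) / c))"
   by simp
  also have "\<dots> = (L / c) * dist z w * (1 - exp (- (c * t)))" by (simp add: exp_minus field_simps)
  also have "\<dots> \<le> (1 / 2) * dist z w * 1"
   using c Lnn t by (intro mult_mono) (auto simp: field_simps)
  finally show "dist (apply_bcontfun (\<Psi> z) t0) (apply_bcontfun (\<Psi> w) t0) \<le> 1 / 2 * dist z w" by simp
 qed
 obtain z where z: "\<Psi> z = z" using banach_fix_type[of "1 / 2" \<Psi>] contr by auto
 define y where "y t = exp (c * t) *\<^sub>R apply_bcontfun z t" for t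
 have y: "y t = y0 + integral {0..t} (\<lambda>s. A s (y s))" if "t \<in> {0..T}" for t
 proof -
  have "apply_bcontfun z t = \<Phi> (apply_bcontfun z) t" using \<Psi>[of z t] z cl(2)[OF that] by simp
  then show ?thesis by (simp add: y_def \<Phi>_def exp_minus)
 qed
 have cy: "continuous_on {0..T} (\<lambda>s. A s (y s))" unfolding y_def by (rule contA) simp
 show thesis
 proof (rule that)
  show "y 0 = y0" using y[of 0] T by simp
  fix t assume t: "t \<in> {0..T}"
  have "((\<lambda>t. y0 + integral {0..t} (\<lambda>s. A s (y s))) has_vector_derivative 0 + A t (y t)) (at t within {0..T})"
   by (intro has_vector_derivative_add has_vector_derivative_const integral_has_vector_derivative cy t)
  then have "((\<lambda>t. y0 + integral {0..t} (\<lambda>s. A s (y s))) has_vector_derivative A t (y t)) (at t within {0..T})"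
   by simp
  then show "(y has_vector_derivative A t (y t)) (at t within {0..T})"
   by (rule has_vector_derivative_transform[rotated 2]) (use t y in auto)
 qed
qed

text \<open>\<open>\<eta>\<close> measures the change of the vector field along the second solution.
  In the application it is the effect of moving the spectral parameter.\<close>

lemma ode_dependence:
 fixes y z :: "real \<Rightarrow> 'a::euclidean_space"
 assumes dy: "\<And>t. t \<in> {0..T} \<Longrightarrow> (y has_vector_derivative y' t) (at t within {0..T})"
  and dz: "\<And>t. t \<in> {0..T} \<Longrightarrow> (z has_vector_derivative z' t) (at t within {0..T})"
  and le: "\<And>t. t \<in> {0..T} \<Longrightarrow> norm (y' t - z' t) \<le> L * norm (y t - z t) + \<eta>"
  and init: "norm (y 0 - z 0) \<le> \<delta>" and L: "L \<ge> 0" and e: "\<eta> \<ge> 0" and t: "t \<in> {0..T}"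
 shows "norm (y t - z t) \<le> (\<delta> + \<eta> * T) * exp (L * t)"
proof (rule gronwall[OF _ L _ t])
 have d: "((\<lambda>t. y t - z t) has_vector_derivative y' t - z' t) (at t within {0..T})" if "t \<in> {0..T}" for t
  by (intro has_vector_derivative_diff dy dz that)
 have c: "continuous_on {0..T} (\<lambda>t. y t - z t)"
  unfolding continuous_on_eq_continuous_within using d has_vector_derivative_continuous by blast
 then show "continuous_on {0..T} (\<lambda>t. norm (y t - z t))" by (rule continuous_on_norm)
 fix t assume t: "t \<in> {0..T}"
 have "((\<lambda>t. y' t - z' t) has_integral (y t - z t) - (y 0 - z 0)) {0..t}"
  by (rule fundamental_theorem_of_calculus)
   (use t in \<open>auto intro!: has_vector_derivative_within_subset[OF d]\<close>)
 then have i: "(\<lambda>t. y' t - z' t) integrable_on {0..t}" "integral {0..t} (\<lambda>t. y' t - z' t) = (y t - z t) - (y 0 - z 0)"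
  by (auto simp: has_integral_iff)
 have cn: "continuous_on {0..t} (\<lambda>t. norm (y t - z t))"
  by (rule continuous_on_subset[OF continuous_on_norm[OF c]]) (use t in auto)
 have i2: "(\<lambda>t. L * norm (y t - z t) + \<eta>) integrable_on {0..t}"
  by (intro integrable_continuous_real continuous_intros cn)
 have "norm ((y t - z t) - (y 0 - z 0)) \<le> integral {0..t} (\<lambda>t. L * norm (y t - z t) + \<eta>)"
  unfolding i(2)[symmetric] by (rule integral_norm_bound_integral[OF i(1) i2]) (use le t in auto)
 also have "\<dots> = L * integral {0..t} (\<lambda>t. norm (y t - z t)) + \<eta> * t"
  using t by (subst Henstock_Kurzweil_Integration.integral_add) (auto intro!: integrable_continuous_real continuous_intros cn)
 also have "\<eta> * t \<le> \<eta> * T" using t e by (intro mult_left_mono) auto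
 finally show "norm (y t - z t) \<le> (\<delta> + \<eta> * T) + L * integral {0..t} (\<lambda>t. norm (y t - z t))"
  using init norm_triangle_ineq[of "(y t - z t) - (y 0 - z 0)" "y 0 - z 0"] by simp
qed

section \<open>Integral inequalities\<close>

lemma Cauchy_Schwarz_integral:
 fixes f g :: "real \<Rightarrow> real"
 assumes f: "continuous_on {a..b} f" and g: "continuous_on {a..b} g"
 shows "\<bar>integral {a..b} (\<lambda>t. f t * g t)\<bar> \<le> sqrt (integral {a..b} (\<lambda>t. (f t)^2)) * sqrt (integral {a..b} (\<lambda>t. (g t)^2))"
proof -
 define A P C where "A = integral {a..b} (\<lambda>t. (f t)^2)" and "P = integral {a..b} (\<lambda>t. f t * g t)"
  and "C = integral {a..b} (\<lambda>t. (g t)^2)"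
 have i: "(\<lambda>t. (f t)^2) integrable_on {a..b}" "(\<lambda>t. f t * g t) integrable_on {a..b}" "(\<lambda>t. (g t)^2) integrable_on {a..b}"
  by (intro integrable_continuous_real continuous_intros f g)+
 have nn: "A \<ge> 0" "C \<ge> 0" unfolding A_def C_def by (auto intro!: Henstock_Kurzweil_Integration.integral_nonneg i)
 have q: "A - 2 * l * P + l^2 * C \<ge> 0" for l
 proof -
  have "((\<lambda>t. (f t)^2 - (2 * l) * (f t * g t) + l^2 * (g t)^2) has_integral A - (2 * l) * P + l^2 * C) {a..b}"
   unfolding A_def P_def C_def by (intro has_integral_add has_integral_diff has_integral_mult_right integrable_integral i)
  moreover have "(f t)^2 - (2 * l) * (f t * g t) + l^2 * (g t)^2 = (f t - l * g t)^2" for t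
   by (simp add: power2_eq_square algebra_simps)
  ultimately have "((\<lambda>t. (f t - l * g t)^2) has_integral A - (2 * l) * P + l^2 * C) {a..b}"
   by (simp only:)
  then have "0 \<le> A - (2 * l) * P + l^2 * C" by (rule has_integral_nonneg) simp
  then show ?thesis by simp
 qed
 have "P^2 \<le> A * C"
 proof (cases "C = 0")
  case True
  have "P = 0"
  proof (rule ccontr)
   assume "P \<noteq> 0"
   then show False using q[of "(A + 1) / (2 * P)"] True nn by (simp add: field_simps)
  qed
  then show ?thesis using True by simp
 next
  case False
  then have C: "C > 0" using nn by simp
  have "A - P^2 / C \<ge> 0" using q[of "P / C"] C by (simp add: power2_eq_square field_simps)
  then show ?thesis using C by (simp add: field_simps)
 qed
 then have "sqrt (P^2) \<le> sqrt (A * C)" by (rule real_sqrt_le_mono)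
 then show ?thesis by (simp add: A_def P_def C_def real_sqrt_mult)
qed

lemma integral_mono_continuous:
 fixes f g :: "real \<Rightarrow> real"
 assumes "continuous_on {a..b} f" "continuous_on {a..b} g" "\<And>t. t \<in> {a..b} \<Longrightarrow> f t \<le> g t"
 shows "integral {a..b} f \<le> integral {a..b} g"
 using assms by (intro integral_le integrable_continuous_real) auto

lemma integral_norm_le_continuous:
 fixes f :: "real \<Rightarrow> 'a::euclidean_space" and g :: "real \<Rightarrow> real"
 assumes "continuous_on {a..b} f" "continuous_on {a..b} g" "\<And>t. t \<in> {a..b} \<Longrightarrow> norm (f t) \<le> g t"
 shows "norm (integral {a..b} f) \<le> integral {a..b} g"
 using assms by (intro integral_norm_bound_integral integrable_continuous_real) auto

definition L2n :: "(real \<Rightarrow> complex) \<Rightarrow> real" where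
 "L2n f = sqrt (integral {0..2} (\<lambda>t. (cmod (f t))^2))"

lemma L2n_nonneg: "continuous_on {0..2} f \<Longrightarrow> 0 \<le> L2n f"
 unfolding L2n_def by (intro real_sqrt_ge_zero Henstock_Kurzweil_Integration.integral_nonneg integrable_continuous_real continuous_intros) auto

lemma L2n_sq: "continuous_on {0..2} f \<Longrightarrow> (L2n f)^2 = integral {0..2} (\<lambda>t. (cmod (f t))^2)"
 unfolding L2n_def by (intro real_sqrt_pow2 Henstock_Kurzweil_Integration.integral_nonneg integrable_continuous_real continuous_intros) auto

lemma integral_cmod_mult_le:
 assumes "continuous_on {0..2} f" "continuous_on {0..2} g" "integral {0..2} (\<lambda>t. (g t)^2) \<le> G^2" "G \<ge> 0"
 shows "integral {0..2} (\<lambda>t. cmod (f t) * g t) \<le> L2n f * G"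
proof -
 have "\<bar>integral {0..2} (\<lambda>t. cmod (f t) * g t)\<bar> \<le> L2n f * sqrt (integral {0..2} (\<lambda>t. (g t)^2))"
  unfolding L2n_def by (intro Cauchy_Schwarz_integral continuous_on_norm assms)
 then have "integral {0..2} (\<lambda>t. cmod (f t) * g t) \<le> L2n f * sqrt (integral {0..2} (\<lambda>t. (g t)^2))"
  by (rule order_trans[OF abs_ge_self])
 also have "\<dots> \<le> L2n f * sqrt (G^2)"
  by (intro mult_left_mono real_sqrt_le_mono assms L2n_nonneg)
 finally show ?thesis using assms(4) by simp
qed

lemma L2n_triangle:
 assumes "continuous_on {0..2} f" "continuous_on {0..2} g" "\<And>t. t \<in> {0..2} \<Longrightarrow> cmod (k t) \<le> cmod (f t) + c * cmod (g t)"
  "continuous_on {0..2} k" "c \<ge> 0"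
 shows "L2n k \<le> L2n f + c * L2n g"
proof (rule power2_le_imp_le)
 note ii = integrable_continuous_real
 have cf: "continuous_on {0..2} (\<lambda>t. (cmod (f t))^2)" "continuous_on {0..2} (\<lambda>t. (cmod (g t))^2)"
  "continuous_on {0..2} (\<lambda>t. cmod (f t) * cmod (g t))" by (intro continuous_intros assms)+
 have II: "integral {0..2} (\<lambda>t. cmod (f t) * cmod (g t)) \<le> L2n f * L2n g"
  by (rule integral_cmod_mult_le[OF assms(1) continuous_on_norm[OF assms(2)] eq_refl[OF L2n_sq[OF assms(2), symmetric]] L2n_nonneg[OF assms(2)]])
 have "(L2n k)^2 \<le> integral {0..2} (\<lambda>t. (cmod (f t))^2 + (2 * c) * (cmod (f t) * cmod (g t)) + c^2 * (cmod (g t))^2)"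
  unfolding L2n_sq[OF assms(4)]
 proof (rule integral_mono_continuous)
  fix t :: real assume t: "t \<in> {0..2}"
  have "(cmod (k t))^2 \<le> (cmod (f t) + c * cmod (g t))^2" by (intro power_mono assms t) auto
  then show "(cmod (k t))^2 \<le> (cmod (f t))^2 + (2 * c) * (cmod (f t) * cmod (g t)) + c^2 * (cmod (g t))^2"
   by (simp add: power2_eq_square algebra_simps)
 qed (intro continuous_intros cf assms)+
 also have "\<dots> = (L2n f)^2 + (2 * c) * integral {0..2} (\<lambda>t. cmod (f t) * cmod (g t)) + c^2 * (L2n g)^2"
  unfolding L2n_sq[OF assms(1)] L2n_sq[OF assms(2)]
  by (intro integral_unique has_integral_add has_integral_mult_right integrable_integral ii cf)
 also have "(2 * c) * integral {0..2} (\<lambda>t. cmod (f t) * cmod (g t)) \<le> (2 * c) * (L2n f * L2n g)"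
  by (rule mult_left_mono, rule II) (use assms in auto)
 finally show "(L2n k)^2 \<le> (L2n f + c * L2n g)^2" by (simp add: power2_eq_square algebra_simps)
qed (use assms in \<open>auto intro!: add_nonneg_nonneg mult_nonneg_nonneg L2n_nonneg\<close>)

lemma integral_exp_neg_le:
 assumes "k > 0" shows "integral {0..2} (\<lambda>t. exp (- (k * t))) \<le> 1 / (k::real)"
proof -
 have "((\<lambda>t. exp (- (k * t))) has_integral (- exp (- (k * 2)) / k - (- exp (- (k * 0)) / k))) {0..2}"
  by (rule fundamental_theorem_of_calculus)
   (use assms in \<open>auto intro!: derivative_eq_intros simp: has_real_derivative_iff_has_vector_derivative[symmetric]\<close>)
 then have "integral {0..2} (\<lambda>t. exp (- (k * t))) = 1 / k - exp (- (k * 2)) / k" by (simp add: integral_unique)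
 then show ?thesis using assms by simp
qed

lemma integral_exp_neg_right_le:
 assumes "k > 0" shows "integral {0..2} (\<lambda>t. exp (- (k * (2 - t)))) \<le> 1 / (k::real)"
proof -
 have "((\<lambda>t. exp (- (k * (2 - t)))) has_integral (exp (- (k * (2 - 2))) / k - exp (- (k * (2 - 0))) / k)) {0..2}"
  by (rule fundamental_theorem_of_calculus)
   (use assms in \<open>auto intro!: derivative_eq_intros simp: has_real_derivative_iff_has_vector_derivative[symmetric]\<close>)
 then have "integral {0..2} (\<lambda>t. exp (- (k * (2 - t)))) = 1 / k - exp (- (k * 2)) / k" by (simp add: integral_unique)
 then show ?thesis using assms by simp
qed

lemma integral_inverse_shift_le:
 assumes h: "h > 0"
 shows "integral {0..2} (\<lambda>t. 1 / (t + h)^2) \<le> 1 / (h::real)"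
  and "integral {0..2} (\<lambda>t. 1 / (t + h)^3) \<le> 1 / h^2"
  and "integral {0..2} (\<lambda>t. 1 / (t + h)) = ln ((2 + h) / h)"
proof -
 have hv: "(f has_real_derivative f' t) (at t) \<Longrightarrow> (f has_vector_derivative f' t) (at t within {0..2})" for f f' and t :: real
  by (auto simp: has_real_derivative_iff_has_vector_derivative intro: has_vector_derivative_at_within)
 have d1: "((\<lambda>t. t + h) has_real_derivative 1) (at t)" for t
  by (auto intro!: derivative_eq_intros)
 have "((\<lambda>t. 1 / (t + h)^2) has_integral (- inverse (2 + h) - (- inverse (0 + h)))) {0..2}"
 proof (rule fundamental_theorem_of_calculus)
  fix t :: real assume t: "t \<in> {0..2}"
  have "((\<lambda>t. - inverse (t + h)) has_real_derivative 1 / (t + h)^2) (at t)"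
   by (rule DERIV_cong[OF DERIV_minus[OF DERIV_inverse_fun[OF d1]]]) (use t h in \<open>auto simp: power2_eq_square divide_inverse\<close>)
  then show "((\<lambda>t. - inverse (t + h)) has_vector_derivative 1 / (t + h)^2) (at t within {0..2})" by (rule hv)
 qed simp
 then have "integral {0..2} (\<lambda>t. 1 / (t + h)^2) = - inverse (2 + h) - (- inverse (0 + h))" by (rule integral_unique)
 then show i2: "integral {0..2} (\<lambda>t. 1 / (t + h)^2) \<le> 1 / h" using h by (simp add: divide_inverse)
 have c: "continuous_on {0..2} (\<lambda>t. 1 / (t + h)^2)" "continuous_on {0..2} (\<lambda>t. 1 / (t + h)^3)"
  using h by (auto intro!: continuous_intros)
 have "integral {0..2} (\<lambda>t. 1 / (t + h)^3) \<le> integral {0..2} (\<lambda>t. 1 / h * (1 / (t + h)^2))"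
 proof (rule integral_mono_continuous[OF c(2)])
  show "continuous_on {0..2} (\<lambda>t. 1 / h * (1 / (t + h)^2))" by (intro continuous_intros c)
  fix t :: real assume t: "t \<in> {0..2}"
  have "h * (t + h)^2 \<le> (t + h) * (t + h)^2" using t h by (intro mult_right_mono) auto
  then have "1 / ((t + h) * (t + h)^2) \<le> 1 / (h * (t + h)^2)" using h t by (intro divide_left_mono) auto
  then show "1 / (t + h)^3 \<le> 1 / h * (1 / (t + h)^2)" by (simp add: power3_eq_cube power2_eq_square mult.assoc)
 qed
 also have "\<dots> = 1 / h * integral {0..2} (\<lambda>t. 1 / (t + h)^2)" by (rule integral_mult_right)
 also have "\<dots> \<le> 1 / h * (1 / h)" using h i2 by (intro mult_left_mono) auto
 finally show "integral {0..2} (\<lambda>t. 1 / (t + h)^3) \<le> 1 / h^2" by (simp add: power2_eq_square)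
 have "((\<lambda>t. 1 / (t + h)) has_integral (ln (2 + h) - ln (0 + h))) {0..2}"
 proof (rule fundamental_theorem_of_calculus)
  fix t :: real assume t: "t \<in> {0..2}"
  have "((\<lambda>t. ln (t + h)) has_real_derivative 1 / (t + h)) (at t)"
   by (rule DERIV_cong[OF DERIV_chain2[OF DERIV_ln d1]]) (use t h in \<open>auto simp: divide_inverse\<close>)
  then show "((\<lambda>t. ln (t + h)) has_vector_derivative 1 / (t + h)) (at t within {0..2})" by (rule hv)
 qed simp
 then show "integral {0..2} (\<lambda>t. 1 / (t + h)) = ln ((2 + h) / h)" using h by (simp add: integral_unique ln_div)
qed

lemma quadratic_le_imp_linear_le:
 fixes X Y p q :: real
 assumes "Y^2 \<le> p * (X * Y) + q * X^2" "p \<ge> 0" "q \<ge> 0" "X \<ge> 0" "Y \<ge> 0"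
 shows "Y \<le> (p + q + 1) * X"
proof (rule ccontr)
 assume n: "\<not> ?thesis"
 then have Y: "Y > 0" using assms by (smt (verit) mult_nonneg_nonneg)
 have "X * 1 \<le> X * (p + q + 1)" using assms by (intro mult_left_mono) auto
 then have XY: "X \<le> Y" using n by (simp add: mult.commute)
 have "q * X^2 \<le> q * (X * Y)" using XY assms by (simp add: power2_eq_square mult_left_mono)
 then have "Y^2 \<le> (p + q) * X * Y" using assms by (simp add: algebra_simps)
 then have "Y \<le> (p + q) * X" using Y by (simp add: power2_eq_square)
 then show False using n assms by (simp add: algebra_simps)
qed

lemma vector_FTC:
 fixes f :: "real \<Rightarrow> 'a::banach"
 assumes "a \<le> b" "\<And>t. t \<in> {a..b} \<Longrightarrow> (f has_vector_derivative f' t) (at t within {a..b})"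
 shows "integral {a..b} f' = f b - f a"
 using fundamental_theorem_of_calculus[OF assms(1), of f f'] assms(2) by (auto intro: integral_unique)

text \<open>Tailored to a boundary layer: for \<open>T\<close> of order \<open>h\<close> and
  \<open>k\<close> of order \<open>1 / h^2\<close> the exponent \<open>k * T * T\<close> stays
  bounded as \<open>h\<close> tends to 0, and the initial slope enters only with the small factor
  \<open>T\<close>.\<close>

lemma second_order_gronwall:
 fixes y :: "real \<Rightarrow> complex"
 assumes T: "T \<ge> 0" and y0: "y 0 = 0"
  and dy: "\<And>t. t \<in> {0..T} \<Longrightarrow> (y has_vector_derivative y1 t) (at t within {0..T})"
  and dy1: "\<And>t. t \<in> {0..T} \<Longrightarrow> (y1 has_vector_derivative y2 t) (at t within {0..T})"
  and c2: "continuous_on {0..T} y2"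
  and le: "\<And>t. t \<in> {0..T} \<Longrightarrow> cmod (y2 t) \<le> k * cmod (y t) + f" and k: "k \<ge> 0" "f \<ge> 0" and t: "t \<in> {0..T}"
 shows "cmod (y t) \<le> (T * cmod (y1 0) + T^2 * f) * exp (k * T * T)"
proof -
 have cy: "continuous_on {0..T} y" "continuous_on {0..T} y1"
  unfolding continuous_on_eq_continuous_within using dy dy1 has_vector_derivative_continuous by blast+
 have i1: "integral {0..t} (\<lambda>s. k * cmod (y s) + f) \<le> k * integral {0..t} (\<lambda>s. cmod (y s)) + f * T" if "t \<in> {0..T}" for t
 proof -
  have "continuous_on {0..t} (\<lambda>s. cmod (y s))"
   by (rule continuous_on_subset[OF continuous_on_norm[OF cy(1)]]) (use that in auto)
  then have "integral {0..t} (\<lambda>s. k * cmod (y s) + f) = k * integral {0..t} (\<lambda>s. cmod (y s)) + f * t"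
   using that by (subst Henstock_Kurzweil_Integration.integral_add) (auto intro!: integrable_continuous_real continuous_intros)
  also have "f * t \<le> f * T" using that k by (intro mult_left_mono) auto
  finally show ?thesis by simp
 qed
 have mono: "integral {0..s} (\<lambda>s. cmod (y s)) \<le> integral {0..t} (\<lambda>s. cmod (y s))" if "0 \<le> s" "s \<le> t" "t \<le> T" for s t
  by (rule integral_subset_le)
   (use that in \<open>auto intro!: integrable_continuous_real continuous_intros continuous_on_subset[OF cy(1)]\<close>)
 have y1b: "cmod (y1 s) \<le> cmod (y1 0) + k * integral {0..s} (\<lambda>s. cmod (y s)) + f * T" if s: "s \<in> {0..T}" for s
 proof -
  have "integral {0..s} y2 = y1 s - y1 0"
   by (rule vector_FTC) (use s in \<open>auto intro!: has_vector_derivative_within_subset[OF dy1]\<close>)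
  moreover have "norm (integral {0..s} y2) \<le> integral {0..s} (\<lambda>s. k * cmod (y s) + f)"
   by (rule integral_norm_le_continuous)
    (use s le in \<open>auto intro!: continuous_intros continuous_on_subset[OF cy(1)] continuous_on_subset[OF c2]\<close>)
  ultimately have "cmod (y1 s - y1 0) \<le> k * integral {0..s} (\<lambda>s. cmod (y s)) + f * T" using i1[OF s] by simp
  then show ?thesis using norm_triangle_ineq[of "y1 s - y1 0" "y1 0"] by simp
 qed
 have "cmod (y t) \<le> (T * cmod (y1 0) + T^2 * f) * exp ((k * T) * t)"
 proof (rule gronwall[OF _ _ _ t, of "\<lambda>t. cmod (y t)" "k * T"])
  show "continuous_on {0..T} (\<lambda>t. cmod (y t))" using cy by (intro continuous_intros)
  show "k * T \<ge> 0" using k T by simp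
  fix t assume t: "t \<in> {0..T}"
  define K where "K = cmod (y1 0) + k * integral {0..t} (\<lambda>s. cmod (y s)) + f * T"
  have "integral {0..t} (\<lambda>s. cmod (y s)) \<ge> 0"
   by (intro Henstock_Kurzweil_Integration.integral_nonneg integrable_continuous_real continuous_intros continuous_on_subset[OF cy(1)]) (use t in auto)
  then have K0: "K \<ge> 0" using k T by (simp add: K_def)
  have "norm (y t - y 0) \<le> K * (t - 0)"
  proof (rule vector_mvt_bound)
   fix s assume s: "0 \<le> s" "s \<le> t"
   show "(y has_vector_derivative y1 s) (at s within {0..t})"
    by (rule has_vector_derivative_within_subset[OF dy]) (use s t in auto)
   have "k * integral {0..s} (\<lambda>s. cmod (y s)) \<le> k * integral {0..t} (\<lambda>s. cmod (y s))"
    by (intro mult_left_mono mono) (use s t k in auto)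
   then show "cmod (y1 s) \<le> K" using y1b[of s] s t by (simp add: K_def)
  qed (use t in auto)
  then have "cmod (y t) \<le> K * t" using y0 by simp
  also have "\<dots> \<le> K * T" using K0 t by (intro mult_left_mono) auto
  also have "\<dots> = T * cmod (y1 0) + T^2 * f + k * T * integral {0..t} (\<lambda>s. cmod (y s))"
   by (simp add: K_def power2_eq_square algebra_simps)
  finally show "cmod (y t) \<le> T * cmod (y1 0) + T^2 * f + k * T * integral {0..t} (\<lambda>s. cmod (y s))" .
 qed
 also have "\<dots> \<le> (T * cmod (y1 0) + T^2 * f) * exp (k * T * T)"
  using t k T by (intro mult_left_mono) (auto intro!: mult_left_mono)
 finally show ?thesis .
qed

section \<open>Energy estimates for the boundary layer\<close>

text \<open>Here \<open>t = x + 1\<close>, \<open>V t = U x - U (-1)\<close> and \<open>th = \<beta> powr (-1/12)\<close>, so that all layer widths are integer powers of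
 \<open>th\<close>: \<open>h = th^4\<close> at the wall \<open>t = 0\<close> and \<open>th^6\<close> at \<open>t = 2\<close>.  The constant \<open>B\<close> is independent of \<open>th\<close>.\<close>

locale wall_profile =
 fixes V V1 V2 :: "real \<Rightarrow> real" and B th :: real
 assumes B1: "B \<ge> 1" and th: "0 < th" "th \<le> 1"
  and dV: "\<And>t. t \<in> {0..2} \<Longrightarrow> (V has_real_derivative V1 t) (at t within {0..2})"
  and dV1: "\<And>t. t \<in> {0..2} \<Longrightarrow> (V1 has_real_derivative V2 t) (at t within {0..2})"
  and cV2: "continuous_on {0..2} V2"
  and V0: "V 0 = 0" and Vlow: "\<And>t. t \<in> {0..2} \<Longrightarrow> t / B \<le> V t" and Vup: "\<And>t. t \<in> {0..2} \<Longrightarrow> V t \<le> B * t"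
  and Vlin: "\<And>t. t \<in> {0..2} \<Longrightarrow> \<bar>V t - t\<bar> \<le> B * t^2"
  and Vend: "\<And>t. t \<in> {0..2} \<Longrightarrow> \<bar>V t - V 2\<bar> \<le> B * (2 - t)"
  and V1b: "\<And>t. t \<in> {0..2} \<Longrightarrow> \<bar>V1 t\<bar> \<le> B" and V2b: "\<And>t. t \<in> {0..2} \<Longrightarrow> \<bar>V2 t\<bar> \<le> B"
begin

definition h :: real where "h = th^4"

lemma h: "h > 0" "h \<le> 1" using th by (auto simp: h_def power_le_one)

lemma cV: "continuous_on {0..2} V" "continuous_on {0..2} V1"
 unfolding continuous_on_eq_continuous_within using dV dV1 DERIV_continuous by blast+

lemma B0: "B > 0" using B1 by simp

lemma Vh:
 assumes "t \<in> {0..2}" shows "(t + h) / B \<le> V t + h"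
proof -
 have "h * 1 \<le> h * B" using B1 h by (intro mult_left_mono) auto
 then have "h / B \<le> h" using B0 by (simp add: divide_le_eq)
 then show ?thesis using Vlow[OF assms] by (simp add: add_divide_distrib)
qed

lemma Vh_pos:
 assumes "t \<in> {0..2}" shows "V t + h > 0"
proof -
 have "(t + h) / B > 0" using assms h B0 by (intro divide_pos_pos) auto
 then show ?thesis using Vh[OF assms] by linarith
qed

lemma inv_Vh: "t \<in> {0..2} \<Longrightarrow> 1 / (V t + h) \<le> B / (t + h)"
 using Vh[of t] Vh_pos[of t] h B0 by (simp add: field_simps)

lemma inv_Vh2:
 assumes "t \<in> {0..2}" shows "1 / (V t + h)^2 \<le> B^2 / (t + h)^2"
proof -
 have "(1 / (V t + h))^2 \<le> (B / (t + h))^2"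
  by (rule power_mono[OF inv_Vh[OF assms]]) (use Vh_pos[OF assms] in auto)
 then show ?thesis by (simp add: power_divide)
qed

end

section \<open>Coercivity of the Rayleigh form with shifted profile\<close>

locale dirichlet_profile = wall_profile +
 fixes u u1 u2 :: "real \<Rightarrow> complex"
 assumes du: "\<And>t. t \<in> {0..2} \<Longrightarrow> (u has_vector_derivative u1 t) (at t within {0..2})"
  and du1: "\<And>t. t \<in> {0..2} \<Longrightarrow> (u1 has_vector_derivative u2 t) (at t within {0..2})"
  and cu2: "continuous_on {0..2} u2"
  and u0: "u 0 = 0" and u2: "u 2 = 0"
begin

lemma cu: "continuous_on {0..2} u" "continuous_on {0..2} u1"
 unfolding continuous_on_eq_continuous_within using du du1 has_vector_derivative_continuous by blast+

definition N :: real where "N = L2n u1"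

lemma N0: "N \<ge> 0" unfolding N_def by (rule L2n_nonneg[OF cu(2)])

lemma u_diff_bound:
 assumes "0 \<le> a" "a \<le> b" "b \<le> 2"
 shows "cmod (u b - u a) \<le> sqrt (b - a) * N"
proof -
 have c: "continuous_on {a..b} u1" by (rule continuous_on_subset[OF cu(2)]) (use assms in auto)
 have "integral {a..b} u1 = u b - u a"
  by (rule vector_FTC) (use assms in \<open>auto intro!: has_vector_derivative_within_subset[OF du]\<close>)
 then have "cmod (u b - u a) \<le> integral {a..b} (\<lambda>t. 1 * cmod (u1 t))"
  using integral_norm_le_continuous[OF c continuous_on_norm[OF c]] by simp
 also have "\<dots> \<le> sqrt (integral {a..b} (\<lambda>t. 1^2)) * sqrt (integral {a..b} (\<lambda>t. (cmod (u1 t))^2))"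
  by (rule order_trans[OF abs_ge_self Cauchy_Schwarz_integral]) (intro continuous_intros c)+
 also have "\<dots> \<le> sqrt (b - a) * N"
 proof (intro mult_mono)
  show "sqrt (integral {a..b} (\<lambda>t. 1^2)) \<le> sqrt (b - a)" using assms by simp
  show "sqrt (integral {a..b} (\<lambda>t. (cmod (u1 t))^2)) \<le> N" unfolding N_def L2n_def
  proof (rule real_sqrt_le_mono, rule integral_subset_le)
   show "(\<lambda>t. (cmod (u1 t))^2) integrable_on {a..b}" by (intro integrable_continuous_real continuous_intros c)
   show "(\<lambda>t. (cmod (u1 t))^2) integrable_on {0..2}" by (intro integrable_continuous_real continuous_intros cu)
  qed (use assms in auto)
  show "0 \<le> sqrt (b - a)" using assms by simp
  show "0 \<le> sqrt (integral {a..b} (\<lambda>t. (cmod (u1 t))^2))"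
   by (intro real_sqrt_ge_zero Henstock_Kurzweil_Integration.integral_nonneg integrable_continuous_real continuous_intros c) auto
 qed
 finally show ?thesis .
qed

lemma u_bound_left: "t \<in> {0..2} \<Longrightarrow> cmod (u t) \<le> sqrt t * N"
 using u_diff_bound[of 0 t] u0 by simp

lemma u_bound_right: "t \<in> {0..2} \<Longrightarrow> cmod (u t) \<le> sqrt (2 - t) * N"
 using u_diff_bound[of t 2] u2 by simp

definition Q :: real where "Q = integral {0..2} (\<lambda>t. (cmod (u1 t))^2 + V2 t / (V t + h) * (cmod (u t))^2)"

text \<open>Writing \<open>u = (V + h) * g\<close> turns the form into a perfect square:
  \<open>Q\<close> is the squared norm of \<open>z = (V + h) * g'\<close>. Hardy's inequality
  recovers \<open>g\<close> from \<open>z\<close>, and \<open>u' = z + V' * g\<close> then gives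
  \<open>u'\<close>; the constant is \<open>(3 * B^2)^2\<close>.\<close>

lemma coercive: "N^2 \<le> 9 * B^4 * Q"
proof -
 let ?D = "\<lambda>t. V t + h"
 define g where "g t = (1 / ?D t) *\<^sub>R u t" for t
 define z where "z t = u1 t - V1 t *\<^sub>R g t" for t
 have D: "?D t > 0" if "t \<in> {0..2}" for t using Vh_pos[OF that] .
 have cD: "continuous_on {0..2} (\<lambda>t. 1 / ?D t)"
  by (intro continuous_intros cV) (use D in force)
 have cg: "continuous_on {0..2} g" unfolding g_def by (intro continuous_intros cD cu)
 have cz: "continuous_on {0..2} z" unfolding z_def by (intro continuous_intros cg cu cV)
 have dD: "((\<lambda>t. 1 / ?D t) has_real_derivative - V1 t / (?D t)^2) (at t within {0..2})" if t: "t \<in> {0..2}" for t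
 proof -
  have "((\<lambda>t. V t + h) has_real_derivative V1 t) (at t within {0..2})"
   using DERIV_add[OF dV[OF t] DERIV_const[of h]] by simp
  from DERIV_inverse_fun[OF this] D[OF t] show ?thesis by (simp add: divide_inverse power2_eq_square)
 qed
 have dg: "(g has_vector_derivative (1 / ?D t) *\<^sub>R z t) (at t within {0..2})" if t: "t \<in> {0..2}" for t
 proof -
  have "(g has_vector_derivative (1 / ?D t) *\<^sub>R u1 t + (- V1 t / (?D t)^2) *\<^sub>R u t) (at t within {0..2})"
   unfolding g_def by (rule has_vector_derivative_scaleR[OF dD[OF t] du[OF t]])
  then show ?thesis by (simp add: z_def g_def scaleR_diff_right power2_eq_square)
 qed
 \<comment> \<open>The integral of the derivative of \<open>t * (cmod g)^2\<close> is zero, since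
   \<open>u 2 = 0\<close> and the weight \<open>t\<close> vanishes at 0. Because
   \<open>V \<ge> t / B\<close>, the factor \<open>t / (V + h)\<close> in the cross term is at most
   \<open>B\<close>.\<close>
 have hardy: "L2n g \<le> 2 * B * L2n z"
 proof -
  have "integral {0..2} (\<lambda>t. (cmod (g t))^2 + t * (2 * Re (cnj (g t) * ((1 / ?D t) *\<^sub>R z t)))) = 2 * (cmod (g 2))^2 - 0 * (cmod (g 0))^2"
  proof (rule vector_FTC)
   fix t :: real assume t: "t \<in> {0..2}"
   have "((\<lambda>t. t * (cmod (g t))^2) has_real_derivative 1 * (cmod (g t))^2 + (2 * Re (cnj (g t) * ((1 / ?D t) *\<^sub>R z t))) * t) (at t within {0..2})"
    by (intro DERIV_mult DERIV_ident norm_square_has_derivative dg t)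
   then show "((\<lambda>t. t * (cmod (g t))^2) has_vector_derivative (cmod (g t))^2 + t * (2 * Re (cnj (g t) * ((1 / ?D t) *\<^sub>R z t)))) (at t within {0..2})"
    by (simp add: has_real_derivative_iff_has_vector_derivative mult.commute)
  qed simp
  also have "\<dots> = 0" using u2 by (simp add: g_def)
  finally have z0: "integral {0..2} (\<lambda>t. (cmod (g t))^2 + t * (2 * Re (cnj (g t) * ((1 / ?D t) *\<^sub>R z t)))) = 0" .
  have c1: "continuous_on {0..2} (\<lambda>t. t * (2 * Re (cnj (g t) * ((1 / ?D t) *\<^sub>R z t))))"
   by (intro continuous_intros cg cz cD)
  have c2: "continuous_on {0..2} (\<lambda>t. (cmod (g t))^2)" by (intro continuous_intros cg)
  have "(L2n g)^2 = - integral {0..2} (\<lambda>t. t * (2 * Re (cnj (g t) * ((1 / ?D t) *\<^sub>R z t))))"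
   using z0 unfolding L2n_sq[OF cg]
   by (subst (asm) Henstock_Kurzweil_Integration.integral_add) (intro integrable_continuous_real c1 c2 | linarith)+
  also have "\<dots> \<le> integral {0..2} (\<lambda>t. (2 * B) * (cmod (g t) * cmod (z t)))"
   unfolding Henstock_Kurzweil_Integration.integral_neg[symmetric]
  proof (rule integral_mono_continuous)
   fix t :: real assume t: "t \<in> {0..2}"
   have "- (t * (2 * Re (cnj (g t) * ((1 / ?D t) *\<^sub>R z t)))) = (2 * t / ?D t) * - Re (1 * (cnj (g t) * z t))"
   proof -
    have "Re (cnj (g t) * ((1 / ?D t) *\<^sub>R z t)) = (1 / ?D t) * Re (1 * (cnj (g t) * z t))"
     by (simp only: mult_scaleR_right scaleR_complex.simps mult_1_left)
    moreover have "- (t * (2 * ((1 / d) * X))) = (2 * t / d) * - X" for d X :: real by simp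
    ultimately show ?thesis by (simp only:)
   qed
   also have "\<dots> \<le> (2 * t / ?D t) * (cmod (g t) * cmod (z t))"
    using Re_cnj_mult_le[of 1 "g t" "z t"] D[OF t] t by (intro mult_left_mono) auto
   also have "\<dots> \<le> (2 * B) * (cmod (g t) * cmod (z t))"
   proof (rule mult_right_mono)
    have "t \<le> B * V t" using Vlow[OF t] B0 by (simp add: field_simps)
    also have "\<dots> \<le> B * ?D t" using B0 h by simp
    finally show "2 * t / ?D t \<le> 2 * B" using D[OF t] by (simp add: field_simps)
   qed simp
   finally show "- (t * (2 * Re (cnj (g t) * ((1 / ?D t) *\<^sub>R z t)))) \<le> (2 * B) * (cmod (g t) * cmod (z t))" .
  qed (intro continuous_intros c1 cg cz)+
  also have "\<dots> = 2 * B * integral {0..2} (\<lambda>t. cmod (g t) * cmod (z t))" by (rule integral_mult_right)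
  also have "\<dots> \<le> 2 * B * (L2n g * L2n z)"
   using B0 integral_cmod_mult_le[OF cg continuous_on_norm[OF cz] eq_refl[OF L2n_sq[OF cz, symmetric]] L2n_nonneg[OF cz]]
   by (intro mult_left_mono) auto
  finally have "L2n g * L2n g \<le> (2 * B * L2n z) * L2n g" by (simp add: power2_eq_square mult_ac)
  then show ?thesis using L2n_nonneg[OF cg] L2n_nonneg[OF cz] B0 by (cases "L2n g = 0") auto
 qed
 have "N \<le> L2n z + B * L2n g" unfolding N_def
 proof (rule L2n_triangle[OF cz cg _ cu(2)])
  fix t :: real assume t: "t \<in> {0..2}"
  have "cmod (u1 t) = cmod (z t + V1 t *\<^sub>R g t)" by (simp add: z_def)
  also have "\<dots> \<le> cmod (z t) + \<bar>V1 t\<bar> * cmod (g t)" by (rule order_trans[OF norm_triangle_ineq]) simp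
  also have "\<dots> \<le> cmod (z t) + B * cmod (g t)" using V1b[OF t] by (intro add_left_mono mult_right_mono) auto
  finally show "cmod (u1 t) \<le> cmod (z t) + B * cmod (g t)" .
 qed (use B0 in auto)
 also have "\<dots> \<le> L2n z + B * (2 * B * L2n z)" using hardy B0 by (intro add_left_mono mult_left_mono) auto
 also have "\<dots> \<le> 3 * B^2 * L2n z"
 proof -
  have "1 * L2n z \<le> B^2 * L2n z" using B1 L2n_nonneg[OF cz] by (intro mult_right_mono) (auto simp: one_le_power)
  then show ?thesis by (simp add: power2_eq_square algebra_simps)
 qed
 finally have "N^2 \<le> (3 * B^2 * L2n z)^2" using N0 by (rule power_mono)
 also have "\<dots> = 9 * B^4 * (L2n z)^2" by (simp add: power_mult_distrib)
 \<comment> \<open>Expanding the square, the difference to the integrand of \<open>Q\<close> is the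
   derivative of \<open>V' * (cmod u)^2 / (V + h)\<close>, which vanishes at both ends.\<close>
 also have "(L2n z)^2 = Q"
 proof -
  let ?F = "\<lambda>t. V1 t * ((1 / ?D t) * (cmod (u t))^2)"
  let ?F' = "\<lambda>t. V2 t * ((1 / ?D t) * (cmod (u t))^2) + (- V1 t / (?D t)^2 * (cmod (u t))^2 + 2 * Re (cnj (u t) * u1 t) * (1 / ?D t)) * V1 t"
  have "integral {0..2} ?F' = ?F 2 - ?F 0"
  proof (rule vector_FTC)
   fix t :: real assume t: "t \<in> {0..2}"
   have "(?F has_real_derivative ?F' t) (at t within {0..2})"
    by (intro DERIV_mult dV1 dD norm_square_has_derivative du t)
   then show "(?F has_vector_derivative ?F' t) (at t within {0..2})" by (simp add: has_real_derivative_iff_has_vector_derivative)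
  qed simp
  then have F0: "integral {0..2} ?F' = 0" using u0 u2 by simp
  have cF: "continuous_on {0..2} ?F'" by (intro continuous_intros cV cV2 cu; use D in force)
  have eq: "(cmod (u1 t))^2 + V2 t / ?D t * (cmod (u t))^2 = (cmod (z t))^2 + ?F' t" if t: "t \<in> {0..2}" for t
  proof -
   define c where "c = V1 t / ?D t"
   have z: "z t = u1 t - of_real c * u t" by (simp add: z_def g_def c_def scaleR_conv_of_real)
   have "(cmod (z t))^2 = (cmod (u1 t))^2 - 2 * c * Re (cnj (u t) * u1 t) + c^2 * (cmod (u t))^2"
    unfolding z cmod_power2 by (simp add: power2_eq_square algebra_simps)
   moreover have "P + v2 / d * m = (P - 2 * (v / d) * X + (v / d)^2 * m) + (v2 * ((1 / d) * m) + (- v / d^2 * m + 2 * X * (1 / d)) * v)"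
    for P v2 d m v X :: real by (simp add: power_divide power2_eq_square algebra_simps)
   ultimately show ?thesis by (simp only: c_def)
  qed
  have "Q = integral {0..2} (\<lambda>t. (cmod (z t))^2 + ?F' t)"
   unfolding Q_def by (rule Henstock_Kurzweil_Integration.integral_cong) (use eq in blast)
  also have "\<dots> = integral {0..2} (\<lambda>t. (cmod (z t))^2) + integral {0..2} ?F'"
   by (intro Henstock_Kurzweil_Integration.integral_add integrable_continuous_real cF continuous_intros cz)
  finally show ?thesis using F0 L2n_sq[OF cz] by simp
 qed
 finally show ?thesis .
qed

end

section \<open>Layer profiles against powers of the distance, and the Airy layer at the wall\<close>

lemma sqrt_le_exp:
 assumes "x \<ge> 0" shows "sqrt x \<le> exp x"
proof -
 have "x \<le> (1 + x)^2" using assms by (simp add: power2_eq_square algebra_simps)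
 then have "sqrt x \<le> 1 + x" using assms by (intro real_le_lsqrt) auto
 then show ?thesis using exp_ge_add_one_self[of x] by linarith
qed

lemma square_le_2exp:
 assumes "x \<ge> 0" shows "x^2 \<le> 2 * exp (x::real)"
 using exp_lower_Taylor_quadratic[OF assms] assms by simp

text \<open>Common pattern of these bounds: half of the exponential rate is traded for the power of
  \<open>t\<close>, which turns into the same power of the layer width.\<close>

lemma sqrt_times_exp_le:
 assumes "t \<ge> 0" "h > 0"
 shows "sqrt t * exp (- (2 * t / h)) \<le> sqrt h * exp (- (t / h))"
proof -
 have "sqrt t = sqrt h * sqrt (t / h)" using assms by (simp add: real_sqrt_mult[symmetric])
 also have "\<dots> \<le> sqrt h * exp (t / h)" using assms by (intro mult_left_mono sqrt_le_exp) auto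
 finally have "sqrt t * exp (- (2 * t / h)) \<le> sqrt h * exp (t / h) * exp (- (2 * t / h))"
  by (rule mult_right_mono) simp
 then show ?thesis by (simp add: mult.assoc exp_add[symmetric])
qed

lemma mult_exp_le:
 assumes "t \<ge> 0" "h > 0"
 shows "t * exp (- (2 * t / h)) \<le> h * exp (- (t / h :: real))"
proof -
 have "t / h \<le> exp (t / h)" using exp_ge_add_one_self[of "t / h"] by linarith
 then have "t \<le> h * exp (t / h)" using assms by (simp add: field_simps)
 then have "t * exp (- (2 * t / h)) \<le> h * exp (t / h) * exp (- (2 * t / h))" by (rule mult_right_mono) simp
 then show ?thesis by (simp add: mult.assoc exp_add[symmetric])
qed

lemma square_mult_exp_le:
 assumes "t \<ge> 0" "h > 0"
 shows "t^2 * exp (- (2 * t / h)) \<le> 2 * h^2 * exp (- (t / h :: real))"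
proof -
 have "(t / h)^2 \<le> 2 * exp (t / h)" using assms by (intro square_le_2exp) auto
 then have "t^2 \<le> 2 * h^2 * exp (t / h)" using assms by (simp add: field_simps)
 then have "t^2 * exp (- (2 * t / h)) \<le> 2 * h^2 * exp (t / h) * exp (- (2 * t / h))" by (rule mult_right_mono) simp
 then show ?thesis by (simp add: mult.assoc exp_add[symmetric])
qed

lemma sqrt_times_exp_le':
 assumes "r \<ge> 0" "k > 0"
 shows "sqrt r * exp (- (k * r)) \<le> 2 / sqrt k * exp (- (k / 2 * r))"
proof -
 have "sqrt r = 1 / sqrt k * (sqrt 2 * sqrt (k / 2 * r))" using assms by (simp add: real_sqrt_mult real_sqrt_divide)
 also have "\<dots> \<le> 1 / sqrt k * (2 * exp (k / 2 * r))"
  using assms sqrt_le_exp[of "k / 2 * r"] by (intro mult_left_mono mult_mono) (auto intro!: real_le_lsqrt)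
 finally have "sqrt r * exp (- (k * r)) \<le> 1 / sqrt k * (2 * exp (k / 2 * r)) * exp (- (k * r))"
  by (rule mult_right_mono) simp
 also have "\<dots> = 2 / sqrt k * (exp (k / 2 * r) * exp (- (k * r)))" by simp
 also have "exp (k / 2 * r) * exp (- (k * r)) = exp (- (k / 2 * r))" by (simp add: exp_add[symmetric])
 finally show ?thesis .
qed

text \<open>\<open>hat\<close> is the Airy layer at the wall, multiplied by a linear factor so that it vanishes at \<open>t = 2\<close>;
 \<open>hat_res\<close> is its residual in the equation \<open>y'' = pp * y\<close>.\<close>

locale airy_layer = wall_profile +
 fixes nu :: complex
 assumes nuB: "cmod nu \<le> B"
  and W: "\<And>s. s \<ge> 0 \<Longrightarrow> cmod (tairy (nu - \<i> * of_real s)) \<le> B * exp (- (2 * s))"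
   "\<And>s. s \<ge> 0 \<Longrightarrow> cmod (tairy' (nu - \<i> * of_real s)) \<le> B * exp (- (2 * s))"
  and Wlow: "cmod (tairy nu) \<ge> 1 / B"
begin

text \<open>The potential of the vorticity equation at
  \<open>\<Lambda> = \<i> * U (-1) + h * nu\<close> with \<open>\<beta> = 1 / th^12\<close>; the
  product \<open>\<beta> * h\<close> is \<open>1 / th^8\<close>.\<close>

definition pp where "pp t = \<i> * of_real (V t / th^12) - nu / of_real (th^8)"
definition Wh where "Wh t = tairy (nu - \<i> * of_real (t / h))"
definition Wh1 where "Wh1 t = - \<i> * tairy' (nu - \<i> * of_real (t / h))"
definition hat where "hat t = of_real (1 - t / 2) * Wh t"
definition hat1 where "hat1 t = of_real (1 - t / 2) * ((1 / h) *\<^sub>R Wh1 t) - of_real (1 / 2) * Wh t"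
definition hat_res where "hat_res t = \<i> * of_real ((V t - t) / th^12) * hat t + (1 / h) *\<^sub>R Wh1 t"

lemma dpoly: "((\<lambda>t. of_real (f t) :: complex) has_vector_derivative of_real f') (at t within S)"
 if "(f has_real_derivative f') (at t within S)"
 using bounded_linear.has_vector_derivative[OF bounded_linear_of_real[where 'a = complex] that[unfolded has_real_derivative_iff_has_vector_derivative]] .

lemma dWh: "(Wh has_vector_derivative (1 / h) *\<^sub>R Wh1 t) (at t within S)"
 and dWh1: "(Wh1 has_vector_derivative (1 / h) *\<^sub>R ((\<i> * of_real (t / h) - nu) * Wh t)) (at t within S)"
 and dGa: "((\<lambda>t. \<i> * (- eig_fun (nu - \<i> * of_real (t / h)))) has_vector_derivative (1 / h) *\<^sub>R Wh t) (at t within S)"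
proof -
 have dsc: "((\<lambda>t. f (t / h)) has_vector_derivative (1 / h) *\<^sub>R f') (at t within S)"
  if "(f has_vector_derivative f') (at (t / h))" for f :: "real \<Rightarrow> complex" and f' t
 proof -
  have "((\<lambda>t. t / h) has_vector_derivative 1 / h) (at t)"
   unfolding has_real_derivative_iff_has_vector_derivative[symmetric] by (rule DERIV_cdivide[OF DERIV_ident])
  from vector_diff_chain_at[OF this that] show ?thesis by (auto simp: o_def intro: has_vector_derivative_at_within)
 qed
 show "(Wh has_vector_derivative (1 / h) *\<^sub>R Wh1 t) (at t within S)"
  unfolding Wh_def[abs_def] Wh1_def using dsc[OF tairy_along_line(1)] .
 show "(Wh1 has_vector_derivative (1 / h) *\<^sub>R ((\<i> * of_real (t / h) - nu) * Wh t)) (at t within S)"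
  unfolding Wh_def Wh1_def[abs_def] using dsc[OF tairy_along_line(2)] .
 show "((\<lambda>t. \<i> * (- eig_fun (nu - \<i> * of_real (t / h)))) has_vector_derivative (1 / h) *\<^sub>R Wh t) (at t within S)"
  unfolding Wh_def using dsc[OF tairy_along_line(3)] .
qed

lemma Whb: "t \<ge> 0 \<Longrightarrow> cmod (Wh t) \<le> B * exp (- (2 * t / h))" "t \<ge> 0 \<Longrightarrow> cmod (Wh1 t) \<le> B * exp (- (2 * t / h))"
 using W(1,2)[of "t / h"] h by (auto simp: Wh_def Wh1_def norm_mult)

lemma dhat: "(hat has_vector_derivative hat1 t) (at t within S)"
 and dhat1: "(hat1 has_vector_derivative pp t * hat t - hat_res t) (at t within S)"
proof -
 have l: "((\<lambda>t. 1 - t / 2) has_real_derivative - (1 / 2)) (at t within S)" for t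
  by (auto intro!: derivative_eq_intros)
 have "(hat has_vector_derivative of_real (1 - t / 2) * ((1 / h) *\<^sub>R Wh1 t) + of_real (- (1 / 2)) * Wh t) (at t within S)"
  unfolding hat_def[abs_def] by (intro has_vector_derivative_mult dpoly l dWh)
 then show "(hat has_vector_derivative hat1 t) (at t within S)" by (simp add: hat1_def)
 have "(hat1 has_vector_derivative (of_real (1 - t / 2) * ((1 / h) *\<^sub>R ((1 / h) *\<^sub>R ((\<i> * of_real (t / h) - nu) * Wh t))) + of_real (- (1 / 2)) * ((1 / h) *\<^sub>R Wh1 t))
   - of_real (1 / 2) * ((1 / h) *\<^sub>R Wh1 t)) (at t within S)" unfolding hat1_def[abs_def]
  by (intro has_vector_derivative_diff has_vector_derivative_mult has_vector_derivative_mult_right dpoly l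
    bounded_linear.has_vector_derivative[OF bounded_linear_scaleR_right] dWh1 dWh)
 moreover have "(of_real (1 - t / 2) * ((1 / h) *\<^sub>R ((1 / h) *\<^sub>R ((\<i> * of_real (t / h) - nu) * Wh t))) + of_real (- (1 / 2)) * ((1 / h) *\<^sub>R Wh1 t))
   - of_real (1 / 2) * ((1 / h) *\<^sub>R Wh1 t) = pp t * hat t - hat_res t"
 proof -
  have "(1 / h) * (1 / h) * (t / h) = t / th^12" "(1 / h) * (1 / h) = 1 / th^8" by (simp_all add: h_def flip: power_add)
  then have "of_real (1 / h) * (of_real (1 / h) * of_real (t / h)) = (of_real (t / th^12) :: complex)"
   "of_real (1 / h) * of_real (1 / h) = (1 / of_real (th^8) :: complex)"
   by (metis mult.assoc of_real_mult, metis of_real_1 of_real_divide of_real_mult)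
  then have k: "of_real (1 / h) * (of_real (1 / h) * (\<i> * of_real (t / h) - nu)) = \<i> * of_real (t / th^12) - nu / of_real (th^8)"
   by (simp add: right_diff_distrib mult.assoc[symmetric] divide_inverse del: of_real_divide of_real_power)
  have v: "of_real ((V t - t) / th^12) = of_real (V t / th^12) - (of_real (t / th^12) :: complex)"
   by (simp only: diff_divide_distrib of_real_diff)
  have a: "of_real (1 - t / 2) * ((1 / h) *\<^sub>R ((1 / h) *\<^sub>R ((\<i> * of_real (t / h) - nu) * Wh t)))
    = (\<i> * of_real (t / th^12) - nu / of_real (th^8)) * (of_real (1 - t / 2) * Wh t)"
   unfolding k[symmetric] scaleR_conv_of_real by (simp only: mult_ac)
  show ?thesis unfolding a pp_def hat_def hat_res_def v by (simp only: ring_distribs) simp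
 qed
 ultimately show "(hat1 has_vector_derivative pp t * hat t - hat_res t) (at t within S)" by simp
qed

lemma hat_bound:
 assumes "t \<in> {0..2}" shows "cmod (hat t) \<le> B * exp (- (2 * t / h))"
proof -
 have "cmod (hat t) \<le> 1 * cmod (Wh t)" unfolding hat_def norm_mult norm_of_real by (intro mult_right_mono) (use assms in auto)
 then show ?thesis using Whb(1)[of t] assms by auto
qed

text \<open>Replacing \<open>V\<close> by \<open>t\<close> costs \<open>B * t^2 / th^12\<close>;
  against the layer \<open>t^2\<close> counts as \<open>h^2 = th^8\<close>. The linear cutoff
  contributes one derivative of the layer, of size \<open>1 / h = 1 / th^4\<close>. Both errors
  therefore have the same order.\<close>

lemma hat_res_bound:
 assumes t: "t \<in> {0..2}" shows "cmod (hat_res t) \<le> 3 * B^2 / th^4 * exp (- (t / h))"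
proof -
 have ee: "exp (- (2 * t / h)) \<le> exp (- (t / h))" using t h by (simp add: divide_right_mono)
 have "cmod (\<i> * of_real ((V t - t) / th^12) * hat t) = \<bar>V t - t\<bar> / th^12 * cmod (hat t)"
  using th by (simp only: norm_mult norm_of_real) simp
 also have "\<dots> \<le> (B * t^2) / th^12 * (B * exp (- (2 * t / h)))"
  using Vlin[OF t] th B0 by (intro mult_mono divide_right_mono hat_bound t) auto
 also have "\<dots> = B^2 / th^12 * (t^2 * exp (- (2 * t / h)))" by (simp add: power2_eq_square)
 also have "\<dots> \<le> B^2 / th^12 * (2 * h^2 * exp (- (t / h)))"
  using th t h by (intro mult_left_mono square_mult_exp_le) auto
 also have "\<dots> = 2 * B^2 / th^4 * exp (- (t / h))" using th by (simp add: h_def field_simps flip: power_add power_mult)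
 finally have a: "cmod (\<i> * of_real ((V t - t) / th^12) * hat t) \<le> 2 * B^2 / th^4 * exp (- (t / h))" .
 have "B * 1 \<le> B * B" using B1 by (intro mult_left_mono) auto
 then have "B * exp (- (2 * t / h)) \<le> B^2 * exp (- (t / h))" using ee B0 by (intro mult_mono) (auto simp: power2_eq_square)
 then have "1 / h * cmod (Wh1 t) \<le> 1 / h * (B^2 * exp (- (t / h)))"
  using Whb(2)[of t] t h by (intro mult_left_mono) auto
 then have b: "cmod ((1 / h) *\<^sub>R Wh1 t) \<le> B^2 / th^4 * exp (- (t / h))" using h by (simp add: h_def)
 have "3 * B^2 / th^4 * exp (- (t / h)) = 2 * B^2 / th^4 * exp (- (t / h)) + B^2 / th^4 * exp (- (t / h))"
  by (simp add: field_simps)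
 then show ?thesis unfolding hat_res_def using a b norm_triangle_ineq[of "\<i> * of_real ((V t - t) / th^12) * hat t" "(1 / h) *\<^sub>R Wh1 t"] by linarith
qed

end

text \<open>The vorticity \<open>u'' - \<alpha>^2 * u\<close> is split into explicit layers \<open>om\<close> and a remainder \<open>y\<close> that vanishes at both ends.\<close>

locale os_layer = dirichlet_profile V V1 V2 B th u u1 u2 + airy_layer V V1 V2 B th nu
 for V V1 V2 B th u u1 u2 nu +
 fixes y y1 r om :: "real \<Rightarrow> complex" and \<alpha> Ra Rb Ga Gb \<kappa> :: real
 assumes u2eq: "\<And>t. t \<in> {0..2} \<Longrightarrow> u2 t = y t + om t + of_real (\<alpha>^2) * u t"
  and dy: "\<And>t. t \<in> {0..2} \<Longrightarrow> (y has_vector_derivative y1 t) (at t within {0..2})"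
  and dy1: "\<And>t. t \<in> {0..2} \<Longrightarrow> (y1 has_vector_derivative pp t * y t - \<i> * of_real (V2 t / th^12) * u t - r t) (at t within {0..2})"
  and y0: "y 0 = 0" and y2: "y 2 = 0"
  and cr: "continuous_on {0..2} r" and com: "continuous_on {0..2} om"
  and nn: "Ra \<ge> 0" "Rb \<ge> 0" "Ga \<ge> 0" "Gb \<ge> 0"
  and rb: "\<And>t. t \<in> {0..2} \<Longrightarrow> cmod (r t) \<le> Ra * exp (- (t / h)) + Rb * t * exp (- (\<kappa> * (2 - t)))"
  and omb: "\<And>t. t \<in> {0..2} \<Longrightarrow> cmod (om t) \<le> Ga * exp (- (2 * t / h)) + Gb * exp (- (\<kappa> * (2 - t)))"
  and kap: "\<kappa> \<ge> 1 / (2 * B * th^6)"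
begin

definition y2 :: "real \<Rightarrow> complex" where
 "y2 t = pp t * y t - \<i> * of_real (V2 t / th^12) * u t - r t"

lemma dy2: "t \<in> {0..2} \<Longrightarrow> (y1 has_vector_derivative y2 t) (at t within {0..2})"
 unfolding y2_def by (rule dy1)

lemma cy: "continuous_on {0..2} y" "continuous_on {0..2} y1" "continuous_on {0..2} y2"
proof -
 show c: "continuous_on {0..2} y" "continuous_on {0..2} y1"
  unfolding continuous_on_eq_continuous_within using dy dy2 has_vector_derivative_continuous by blast+
 show "continuous_on {0..2} y2" unfolding y2_def pp_def
  by (intro continuous_intros cV cV2 cu c cr) (use th in auto)
qed

lemma kap0: "\<kappa> > 0" "1 / \<kappa> \<le> 2 * B * th^6" "1 / sqrt \<kappa> \<le> 2 * B * th^3"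
proof -
 have p: "1 / (2 * B * th^6) > 0" using B0 th by simp
 then show k0: "\<kappa> > 0" using kap by linarith
 show k1: "1 / \<kappa> \<le> 2 * B * th^6" using kap k0 B0 th by (simp add: field_simps)
 have "1 / sqrt \<kappa> = sqrt (1 / \<kappa>)" by (simp add: real_sqrt_divide)
 also have "\<dots> \<le> sqrt ((2 * B * th^3)^2)"
 proof (rule real_sqrt_le_mono)
  have "2 * B * th^6 * 1 \<le> 2 * B * th^6 * (2 * B)" using B1 th by (intro mult_left_mono) auto
  also have "\<dots> = (2 * B * th^3)^2" by (simp add: power2_eq_square flip: power_add)
  finally show "1 / \<kappa> \<le> (2 * B * th^3)^2" using k1 by linarith
 qed
 also have "\<dots> = 2 * B * th^3" using B0 th by simp
 finally show "1 / sqrt \<kappa> \<le> 2 * B * th^3" .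
qed

lemma V2u_bound:
 assumes t: "t \<in> {0..2}" shows "cmod (\<i> * of_real (V2 t / th^12) * u t) \<le> B / th^12 * (sqrt t * N)"
proof -
 have "cmod (\<i> * of_real (V2 t / th^12) * u t) = \<bar>V2 t\<bar> / th^12 * cmod (u t)" using th by (simp only: norm_mult norm_of_real) simp
 also have "\<dots> \<le> B / th^12 * (sqrt t * N)" using V2b[OF t] th by (intro mult_mono divide_right_mono u_bound_left t) auto
 finally show ?thesis .
qed

lemma r_bound:
 assumes t: "t \<in> {0..2}" shows "cmod (r t) \<le> Ra + Rb * t"
proof -
 have "Rb * t * exp (- (\<kappa> * (2 - t))) \<le> Rb * t * 1" using nn t kap0 by (intro mult_left_mono) auto
 moreover have "Ra * exp (- (t / h)) \<le> Ra * 1" using nn t h by (intro mult_left_mono) auto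
 ultimately show ?thesis using rb[OF t] by simp
qed

text \<open>\<open>D\<close> weights \<open>y\<close> with \<open>t + h\<close>, which is comparable
  with \<open>V + h\<close> and does not degenerate at the wall. Divided by \<open>th^12\<close> it
  stands for the potential energy, so \<open>Y\<close> is the energy norm of
  \<open>y'' = pp * y\<close>.\<close>

definition D :: real where "D = integral {0..2} (\<lambda>t. (t + h) * (cmod (y t))^2)"
definition Y :: real where "Y = sqrt ((L2n y1)^2 + D / th^12)"

lemma D0: "D \<ge> 0"
 unfolding D_def by (intro Henstock_Kurzweil_Integration.integral_nonneg integrable_continuous_real continuous_intros cy) (use h in auto)

lemma Y0: "Y \<ge> 0" and Ysq: "Y^2 = (L2n y1)^2 + D / th^12"
 and y1Y: "L2n y1 \<le> Y" and DY: "sqrt D \<le> th^6 * Y"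
proof -
 have p: "(L2n y1)^2 + D / th^12 \<ge> 0" using D0 th by (intro add_nonneg_nonneg divide_nonneg_pos) auto
 show Y0: "Y \<ge> 0" unfolding Y_def using p by simp
 show Ysq: "Y^2 = (L2n y1)^2 + D / th^12" unfolding Y_def using p by simp
 have "D / th^12 \<ge> 0" using D0 th by simp
 then have "(L2n y1)^2 \<le> Y^2" using Ysq by linarith
 then show "L2n y1 \<le> Y" using Y0 by (rule power2_le_imp_le)
 have "D / th^12 \<le> Y^2" using Ysq zero_le_power2[of "L2n y1"] by linarith
 then have "D \<le> Y^2 * th^12" using th by (simp add: divide_le_eq)
 also have "\<dots> = (th^6 * Y)^2" by (simp add: power_mult_distrib flip: power_mult)
 finally show "sqrt D \<le> th^6 * Y" using Y0 th by (intro real_le_lsqrt) auto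
qed

text \<open>Cauchy-Schwarz with weight \<open>t + h\<close>. Every use of \<open>y\<close> thus
  gains \<open>th^6\<close>, and each of the following estimates reduces to the integral of
  \<open>g^2 / (t + h)\<close>.\<close>

lemma y_weighted:
 assumes g: "continuous_on {0..2} g" "integral {0..2} (\<lambda>t. (g t)^2 / (t + h)) \<le> G^2" "G \<ge> 0"
 shows "integral {0..2} (\<lambda>t. cmod (y t) * g t) \<le> th^6 * Y * G"
proof -
 have cs: "continuous_on {0..2} (\<lambda>t. sqrt (t + h))" by (intro continuous_intros)
 have cg: "continuous_on {0..2} (\<lambda>t. g t / sqrt (t + h))"
  by (intro continuous_intros g) (use h in force)
 have "integral {0..2} (\<lambda>t. cmod (y t) * g t) = integral {0..2} (\<lambda>t. (sqrt (t + h) * cmod (y t)) * (g t / sqrt (t + h)))"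
  by (rule Henstock_Kurzweil_Integration.integral_cong) (use h in auto)
 also have "\<dots> \<le> sqrt (integral {0..2} (\<lambda>t. (sqrt (t + h) * cmod (y t))^2)) * sqrt (integral {0..2} (\<lambda>t. (g t / sqrt (t + h))^2))"
  by (rule order_trans[OF abs_ge_self Cauchy_Schwarz_integral]) (intro continuous_on_mult cs continuous_on_norm cy cg)+
 also have "integral {0..2} (\<lambda>t. (sqrt (t + h) * cmod (y t))^2) = D"
  unfolding D_def by (rule Henstock_Kurzweil_Integration.integral_cong) (use h in \<open>auto simp: power_mult_distrib\<close>)
 also have "integral {0..2} (\<lambda>t. (g t / sqrt (t + h))^2) = integral {0..2} (\<lambda>t. (g t)^2 / (t + h))"
  by (rule Henstock_Kurzweil_Integration.integral_cong) (use h in \<open>auto simp: power_divide\<close>)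
 also have "sqrt D * sqrt (integral {0..2} (\<lambda>t. (g t)^2 / (t + h))) \<le> (th^6 * Y) * sqrt (G^2)"
  by (intro mult_mono DY real_sqrt_le_mono g) (use th Y0 in \<open>auto intro!: real_sqrt_ge_zero Henstock_Kurzweil_Integration.integral_nonneg
    integrable_continuous_real continuous_intros g simp: h(1) less_imp_le add_nonneg_pos h(1)[THEN less_imp_neq, symmetric] add_nonneg_eq_0_iff\<close>)
 finally show ?thesis using g(3) by simp
qed

lemma int_exp_h: "integral {0..2} (\<lambda>t. exp (- (t / h))) \<le> th^4"
 using integral_exp_neg_le[of "1 / h"] h by (simp add: h_def)

lemma int_exp_kap: "integral {0..2} (\<lambda>t. exp (- (\<kappa> * (2 - t)))) \<le> 2 * B * th^6"
 using integral_exp_neg_right_le[OF kap0(1)] kap0(2) by linarith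

lemma cexp: "continuous_on {0..2} (\<lambda>t. exp (- (t / h)))" "continuous_on {0..2} (\<lambda>t. exp (- (\<kappa> * (2 - t))))"
 "continuous_on {0..2} (\<lambda>t. exp (- (2 * t / h)))"
 by (intro continuous_intros; use h in force)+

lemma y_exp: "integral {0..2} (\<lambda>t. cmod (y t) * exp (- (t / h))) \<le> th^6 * Y"
proof -
 have "integral {0..2} (\<lambda>t. cmod (y t) * exp (- (t / h))) \<le> th^6 * Y * 1"
 proof (rule y_weighted[OF cexp(1)])
  have "integral {0..2} (\<lambda>t. (exp (- (t / h)))^2 / (t + h)) \<le> integral {0..2} (\<lambda>t. 1 / h * exp (- (t / h)))"
  proof (rule integral_mono_continuous)
   fix t :: real assume t: "t \<in> {0..2}"
   have "(exp (- (t / h)))^2 \<le> exp (- (t / h))" using t h by (simp add: power2_eq_square mult_left_le)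
   then have "(exp (- (t / h)))^2 / (t + h) \<le> exp (- (t / h)) / h" using t h by (intro frac_le) auto
   then show "(exp (- (t / h)))^2 / (t + h) \<le> 1 / h * exp (- (t / h))" by simp
  qed (intro continuous_intros cexp; use h in force)+
  also have "\<dots> = 1 / h * integral {0..2} (\<lambda>t. exp (- (t / h)))" by (rule integral_mult_right)
  also have "\<dots> \<le> 1 / h * h" using int_exp_h h by (intro mult_left_mono) (auto simp: h_def)
  finally show "integral {0..2} (\<lambda>t. (exp (- (t / h)))^2 / (t + h)) \<le> 1^2" using h by simp
 qed simp
 then show ?thesis by simp
qed

lemma y_exp_kap: "integral {0..2} (\<lambda>t. cmod (y t) * (t * exp (- (\<kappa> * (2 - t))))) \<le> th^6 * Y * (2 * B * th^3)"
proof (rule y_weighted)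
 show "continuous_on {0..2} (\<lambda>t. t * exp (- (\<kappa> * (2 - t))))" by (intro continuous_intros)
 have "integral {0..2} (\<lambda>t. (t * exp (- (\<kappa> * (2 - t))))^2 / (t + h)) \<le> integral {0..2} (\<lambda>t. 2 * exp (- (\<kappa> * (2 - t))))"
 proof (rule integral_mono_continuous)
  fix t :: real assume t: "t \<in> {0..2}"
  have "(exp (- (\<kappa> * (2 - t))))^2 \<le> exp (- (\<kappa> * (2 - t)))" using t kap0 by (simp add: power2_eq_square mult_left_le)
  moreover have "t^2 / (t + h) \<le> 2"
  proof -
   have "t^2 \<le> 2 * t" using t by (simp add: power2_eq_square mult_right_mono)
   also have "\<dots> \<le> 2 * (t + h)" using h by simp
   finally show ?thesis using t h by (simp add: divide_le_eq)
  qed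
  ultimately have "t^2 / (t + h) * (exp (- (\<kappa> * (2 - t))))^2 \<le> 2 * exp (- (\<kappa> * (2 - t)))"
   using t h by (intro mult_mono) auto
  then show "(t * exp (- (\<kappa> * (2 - t))))^2 / (t + h) \<le> 2 * exp (- (\<kappa> * (2 - t)))" by (simp add: power_mult_distrib)
 qed (intro continuous_intros; use h in force)+
 also have "\<dots> = 2 * integral {0..2} (\<lambda>t. exp (- (\<kappa> * (2 - t))))" by (rule integral_mult_right)
 also have "\<dots> \<le> 2 * (2 * B * th^6)" using int_exp_kap by simp
 also have "\<dots> \<le> (2 * B * th^3)^2"
 proof -
  have "4 * B * th^6 * 1 \<le> 4 * B * th^6 * B" using B1 th by (intro mult_left_mono) auto
  then show ?thesis by (simp add: power2_eq_square mult_ac flip: power_add)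
 qed
 finally show "integral {0..2} (\<lambda>t. (t * exp (- (\<kappa> * (2 - t))))^2 / (t + h)) \<le> (2 * B * th^3)^2" .
qed (use B0 th in auto)

lemma y_sqrt: "integral {0..2} (\<lambda>t. cmod (y t) * sqrt t) \<le> th^6 * Y * 2"
proof (rule y_weighted)
 have "integral {0..2} (\<lambda>t. (sqrt t)^2 / (t + h)) \<le> integral {0..2::real} (\<lambda>t. 1 :: real)"
  by (rule integral_mono_continuous) (use h in \<open>auto intro!: continuous_intros simp: add_nonneg_eq_0_iff\<close>)
 then show "integral {0..2} (\<lambda>t. (sqrt t)^2 / (t + h)) \<le> 2^2" by simp
qed (intro continuous_intros | simp)+

lemma y_sqrt_weight: "integral {0..2} (\<lambda>t. cmod (y t) * (sqrt t / (t + h))) \<le> th^4 * Y"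
proof -
 have "integral {0..2} (\<lambda>t. cmod (y t) * (sqrt t / (t + h))) \<le> th^6 * Y * (1 / th^2)"
 proof (rule y_weighted)
  show c: "continuous_on {0..2} (\<lambda>t. sqrt t / (t + h))" by (intro continuous_intros) (use h in force)
  have "integral {0..2} (\<lambda>t. (sqrt t / (t + h))^2 / (t + h)) \<le> integral {0..2} (\<lambda>t. 1 / (t + h)^2)"
  proof (rule integral_mono_continuous)
   fix t :: real assume t: "t \<in> {0..2}"
   have "(sqrt t / (t + h))^2 / (t + h) = (t / (t + h)) * (1 / (t + h)^2)"
    using t by (simp add: power_divide power2_eq_square)
   also have "\<dots> \<le> 1 * (1 / (t + h)^2)" using t h by (intro mult_right_mono) (auto simp: divide_le_eq)
   finally show "(sqrt t / (t + h))^2 / (t + h) \<le> 1 / (t + h)^2" by simp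
  qed (intro continuous_intros c; use h in force)+
  also have "\<dots> \<le> 1 / h" by (rule integral_inverse_shift_le(1)[OF h(1)])
  also have "\<dots> = (1 / th^2)^2" by (simp add: h_def power_divide flip: power_mult)
  finally show "integral {0..2} (\<lambda>t. (sqrt t / (t + h))^2 / (t + h)) \<le> (1 / th^2)^2" .
 qed (use th in auto)
 also have "th^6 * Y * (1 / th^2) = th^4 * Y" using th by (simp add: field_simps flip: power_add)
 finally show ?thesis .
qed

end

text \<open>\<open>layer_S\<close> counts layer widths: since
  \<open>5 * B^2 \<ge> 4 * B^2 + 1\<close>, beyond this distance \<open>V / th^12\<close> pays for
  the term in \<open>nu\<close> and for the weight \<open>(t + h) / (2 * B * th^12)\<close>. The
  exponent in \<open>layer_K\<close> is \<open>k * T * T\<close> of the second-order Gronwall bound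
  on that distance, and \<open>energy_K\<close> is \<open>p + q + 1\<close> from
  \<open>quadratic_le_imp_linear_le\<close>.\<close>

definition layer_S :: "real \<Rightarrow> real" where "layer_S B = 5 * B^2"
definition layer_K :: "real \<Rightarrow> real" where
 "layer_K B = exp (B * (layer_S B + 1) * (layer_S B)^2) * (4 * B^3 * (layer_S B)^3)"
definition energy_K :: "real \<Rightarrow> real" where
 "energy_K B = 16 * B^2 + 24 * B^2 * exp (layer_S B) * (layer_K B)^2 + 1"

section \<open>The two coupled estimates, for \<open>u'\<close> and for the remainder
  \<open>y\<close>\<close>

context os_layer
begin

lemma y1_weight: "integral {0..2} (\<lambda>t. cmod (y1 t) * (sqrt t / (t + h)^2)) \<le> Y / th^4"
proof -
 have c: "continuous_on {0..2} (\<lambda>t. sqrt t / (t + h)^2)" by (intro continuous_intros) (use h in force)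
 have "integral {0..2} (\<lambda>t. cmod (y1 t) * (sqrt t / (t + h)^2)) \<le> L2n y1 * (1 / th^4)"
 proof (rule integral_cmod_mult_le[OF cy(2) c])
  have "integral {0..2} (\<lambda>t. (sqrt t / (t + h)^2)^2) \<le> integral {0..2} (\<lambda>t. 1 / (t + h)^3)"
  proof (rule integral_mono_continuous)
   fix t :: real assume t: "t \<in> {0..2}"
   have "(sqrt t / (t + h)^2)^2 = (t / (t + h)) * (1 / (t + h)^3)"
    using t by (simp add: power_divide eval_nat_numeral)
   also have "\<dots> \<le> 1 * (1 / (t + h)^3)" using t h by (intro mult_right_mono) (auto simp: divide_le_eq)
   finally show "(sqrt t / (t + h)^2)^2 \<le> 1 / (t + h)^3" by simp
  qed (intro continuous_intros c; use h in force)+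
  also have "\<dots> \<le> 1 / h^2" by (rule integral_inverse_shift_le(2)[OF h(1)])
  finally show "integral {0..2} (\<lambda>t. (sqrt t / (t + h)^2)^2) \<le> (1 / th^4)^2" by (simp add: h_def power_divide)
 qed (use th in auto)
 also have "\<dots> \<le> Y * (1 / th^4)" using y1Y th by (intro mult_right_mono) auto
 finally show ?thesis by simp
qed

lemma y1_u1: "integral {0..2} (\<lambda>t. cmod (y1 t) * cmod (u1 t)) \<le> Y * N"
proof -
 have "integral {0..2} (\<lambda>t. cmod (y1 t) * cmod (u1 t)) \<le> L2n y1 * N" unfolding N_def
  by (rule integral_cmod_mult_le[OF cy(2) continuous_on_norm[OF cu(2)] eq_refl[OF L2n_sq[OF cu(2), symmetric]] L2n_nonneg[OF cu(2)]])
 also have "\<dots> \<le> Y * N" by (intro mult_right_mono y1Y N0)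
 finally show ?thesis .
qed

text \<open>The equation for \<open>y\<close>, multiplied by \<open>cnj u / (V + h)\<close>, turns the integral of \<open>y * cnj u\<close> into the form \<open>Q\<close>, which is
 coercive because \<open>V > 0\<close>.\<close>

lemma estimate_N:
 "N \<le> 144 * B^7 * (th^8 * Y + th^6 * Ga + th^9 * Gb + th^14 * Ra + th^18 * Rb)"
proof -
 define iv where "iv t = 1 / (V t + h)" for t
 \<comment> \<open>This is the inverse of \<open>\<i> * \<beta>\<close>. Times \<open>pp\<close> it
   equals \<open>V + \<i> * nu * h\<close>, so that division by \<open>V + h\<close> leaves
   \<open>y\<close> itself up to an error of relative size \<open>h / (V + h)\<close>.\<close>
 define \<gamma> :: complex where "\<gamma> = - \<i> * of_real (th^12)"
 have civ: "continuous_on {0..2} iv"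
  unfolding iv_def by (intro continuous_intros cV) (use Vh_pos in force)
 define iv' where "iv' t = - V1 t * (iv t)^2" for t
 have div: "(iv has_real_derivative iv' t) (at t within {0..2})" if t: "t \<in> {0..2}" for t
 proof -
  have "((\<lambda>t. V t + h) has_real_derivative V1 t) (at t within {0..2})"
   using DERIV_add[OF dV[OF t] DERIV_const[of h]] by simp
  from DERIV_inverse_fun[OF this] Vh_pos[OF t] show ?thesis
   by (simp add: iv_def[abs_def] iv'_def divide_inverse power2_eq_square)
 qed
 have civ': "continuous_on {0..2} iv'" unfolding iv'_def by (intro continuous_intros cV civ)
 define G where "G t = iv' t *\<^sub>R cnj (u t) + iv t *\<^sub>R cnj (u1 t)" for t
 have cG: "continuous_on {0..2} G" unfolding G_def by (intro continuous_intros civ civ' cu)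
 define F1' where "F1' t = y2 t * (iv t *\<^sub>R cnj (u t)) + y1 t * G t" for t
 define F2' where "F2' t = u2 t * cnj (u t) + u1 t * cnj (u1 t)" for t
 have cF: "continuous_on {0..2} F1'" "continuous_on {0..2} F2'"
  unfolding F1'_def F2'_def by (intro continuous_intros cu cu2 cy civ cG)+
 have I1: "integral {0..2} F1' = 0"
 proof -
  have "integral {0..2} F1' = y1 2 * (iv 2 *\<^sub>R cnj (u 2)) - y1 0 * (iv 0 *\<^sub>R cnj (u 0))"
  proof (rule vector_FTC)
   fix t :: real assume t: "t \<in> {0..2}"
   have "((\<lambda>t. iv t *\<^sub>R cnj (u t)) has_vector_derivative G t) (at t within {0..2})"
    using has_vector_derivative_scaleR[OF div[OF t] has_vector_derivative_cnj[OF du[OF t]]] by (simp add: G_def add.commute)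
   from has_vector_derivative_mult[OF dy2[OF t] this]
   show "((\<lambda>t. y1 t * (iv t *\<^sub>R cnj (u t))) has_vector_derivative F1' t) (at t within {0..2})"
    by (simp add: F1'_def add.commute)
  qed simp
  then show ?thesis using u0 u2 by simp
 qed
 have I2: "integral {0..2} F2' = 0"
 proof -
  have "integral {0..2} F2' = u1 2 * cnj (u 2) - u1 0 * cnj (u 0)"
  proof (rule vector_FTC)
   fix t :: real assume t: "t \<in> {0..2}"
   from has_vector_derivative_mult[OF du1[OF t] has_vector_derivative_cnj[OF du[OF t]]]
   show "((\<lambda>t. u1 t * cnj (u t)) has_vector_derivative F2' t) (at t within {0..2})"
    by (simp add: F2'_def add.commute)
  qed simp
  then show ?thesis using u0 u2 by simp
 qed
 \<comment> \<open>The term with \<open>\<alpha>^2\<close> has the favourable sign and is simply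
   dropped when \<open>q\<close> is compared with the integrand of \<open>Q\<close>.\<close>
 define q where "q t = ((cmod (u1 t))^2 + V2 t / (V t + h) * (cmod (u t))^2) + \<alpha>^2 * (cmod (u t))^2" for t
 \<comment> \<open>All that separates the form from exact derivatives: the explicit layers, the
   defect of \<open>V + \<i> * nu * h\<close> against \<open>V + h\<close>, the residual
   \<open>r\<close>, and the product of \<open>y'\<close> with the derivative of
   \<open>cnj u / (V + h)\<close>.\<close>
 define E where "E t = om t * cnj (u t) + of_real (h * iv t) * (1 - \<i> * nu) * y t * cnj (u t)
   + \<gamma> * r t * (iv t *\<^sub>R cnj (u t)) - \<gamma> * y1 t * G t" for t
 have cE: "continuous_on {0..2} E" unfolding E_def by (intro continuous_intros com cu civ cy cr cG)
 have g0: "\<gamma> * (\<i> * of_real (x / th^12)) = of_real x" for x :: real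
  using th by (simp add: \<gamma>_def)
 have gpp: "\<gamma> * pp t = of_real (V t) + \<i> * nu * of_real h" for t
 proof -
  have "of_real (th^12) * (nu / of_real (th^8)) = nu * of_real h"
   using th by (simp add: h_def field_simps flip: power_add)
  moreover have "\<gamma> * (nu / of_real (th^8)) = - \<i> * (of_real (th^12) * (nu / of_real (th^8)))"
   by (simp only: \<gamma>_def mult.assoc)
  ultimately have "\<gamma> * (nu / of_real (th^8)) = - (\<i> * nu * of_real h)" by simp
  then show ?thesis unfolding pp_def right_diff_distrib g0 by simp
 qed
 have eq: "of_real (q t) = F2' t - \<gamma> * F1' t - E t" if t: "t \<in> {0..2}" for t
 proof -
  have ivD: "of_real (V t) * of_real (iv t) = (1 :: complex) - of_real h * of_real (iv t)"
  proof -
   have "V t * iv t = 1 - h * iv t" using Vh_pos[OF t] by (simp add: iv_def field_simps)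
   then show ?thesis by (metis of_real_1 of_real_diff of_real_mult)
  qed
  have y2': "\<gamma> * y2 t = (of_real (V t) + \<i> * nu * of_real h) * y t - of_real (V2 t) * u t - \<gamma> * r t"
  proof -
   have "\<gamma> * y2 t = (\<gamma> * pp t) * y t - (\<gamma> * (\<i> * of_real (V2 t / th^12))) * u t - \<gamma> * r t"
    unfolding y2_def by (simp only: right_diff_distrib mult.assoc)
   then show ?thesis unfolding gpp g0 .
  qed
  have gF: "\<gamma> * F1' t = (\<gamma> * y2 t) * (of_real (iv t) * cnj (u t)) + \<gamma> * y1 t * G t"
   by (simp add: F1'_def scaleR_conv_of_real algebra_simps)
  have "of_real (q t) = (u1 t * cnj (u1 t) + of_real (V2 t) * of_real (iv t) * (u t * cnj (u t))) + of_real (\<alpha>^2) * (u t * cnj (u t))"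
  proof -
   have "q t = ((cmod (u1 t))^2 + (V2 t * iv t) * (cmod (u t))^2) + \<alpha>^2 * (cmod (u t))^2" by (simp add: q_def iv_def)
   then show ?thesis by (simp only: of_real_add of_real_mult complex_norm_square)
  qed
  moreover have "F2' t - \<gamma> * F1' t - E t = (u1 t * cnj (u1 t) + of_real (V2 t) * of_real (iv t) * (u t * cnj (u t))) + of_real (\<alpha>^2) * (u t * cnj (u t))
    + (1 - of_real h * of_real (iv t) - of_real (V t) * of_real (iv t)) * (y t * cnj (u t))"
   unfolding gF y2' F2'_def E_def u2eq[OF t] scaleR_conv_of_real of_real_mult by (simp only: ring_distribs) (simp add: algebra_simps)
  ultimately show ?thesis unfolding ivD by simp
 qed
 have cq: "continuous_on {0..2} q"
  unfolding q_def by (intro continuous_intros cu cV cV2) (use Vh_pos in force)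
 define C1 C2 where "C1 = (\<lambda>t. exp (- (t / h)))" and "C2 = (\<lambda>t. exp (- (\<kappa> * (2 - t))))"
 define C3 where "C3 = (\<lambda>t. exp (- (\<kappa> / 2 * (2 - t))))"
 define C4 where "C4 = (\<lambda>t. cmod (y t) * (sqrt t / (t + h)))"
 define C5 where "C5 = (\<lambda>t. cmod (y1 t) * cmod (u1 t))"
 define C6 where "C6 = (\<lambda>t. cmod (y1 t) * (sqrt t / (t + h)^2))"
 have cC: "continuous_on {0..2} C1" "continuous_on {0..2} C2" "continuous_on {0..2} C3"
  "continuous_on {0..2} C4" "continuous_on {0..2} C5" "continuous_on {0..2} C6"
  unfolding C1_def C2_def C3_def C4_def C5_def C6_def
  by (intro continuous_intros cy cu; use h in force)+
 define e where "e t = (N * Ga * th^2) * C1 t + (N * Gb * (4 * B * th^3)) * C3 t + (2 * B^2 * h * N) * C4 t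
   + (N * B * th^10 * Ra) * C1 t + (2 * N * B * th^12 * Rb) * C2 t + (B * th^8) * C5 t + (B^3 * th^12 * N) * C6 t" for t
 have ce: "continuous_on {0..2} e" unfolding e_def by (intro continuous_intros cC)
 have Ee: "cmod (E t) \<le> e t" if t: "t \<in> {0..2}" for t
 proof -
  have ut: "cmod (u t) \<le> sqrt t * N" "cmod (u t) \<le> sqrt (2 - t) * N" using u_bound_left[OF t] u_bound_right[OF t] .
  have th0: "t + h > 0" using t h by simp
  have iv0: "iv t > 0" "iv t \<le> B / (t + h)" "(iv t)^2 \<le> B^2 / (t + h)^2"
   using Vh_pos[OF t] inv_Vh[OF t] inv_Vh2[OF t] by (auto simp: iv_def power_divide)
  have ivu: "iv t * cmod (u t) \<le> B * N * (sqrt t / (t + h))"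
  proof -
   have "iv t * cmod (u t) \<le> B / (t + h) * (sqrt t * N)" by (intro mult_mono iv0 ut) (use iv0 B0 th0 in auto)
   then show ?thesis by (simp add: mult_ac)
  qed
  \<comment> \<open>\<open>u\<close> vanishes like a square root at both ends, so each layer is
    paired with the bound from its own end. This gains \<open>sqrt h = th^2\<close> at the wall and
    a multiple of \<open>th^3\<close> at the layer of width \<open>th^6\<close>.\<close>
  have t1: "cmod (om t * cnj (u t)) \<le> (N * Ga * th^2) * C1 t + (N * Gb * (4 * B * th^3)) * C3 t"
  proof -
   have sh: "sqrt h = th^2" using th real_sqrt_unique[of "th^2" h] by (simp add: h_def flip: power_mult)
   have "cmod (om t * cnj (u t)) \<le> (Ga * exp (- (2 * t / h)) + Gb * exp (- (\<kappa> * (2 - t)))) * cmod (u t)"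
    unfolding norm_mult complex_mod_cnj by (intro mult_right_mono omb t) simp
   also have "\<dots> = Ga * exp (- (2 * t / h)) * cmod (u t) + Gb * exp (- (\<kappa> * (2 - t))) * cmod (u t)" by (simp add: distrib_right)
   also have "\<dots> \<le> Ga * exp (- (2 * t / h)) * (sqrt t * N) + Gb * exp (- (\<kappa> * (2 - t))) * (sqrt (2 - t) * N)"
    by (intro add_mono mult_left_mono ut) (use nn in auto)
   also have "\<dots> = N * Ga * (sqrt t * exp (- (2 * t / h))) + N * Gb * (sqrt (2 - t) * exp (- (\<kappa> * (2 - t))))" by (simp add: mult_ac)
   also have "\<dots> \<le> N * Ga * (sqrt h * exp (- (t / h))) + N * Gb * (2 / sqrt \<kappa> * exp (- (\<kappa> / 2 * (2 - t))))"
    by (intro add_mono mult_left_mono sqrt_times_exp_le sqrt_times_exp_le') (use t h kap0 N0 nn in auto)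
   also have "\<dots> \<le> N * Ga * (sqrt h * exp (- (t / h))) + N * Gb * ((4 * B * th^3) * exp (- (\<kappa> / 2 * (2 - t))))"
    using kap0(3) N0 nn by (intro add_mono mult_left_mono mult_right_mono order_refl) auto
   finally show ?thesis by (simp add: C1_def C3_def sh mult_ac)
  qed
  have t2: "cmod (of_real (h * iv t) * (1 - \<i> * nu) * y t * cnj (u t)) \<le> (2 * B^2 * h * N) * C4 t"
  proof -
   have "cmod (1 - \<i> * nu) \<le> 2 * B" using norm_triangle_ineq4[of 1 "\<i> * nu"] nuB B1 by (simp add: norm_mult)
   then have "(h * cmod (y t)) * ((iv t * cmod (u t)) * cmod (1 - \<i> * nu)) \<le> (h * cmod (y t)) * ((B * N * (sqrt t / (t + h))) * (2 * B))"
    by (intro mult_left_mono mult_mono ivu) (use iv0 h B0 N0 t in auto)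
   then show ?thesis using iv0 h by (simp add: norm_mult C4_def power2_eq_square mult_ac)
  qed
  have g: "cmod \<gamma> = th^12" using th by (simp add: \<gamma>_def norm_mult norm_power)
  have t3: "cmod (\<gamma> * r t * (iv t *\<^sub>R cnj (u t))) \<le> (N * B * th^10 * Ra) * C1 t + (2 * N * B * th^12 * Rb) * C2 t"
  proof -
   \<comment> \<open>The first bound is the inequality of arithmetic and geometric means for
     \<open>t\<close> and \<open>h = th^4\<close>. The second uses the factor \<open>t\<close> that
     the residual of the right layer carries.\<close>
   have w: "sqrt t / (t + h) \<le> 1 / th^2" "t * (sqrt t / (t + h)) \<le> 2"
   proof -
    have "sqrt t * th^2 \<le> t + h"
    proof -
     have "(sqrt t - th^2)^2 \<ge> 0" by simp
     then have "2 * (sqrt t * th^2) \<le> t + h" using t by (simp add: power2_diff h_def flip: power_mult)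
     moreover have "sqrt t * th^2 \<ge> 0" using t by simp
     ultimately show ?thesis by linarith
    qed
    then show "sqrt t / (t + h) \<le> 1 / th^2" using th0 th by (simp add: field_simps)
    have "t * sqrt t \<le> (t + h) * 2"
     by (intro mult_mono) (use t h real_sqrt_le_mono[of t 4] in auto)
    then show "t * (sqrt t / (t + h)) \<le> 2" using th0 by (simp add: field_simps)
   qed
   have "cmod (\<gamma> * r t * (iv t *\<^sub>R cnj (u t))) = th^12 * cmod (r t) * (iv t * cmod (u t))"
    using iv0 by (simp add: norm_mult g)
   also have "\<dots> \<le> th^12 * (Ra * C1 t + Rb * t * C2 t) * (B * N * (sqrt t / (t + h)))"
   proof -
    have "Ra * C1 t + Rb * t * C2 t \<ge> 0" using nn t by (auto simp: C1_def C2_def)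
    then have "cmod (r t) * (iv t * cmod (u t)) \<le> (Ra * C1 t + Rb * t * C2 t) * (B * N * (sqrt t / (t + h)))"
     by (intro mult_mono[OF _ ivu]) (use rb[OF t] iv0 in \<open>auto simp: C1_def C2_def\<close>)
    moreover have "0 \<le> th^12" using th by simp
    ultimately show ?thesis unfolding mult.assoc by (rule mult_left_mono)
   qed
   also have "\<dots> = th^12 * B * N * (Ra * C1 t * (sqrt t / (t + h)) + Rb * C2 t * (t * (sqrt t / (t + h))))" by (simp add: algebra_simps)
   also have "\<dots> \<le> th^12 * B * N * (Ra * C1 t * (1 / th^2) + Rb * C2 t * 2)"
    by (intro mult_left_mono add_mono w) (use nn th B0 N0 in \<open>auto simp: C1_def C2_def\<close>)
   also have "\<dots> = (th^12 * (1 / th^2)) * (B * N * Ra * C1 t) + th^12 * B * N * Rb * C2 t * 2" by (simp add: algebra_simps)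
   also have "th^12 * (1 / th^2) = th^10" using th by (simp add: field_simps flip: power_add)
   finally show ?thesis by (simp add: mult_ac)
  qed
  have t4: "cmod (\<gamma> * y1 t * G t) \<le> (B * th^8) * C5 t + (B^3 * th^12 * N) * C6 t"
  proof -
   have "cmod (G t) \<le> \<bar>iv' t\<bar> * cmod (u t) + iv t * cmod (u1 t)"
    unfolding G_def using norm_triangle_ineq[of "iv' t *\<^sub>R cnj (u t)" "iv t *\<^sub>R cnj (u1 t)"] iv0 by simp
   also have "\<dots> \<le> B^3 * N * (sqrt t / (t + h)^2) + B / th^4 * cmod (u1 t)"
   proof (rule add_mono)
    have "\<bar>iv' t\<bar> \<le> B * (B^2 / (t + h)^2)"
     unfolding iv'_def abs_mult abs_minus_cancel by (intro mult_mono) (use V1b[OF t] iv0 B0 in auto)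
    then have "\<bar>iv' t\<bar> * cmod (u t) \<le> B * (B^2 / (t + h)^2) * (sqrt t * N)"
     by (intro mult_mono ut) (use B0 in auto)
    then show "\<bar>iv' t\<bar> * cmod (u t) \<le> B^3 * N * (sqrt t / (t + h)^2)" by (simp add: power2_eq_square power3_eq_cube mult_ac)
    have "B / (t + h) \<le> B / th^4" using t B0 th th0 by (intro divide_left_mono) (auto simp: h_def intro!: mult_pos_pos)
    then have "iv t \<le> B / th^4" using iv0 by linarith
    then show "iv t * cmod (u1 t) \<le> B / th^4 * cmod (u1 t)" by (rule mult_right_mono) simp
   qed
   finally have "th^12 * cmod (y1 t) * cmod (G t) \<le> th^12 * cmod (y1 t) * (B^3 * N * (sqrt t / (t + h)^2) + B / th^4 * cmod (u1 t))"
    using th by (intro mult_left_mono) auto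
   also have "\<dots> = (B^3 * th^12 * N) * C6 t + (th^12 / th^4) * (B * C5 t)"
    by (simp add: C5_def C6_def algebra_simps)
   also have "th^12 / th^4 = th^8" using th by (simp add: field_simps flip: power_add)
   finally show ?thesis by (simp add: norm_mult g mult_ac)
  qed
  have "cmod (E t) \<le> cmod (om t * cnj (u t)) + cmod (of_real (h * iv t) * (1 - \<i> * nu) * y t * cnj (u t))
    + cmod (\<gamma> * r t * (iv t *\<^sub>R cnj (u t))) + cmod (\<gamma> * y1 t * G t)"
   unfolding E_def by (intro order_trans[OF norm_triangle_ineq4] add_mono order_trans[OF norm_triangle_ineq] order_refl)
  then show ?thesis using t1 t2 t3 t4 unfolding e_def by linarith
 qed
 define S where "S = th^8 * Y + th^6 * Ga + th^9 * Gb + th^14 * Ra + th^18 * Rb"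
 have ie: "integral {0..2} e \<le> 16 * B^3 * N * S"
 proof -
  have "integral {0..2} e = (N * Ga * th^2) * integral {0..2} C1 + (N * Gb * (4 * B * th^3)) * integral {0..2} C3 + (2 * B^2 * h * N) * integral {0..2} C4
   + (N * B * th^10 * Ra) * integral {0..2} C1 + (2 * N * B * th^12 * Rb) * integral {0..2} C2 + (B * th^8) * integral {0..2} C5 + (B^3 * th^12 * N) * integral {0..2} C6"
   unfolding e_def
   by (intro integral_unique has_integral_add has_integral_mult_right integrable_integral integrable_continuous_real cC)
  also have "\<dots> \<le> (N * Ga * th^2) * th^4 + (N * Gb * (4 * B * th^3)) * (4 * B * th^6) + (2 * B^2 * h * N) * (th^4 * Y)
   + (N * B * th^10 * Ra) * th^4 + (2 * N * B * th^12 * Rb) * (2 * B * th^6) + (B * th^8) * (Y * N) + (B^3 * th^12 * N) * (Y / th^4)"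
  proof (intro add_mono mult_left_mono)
   show "integral {0..2} C3 \<le> 4 * B * th^6"
    using integral_exp_neg_right_le[of "\<kappa> / 2"] kap0 by (simp add: C3_def)
  qed (use int_exp_h int_exp_kap y_sqrt_weight y1_u1 y1_weight N0 nn B0 th h in \<open>auto simp: C1_def C2_def C4_def C5_def C6_def\<close>)
  also have "\<dots> = 1 * N * (th^6 * Ga) + 16 * B^2 * N * (th^9 * Gb) + (2 * B^2 + B + B^3) * N * (th^8 * Y) + B * N * (th^14 * Ra) + 4 * B^2 * N * (th^18 * Rb)"
  proof -
   have "th^12 * (Y / th^4) = th^8 * Y" using th by (simp add: field_simps flip: power_add)
   then have "(B^3 * th^12 * N) * (Y / th^4) = B^3 * N * (th^8 * Y)" by (metis mult.assoc mult.commute)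
   then show ?thesis by (simp add: h_def power2_eq_square[of B] algebra_simps flip: power_add)
  qed
  also have "\<dots> \<le> 16 * B^3 * N * (th^6 * Ga) + 16 * B^3 * N * (th^9 * Gb) + 16 * B^3 * N * (th^8 * Y) + 16 * B^3 * N * (th^14 * Ra) + 16 * B^3 * N * (th^18 * Rb)"
  proof -
   have b: "1 \<le> B^3" "B \<le> B^3" "B^2 \<le> B^3"
    using B1 power_increasing[of 1 3 B] power_increasing[of 2 3 B] by (auto simp: one_le_power)
   then show ?thesis using N0 nn Y0 th by (intro add_mono mult_right_mono) auto
  qed
  finally show ?thesis by (simp add: S_def algebra_simps)
 qed
 have "Q \<le> integral {0..2} q" unfolding Q_def
 proof (rule integral_mono_continuous[OF _ cq])
  show "continuous_on {0..2} (\<lambda>t. (cmod (u1 t))^2 + V2 t / (V t + h) * (cmod (u t))^2)"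
   by (intro continuous_intros cu cV cV2) (use Vh_pos in force)
 qed (simp add: q_def)
 also have "integral {0..2} q \<le> cmod (integral {0..2} E)"
 proof -
  have "of_real (integral {0..2} q) = integral {0..2} (\<lambda>t. of_real (q t) :: complex)"
   by (intro integral_unique[symmetric] has_integral_of_real integrable_integral integrable_continuous_real cq)
  also have "\<dots> = integral {0..2} (\<lambda>t. F2' t - \<gamma> * F1' t - E t)"
   by (rule Henstock_Kurzweil_Integration.integral_cong) (rule eq)
  also have "\<dots> = integral {0..2} F2' - \<gamma> * integral {0..2} F1' - integral {0..2} E"
   by (intro integral_unique has_integral_diff has_integral_mult_right integrable_integral integrable_continuous_real cF cE)
  finally have "of_real (integral {0..2} q) = - integral {0..2} E" using I1 I2 by simp
  then have "\<bar>integral {0..2} q\<bar> = cmod (integral {0..2} E)" by (metis norm_minus_cancel norm_of_real)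
  then show ?thesis by linarith
 qed
 also have "\<dots> \<le> integral {0..2} e" by (rule integral_norm_le_continuous[OF cE ce Ee])
 finally have "Q \<le> 16 * B^3 * N * S" using ie by linarith
 then have "9 * B^4 * Q \<le> 9 * B^4 * (16 * B^3 * N * S)" using B0 by (intro mult_left_mono) auto
 then have "N^2 \<le> 9 * B^4 * (16 * B^3 * N * S)" using coercive by linarith
 also have "\<dots> = (144 * B^7 * S) * N" by (simp add: mult_ac flip: power_add)
 finally have "N * N \<le> (144 * B^7 * S) * N" by (simp add: power2_eq_square)
 moreover have "S \<ge> 0" using nn Y0 th by (simp add: S_def)
 ultimately have "N \<le> 144 * B^7 * S" using N0 B0 by (cases "N = 0") auto
 then show ?thesis by (simp add: S_def)
qed

end

context os_layer
begin

text \<open>Testing the equation for \<open>y\<close> against \<open>hat\<close> isolates \<open>y' 0\<close>.\<close>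

lemma y1_0_bound: "cmod (y1 0) \<le> 3 * B^3 * (th^2 * Y + N / th^6 + th^4 * Ra + th^8 * Rb)"
proof -
 define P where "P t = hat_res t * y t - (\<i> * of_real (V2 t / th^12) * u t + r t) * hat t" for t
 have cW: "continuous_on {0..2} hat" "continuous_on {0..2} Wh1"
  unfolding continuous_on_eq_continuous_within using dhat dWh1 has_vector_derivative_continuous by blast+
 have cP: "continuous_on {0..2} P" unfolding P_def hat_res_def
  by (intro continuous_intros cW cV cV2 cy cu cr) (use th in auto)
 \<comment> \<open>\<open>P\<close> is the derivative of the Wronskian of \<open>y\<close> and
   \<open>hat\<close>. Both functions vanish at 2 and \<open>y\<close> vanishes at 0, so only
   \<open>y1 0 * hat 0\<close> survives.\<close>
 have "integral {0..2} P = (y1 2 * hat 2 - y 2 * hat1 2) - (y1 0 * hat 0 - y 0 * hat1 0)"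
 proof (rule vector_FTC)
  fix t :: real assume t: "t \<in> {0..2}"
  have "((\<lambda>t. y1 t * hat t - y t * hat1 t) has_vector_derivative (y1 t * hat1 t + y2 t * hat t) - (y t * (pp t * hat t - hat_res t) + y1 t * hat1 t)) (at t within {0..2})"
   by (intro has_vector_derivative_diff has_vector_derivative_mult dy dy2 dhat dhat1 t)
  then show "((\<lambda>t. y1 t * hat t - y t * hat1 t) has_vector_derivative P t) (at t within {0..2})"
   by (simp add: P_def y2_def algebra_simps)
 qed simp
 then have IP: "integral {0..2} P = - (y1 0 * tairy nu)" using y0 y2 by (simp add: hat_def Wh_def)
 define C1 C2 where "C1 = (\<lambda>t. cmod (y t) * exp (- (t / h)))" and "C2 = (\<lambda>t. exp (- (t / h)))"
 have cC: "continuous_on {0..2} C1" "continuous_on {0..2} C2" unfolding C1_def C2_def by (intro continuous_intros cy; use h in force)+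
 define e where "e t = (3 * B^2 / th^4) * C1 t + (B^2 * N / th^10 + B * Ra + B * Rb * th^4) * C2 t" for t
 have ce: "continuous_on {0..2} e" unfolding e_def by (intro continuous_intros cC)
 have Pe: "cmod (P t) \<le> e t" if t: "t \<in> {0..2}" for t
 proof -
  have ee: "exp (- (2 * t / h)) \<le> exp (- (t / h))" using t h by (simp add: divide_right_mono)
  have sh: "sqrt h = th^2" using th real_sqrt_unique[of "th^2" h] by (simp add: h_def flip: power_mult)
  have 2: "cmod ((\<i> * of_real (V2 t / th^12) * u t + r t) * hat t) \<le> (B^2 * N / th^10 + B * Ra + B * Rb * th^4) * exp (- (t / h))"
  proof -
   have "cmod (\<i> * of_real (V2 t / th^12) * u t + r t) \<le> B / th^12 * (sqrt t * N) + (Ra + Rb * t)"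
    using V2u_bound[OF t] r_bound[OF t] norm_triangle_ineq[of "\<i> * of_real (V2 t / th^12) * u t" "r t"] by linarith
   then have "cmod ((\<i> * of_real (V2 t / th^12) * u t + r t) * hat t) \<le> (B / th^12 * (sqrt t * N) + (Ra + Rb * t)) * (B * exp (- (2 * t / h)))"
    unfolding norm_mult by (intro mult_mono hat_bound t) (use nn th N0 B0 t in \<open>auto intro!: add_nonneg_nonneg\<close>)
   also have "\<dots> = (B^2 * N / th^12) * (sqrt t * exp (- (2 * t / h))) + B * Ra * exp (- (2 * t / h)) + B * Rb * (t * exp (- (2 * t / h)))"
    by (simp add: power2_eq_square algebra_simps)
   also have "\<dots> \<le> (B^2 * N / th^12) * (sqrt h * exp (- (t / h))) + B * Ra * exp (- (t / h)) + B * Rb * (h * exp (- (t / h)))"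
    by (intro add_mono mult_left_mono sqrt_times_exp_le mult_exp_le ee) (use t h nn B0 N0 th in auto)
   also have "\<dots> = ((B^2 * N / th^12) * th^2 + B * Ra + B * Rb * th^4) * exp (- (t / h))" unfolding sh by (simp add: h_def algebra_simps)
   also have "(B^2 * N / th^12) * th^2 = B^2 * N / th^10" using th by (simp add: field_simps flip: power_add)
   finally show ?thesis .
  qed
  have "cmod (P t) \<le> cmod (hat_res t) * cmod (y t) + cmod ((\<i> * of_real (V2 t / th^12) * u t + r t) * hat t)"
   unfolding P_def norm_mult[symmetric] by (rule norm_triangle_ineq4)
  also have "\<dots> \<le> (3 * B^2 / th^4 * exp (- (t / h))) * cmod (y t) + (B^2 * N / th^10 + B * Ra + B * Rb * th^4) * exp (- (t / h))"
   by (intro add_mono mult_right_mono hat_res_bound t 2) simp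
  finally show ?thesis by (simp add: e_def C1_def C2_def mult_ac)
 qed
 have "1 / B * cmod (y1 0) \<le> cmod (tairy nu) * cmod (y1 0)" using Wlow by (intro mult_right_mono) auto
 also have "\<dots> = cmod (integral {0..2} P)" by (simp add: IP norm_mult mult.commute)
 also have "\<dots> \<le> integral {0..2} e" by (rule integral_norm_le_continuous[OF cP ce Pe])
 also have "\<dots> = (3 * B^2 / th^4) * integral {0..2} C1 + (B^2 * N / th^10 + B * Ra + B * Rb * th^4) * integral {0..2} C2"
  unfolding e_def by (intro integral_unique has_integral_add has_integral_mult_right integrable_integral integrable_continuous_real cC)
 also have "\<dots> \<le> (3 * B^2 / th^4) * (th^6 * Y) + (B^2 * N / th^10 + B * Ra + B * Rb * th^4) * th^4"
  by (intro add_mono mult_left_mono) (use y_exp int_exp_h th nn N0 B0 in \<open>auto simp: C1_def C2_def intro!: add_nonneg_nonneg\<close>)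
 also have "\<dots> = 3 * B^2 * (th^2 * Y) + B^2 * (N / th^6) + B * (th^4 * Ra) + B * (th^8 * Rb)"
  using th by (simp add: field_simps flip: power_add)
 also have "\<dots> \<le> 3 * B^2 * (th^2 * Y) + 3 * B^2 * (N / th^6) + 3 * B^2 * (th^4 * Ra) + 3 * B^2 * (th^8 * Rb)"
 proof -
  have "B * 1 \<le> B * B" using B1 by (intro mult_left_mono) auto
  then have "B \<le> 3 * B^2" unfolding power2_eq_square using B0 by linarith
  then show ?thesis using th nn N0 Y0 by (intro add_mono mult_right_mono) auto
 qed
 finally have "1 / B * cmod (y1 0) \<le> 3 * B^2 * (th^2 * Y + N / th^6 + th^4 * Ra + th^8 * Rb)" by (simp only: distrib_left)
 then have "B * (1 / B * cmod (y1 0)) \<le> B * (3 * B^2 * (th^2 * Y + N / th^6 + th^4 * Ra + th^8 * Rb))"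
  using B0 by (intro mult_left_mono) auto
 then show ?thesis using B0 by (simp add: power3_eq_cube power2_eq_square mult_ac)
qed

text \<open>Within \<open>layer_S B\<close> layer widths the potential is at most
  \<open>B * (layer_S B + 1) / h^2\<close>, so the Gronwall exponent does not depend on
  \<open>th\<close>. The initial slope comes from \<open>y1_0_bound\<close>.\<close>

lemma layer_sup:
 assumes sm: "layer_S B * h \<le> 2" and t: "t \<in> {0..layer_S B * h}"
 shows "cmod (y t) \<le> layer_K B * (th^6 * Y + N / th^2 + th^8 * Ra + th^12 * Rb)"
proof -
 define S where "S = layer_S B"
 define T where "T = S * h"
 have B2: "B^2 \<ge> 1" using B1 by (simp add: one_le_power)
 have S1: "S \<ge> 1" using B2 by (simp add: S_def layer_S_def)
 have T: "0 \<le> T" "T \<le> 2" using sm S1 h by (auto simp: T_def S_def)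
 have sub: "{0..T} \<subseteq> {0..2}" using T by auto
 define k where "k = B * (S + 1) / th^8"
 define f where "f = B * S * N / th^10 + Ra + S * th^4 * Rb"
 define Z where "Z = th^6 * Y + N / th^2 + th^8 * Ra + th^12 * Rb"
 have f0: "f \<ge> 0" unfolding f_def using th B0 S1 N0 nn by (intro add_nonneg_nonneg) auto
 have k0: "k \<ge> 0" using B0 S1 th by (simp add: k_def)
 have "cmod (y t) \<le> (T * cmod (y1 0) + T^2 * f) * exp (k * T * T)"
 proof (rule second_order_gronwall[of T y y1 y2 k f])
  fix t assume t: "t \<in> {0..T}"
  then have t2: "t \<in> {0..2}" using sub by auto
  show "(y has_vector_derivative y1 t) (at t within {0..T})"
   by (rule has_vector_derivative_within_subset[OF dy[OF t2] sub])
  show "(y1 has_vector_derivative y2 t) (at t within {0..T})"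
   by (rule has_vector_derivative_within_subset[OF dy2[OF t2] sub])
  have p: "cmod (pp t) \<le> k"
  proof -
   have "V t \<ge> 0" using Vlow[OF t2] t2 B0 by (meson atLeastAtMost_iff divide_nonneg_pos order_trans)
   then have "cmod (\<i> * of_real (V t / th^12)) = V t / th^12" using th by (simp only: norm_mult norm_of_real) simp
   also have "\<dots> \<le> (B * (S * th^4)) / th^12"
   proof (rule divide_right_mono)
    have "B * t \<le> B * (S * th^4)" using t B0 by (intro mult_left_mono) (auto simp: T_def h_def)
    then show "V t \<le> B * (S * th^4)" using Vup[OF t2] by linarith
   qed (use th in auto)
   also have "\<dots> = B * S / th^8" using th by (simp add: field_simps flip: power_add)
   finally have a: "cmod (\<i> * of_real (V t / th^12)) \<le> B * S / th^8" .
   have "cmod (nu / of_real (th^8)) = cmod nu / th^8" using th by (simp add: norm_divide norm_power)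
   also have "\<dots> \<le> B / th^8" using nuB th by (intro divide_right_mono) auto
   finally have b: "cmod (nu / of_real (th^8)) \<le> B / th^8" .
   have "k = B * S / th^8 + B / th^8" by (simp add: k_def add_divide_distrib distrib_left)
   then show ?thesis unfolding pp_def using a b norm_triangle_ineq4[of "\<i> * of_real (V t / th^12)" "nu / of_real (th^8)"] by linarith
  qed
  have q: "cmod (\<i> * of_real (V2 t / th^12) * u t) \<le> B * S * N / th^10"
  proof -
   have "sqrt t \<le> sqrt ((S * th^2)^2)"
   proof (rule real_sqrt_le_mono)
    have "S * h * 1 \<le> S * h * S" using S1 h by (intro mult_left_mono) auto
    then show "t \<le> (S * th^2)^2" using t by (simp add: T_def h_def power_mult_distrib power2_eq_square[of S] mult_ac flip: power_mult)
   qed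
   then have st: "sqrt t \<le> S * th^2" using S1 by simp
   have "cmod (\<i> * of_real (V2 t / th^12) * u t) \<le> B / th^12 * (sqrt t * N)" by (rule V2u_bound[OF t2])
   also have "\<dots> \<le> B / th^12 * (S * th^2 * N)" using st N0 B0 th by (intro mult_left_mono mult_right_mono) auto
   also have "\<dots> = B * S * N / th^10" using th by (simp add: field_simps flip: power_add)
   finally show ?thesis .
  qed
  have "Rb * t \<le> S * th^4 * Rb" using t nn by (auto simp: T_def h_def mult.commute intro!: mult_left_mono)
  then have rr: "cmod (r t) \<le> Ra + S * th^4 * Rb" using r_bound[OF t2] by simp
  have "cmod (y2 t) \<le> cmod (pp t * y t) + cmod (\<i> * of_real (V2 t / th^12) * u t) + cmod (r t)"
   unfolding y2_def by (rule order_trans[OF norm_triangle_ineq4 add_right_mono[OF norm_triangle_ineq4]])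
  also have "cmod (pp t * y t) \<le> k * cmod (y t)"
   unfolding norm_mult[of _ "y t"] by (rule mult_right_mono[OF p]) simp
  finally show "cmod (y2 t) \<le> k * cmod (y t) + f" using q rr unfolding f_def by linarith
 qed (use t f0 k0 T y0 continuous_on_subset[OF cy(3) sub] in \<open>auto simp: T_def S_def\<close>)
 also have "exp (k * T * T) = exp (B * (S + 1) * S^2)"
 proof -
  have "k * T * T = B * (S + 1) * S^2"
   using th by (simp add: k_def T_def h_def field_simps power2_eq_square[of S] flip: power_add)
  then show ?thesis by simp
 qed
 also have "(T * cmod (y1 0) + T^2 * f) * exp (B * (S + 1) * S^2) \<le> (4 * B^3 * S^3 * Z) * exp (B * (S + 1) * S^2)"
 proof (rule mult_right_mono)
  have S3: "S \<le> S^3" "S^2 \<le> S^3" using S1 power_increasing[of 1 3 S] power_increasing[of 2 3 S] by auto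
  have B3: "B \<le> B^3" "1 \<le> B^3" using B1 power_increasing[of 1 3 B] by (auto simp: one_le_power)
  have "T * cmod (y1 0) \<le> T * (3 * B^3 * (th^2 * Y + N / th^6 + th^4 * Ra + th^8 * Rb))"
   by (intro mult_left_mono y1_0_bound T)
  also have "\<dots> = 3 * B^3 * S * Z" using th by (simp add: T_def h_def Z_def field_simps flip: power_add)
  also have "\<dots> \<le> 3 * B^3 * S^3 * Z"
   using S3 B0 th Y0 N0 nn by (intro mult_right_mono mult_left_mono) (auto simp: Z_def intro!: add_nonneg_nonneg)
  finally have 1: "T * cmod (y1 0) \<le> 3 * B^3 * S^3 * Z" .
  have "T^2 * f = B * (S^2 * S) * (N / th^2) + S^2 * (th^8 * Ra) + (S^2 * S) * (th^12 * Rb)"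
   using th by (simp add: T_def h_def f_def power_mult_distrib field_simps flip: power_add power_mult)
  also have "\<dots> \<le> B^3 * S^3 * (N / th^2) + B^3 * S^3 * (th^8 * Ra) + B^3 * S^3 * (th^12 * Rb)"
  proof -
   have s3: "S^2 * S = S^3" by (simp add: power3_eq_cube power2_eq_square)
   have "S^2 \<le> B^3 * S^3" using mult_mono[OF B3(2) S3(2)] B0 by simp
   then have 1: "S^2 * (th^8 * Ra) \<le> B^3 * S^3 * (th^8 * Ra)" by (rule mult_right_mono) (use nn th in auto)
   have "S^3 \<le> B^3 * S^3" using mult_right_mono[OF B3(2), of "S^3"] S1 by simp
   then have 2: "S^3 * (th^12 * Rb) \<le> B^3 * S^3 * (th^12 * Rb)" by (rule mult_right_mono) (use nn th in auto)
   have "B * S^3 \<le> B^3 * S^3" by (intro mult_mono) (use S3 B3 S1 B0 in auto)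
   then have 3: "B * S^3 * (N / th^2) \<le> B^3 * S^3 * (N / th^2)" by (rule mult_right_mono) (use N0 th in auto)
   show ?thesis unfolding s3 by (intro add_mono 1 2 3)
  qed
  also have "\<dots> \<le> B^3 * S^3 * Z"
  proof -
   have "B^3 * S^3 * (th^6 * Y) \<ge> 0" using B0 S1 th Y0 by simp
   then show ?thesis by (simp add: Z_def distrib_left)
  qed
  finally show "T * cmod (y1 0) + T^2 * f \<le> 4 * B^3 * S^3 * Z" using 1 by linarith
 qed simp
 finally show ?thesis by (simp add: layer_K_def S_def Z_def mult_ac)
qed

end

definition solve_K :: "real \<Rightarrow> real" where "solve_K B = 288 * B^7 * (energy_K B + 1)"

text \<open>The three conditions, in order: the near-wall region fits into the interval; the
  near-wall contribution absorbs into half of \<open>Y^2\<close>; the loop between the estimates for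
  \<open>N\<close> and \<open>Y\<close> absorbs into half of \<open>N\<close>.\<close>

definition small_at :: "real \<Rightarrow> real \<Rightarrow> bool" where
 "small_at B th \<longleftrightarrow> layer_S B * th^4 \<le> 2 \<and> 24 * B^2 * exp (layer_S B) * (layer_K B)^2 * th^8 \<le> 1
   \<and> 288 * B^7 * energy_K B * th^2 \<le> 1"

lemma energy_K_ge1: "B \<ge> 1 \<Longrightarrow> energy_K B \<ge> 1"
 unfolding energy_K_def by (auto intro!: add_nonneg_nonneg mult_nonneg_nonneg)

lemma Re_one_minus_i: "Re ((1 - \<i>) * z) = Re z + Im z" by simp

context os_layer
begin

text \<open>The factor \<open>1 - \<i>\<close> makes the real part of the potential \<open>\<i> * V / th^12\<close> positive.  The term in \<open>nu\<close> is absorbed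
 outside a bounded number of layer widths; inside, \<open>layer_sup\<close> bounds \<open>y\<close> by the initial slope.\<close>

lemma estimate_Y:
 assumes sm: "layer_S B * h \<le> 2" "24 * B^2 * exp (layer_S B) * (layer_K B)^2 * th^8 \<le> 1"
 shows "Y \<le> energy_K B * (N / th^6 + th^6 * Ra + th^9 * Rb)"
proof -
 define S where "S = layer_S B"
 define X where "X = N / th^6 + th^6 * Ra + th^9 * Rb"
 define L where "L = layer_K B * (th^6 * Y + N / th^2 + th^8 * Ra + th^12 * Rb)"
 have B2: "B^2 \<ge> 1" using B1 by (simp add: one_le_power)
 have S1: "S = 5 * B^2" "S \<ge> 5" using B2 by (simp_all add: S_def layer_S_def)
 have K0: "layer_K B \<ge> 0" using B0 S1 by (simp add: layer_K_def S_def[symmetric])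
 have X0: "X \<ge> 0" using N0 nn th by (simp add: X_def)
 have L0: "L \<ge> 0" unfolding L_def using K0 N0 nn th Y0 by (intro mult_nonneg_nonneg add_nonneg_nonneg) auto
 define C1 C2 C3 C4 where "C1 = (\<lambda>t. cmod (y t) * sqrt t)" and "C2 = (\<lambda>t. cmod (y t) * exp (- (t / h)))"
  and "C3 = (\<lambda>t. cmod (y t) * (t * exp (- (\<kappa> * (2 - t)))))" and "C4 = (\<lambda>t. exp (- (t / h)))"
 have cC: "continuous_on {0..2} C1" "continuous_on {0..2} C2" "continuous_on {0..2} C3" "continuous_on {0..2} C4"
  unfolding C1_def C2_def C3_def C4_def by (intro continuous_intros cy; use h in force)+
 define C5 C6 where "C5 = (\<lambda>t. (cmod (y1 t))^2)" and "C6 = (\<lambda>t. (t + h) * (cmod (y t))^2)"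
 have cC': "continuous_on {0..2} C5" "continuous_on {0..2} C6" unfolding C5_def C6_def by (intro continuous_intros cy)+
 define F where "F t = y2 t * cnj (y t) + y1 t * cnj (y1 t)" for t
 have cF: "continuous_on {0..2} F" unfolding F_def by (intro continuous_intros cy)
 have IF: "integral {0..2} F = 0"
 proof -
  have "integral {0..2} F = y1 2 * cnj (y 2) - y1 0 * cnj (y 0)"
  proof (rule vector_FTC)
   fix t :: real assume t: "t \<in> {0..2}"
   from has_vector_derivative_mult[OF dy2[OF t] has_vector_derivative_cnj[OF dy[OF t]]]
   show "((\<lambda>t. y1 t * cnj (y t)) has_vector_derivative F t) (at t within {0..2})" by (simp add: F_def add.commute)
  qed simp
  then show ?thesis using y0 y2 by simp
 qed
 define m where "m t = C5 t + (1 / (2 * B * th^12)) * C6 t - (3 * B * L^2 * exp S / th^8) * C4 t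
   - ((2 * B * N / th^12) * C1 t + (2 * Ra) * C2 t + (2 * Rb) * C3 t)" for t
 have cm: "continuous_on {0..2} m" unfolding m_def by (intro continuous_intros cC cC')
 have mF: "m t \<le> Re ((1 - \<i>) * F t)" if t: "t \<in> {0..2}" for t
 proof -
  define pr where "pr = V t / th^12 - (Re nu + Im nu) / th^8"
  define X1 where "X1 = \<i> * of_real (V2 t / th^12) * u t + r t"
  have F_eq: "F t = (\<i> * of_real (V t / th^12) - nu / of_real (th^8)) * of_real ((cmod (y t))^2) - X1 * cnj (y t) + of_real ((cmod (y1 t))^2)"
   unfolding F_def y2_def pp_def X1_def complex_norm_square by (simp only: ring_distribs mult.assoc)  (simp add: algebra_simps)
  have Rp: "Re ((1 - \<i>) * ((\<i> * of_real (V t / th^12) - nu / of_real (th^8)) * of_real x)) = pr * x" for x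
  proof -
   have d: "nu / of_real (th^8) = Complex (Re nu / th^8) (Im nu / th^8)"
    by (simp add: complex_eq_iff Re_divide_of_real Im_divide_of_real del: of_real_power)
   show ?thesis unfolding d Re_one_minus_i by (simp add: pr_def algebra_simps add_divide_distrib)
  qed
  have e1: "Re ((1 - \<i>) * F t) = pr * (cmod (y t))^2 - Re ((1 - \<i>) * (X1 * cnj (y t))) + (cmod (y1 t))^2"
   unfolding F_eq distrib_left right_diff_distrib[of "1 - \<i>"] plus_complex.sel minus_complex.sel Rp by simp
  have e2: "Re ((1 - \<i>) * (X1 * cnj (y t))) \<le> (2 * B * N / th^12) * C1 t + (2 * Ra) * C2 t + (2 * Rb) * C3 t"
  proof -
   have "Re ((1 - \<i>) * (X1 * cnj (y t))) \<le> cmod ((1 - \<i>) * (X1 * cnj (y t)))" by (rule complex_Re_le_cmod)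
   also have "\<dots> \<le> 2 * (cmod X1 * cmod (y t))"
   proof -
    have "cmod (1 - \<i>) \<le> 2" using norm_triangle_ineq4[of 1 \<i>] by simp
    then show ?thesis unfolding norm_mult complex_mod_cnj by (intro mult_right_mono) auto
   qed
   also have "cmod X1 \<le> B / th^12 * (sqrt t * N) + (Ra * exp (- (t / h)) + Rb * t * exp (- (\<kappa> * (2 - t))))"
   proof -
    show ?thesis unfolding X1_def using rb[OF t] V2u_bound[OF t] norm_triangle_ineq[of "\<i> * of_real (V2 t / th^12) * u t" "r t"] by linarith
   qed
   finally show ?thesis by (simp add: mult_right_mono C1_def C2_def C3_def algebra_simps)
  qed
  have e3: "pr * (cmod (y t))^2 \<ge> (1 / (2 * B * th^12)) * C6 t - (3 * B * L^2 * exp S / th^8) * C4 t"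
  proof -
   have nub: "Re nu + Im nu \<le> 2 * B" using nuB complex_Re_le_cmod[of nu] abs_Im_le_cmod[of nu] by linarith
   have ts: "t / B / th^12 = (t / h) / B / th^8" "(t + h) / (2 * B * th^12) = (t / h + 1) / (2 * B) / th^8"
    using th B0 by (simp_all add: h_def field_simps flip: power_add)
   have "pr \<ge> t / B / th^12 - 2 * B / th^8"
    unfolding pr_def using Vlow[OF t] nub th by (intro diff_mono divide_right_mono) auto
   then have pr: "pr - (t + h) / (2 * B * th^12) \<ge> ((t / h) / B - 2 * B - (t / h + 1) / (2 * B)) / th^8"
    unfolding ts by (simp add: diff_divide_distrib)
   \<comment> \<open>Beyond \<open>S\<close> layer widths the left side is nonnegative. Closer to
     the wall its coefficient is at worst \<open>- 3 * B / th^8\<close>, where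
     \<open>layer_sup\<close> bounds \<open>y\<close>; the factor
     \<open>exp S * exp (- (t / h)) \<ge> 1\<close> makes that bound an integrable function on the
     whole interval, with integral of order \<open>h\<close>.\<close>
   have "(pr - (t + h) / (2 * B * th^12)) * (cmod (y t))^2 \<ge> - ((3 * B * L^2 * exp S / th^8) * C4 t)"
   proof (cases "t / h \<ge> S")
    case True
    have "(t / h) / B - 2 * B - (t / h + 1) / (2 * B) = ((t / h) - 4 * B^2 - 1) / (2 * B)"
     using B0 by (simp add: field_simps power2_eq_square)
    also have "\<dots> \<ge> 0" using True S1 B2 B0 by simp
    finally have "(pr - (t + h) / (2 * B * th^12)) \<ge> 0" using pr th by (meson divide_nonneg_pos order_trans zero_less_power)
    moreover have "(3 * B * L^2 * exp S / th^8) * C4 t \<ge> 0" using B0 th by (simp add: C4_def)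
    ultimately show ?thesis by (smt (verit) mult_nonneg_nonneg zero_le_power2)
   next
    case False
    have yL: "cmod (y t) \<le> L" unfolding L_def
    proof (rule layer_sup[OF sm(1)])
     have "t / h < layer_S B" using False by (simp add: S_def)
     then have "t < layer_S B * h" using h by (simp add: divide_less_eq)
     then show "t \<in> {0..layer_S B * h}" using t by simp
    qed
    have tb: "t / h \<ge> 0" using t h by simp
    have "(t / h) / B - (t / h + 1) / (2 * B) = (t / h) / (2 * B) - 1 / (2 * B)" using B0 by (simp add: field_simps)
    moreover have "(t / h) / (2 * B) \<ge> 0" by (rule divide_nonneg_pos[OF tb]) (use B0 in simp)
    moreover have "1 / (2 * B) \<le> B" using B1 mult_mono[of 1 B 1 "2 * B"] by (simp add: divide_le_eq)
    ultimately have "(t / h) / B - 2 * B - (t / h + 1) / (2 * B) \<ge> - (3 * B)" by linarith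
    then have "((t / h) / B - 2 * B - (t / h + 1) / (2 * B)) / th^8 \<ge> - (3 * B) / th^8" using th by (intro divide_right_mono) auto
    then have p2: "pr - (t + h) / (2 * B * th^12) \<ge> - (3 * B / th^8)" using pr by simp
    have ex: "1 \<le> exp S * C4 t" using False by (simp add: C4_def exp_add[symmetric])
    have "(cmod (y t))^2 \<le> L^2 * (exp S * C4 t)"
    proof -
     have "(cmod (y t))^2 \<le> L^2 * 1" using power_mono[OF yL, of 2] by simp
     also have "\<dots> \<le> L^2 * (exp S * C4 t)" by (intro mult_left_mono ex) simp
     finally show ?thesis .
    qed
    then have "3 * B / th^8 * (cmod (y t))^2 \<le> 3 * B / th^8 * (L^2 * (exp S * C4 t))" using B0 th by (intro mult_left_mono) auto
    moreover have "- (3 * B / th^8) * (cmod (y t))^2 \<le> (pr - (t + h) / (2 * B * th^12)) * (cmod (y t))^2" using p2 by (intro mult_right_mono) auto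
    ultimately show ?thesis by (simp add: mult_ac)
   qed
   moreover have "(pr - (t + h) / (2 * B * th^12)) * (cmod (y t))^2 = pr * (cmod (y t))^2 - (1 / (2 * B * th^12)) * C6 t"
    by (simp add: C6_def left_diff_distrib)
   ultimately show ?thesis by linarith
  qed
  show ?thesis unfolding m_def e1 using e2 e3 by (simp add: C5_def)
 qed
 have "integral {0..2} m \<le> integral {0..2} (\<lambda>t. Re ((1 - \<i>) * F t))"
  by (intro integral_mono_continuous cm mF continuous_intros cF)
 also have "\<dots> = Re ((1 - \<i>) * integral {0..2} F)"
  by (intro integral_unique has_integral_Re has_integral_mult_right integrable_integral integrable_continuous_real cF)
 finally have m0: "integral {0..2} m \<le> 0" using IF by simp
 have meq: "integral {0..2} m = integral {0..2} C5 + (1 / (2 * B * th^12)) * integral {0..2} C6 - (3 * B * L^2 * exp S / th^8) * integral {0..2} C4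
   - ((2 * B * N / th^12) * integral {0..2} C1 + (2 * Ra) * integral {0..2} C2 + (2 * Rb) * integral {0..2} C3)"
  unfolding m_def
  by (intro integral_unique has_integral_add has_integral_diff has_integral_mult_right integrable_integral integrable_continuous_real cC cC')
 have I56: "integral {0..2} C5 = (L2n y1)^2" "integral {0..2} C6 = D" by (simp_all add: C5_def C6_def D_def L2n_sq cy)
 have ar: "a + b - c - d \<le> 0 \<Longrightarrow> a + b \<le> c + d" for a b c d :: real by simp
 have main: "(L2n y1)^2 + (1 / (2 * B * th^12)) * D \<le> (3 * B * L^2 * exp S / th^8) * integral {0..2} C4
   + ((2 * B * N / th^12) * integral {0..2} C1 + (2 * Ra) * integral {0..2} C2 + (2 * Rb) * integral {0..2} C3)"
  by (rule ar) (rule m0[unfolded meq I56])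
 also have "\<dots> \<le> (3 * B * L^2 * exp S / th^8) * th^4 + ((2 * B * N / th^12) * (th^6 * Y * 2) + (2 * Ra) * (th^6 * Y) + (2 * Rb) * (th^6 * Y * (2 * B * th^3)))"
  by (intro add_mono mult_left_mono) (use int_exp_h y_sqrt y_exp y_exp_kap nn N0 B0 th in \<open>auto simp: C1_def C2_def C3_def C4_def\<close>)
 also have "\<dots> = 3 * B * exp S * (L / th^2)^2 + (4 * B * (N / th^6) + 2 * (th^6 * Ra) + 4 * B * (th^9 * Rb)) * Y"
  using th by (simp add: field_simps flip: power_add power_mult)
 also have "\<dots> \<le> 3 * B * exp S * (L / th^2)^2 + (4 * B * X) * Y"
 proof -
  have "2 * (th^6 * Ra) \<le> 4 * B * (th^6 * Ra)" using B1 nn th by (intro mult_right_mono) auto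
  then have "4 * B * (N / th^6) + 2 * (th^6 * Ra) + 4 * B * (th^9 * Rb) \<le> 4 * B * X" by (simp add: X_def distrib_left)
  then show ?thesis using Y0 by (intro add_left_mono mult_right_mono)
 qed
 finally have m1: "(L2n y1)^2 + (1 / (2 * B * th^12)) * D \<le> 3 * B * exp S * (L / th^2)^2 + (4 * B * X) * Y" .
 have "Y^2 / (2 * B) \<le> (L2n y1)^2 + (1 / (2 * B * th^12)) * D"
 proof -
  have "(L2n y1)^2 * 1 \<le> (L2n y1)^2 * (2 * B)" using B1 by (intro mult_left_mono) auto
  then have "(L2n y1)^2 / (2 * B) \<le> (L2n y1)^2" using B0 by (simp add: divide_le_eq)
  then show ?thesis unfolding Ysq by (simp add: add_divide_distrib mult_ac)
 qed
 moreover have "(L / th^2)^2 \<le> 2 * (layer_K B)^2 * (th^8 * Y^2 + X^2)"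
 proof -
  have "L / th^2 = layer_K B * (th^4 * Y + (N / th^4 + th^6 * Ra + th^10 * Rb))"
   using th by (simp add: L_def field_simps flip: power_add)
  also have "\<dots> \<le> layer_K B * (th^4 * Y + X)"
  proof -
   have "N / th^4 \<le> N / th^6" using th N0 by (intro divide_left_mono power_decreasing) auto
   moreover have "th^10 * Rb \<le> th^9 * Rb" using th nn by (intro mult_right_mono power_decreasing) auto
   ultimately show ?thesis using K0 by (intro mult_left_mono) (auto simp: X_def)
  qed
  finally have "(L / th^2)^2 \<le> (layer_K B * (th^4 * Y + X))^2" using L0 th by (intro power_mono) auto
  also have "\<dots> = (layer_K B)^2 * (th^4 * Y + X)^2" by (simp add: power_mult_distrib)
  also have "\<dots> \<le> (layer_K B)^2 * (2 * ((th^4 * Y)^2 + X^2))"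
  proof (rule mult_left_mono)
   show "(th^4 * Y + X)^2 \<le> 2 * ((th^4 * Y)^2 + X^2)"
    using zero_le_power2[of "th^4 * Y - X"] by (simp add: power2_eq_square algebra_simps)
  qed simp
  also have "(th^4 * Y)^2 = th^8 * Y^2" by (simp add: power_mult_distrib flip: power_mult)
  finally show ?thesis by (simp only: mult_ac)
 qed
 ultimately have "Y^2 / (2 * B) \<le> 3 * B * exp S * (2 * (layer_K B)^2 * (th^8 * Y^2 + X^2)) + (4 * B * X) * Y"
  using m1 B0 by (smt (verit) mult_left_mono exp_ge_zero mult_nonneg_nonneg)
 then have "2 * B * (Y^2 / (2 * B)) \<le> 2 * B * (3 * B * exp S * (2 * (layer_K B)^2 * (th^8 * Y^2 + X^2)) + (4 * B * X) * Y)"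
  using B0 by (intro mult_left_mono) auto
 then have "Y^2 \<le> 12 * B^2 * exp S * (layer_K B)^2 * th^8 * Y^2 + 12 * B^2 * exp S * (layer_K B)^2 * X^2 + 8 * B^2 * (X * Y)"
  using B0 by (simp add: power2_eq_square[of B] algebra_simps)
 moreover have "12 * B^2 * exp S * (layer_K B)^2 * th^8 * Y^2 \<le> 1 / 2 * Y^2"
  using sm(2) by (intro mult_right_mono) (auto simp: S_def)
 ultimately have "Y^2 \<le> (16 * B^2) * (X * Y) + (24 * B^2 * exp S * (layer_K B)^2) * X^2" by linarith
 from quadratic_le_imp_linear_le[OF this] show ?thesis
  using X0 Y0 B0 by (simp add: energy_K_def S_def X_def)
qed

text \<open>\<open>N\<close> is bounded by \<open>th^8 * Y\<close> plus data and \<open>Y\<close> by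
  \<open>N / th^6\<close> plus data. The composition returns \<open>N\<close> with the factor
  \<open>th^2\<close>, which smallness absorbs.\<close>

lemma estimates:
 assumes sm: "small_at B th"
 shows "N \<le> solve_K B * (th^6 * Ga + th^9 * Gb + th^14 * Ra + th^17 * Rb)" (is "N \<le> _ * ?S")
  and "Y \<le> energy_K B * (N / th^6 + th^6 * Ra + th^9 * Rb)"
proof -
 show Y: "Y \<le> energy_K B * (N / th^6 + th^6 * Ra + th^9 * Rb)"
  using sm by (intro estimate_Y) (auto simp: small_at_def h_def)
 have E1: "energy_K B \<ge> 1" using energy_K_ge1[OF B1] .
 have "th^8 * Y \<le> th^8 * (energy_K B * (N / th^6 + th^6 * Ra + th^9 * Rb))" using th by (intro mult_left_mono Y) auto
 also have "\<dots> = energy_K B * (th^2 * N) + energy_K B * (th^14 * Ra + th^17 * Rb)" using th by (simp add: field_simps flip: power_add)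
 finally have 8: "th^8 * Y \<le> energy_K B * (th^2 * N) + energy_K B * (th^14 * Ra + th^17 * Rb)" .
 have 18: "th^18 * Rb \<le> th^17 * Rb" using th nn by (intro mult_right_mono power_decreasing) auto
 have "energy_K B * (th^14 * Ra + th^17 * Rb) \<le> energy_K B * ?S"
  using E1 nn th by (intro mult_left_mono) auto
 then have "th^8 * Y + th^6 * Ga + th^9 * Gb + th^14 * Ra + th^18 * Rb \<le> energy_K B * (th^2 * N) + (energy_K B + 1) * ?S"
  using 8 18 by (simp add: distrib_right)
 then have "144 * B^7 * (th^8 * Y + th^6 * Ga + th^9 * Gb + th^14 * Ra + th^18 * Rb) \<le> 144 * B^7 * (energy_K B * (th^2 * N) + (energy_K B + 1) * ?S)"
  using B0 by (intro mult_left_mono) auto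
 then have "N \<le> 144 * B^7 * (energy_K B * (th^2 * N) + (energy_K B + 1) * ?S)" using estimate_N by linarith
 also have "\<dots> = (288 * B^7 * energy_K B * th^2) * (N / 2) + solve_K B * ?S / 2" by (simp add: solve_K_def algebra_simps)
 also have "(288 * B^7 * energy_K B * th^2) * (N / 2) \<le> 1 * (N / 2)" using sm N0 by (intro mult_right_mono) (auto simp: small_at_def)
 finally show "N \<le> solve_K B * ?S" by simp
qed

end

section \<open>The solution with prescribed wall vorticity\<close>

lemma mult_exp_le_right:
 assumes "k > 0" shows "r * exp (- (k * r)) \<le> 2 / k * exp (- (k / 2 * r :: real))"
proof -
 have "k / 2 * r \<le> exp (k / 2 * r)" using exp_ge_add_one_self[of "k / 2 * r"] by linarith
 then have "r \<le> 2 / k * exp (k / 2 * r)" using assms by (simp add: field_simps)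
 then have "r * exp (- (k * r)) \<le> 2 / k * exp (k / 2 * r) * exp (- (k * r))" by (rule mult_right_mono) simp
 also have "\<dots> = 2 / k * (exp (k / 2 * r) * exp (- (k * r)))" by simp
 also have "exp (k / 2 * r) * exp (- (k * r)) = exp (- (k / 2 * r))" by (simp add: exp_add[symmetric])
 finally show ?thesis .
qed

locale os_solution = airy_layer +
 fixes u u1 w w1 :: "real \<Rightarrow> complex" and \<alpha> :: real
 assumes Wg: "\<And>s. s \<ge> 0 \<Longrightarrow> cmod (eig_fun (nu - \<i> * of_real s)) \<le> B * exp (- (2 * s))"
  and al: "\<alpha>^2 \<le> B"
  and du: "\<And>t. t \<in> {0..2} \<Longrightarrow> (u has_vector_derivative u1 t) (at t within {0..2})"
  and du1: "\<And>t. t \<in> {0..2} \<Longrightarrow> (u1 has_vector_derivative w t + of_real (\<alpha>^2) * u t) (at t within {0..2})"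
  and dw: "\<And>t. t \<in> {0..2} \<Longrightarrow> (w has_vector_derivative w1 t) (at t within {0..2})"
  and dw1: "\<And>t. t \<in> {0..2} \<Longrightarrow> (w1 has_vector_derivative
    pp t * w t - \<i> * of_real (V2 t / th^12) * u t) (at t within {0..2})"
  and u0: "u 0 = 0" and u2: "u 2 = 0"
begin

lemma cuw: "continuous_on {0..2} u" "continuous_on {0..2} u1" "continuous_on {0..2} w" "continuous_on {0..2} w1"
 unfolding continuous_on_eq_continuous_within using du du1 dw dw1 has_vector_derivative_continuous by blast+

text \<open>\<open>\<sigma>^2 = \<i> * V 2 / th^12\<close>, so \<open>omp\<close> is an exponential layer at \<open>t = 2\<close>; its cubic factor makes it vanish at \<open>t = 0\<close>.\<close>

definition k2 :: real where "k2 = sqrt (V 2 / 2) / th^6"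
definition \<sigma> :: complex where "\<sigma> = of_real k2 * (1 + \<i>)"
definition omm where "omm t = hat t / tairy nu"
definition omm1 where "omm1 t = hat1 t / tairy nu"
definition rhm where "rhm t = hat_res t / tairy nu"
definition ex where "ex t = exp (- \<sigma> * of_real (2 - t))"
definition omp where "omp t = of_real (t^3 / 8) * ex t"
definition omp1 where "omp1 t = (of_real (3 * t^2 / 8) + of_real (t^3 / 8) * \<sigma>) * ex t"
definition rhp where "rhp t = (- of_real (3 * t / 4) - of_real (3 * t^2 / 4) * \<sigma>
  + of_real (t^3 / 8) * (\<i> * of_real ((V t - V 2) / th^12) - nu / of_real (th^8))) * ex t"

lemma tnz: "tairy nu \<noteq> 0" "1 / cmod (tairy nu) \<le> B"
proof -
 have "0 < 1 / B" using B0 by simp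
 then have "cmod (tairy nu) > 0" using Wlow by linarith
 then show "tairy nu \<noteq> 0" "1 / cmod (tairy nu) \<le> B" using Wlow B0 by (auto simp: field_simps)
qed

lemma V2pos: "V 2 / 2 \<ge> 1 / B" "V 2 / 2 \<le> B" using Vlow[of 2] Vup[of 2] by auto

lemma k2: "k2 > 0" "1 / (B * th^6) \<le> k2" "k2 \<le> B / th^6" "1 / k2 \<le> B * th^6"
proof -
 have "sqrt ((1 / B)^2) \<le> sqrt (V 2 / 2)"
 proof (rule real_sqrt_le_mono)
  have "(1 / B) * (1 / B) \<le> 1 / B * 1" using B1 by (intro mult_left_mono) auto
  then show "(1 / B)^2 \<le> V 2 / 2" using V2pos by (simp add: power2_eq_square)
 qed
 then have l: "1 / B \<le> sqrt (V 2 / 2)" using B0 by simp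
 have "sqrt (V 2 / 2) \<le> sqrt (B^2)"
 proof (rule real_sqrt_le_mono)
  have "B * 1 \<le> B * B" using B1 by (intro mult_left_mono) auto
  then show "V 2 / 2 \<le> B^2" using V2pos by (simp add: power2_eq_square)
 qed
 then have u: "sqrt (V 2 / 2) \<le> B" using B0 by simp
 have "1 / B / th^6 \<le> k2" unfolding k2_def using l th by (intro divide_right_mono) auto
 then show 1: "1 / (B * th^6) \<le> k2" by simp
 show "k2 \<le> B / th^6" unfolding k2_def using u th by (intro divide_right_mono) auto
 have "0 < 1 / (B * th^6)" using B0 th by simp
 then show p: "k2 > 0" using 1 by linarith
 show "1 / k2 \<le> B * th^6" using 1 p B0 th by (simp add: field_simps)
qed

lemma sigma: "\<sigma>^2 = \<i> * of_real (V 2 / th^12)" "cmod \<sigma> \<le> 2 * k2" "Re \<sigma> = k2" "\<sigma> \<noteq> 0" "k2 \<le> cmod \<sigma>"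
proof -
 have "V 2 / 2 \<ge> 0" using V2pos B0 by (meson divide_nonneg_pos order_trans zero_le_one)
 then have "k2^2 = V 2 / 2 / th^12" by (simp add: k2_def power_divide flip: power_mult)
 then have "of_real (k2^2) = (of_real (V 2 / 2 / th^12) :: complex)" by (simp only:)
 moreover have "\<sigma>^2 = of_real (k2^2) * (2 * \<i>)" by (simp add: \<sigma>_def power2_eq_square algebra_simps)
 ultimately show "\<sigma>^2 = \<i> * of_real (V 2 / th^12)" by simp
 show "Re \<sigma> = k2" by (simp add: \<sigma>_def)
 then show "k2 \<le> cmod \<sigma>" "\<sigma> \<noteq> 0" using complex_Re_le_cmod[of \<sigma>] k2 by auto
 have "cmod (1 + \<i>) \<le> 2" using norm_triangle_ineq[of 1 \<i>] by simp
 then have "\<bar>k2\<bar> * cmod (1 + \<i>) \<le> \<bar>k2\<bar> * 2" by (intro mult_left_mono) auto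
 then show "cmod \<sigma> \<le> 2 * k2" using k2 by (simp add: \<sigma>_def norm_mult)
qed

lemma ex_norm: "cmod (ex t) = exp (- (k2 * (2 - t)))" by (simp add: ex_def sigma(3))

lemma dex: "(ex has_vector_derivative \<sigma> * ex t) (at t within S)"
proof -
 have "((\<lambda>z. exp (- \<sigma> * (2 - z))) has_field_derivative (\<sigma> * exp (- \<sigma> * (2 - of_real t)))) (at (of_real t))"
  by (auto intro!: derivative_eq_intros)
 from has_vector_derivative_real_field[OF this] show ?thesis by (simp add: ex_def[abs_def])
qed

lemma domp: "(omp has_vector_derivative omp1 t) (at t within S)"
 and domp1: "(omp1 has_vector_derivative pp t * omp t - rhp t) (at t within S)"
proof -
 have p3: "((\<lambda>t. t^3 / 8) has_real_derivative 3 * t^2 / 8) (at t within S)" for t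
  by (auto intro!: derivative_eq_intros)
 have p2: "((\<lambda>t. 3 * t^2 / 8) has_real_derivative 3 * t / 4) (at t within S)" for t
  by (auto intro!: derivative_eq_intros)
 have "(omp has_vector_derivative of_real (t^3 / 8) * (\<sigma> * ex t) + of_real (3 * t^2 / 8) * ex t) (at t within S)"
  unfolding omp_def[abs_def] by (intro has_vector_derivative_mult dpoly p3 dex)
 then show "(omp has_vector_derivative omp1 t) (at t within S)" by (simp add: omp1_def algebra_simps)
 have "(omp1 has_vector_derivative (of_real (3 * t^2 / 8) + of_real (t^3 / 8) * \<sigma>) * (\<sigma> * ex t) + (of_real (3 * t / 4) + of_real (3 * t^2 / 8) * \<sigma>) * ex t) (at t within S)"
  unfolding omp1_def[abs_def]
  by (intro has_vector_derivative_mult has_vector_derivative_add has_vector_derivative_mult_left dpoly p3 p2 dex)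
 moreover have "(of_real (3 * t^2 / 8) + of_real (t^3 / 8) * \<sigma>) * (\<sigma> * ex t) + (of_real (3 * t / 4) + of_real (3 * t^2 / 8) * \<sigma>) * ex t
   = pp t * omp t - rhp t"
 proof -
  have v: "of_real ((V t - V 2) / th^12) = of_real (V t / th^12) - (of_real (V 2 / th^12) :: complex)"
   by (simp only: diff_divide_distrib of_real_diff)
  have "pp t * omp t - rhp t = (of_real (t^3 / 8) * (\<i> * of_real (V 2 / th^12)) + of_real (3 * t / 4) + of_real (3 * t^2 / 4) * \<sigma>) * ex t"
   unfolding pp_def omp_def rhp_def v by (simp only: algebra_simps) simp
  also have "of_real (3 * t^2 / 4) = 2 * (of_real (3 * t^2 / 8) :: complex)" by simp
  finally show ?thesis unfolding sigma(1)[symmetric] by (simp add: algebra_simps power2_eq_square)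
 qed
 ultimately show "(omp1 has_vector_derivative pp t * omp t - rhp t) (at t within S)" by simp
qed

lemma domm: "(omm has_vector_derivative omm1 t) (at t within S)"
 and domm1: "(omm1 has_vector_derivative pp t * omm t - rhm t) (at t within S)"
 using has_vector_derivative_divide[OF dhat, of "tairy nu"] has_vector_derivative_divide[OF dhat1, of "tairy nu"]
 by (simp_all add: omm_def[abs_def] omm1_def[abs_def] rhm_def diff_divide_distrib)

definition y where "y t = w t - w 0 * omm t - w 2 * omp t"
definition y1 where "y1 t = w1 t - w 0 * omm1 t - w 2 * omp1 t"
definition om where "om t = w 0 * omm t + w 2 * omp t"
definition r where "r t = - (w 0 * rhm t) - w 2 * rhp t"

lemma cexps: "continuous_on {0..2} ex" "continuous_on {0..2} omm" "continuous_on {0..2} omp" "continuous_on {0..2} Wh" "continuous_on {0..2} Wh1" "continuous_on {0..2} hat"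
 unfolding continuous_on_eq_continuous_within using dex domm domp dWh dWh1 dhat has_vector_derivative_continuous by blast+

lemma divide_tairy_le: "cmod x \<le> K \<Longrightarrow> cmod (x / tairy nu) \<le> B * K"
 using mult_mono[of "cmod x" K "1 / cmod (tairy nu)" B] tnz order_trans[OF norm_ge_zero, of x K]
 by (simp add: norm_divide mult.commute)

lemma omm_bound: "t \<in> {0..2} \<Longrightarrow> cmod (omm t) \<le> B^2 * exp (- (2 * t / h))"
 using divide_tairy_le[OF hat_bound] by (simp add: omm_def power2_eq_square mult.assoc)

lemma rhm_bound: "t \<in> {0..2} \<Longrightarrow> cmod (rhm t) \<le> 3 * B^3 / th^4 * exp (- (t / h))"
 using divide_tairy_le[OF hat_res_bound, of t] by (simp add: rhm_def power2_eq_square power3_eq_cube mult_ac)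

lemma omp_bound:
 assumes "t \<in> {0..2}" shows "cmod (omp t) \<le> exp (- (k2 * (2 - t)))"
proof -
 have "t^3 \<le> 2^3" using assms by (intro power_mono) auto
 then have "\<bar>t^3 / 8\<bar> * exp (- (k2 * (2 - t))) \<le> 1 * exp (- (k2 * (2 - t)))" using assms by (intro mult_right_mono) auto
 then show ?thesis unfolding omp_def norm_mult norm_of_real ex_norm by simp
qed

text \<open>At the right end \<open>V t - V 2\<close> is \<open>O(2 - t)\<close>; half of the
  exponential rate turns this distance into \<open>th^6\<close>. The factor \<open>t\<close>, a
  remnant of the cubic cutoff, is retained because the residual is later divided by
  \<open>V + h\<close>, which is small at the wall.\<close>

lemma rhp_bound:
 assumes t: "t \<in> {0..2}" shows "cmod (rhp t) \<le> 6 * B^2 / th^8 * t * exp (- (k2 / 2 * (2 - t)))"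
proof -
 define e0 e1 where "e0 = exp (- (k2 * (2 - t)))" and "e1 = exp (- (k2 / 2 * (2 - t)))"
 have e: "0 \<le> e0" "e0 \<le> e1" "(2 - t) * e0 \<le> 2 * B * th^6 * e1"
 proof -
  show "0 \<le> e0" "e0 \<le> e1" using t k2 by (auto simp: e0_def e1_def)
  have "(2 - t) * e0 \<le> 2 / k2 * e1" unfolding e0_def e1_def by (rule mult_exp_le_right[OF k2(1)])
  also have "\<dots> \<le> 2 * B * th^6 * e1" using k2(4) by (intro mult_right_mono) (auto simp: e1_def)
  finally show "(2 - t) * e0 \<le> 2 * B * th^6 * e1" .
 qed
 have t23: "t^2 \<le> 2 * t" "t^3 \<le> 4 * t"
 proof -
  show "t^2 \<le> 2 * t" using t by (simp add: power2_eq_square mult_right_mono)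
  have "t * (t * t) \<le> t * (2 * 2)" using t by (intro mult_left_mono mult_mono) auto
  then show "t^3 \<le> 4 * t" by (simp add: power3_eq_cube)
 qed
 define q6 q8 q12 where "q6 = 1 / th^6" and "q8 = 1 / th^8" and "q12 = 1 / th^12"
 have q: "1 \<le> q8" "q6 \<le> q8" "0 \<le> q6" "0 \<le> q12" "0 \<le> q8"
  unfolding q6_def q8_def q12_def using th by (auto simp: divide_simps power_le_one intro!: power_decreasing)
 have v: "cmod (\<i> * of_real ((V t - V 2) / th^12) - nu / of_real (th^8)) \<le> B * (2 - t) / th^12 + B / th^8"
 proof -
  have "cmod (\<i> * of_real ((V t - V 2) / th^12)) = \<bar>V t - V 2\<bar> / th^12" using th by (simp only: norm_mult norm_of_real) simp
  also have "\<dots> \<le> B * (2 - t) / th^12" using Vend[OF t] th by (intro divide_right_mono) auto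
  finally have 1: "cmod (\<i> * of_real ((V t - V 2) / th^12)) \<le> B * (2 - t) / th^12" .
  have "cmod (nu / of_real (th^8)) = cmod nu / th^8" using th by (simp add: norm_divide norm_power)
  also have "\<dots> \<le> B / th^8" using nuB th by (intro divide_right_mono) auto
  finally show ?thesis using 1 norm_triangle_ineq4[of "\<i> * of_real ((V t - V 2) / th^12)" "nu / of_real (th^8)"] by linarith
 qed
 have "cmod (rhp t) \<le> (3 * t / 4 + 3 * t^2 / 4 * cmod \<sigma> + t^3 / 8 * (B * (2 - t) / th^12 + B / th^8)) * e0"
 proof -
  have "cmod (- of_real (3 * t / 4) - of_real (3 * t^2 / 4) * \<sigma>
    + of_real (t^3 / 8) * (\<i> * of_real ((V t - V 2) / th^12) - nu / of_real (th^8)))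
   \<le> cmod (- of_real (3 * t / 4) :: complex) + cmod (of_real (3 * t^2 / 4) * \<sigma>)
    + cmod (of_real (t^3 / 8) * (\<i> * of_real ((V t - V 2) / th^12) - nu / of_real (th^8)))"
   by (rule order_trans[OF norm_triangle_ineq add_right_mono[OF norm_triangle_ineq4]])
  also have "\<dots> = 3 * t / 4 + 3 * t^2 / 4 * cmod \<sigma> + t^3 / 8 * cmod (\<i> * of_real ((V t - V 2) / th^12) - nu / of_real (th^8))"
   unfolding norm_mult norm_minus_cancel norm_of_real using t by simp
  also have "\<dots> \<le> 3 * t / 4 + 3 * t^2 / 4 * cmod \<sigma> + t^3 / 8 * (B * (2 - t) / th^12 + B / th^8)"
   using v t by (intro add_left_mono mult_left_mono) auto
  finally show ?thesis unfolding rhp_def norm_mult[of _ "ex t"] ex_norm e0_def[symmetric] by (rule mult_right_mono[OF _ e(1)])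
 qed
 also have "\<dots> \<le> (3 * t / 4 + 3 * (2 * t) / 4 * (2 * (B / th^6)) + (4 * t) / 8 * (B * (2 - t) / th^12 + B / th^8)) * e0"
 proof (intro mult_right_mono add_mono mult_mono order_refl)
  show "cmod \<sigma> \<le> 2 * (B / th^6)" using sigma(2) k2(3) by linarith
  show "3 * t^2 / 4 \<le> 3 * (2 * t) / 4" using t23 by simp
  show "t^3 / 8 \<le> 4 * t / 8" using t23 by simp
  show "0 \<le> B * (2 - t) / th^12 + B / th^8" using B0 th t by simp
 qed (use t e in auto)
 also have "\<dots> = t * ((3 / 4 + 3 * B * q6 + B / 2 * q8) * e0 + B / 2 * q12 * ((2 - t) * e0))"
 proof -
  have f: "B / th^6 = B * q6" "B * (2 - t) / th^12 = B * (2 - t) * q12" "B / th^8 = B * q8"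
   by (simp_all add: q6_def q8_def q12_def)
  show ?thesis unfolding f by (simp add: field_simps)
 qed
 also have "\<dots> \<le> t * ((3 / 4 * q8 + 3 * B * q8 + B / 2 * q8) * e1 + B / 2 * q12 * (2 * B * th^6 * e1))"
 proof (intro mult_left_mono add_mono)
  have "3 * B * q6 \<le> 3 * B * q8" using q B0 by (intro mult_left_mono) auto
  then have "3 / 4 + 3 * B * q6 + B / 2 * q8 \<le> 3 / 4 * q8 + 3 * B * q8 + B / 2 * q8" using q by linarith
  then show "(3 / 4 + 3 * B * q6 + B / 2 * q8) * e0 \<le> (3 / 4 * q8 + 3 * B * q8 + B / 2 * q8) * e1"
   by (rule mult_mono[OF _ e(2) _ e(1)]) (use q B0 in auto)
  show "(2 - t) * e0 \<le> 2 * B * th^6 * e1" by (rule e(3))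
 qed (use t q B0 in auto)
 also have "\<dots> = t * e1 * (3 / 4 * q8 + 3 * B * q8 + B / 2 * q8 + B^2 * q6)"
 proof -
  have "q12 * th^6 = q6" using th by (simp add: q12_def q6_def field_simps flip: power_add)
  then have "B / 2 * q12 * (2 * B * th^6 * e1) = B^2 * q6 * e1" by (simp add: power2_eq_square mult_ac)
  then show ?thesis by (simp only: distrib_left distrib_right mult_ac)
 qed
 also have "\<dots> \<le> t * e1 * (6 * B^2 * q8)"
 proof (rule mult_left_mono)
  have "B * 1 \<le> B * B" using B1 by (intro mult_left_mono) auto
  then have "3 / 4 + 3 * B + B / 2 \<le> 5 * B^2" unfolding power2_eq_square using B1 by linarith
  then have "(3 / 4 + 3 * B + B / 2) * q8 \<le> 5 * B^2 * q8" using q by (intro mult_right_mono) auto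
  moreover have "B^2 * q6 \<le> B^2 * q8" using q by (intro mult_left_mono) auto
  ultimately show "3 / 4 * q8 + 3 * B * q8 + B / 2 * q8 + B^2 * q6 \<le> 6 * B^2 * q8"
   unfolding distrib_right by linarith
 qed (use t in \<open>simp add: e1_def\<close>)
 finally have "cmod (rhp t) \<le> t * e1 * (6 * B^2 * q8)" .
 then show ?thesis by (simp add: e1_def q8_def mult_ac)
qed

end

text \<open>The layers are normalised to 1 at their own end and vanish at the other, so subtracting
  \<open>w 0 * omm\<close> and \<open>w 2 * omp\<close> from \<open>w\<close> makes the remainder
  vanish at both ends. The rate is halved to \<open>k2 / 2\<close> because the other half was spent
  in \<open>rhp_bound\<close>.\<close>

sublocale os_solution \<subseteq> layer: os_layer V V1 V2 B th u u1 "\<lambda>t. w t + of_real (\<alpha>^2) * u t" nu y y1 r om \<alpha>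
  "3 * B^3 / th^4 * cmod (w 0)" "6 * B^2 / th^8 * cmod (w 2)" "B^2 * cmod (w 0)" "cmod (w 2)" "k2 / 2"
proof unfold_locales
 fix t :: real assume t: "t \<in> {0..2}"
 show "(u has_vector_derivative u1 t) (at t within {0..2})" by (rule du[OF t])
 show "(u1 has_vector_derivative w t + of_real (\<alpha>^2) * u t) (at t within {0..2})" by (rule du1[OF t])
 show "w t + of_real (\<alpha>^2) * u t = y t + om t + of_real (\<alpha>^2) * u t" by (simp add: y_def om_def)
 show "(y has_vector_derivative y1 t) (at t within {0..2})"
  unfolding y_def[abs_def] y1_def by (intro has_vector_derivative_diff has_vector_derivative_mult_right dw domm domp t)
 have "(y1 has_vector_derivative ((pp t * w t - \<i> * of_real (V2 t / th^12) * u t) - w 0 * (pp t * omm t - rhm t) - w 2 * (pp t * omp t - rhp t))) (at t within {0..2})"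
  unfolding y1_def[abs_def]
  by (intro has_vector_derivative_diff has_vector_derivative_mult_right dw1 domm1 domp1 t)
 moreover have "(pp t * w t - \<i> * of_real (V2 t / th^12) * u t) - w 0 * (pp t * omm t - rhm t) - w 2 * (pp t * omp t - rhp t)
   = pp t * y t - \<i> * of_real (V2 t / th^12) * u t - r t"
  unfolding y_def r_def by (simp add: algebra_simps)
 ultimately show "(y1 has_vector_derivative pp t * y t - \<i> * of_real (V2 t / th^12) * u t - r t) (at t within {0..2})"
  by (simp only:)
 have "cmod (r t) \<le> cmod (w 0) * cmod (rhm t) + cmod (w 2) * cmod (rhp t)"
  unfolding r_def norm_mult[symmetric] using norm_triangle_ineq4[of "- (w 0 * rhm t)" "w 2 * rhp t"] by (simp only: norm_minus_cancel)
 also have "\<dots> \<le> cmod (w 0) * (3 * B^3 / th^4 * exp (- (t / h))) + cmod (w 2) * (6 * B^2 / th^8 * t * exp (- (k2 / 2 * (2 - t))))"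
  by (intro add_mono mult_left_mono rhm_bound rhp_bound t) auto
 finally show "cmod (r t) \<le> 3 * B^3 / th^4 * cmod (w 0) * exp (- (t / h)) + 6 * B^2 / th^8 * cmod (w 2) * t * exp (- (k2 / 2 * (2 - t)))"
  by (simp add: mult_ac)
 have "exp (- (k2 * (2 - t))) \<le> exp (- (k2 / 2 * (2 - t)))" using t k2 by simp
 then have op: "cmod (omp t) \<le> exp (- (k2 / 2 * (2 - t)))" using omp_bound[OF t] by linarith
 have "cmod (om t) \<le> cmod (w 0) * cmod (omm t) + cmod (w 2) * cmod (omp t)"
  unfolding om_def norm_mult[symmetric] by (rule norm_triangle_ineq)
 also have "\<dots> \<le> cmod (w 0) * (B^2 * exp (- (2 * t / h))) + cmod (w 2) * exp (- (k2 / 2 * (2 - t)))"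
  by (intro add_mono mult_left_mono omm_bound op t) auto
 finally show "cmod (om t) \<le> B^2 * cmod (w 0) * exp (- (2 * t / h)) + cmod (w 2) * exp (- (k2 / 2 * (2 - t)))"
  by (simp add: mult_ac)
next
 show "y 0 = 0" "y 2 = 0" using tnz by (simp_all add: y_def omm_def hat_def omp_def Wh_def ex_def)
 show "1 / (2 * B * th^6) \<le> k2 / 2" using k2(2) by simp
 show "continuous_on {0..2} om" unfolding om_def by (intro continuous_intros cexps)
 show "continuous_on {0..2} (\<lambda>t. w t + of_real (\<alpha>^2) * u t)" by (intro continuous_intros cuw)
 have "continuous_on {0..2} rhm" unfolding rhm_def hat_res_def by (intro continuous_intros cexps cV) (use th tnz in auto)
 moreover have "continuous_on {0..2} rhp" unfolding rhp_def by (intro continuous_intros cexps cV) (use th in auto)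
 ultimately show "continuous_on {0..2} r" unfolding r_def by (intro continuous_intros)
qed (use nuB W Wlow u0 u2 B0 th in auto)

text \<open>\<open>166 = 2 * 83\<close>, and \<open>83 = 26 + 1 + 56\<close> collects the
  contributions of \<open>y\<close>, of the Airy layer and of \<open>\<alpha>^2 * u\<close> to the
  moment balance in \<open>w2_le\<close>.\<close>

definition exit_K :: "real \<Rightarrow> real" where "exit_K B = 166 * energy_K B * solve_K B * B^5"

lemma solve_K_ge1: "B \<ge> 1 \<Longrightarrow> solve_K B \<ge> 1"
proof -
 assume B: "B \<ge> 1"
 have "1 * 1 \<le> B^7 * (energy_K B + 1)" using energy_K_ge1[OF B] B by (intro mult_mono) (auto simp: one_le_power)
 then show ?thesis by (simp add: solve_K_def)
qed

section \<open>Vorticity at the right end and derivative at the wall\<close>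

locale small_os_solution = os_solution +
 assumes sm: "small_at B th" and sm4: "4 * B * th^6 \<le> 1" and smM: "exit_K B * th \<le> 1 / 2"
begin

abbreviation "E \<equiv> energy_K B"
abbreviation "K \<equiv> solve_K B"
abbreviation "a \<equiv> cmod (w 0)"
abbreviation "b \<equiv> cmod (w 2)"
abbreviation "N \<equiv> layer.N"
abbreviation "Y \<equiv> layer.Y"

lemma EK: "E \<ge> 1" "K \<ge> 1" using energy_K_ge1[OF B1] solve_K_ge1[OF B1] .

lemma Bpow: "i \<le> j \<Longrightarrow> B^i \<le> B^j" by (rule power_increasing[OF _ B1])
lemma thpow: "i \<le> j \<Longrightarrow> th^j \<le> th^i" by (rule power_decreasing) (use th in auto)

text \<open>Wall vorticity costs \<open>th^6\<close>: layer width \<open>th^4\<close> times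
  \<open>th^2\<close> from the square-root vanishing of \<open>u\<close>. Vorticity at the right end
  costs \<open>th^9\<close>, width \<open>th^6\<close> times \<open>th^3\<close>. The residuals of
  both layers are of no larger order.\<close>

lemma N_le: "N \<le> 7 * K * B^3 * (th^6 * a + th^9 * b)"
proof -
 have "th^6 * (B^2 * a) + th^9 * b + th^14 * (3 * B^3 / th^4 * a) + th^17 * (6 * B^2 / th^8 * b)
   = B^2 * (th^6 * a) + 1 * (th^9 * b) + 3 * B^3 * (th^10 * a) + 6 * B^2 * (th^9 * b)"
  using th by (simp add: field_simps flip: power_add)
 also have "\<dots> \<le> B^3 * (th^6 * a) + B^3 * (th^9 * b) + 3 * B^3 * (th^6 * a) + 6 * B^3 * (th^9 * b)"
 proof (intro add_mono)
  show "B^2 * (th^6 * a) \<le> B^3 * (th^6 * a)" by (rule mult_right_mono[OF Bpow]) (use th in auto)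
  show "1 * (th^9 * b) \<le> B^3 * (th^9 * b)" by (rule mult_right_mono) (use th B1 in \<open>auto simp: one_le_power\<close>)
  show "3 * B^3 * (th^10 * a) \<le> 3 * B^3 * (th^6 * a)"
   by (intro mult_left_mono mult_right_mono thpow) (use B0 in auto)
  show "6 * B^2 * (th^9 * b) \<le> 6 * B^3 * (th^9 * b)"
   by (rule mult_right_mono[OF mult_left_mono[OF Bpow]]) (use th in auto)
 qed
 also have "\<dots> \<le> 7 * B^3 * (th^6 * a + th^9 * b)"
  using th B0 by (simp add: distrib_left mult_right_mono)
 finally have s: "th^6 * (B^2 * a) + th^9 * b + th^14 * (3 * B^3 / th^4 * a) + th^17 * (6 * B^2 / th^8 * b)
  \<le> 7 * B^3 * (th^6 * a + th^9 * b)" .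
 have "N \<le> K * (7 * B^3 * (th^6 * a + th^9 * b))"
  by (rule order_trans[OF layer.estimates(1)[OF sm] mult_left_mono[OF s]]) (use EK in auto)
 then show ?thesis by (simp only: mult_ac)
qed

lemma Y_le: "Y \<le> 13 * E * K * B^3 * (a + th * b)"
proof -
 have kb: "0 \<le> K * B^3" "B^3 \<le> K * B^3" "B^2 \<le> K * B^3"
 proof -
  show "0 \<le> K * B^3" using EK B0 by auto
  show 1: "B^3 \<le> K * B^3" using EK B0 by simp
  show "B^2 \<le> K * B^3" using Bpow[of 2 3] 1 by simp
 qed
 have "N / th^6 \<le> 7 * K * B^3 * (th^6 * a + th^9 * b) / th^6" by (rule divide_right_mono[OF N_le]) (use th in auto)
 also have "\<dots> = 7 * (K * B^3) * (a + th^3 * b)" using th by (simp add: field_simps flip: power_add)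
 also have "\<dots> \<le> 7 * (K * B^3) * (a + th * b)"
  using thpow[of 1 3] kb by (intro mult_left_mono add_left_mono mult_right_mono) auto
 finally have 1: "N / th^6 \<le> 7 * (K * B^3) * a + 7 * (K * B^3) * (th * b)" by (simp only: distrib_left)
 have "th^6 * (3 * B^3 / th^4 * a) = 3 * B^3 * (th^2 * a)" using th by (simp add: field_simps flip: power_add)
 also have "\<dots> \<le> 3 * (K * B^3) * (1 * a)"
  using thpow[of 0 2] kb th by (intro mult_mono mult_left_mono) auto
 finally have 2: "th^6 * (3 * B^3 / th^4 * a) \<le> 3 * (K * B^3) * a" by simp
 have "th^9 * (6 * B^2 / th^8 * b) = 6 * B^2 * (th * b)" using th by (simp add: field_simps flip: power_add power_Suc)
 also have "\<dots> \<le> 6 * (K * B^3) * (th * b)" using kb th by (intro mult_right_mono) auto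
 finally have 3: "th^9 * (6 * B^2 / th^8 * b) \<le> 6 * (K * B^3) * (th * b)" .
 have p: "0 \<le> (K * B^3) * a" "0 \<le> (K * B^3) * (th * b)" using kb th by auto
 have "N / th^6 + th^6 * (3 * B^3 / th^4 * a) + th^9 * (6 * B^2 / th^8 * b) \<le> 13 * ((K * B^3) * a) + 13 * ((K * B^3) * (th * b))"
  using 1 2 3 p by linarith
 then have "Y \<le> E * (13 * ((K * B^3) * a) + 13 * ((K * B^3) * (th * b)))"
  by (intro order_trans[OF layer.estimates(2)[OF sm] mult_left_mono]) (use EK in auto)
 then show ?thesis by (simp add: algebra_simps)
qed

text \<open>Among the parts of \<open>u''\<close> only this one contains \<open>\<alpha>\<close>.
  The bound \<open>\<alpha>^2 \<le> B\<close> makes the moment estimates uniform over the given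
  range of \<open>\<alpha>\<close>.\<close>

lemma u_integral_le:
 assumes c: "continuous_on {0..2} g" and g: "\<And>t. t \<in> {0..2} \<Longrightarrow> \<bar>g t\<bar> \<le> (2::real)"
 shows "cmod (integral {0..2} (\<lambda>t. of_real (\<alpha>^2) * u t * of_real (g t))) \<le> 8 * B * N"
proof -
 have "cmod (integral {0..2} (\<lambda>t. of_real (\<alpha>^2) * u t * of_real (g t))) \<le> integral {0..2::real} (\<lambda>t. 4 * B * N)"
 proof (rule integral_norm_le_continuous)
  fix t :: real assume t: "t \<in> {0..2}"
  have "sqrt t \<le> sqrt 4" using t by (intro real_sqrt_le_mono) auto
  then have s: "sqrt t \<le> 2" by simp
  have "sqrt t * N \<le> 2 * N" by (rule mult_right_mono[OF s layer.N0])
  then have u: "cmod (u t) \<le> 2 * N" using layer.u_bound_left[OF t] by linarith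
  have "\<alpha>^2 * cmod (u t) * \<bar>g t\<bar> \<le> B * (2 * N) * 2"
   by (intro mult_mono al u g t mult_nonneg_nonneg) (use B0 layer.N0 in auto)
  then show "cmod (of_real (\<alpha>^2) * u t * of_real (g t)) \<le> 4 * B * N" by (simp add: norm_mult norm_power)
 qed (intro continuous_intros cuw c)+
 also have "\<dots> = 8 * B * N" by simp
 finally show ?thesis .
qed

lemma y_integral_le:
 assumes c: "continuous_on {0..2} g" "continuous_on {0..2} k" and g: "integral {0..2} (\<lambda>t. (g t)^2 / (t + h)) \<le> G^2" "G \<ge> 0"
  and gk: "\<And>t. t \<in> {0..2} \<Longrightarrow> \<bar>k t\<bar> \<le> g t"
 shows "cmod (integral {0..2} (\<lambda>t. y t * of_real (k t))) \<le> th^6 * Y * G"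
proof -
 have "cmod (integral {0..2} (\<lambda>t. y t * of_real (k t))) \<le> integral {0..2} (\<lambda>t. cmod (y t) * g t)"
 proof (rule integral_norm_le_continuous)
  show "cmod (y t * of_real (k t)) \<le> cmod (y t) * g t" if "t \<in> {0..2}" for t
   using gk[OF that] by (simp add: norm_mult mult_left_mono)
 qed (intro continuous_intros layer.cy c)+
 also have "\<dots> \<le> th^6 * Y * G" by (rule layer.y_weighted[OF c(1) g])
 finally show ?thesis .
qed

text \<open>The weight is affine, so two integrations by parts leave only boundary terms, and those
  with \<open>u\<close> vanish.\<close>

lemma weighted_FTC:
 assumes "\<And>t. (k has_real_derivative k') (at t)"
 shows "integral {0..2} (\<lambda>t. (w t + of_real (\<alpha>^2) * u t) * of_real (k t)) = of_real (k 2) * u1 2 - of_real (k 0) * u1 0"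
proof -
 have "integral {0..2} (\<lambda>t. (w t + of_real (\<alpha>^2) * u t) * of_real (k t))
  = (of_real (k 2) * u1 2 - of_real k' * u 2) - (of_real (k 0) * u1 0 - of_real k' * u 0)"
 proof (rule vector_FTC)
  fix t :: real assume t: "t \<in> {0..2}"
  have "((\<lambda>t. of_real (k t) * u1 t - of_real k' * u t) has_vector_derivative
   (of_real (k t) * (w t + of_real (\<alpha>^2) * u t) + of_real k' * u1 t) - of_real k' * u1 t) (at t within {0..2})"
   by (intro has_vector_derivative_diff has_vector_derivative_mult has_vector_derivative_mult_right dpoly du du1 t
    has_field_derivative_at_within[OF assms])
  then show "((\<lambda>t. of_real (k t) * u1 t - of_real k' * u t) has_vector_derivative (w t + of_real (\<alpha>^2) * u t) * of_real (k t)) (at t within {0..2})"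
   by (simp add: mult.commute)
 qed simp
 then show ?thesis using u0 u2 by simp
qed

lemma integral_split:
 assumes "continuous_on {0..2} k"
 shows "integral {0..2} (\<lambda>t. (w t + of_real (\<alpha>^2) * u t) * of_real (k t))
  = integral {0..2} (\<lambda>t. y t * of_real (k t)) + w 0 * integral {0..2} (\<lambda>t. omm t * of_real (k t))
   + w 2 * integral {0..2} (\<lambda>t. omp t * of_real (k t)) + integral {0..2} (\<lambda>t. of_real (\<alpha>^2) * u t * of_real (k t))"
proof -
 have i: "(\<lambda>t. y t * of_real (k t)) integrable_on {0..2}" "(\<lambda>t. w 0 * (omm t * of_real (k t))) integrable_on {0..2}"
  "(\<lambda>t. w 2 * (omp t * of_real (k t))) integrable_on {0..2}" "(\<lambda>t. of_real (\<alpha>^2) * u t * of_real (k t)) integrable_on {0..2}"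
  by (intro integrable_continuous_real continuous_intros layer.cy cexps cuw assms)+
 have "integral {0..2} (\<lambda>t. (w t + of_real (\<alpha>^2) * u t) * of_real (k t))
  = integral {0..2} (\<lambda>t. y t * of_real (k t) + w 0 * (omm t * of_real (k t)) + w 2 * (omp t * of_real (k t)) + of_real (\<alpha>^2) * u t * of_real (k t))"
  by (rule integral_cong) (simp add: y_def algebra_simps)
 also have "\<dots> = integral {0..2} (\<lambda>t. y t * of_real (k t)) + integral {0..2} (\<lambda>t. w 0 * (omm t * of_real (k t)))
   + integral {0..2} (\<lambda>t. w 2 * (omp t * of_real (k t))) + integral {0..2} (\<lambda>t. of_real (\<alpha>^2) * u t * of_real (k t))"
  using i by (simp only: Henstock_Kurzweil_Integration.integral_add integrable_add)
 finally show ?thesis by (simp only: integral_mult_right)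
qed

lemma mult_exp_h_integral: "integral {0..2} (\<lambda>t. t * exp (- (2 * t / h))) \<le> h^2"
proof -
 have "integral {0..2} (\<lambda>t. t * exp (- (2 * t / h))) \<le> integral {0..2} (\<lambda>t. h * exp (- (1 / h * t)))"
  by (rule integral_mono_continuous) (use mult_exp_le h in \<open>auto intro!: continuous_intros\<close>)
 also have "\<dots> = h * integral {0..2} (\<lambda>t. exp (- (1 / h * t)))" by simp
 also have "\<dots> \<le> h * (1 / (1 / h))" using integral_exp_neg_le[of "1 / h"] h by (intro mult_left_mono) auto
 finally show ?thesis by (simp add: power2_eq_square)
qed

text \<open>One integration by parts gives \<open>\<sigma>\<close> times the moment as
  \<open>2\<close> minus an integral over the layer, and that integral is at most
  \<open>4 / k2 \<le> 1\<close>. Hence the moment is at least \<open>1 / cmod \<sigma>\<close>,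
  where \<open>cmod \<sigma> \<le> 2 * B / th^6\<close>.\<close>

lemma omp_moment: "cmod (integral {0..2} (\<lambda>t. omp t * of_real t)) \<ge> th^6 / (2 * B)"
proof -
 have p4: "((\<lambda>t. t^4 / 8) has_real_derivative t^3 / 2) (at t within S)" for t and S :: "real set"
  by (auto intro!: derivative_eq_intros)
 have cp: "continuous_on {0..2} (\<lambda>t. of_real (t^3 / 2) * ex t)" by (intro continuous_intros cexps) auto
 have "integral {0..2} (\<lambda>t. \<sigma> * (omp t * of_real t) + of_real (t^3 / 2) * ex t)
  = of_real (2^4 / 8) * ex 2 - of_real (0^4 / 8) * ex 0"
 proof (rule vector_FTC)
  fix t :: real
  have "((\<lambda>t. of_real (t^4 / 8) * ex t) has_vector_derivative of_real (t^4 / 8) * (\<sigma> * ex t) + of_real (t^3 / 2) * ex t) (at t within {0..2})"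
   by (intro has_vector_derivative_mult dpoly p4 dex)
  moreover have "t^4 = t^3 * t" by (simp add: power_eq_if)
  ultimately show "((\<lambda>t. of_real (t^4 / 8) * ex t) has_vector_derivative \<sigma> * (omp t * of_real t) + of_real (t^3 / 2) * ex t) (at t within {0..2})"
   by (simp add: omp_def mult_ac)
 qed simp
 also have "\<dots> = 2" by (simp add: ex_def)
 also have "integral {0..2} (\<lambda>t. \<sigma> * (omp t * of_real t) + of_real (t^3 / 2) * ex t)
  = \<sigma> * integral {0..2} (\<lambda>t. omp t * of_real t) + integral {0..2} (\<lambda>t. of_real (t^3 / 2) * ex t)"
  by (subst Henstock_Kurzweil_Integration.integral_add) (auto intro!: integrable_continuous_real continuous_intros cexps cp)
 finally have eq: "\<sigma> * integral {0..2} (\<lambda>t. omp t * of_real t) = 2 - integral {0..2} (\<lambda>t. of_real (t^3 / 2) * ex t)"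
  by (simp add: algebra_simps)
 have "cmod (integral {0..2} (\<lambda>t. of_real (t^3 / 2) * ex t)) \<le> integral {0..2} (\<lambda>t. 4 * exp (- (k2 * (2 - t))))"
 proof (rule integral_norm_le_continuous[OF cp])
  fix t :: real assume t: "t \<in> {0..2}"
  have "t^3 \<le> 2^3" using t by (intro power_mono) auto
  then have "\<bar>t^3 / 2\<bar> * exp (- (k2 * (2 - t))) \<le> 4 * exp (- (k2 * (2 - t)))" using t by (intro mult_right_mono) auto
  then show "cmod (of_real (t^3 / 2) * ex t) \<le> 4 * exp (- (k2 * (2 - t)))" by (simp only: norm_mult norm_of_real ex_norm)
 qed (intro continuous_intros)
 also have "\<dots> = 4 * integral {0..2} (\<lambda>t. exp (- (k2 * (2 - t))))" by simp
 also have "\<dots> \<le> 4 * (1 / k2)" using integral_exp_neg_right_le[OF k2(1)] by (intro mult_left_mono) auto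
 also have "\<dots> \<le> 1" using k2(4) sm4 by simp
 finally have "1 \<le> cmod \<sigma> * cmod (integral {0..2} (\<lambda>t. omp t * of_real t))"
  unfolding norm_mult[symmetric] eq using norm_triangle_ineq2[of 2 "integral {0..2} (\<lambda>t. of_real (t^3 / 2) * ex t)"] by simp
 also have "\<dots> \<le> 2 * (B / th^6) * cmod (integral {0..2} (\<lambda>t. omp t * of_real t))"
  using sigma(2) k2(3) by (intro mult_right_mono) auto
 finally show ?thesis using B0 th by (simp add: field_simps)
qed

text \<open>Since \<open>u 0 = u 2 = u' 2 = 0\<close>, the function \<open>u''\<close> is orthogonal to \<open>t\<close>; the contribution of the layer at \<open>t = 2\<close> to
 this moment is of exact order \<open>th^6\<close>.\<close>

lemma w2_le:
 assumes "u1 2 = 0" shows "b \<le> 2 * exit_K B * a"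
proof -
 have ct: "continuous_on {0..2} (\<lambda>t::real. t)" by (intro continuous_intros)
 let ?y = "integral {0..2} (\<lambda>t. y t * of_real t)" and ?m = "integral {0..2} (\<lambda>t. omm t * of_real t)"
  and ?p = "integral {0..2} (\<lambda>t. omp t * of_real t)" and ?u = "integral {0..2} (\<lambda>t. of_real (\<alpha>^2) * u t * of_real t)"
 have r: "r = - (p + q + s)" if "p + q + r + s = 0" for p q r s :: complex
  using that by (simp only: eq_neg_iff_add_eq_0 add_ac)
 have "?y + w 0 * ?m + w 2 * ?p + ?u = 0"
  using integral_split[OF ct] weighted_FTC[of "\<lambda>t. t" 1] assms by (simp add: DERIV_ident)
 then have w2p: "w 2 * ?p = - (?y + w 0 * ?m + ?u)" by (rule r)
 then have e: "b * cmod ?p \<le> cmod ?y + a * cmod ?m + cmod ?u"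
  unfolding norm_mult[symmetric] w2p norm_minus_cancel by (intro order_trans[OF norm_triangle_ineq] add_mono order_refl)
 have Y: "cmod ?y \<le> th^6 * Y * 2"
 proof (rule y_integral_le[OF ct ct])
  have "integral {0..2} (\<lambda>t. t^2 / (t + h)) \<le> integral {0..2::real} (\<lambda>t. 2)"
  proof (rule integral_mono_continuous)
   show "continuous_on {0..2} (\<lambda>t. t^2 / (t + h))" using h by (intro continuous_intros) (smt (verit) atLeastAtMost_iff)
   fix t :: real assume t: "t \<in> {0..2}"
   have "t * t \<le> 2 * (t + h)" using t h by (intro mult_mono) auto
   then show "t^2 / (t + h) \<le> 2" using t h by (simp add: power2_eq_square divide_le_eq)
  qed simp
  then show "integral {0..2} (\<lambda>t. t^2 / (t + h)) \<le> 2^2" by simp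
 qed auto
 have M: "cmod ?m \<le> B^2 * th^8"
 proof -
  have "cmod ?m \<le> integral {0..2} (\<lambda>t. B^2 * (t * exp (- (2 * t / h))))"
  proof (rule integral_norm_le_continuous)
   fix t :: real assume t: "t \<in> {0..2}"
   show "cmod (omm t * of_real t) \<le> B^2 * (t * exp (- (2 * t / h)))"
    using mult_right_mono[OF omm_bound[OF t], of t] t by (simp add: norm_mult mult_ac)
  qed (use h in \<open>auto intro!: continuous_intros cexps\<close>)
  also have "\<dots> = B^2 * integral {0..2} (\<lambda>t. t * exp (- (2 * t / h)))" by simp
  also have "\<dots> \<le> B^2 * h^2" by (rule mult_left_mono[OF mult_exp_h_integral]) simp
  finally show ?thesis by (simp add: h_def flip: power_mult)
 qed
 have U: "cmod ?u \<le> 8 * B * N" by (rule u_integral_le) auto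
 have p: "b * (th^6 / (2 * B)) \<le> b * cmod ?p" by (rule mult_left_mono[OF omp_moment]) simp
 define Z where "Z = E * K * B^4"
 have ek: "K * B^4 \<le> Z" "E * K * B^3 \<le> Z" "B^2 \<le> Z" "0 \<le> Z"
 proof -
  have k: "0 \<le> K * B^4" "B^4 \<le> K * B^4" using EK B0 by auto
  have "1 * (K * B^4) \<le> E * (K * B^4)" by (rule mult_right_mono[OF EK(1) k(1)])
  then show 1: "K * B^4 \<le> Z" by (simp add: Z_def mult_ac)
  show "E * K * B^3 \<le> Z" unfolding Z_def using EK by (intro mult_left_mono Bpow) auto
  show "B^2 \<le> Z" "0 \<le> Z" using 1 k Bpow[of 2 4] by auto
 qed
 have s1: "th^6 * Y * 2 \<le> 26 * (Z * (th^6 * (a + th * b)))"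
 proof -
  have z: "0 \<le> th^6 * (a + th * b)" using th by auto
  have "th^6 * Y * 2 \<le> th^6 * (13 * E * K * B^3 * (a + th * b)) * 2"
   by (intro mult_right_mono mult_left_mono Y_le) (use th in auto)
  also have "\<dots> = 26 * ((E * K * B^3) * (th^6 * (a + th * b)))" by (simp only: mult_ac)
  also have "\<dots> \<le> 26 * (Z * (th^6 * (a + th * b)))" using mult_right_mono[OF ek(2) z] by simp
  finally show ?thesis .
 qed
 have s2: "a * (B^2 * th^8) \<le> Z * (th^6 * (a + th * b))"
 proof -
  have "B^2 * (th^8 * a) \<le> Z * (th^6 * (a + th * b))"
  proof (rule mult_mono[OF ek(3)])
   show "th^8 * a \<le> th^6 * (a + th * b)" by (rule mult_mono[OF thpow]) (use th in auto)
  qed (use ek th in auto)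
  then show ?thesis by (simp add: mult_ac)
 qed
 have s3: "8 * B * N \<le> 56 * (Z * (th^6 * (a + th * b)))"
 proof -
  have z: "0 \<le> th^6 * (a + th * b)" using th by auto
  have "8 * B * N \<le> 8 * B * (7 * K * B^3 * (th^6 * a + th^9 * b))" by (rule mult_left_mono[OF N_le]) (use B0 in auto)
  also have "\<dots> = 56 * ((K * B^4) * (th^6 * a + th^9 * b))" by (simp add: power_eq_if)
  also have "\<dots> \<le> 56 * (Z * (th^6 * (a + th * b)))"
  proof -
   have "th^9 * b \<le> th^7 * b" by (rule mult_right_mono[OF thpow]) auto
   moreover have "th^7 = th^6 * th" by (simp add: power_eq_if)
   ultimately have "th^6 * a + th^9 * b \<le> th^6 * (a + th * b)" by (simp add: distrib_left)
   then have "(K * B^4) * (th^6 * a + th^9 * b) \<le> Z * (th^6 * (a + th * b))"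
    by (rule mult_mono[OF ek(1)]) (use ek th in auto)
   then show ?thesis by simp
  qed
  finally show ?thesis .
 qed
 have "b * (th^6 / (2 * B)) \<le> th^6 * Y * 2 + a * (B^2 * th^8) + 8 * B * N"
  using p e Y U mult_left_mono[OF M, of a] by simp
 then have "b * (th^6 / (2 * B)) \<le> 83 * (Z * (th^6 * (a + th * b)))" using s1 s2 s3 by linarith
 then have "b * th^6 \<le> 83 * (Z * (th^6 * (a + th * b))) * (2 * B)" using B0 by (simp add: divide_le_eq)
 then have "b * th^6 \<le> (166 * Z * B * (a + th * b)) * th^6" by (simp add: algebra_simps)
 then have "b \<le> 166 * Z * B * (a + th * b)" using th by simp
 \<comment> \<open>The vorticity \<open>b\<close> also occurs on the right, but with the factor
   \<open>exit_K B * th \<le> 1 / 2\<close>, so it can be moved to the left.\<close>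
 then have "b \<le> exit_K B * a + (exit_K B * th) * b"
  by (simp add: exit_K_def Z_def algebra_simps power_eq_if)
 also have "\<dots> \<le> exit_K B * a + 1 / 2 * b" by (intro add_left_mono mult_right_mono smM) auto
 finally show ?thesis by simp
qed

text \<open>The moment of \<open>u''\<close> with \<open>2 - t\<close> is \<open>-2 * u' 0\<close>, and the Airy layer contributes \<open>2 * \<i> * h * eig_fun nu / tairy nu\<close> to it.\<close>

lemma wall_derivative_estimate:
 assumes "u1 2 = 0"
 shows "cmod (u1 0 * tairy nu / of_real h + \<i> * w 0 * eig_fun nu)
  \<le> exit_K B * (1 + sqrt (ln ((2 + h) / h))) * th^2 * a"
proof -
 define l where "l = sqrt (ln ((2 + h) / h))"
 have l: "l \<ge> 0" "l^2 = ln ((2 + h) / h)" using h by (auto simp: l_def)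
 have ck: "continuous_on {0..2} (\<lambda>t::real. 2 - t)" by (intro continuous_intros)
 let ?k = "\<lambda>t::real. 2 - t"
 let ?y = "integral {0..2} (\<lambda>t. y t * of_real (?k t))" and ?m = "integral {0..2} (\<lambda>t. omm t * of_real (?k t))"
  and ?p = "integral {0..2} (\<lambda>t. omp t * of_real (?k t))" and ?u = "integral {0..2} (\<lambda>t. of_real (\<alpha>^2) * u t * of_real (?k t))"
 have dk: "(?k has_real_derivative - 1) (at t)" for t by (auto intro!: derivative_eq_intros)
 have id: "?y + w 0 * ?m + w 2 * ?p + ?u = - 2 * u1 0"
  using integral_split[OF ck] weighted_FTC[OF dk] by simp
 have U: "cmod ?u \<le> 8 * B * N" by (rule u_integral_le[OF ck]) auto
 \<comment> \<open>Unlike the weight \<open>t\<close> in \<open>w2_le\<close>, the weight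
   \<open>2 - t\<close> does not vanish at the wall. Its square over \<open>t + h\<close> integrates
   to a logarithm, which is the origin of the root of the logarithm in the final error.\<close>
 have Y: "cmod ?y \<le> th^6 * Y * (2 * l)"
 proof (rule y_integral_le[of "\<lambda>t. 2"])
  have "integral {0..2} (\<lambda>t. 2^2 / (t + h)) = 4 * integral {0..2} (\<lambda>t. 1 / (t + h))" by (simp flip: integral_mult_right)
  also have "\<dots> = (2 * l)^2" by (simp only: integral_inverse_shift_le(3)[OF h(1)] power_mult_distrib l(2)) simp
  finally show "integral {0..2} (\<lambda>t. 2^2 / (t + h)) \<le> (2 * l)^2" by simp
 qed (use l in \<open>auto intro!: continuous_intros\<close>)
 have P: "cmod ?p \<le> 4 * B^2 * th^12"
 proof -
  have "cmod ?p \<le> integral {0..2} (\<lambda>t. 2 / k2 * exp (- (k2 / 2 * (2 - t))))"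
  proof (rule integral_norm_le_continuous)
   fix t :: real assume t: "t \<in> {0..2}"
   have "cmod (omp t) * (2 - t) \<le> exp (- (k2 * (2 - t))) * (2 - t)" using t by (intro mult_right_mono omp_bound) auto
   also have "\<dots> \<le> 2 / k2 * exp (- (k2 / 2 * (2 - t)))" using mult_exp_le_right[OF k2(1), of "2 - t"] by (simp add: mult.commute)
   finally show "cmod (omp t * of_real (2 - t)) \<le> 2 / k2 * exp (- (k2 / 2 * (2 - t)))"
    unfolding norm_mult norm_of_real using t by simp
  qed (intro continuous_intros cexps)+
  also have "\<dots> = 2 / k2 * integral {0..2} (\<lambda>t. exp (- (k2 / 2 * (2 - t))))" by simp
  also have "\<dots> \<le> 2 / k2 * (1 / (k2 / 2))" using k2 by (intro mult_left_mono integral_exp_neg_right_le) auto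
  also have "\<dots> = 4 * ((1 / k2) * (1 / k2))" by simp
  also have "\<dots> \<le> 4 * ((B * th^6) * (B * th^6))" using k2 B0 th by (intro mult_left_mono mult_mono) auto
  also have "\<dots> = 4 * B^2 * th^12" by (simp add: power2_eq_square flip: power_add)
  finally show ?thesis .
 qed
 define g2 where "g2 = eig_fun (nu - \<i> * of_real (2 / h))"
 have M: "cmod (?m - 2 * \<i> * of_real h * eig_fun nu / tairy nu) \<le> 4 * B^2 * th^8"
 proof -
  have "integral {0..2} (\<lambda>t. (1 / h) *\<^sub>R Wh t) = \<i> * (- g2) - \<i> * (- eig_fun nu)"
   unfolding g2_def by (subst vector_FTC[OF _ dGa]) auto
  then have i0: "integral {0..2} (\<lambda>t. of_real h * ((1 / h) *\<^sub>R Wh t)) = of_real h * (\<i> * (- g2) - \<i> * (- eig_fun nu))"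
   by (simp only: integral_mult_right)
  have "(\<lambda>t. of_real h * ((1 / h) *\<^sub>R Wh t)) = Wh" using h by (simp add: scaleR_conv_of_real)
  then have i: "integral {0..2} Wh = of_real h * (\<i> * (- g2) - \<i> * (- eig_fun nu))" using i0 by (simp only:)
  \<comment> \<open>\<open>(1 - t / 2) * (2 - t) = 2 + (t^2 / 2 - 2 * t)\<close>: the constant gives
    twice the mean of the Airy layer, hence \<open>eig_fun\<close>, and the rest is
    \<open>O(t)\<close> and gains another factor \<open>h\<close>.\<close>
  let ?e = "integral {0..2} (\<lambda>t. Wh t * of_real (t^2 / 2 - 2 * t))"
  have "tairy nu * ?m = integral {0..2} (\<lambda>t. tairy nu * (omm t * of_real (2 - t)))" by (simp only: integral_mult_right)
  also have "\<dots> = integral {0..2} (\<lambda>t. 2 * Wh t + Wh t * of_real (t^2 / 2 - 2 * t))"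
  proof (rule integral_cong)
   fix t
   have "tairy nu * omm t = of_real (1 - t / 2) * Wh t" using tnz by (simp add: omm_def hat_def)
   then have "tairy nu * (omm t * of_real (2 - t)) = of_real (1 - t / 2) * Wh t * of_real (2 - t)" by (simp only: mult.assoc[symmetric])
   then show "tairy nu * (omm t * of_real (2 - t)) = 2 * Wh t + Wh t * of_real (t^2 / 2 - 2 * t)"
    by (simp add: field_simps power2_eq_square)
  qed
  also have "\<dots> = 2 * integral {0..2} Wh + ?e"
   by (subst Henstock_Kurzweil_Integration.integral_add)
    (auto intro!: integrable_continuous_real continuous_intros cexps)
  finally have tm: "tairy nu * (?m - 2 * \<i> * of_real h * eig_fun nu / tairy nu) = ?e - 2 * of_real h * \<i> * g2"
   using tnz by (simp add: i algebra_simps)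
  have e: "cmod ?e \<le> 2 * B * h^2"
  proof -
   have "cmod ?e \<le> integral {0..2} (\<lambda>t. 2 * B * (t * exp (- (2 * t / h))))"
   proof (rule integral_norm_le_continuous)
    fix t :: real assume t: "t \<in> {0..2}"
    have "t * t \<le> 2 * t" using t by (intro mult_right_mono) auto
    then have a: "\<bar>t^2 / 2 - 2 * t\<bar> \<le> 2 * t" using t by (auto simp: power2_eq_square abs_if)
    have "cmod (Wh t) * \<bar>t^2 / 2 - 2 * t\<bar> \<le> B * exp (- (2 * t / h)) * (2 * t)"
     by (intro mult_mono Whb a) (use t B0 in auto)
    then show "cmod (Wh t * of_real (t^2 / 2 - 2 * t)) \<le> 2 * B * (t * exp (- (2 * t / h)))"
     unfolding norm_mult norm_of_real by (simp add: mult_ac)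
   qed (use h in \<open>auto intro!: continuous_intros cexps\<close>)
   also have "\<dots> = 2 * B * integral {0..2} (\<lambda>t. t * exp (- (2 * t / h)))" by simp
   also have "\<dots> \<le> 2 * B * h^2" by (rule mult_left_mono[OF mult_exp_h_integral]) (use B0 in auto)
   finally show ?thesis .
  qed
  \<comment> \<open>The value at the far end is exponentially small; the crude bound by a multiple
    of \<open>h\<close> already matches the error \<open>h^2\<close> of the other term.\<close>
  have g: "cmod g2 \<le> B * h"
  proof -
   have "4 / h \<le> exp (4 / h)" using exp_ge_add_one_self[of "4 / h"] by linarith
   then have "1 / exp (4 / h) \<le> 1 / (4 / h)" using h by (intro divide_left_mono) auto
   moreover have "exp (- (2 * (2 / h))) = 1 / exp (4 / h)" by (simp add: exp_minus inverse_eq_divide)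
   moreover have "1 / (4 / h) \<le> h" using h by simp
   ultimately have "exp (- (2 * (2 / h))) \<le> h" by linarith
   then have "B * exp (- (2 * (2 / h))) \<le> B * h" using B0 by (intro mult_left_mono) auto
   moreover have "cmod g2 \<le> B * exp (- (2 * (2 / h)))" unfolding g2_def by (rule Wg) (use h in auto)
   ultimately show ?thesis by linarith
  qed
  have "cmod (2 * of_real h * \<i> * g2) = 2 * h * cmod g2" using h by (simp add: norm_mult)
  also have "\<dots> \<le> 2 * h * (B * h)" using h by (intro mult_left_mono g) auto
  also have "\<dots> = 2 * B * h^2" by (simp add: power2_eq_square)
  finally have g': "cmod (2 * of_real h * \<i> * g2) \<le> 2 * B * h^2" .
  have "2 * B * h^2 + 2 * B * h^2 = 4 * B * h^2" by simp
  then have "cmod (tairy nu) * cmod (?m - 2 * \<i> * of_real h * eig_fun nu / tairy nu) \<le> 4 * B * h^2"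
   unfolding norm_mult[symmetric] tm
   using order_trans[OF norm_triangle_ineq4 add_mono[OF e g']] by (simp only:)
  then have "1 / B * cmod (?m - 2 * \<i> * of_real h * eig_fun nu / tairy nu) \<le> 4 * B * h^2"
   by (rule order_trans[rotated]) (intro mult_right_mono Wlow norm_ge_zero)
  then have "cmod (?m - 2 * \<i> * of_real h * eig_fun nu / tairy nu) \<le> 4 * B * h^2 * B" using B0 by (simp add: divide_le_eq)
  then show ?thesis by (simp add: h_def power2_eq_square mult_ac flip: power_add)
 qed
 define X where "X = u1 0 * tairy nu / of_real h + \<i> * w 0 * eig_fun nu"
 have X: "X * (2 * of_real h / tairy nu) = - (?y + w 0 * (?m - 2 * \<i> * of_real h * eig_fun nu / tairy nu) + w 2 * ?p + ?u)"
 proof -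
  have "(v * T / H + \<i> * c * g) * (2 * H / T) = - (p + c * (m - 2 * \<i> * H * g / T) + q + r)"
   if "p + c * m + q + r = - 2 * v" "T \<noteq> 0" "H \<noteq> 0" for v T H c g p m q r :: complex
  proof -
   have "(v * T / H + \<i> * c * g) * (2 * H / T) = - (- 2 * v) + c * (2 * \<i> * H * g / T)" using that by (simp add: field_simps)
   also have "\<dots> = - (p + c * (m - 2 * \<i> * H * g / T) + q + r)" unfolding that(1)[symmetric] by (simp add: right_diff_distrib)
   finally show ?thesis .
  qed
  from this[OF id tnz(1)] show ?thesis unfolding X_def using h by simp
 qed
 have nz: "2 * h / B \<le> cmod (2 * of_real h / tairy nu)"
 proof -
  have "cmod (tairy nu) \<le> B" using W(1)[of 0] by simp
  then have "2 * h / B \<le> 2 * h / cmod (tairy nu)" using h tnz by (intro divide_left_mono) (auto intro!: mult_pos_pos B0)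
  then show ?thesis using h by (simp add: norm_divide norm_mult)
 qed
 \<comment> \<open>From here on each contribution of the right end can be charged to the wall
   vorticity \<open>a\<close>.\<close>
 have b2: "th * b \<le> a"
 proof -
  have "th * b \<le> th * (2 * exit_K B * a)" by (rule mult_left_mono[OF w2_le[OF assms]]) (use th in auto)
  also have "\<dots> = 2 * (exit_K B * th) * a" by simp
  also have "\<dots> \<le> 2 * (1 / 2) * a" by (intro mult_right_mono mult_left_mono smM) auto
  finally show ?thesis by simp
 qed
 have EKp: "E * K \<ge> 1" "K \<le> E * K" "0 \<le> E" "0 \<le> K"
  using EK mult_mono[of 1 E 1 K] mult_right_mono[of 1 E K] by auto
 define Z where "Z = E * K * B^4"
 have Z: "E * K * B^3 \<le> Z" "K * B^4 \<le> Z" "B^2 \<le> Z"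
 proof -
  show "E * K * B^3 \<le> Z" unfolding Z_def using EKp by (intro mult_left_mono Bpow) auto
  show "K * B^4 \<le> Z" unfolding Z_def using EKp B0 by (intro mult_right_mono) auto
  have "1 * B^4 \<le> E * K * B^4" using EKp B0 by (intro mult_right_mono) auto
  then show "B^2 \<le> Z" unfolding Z_def using Bpow[of 2 4] by simp
 qed
 define q where "q = th^6 * a"
 have q: "0 \<le> q" "th^8 * a \<le> q" "th^12 * b \<le> q" "th^9 * b \<le> q"
 proof -
  show "0 \<le> q" using th by (simp add: q_def)
  show "th^8 * a \<le> q" unfolding q_def by (intro mult_right_mono thpow) auto
  have "th^9 * b \<le> th^7 * b" by (intro mult_right_mono thpow) auto
  also have "\<dots> = th^6 * (th * b)" by (simp add: power_eq_if)
  also have "\<dots> \<le> q" unfolding q_def by (intro mult_left_mono b2) (use th in auto)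
  finally show 9: "th^9 * b \<le> q" .
  have "th^12 * b \<le> th^9 * b" by (intro mult_right_mono thpow) auto
  with 9 show "th^12 * b \<le> q" by simp
 qed
 have Zq: "0 \<le> Z * q" using q Z by (intro mult_nonneg_nonneg) (auto simp: Z_def EKp B0 less_imp_le)
 have s1: "th^6 * Y * (2 * l) \<le> 52 * (l * (Z * q))"
 proof -
  have "Y \<le> 13 * E * K * B^3 * (2 * a)"
   by (rule order_trans[OF Y_le mult_left_mono]) (use b2 EKp B0 in auto)
  then have "th^6 * Y * (2 * l) \<le> th^6 * (13 * E * K * B^3 * (2 * a)) * (2 * l)"
   by (intro mult_right_mono mult_left_mono) (use th l in auto)
  also have "\<dots> = 52 * (l * ((E * K * B^3) * q))" by (simp add: q_def)
  also have "\<dots> \<le> 52 * (l * (Z * q))" by (intro mult_left_mono mult_right_mono Z l q) auto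
  finally show ?thesis .
 qed
 have s2: "a * (4 * B^2 * th^8) \<le> 4 * (Z * q)"
  using mult_mono[OF Z(3) q(2)] th Z by (simp add: mult_ac order_trans[OF zero_le_power2 Z(3)])
 have s3: "b * (4 * B^2 * th^12) \<le> 4 * (Z * q)"
  using mult_mono[OF Z(3) q(3)] th Z by (simp add: mult_ac order_trans[OF zero_le_power2 Z(3)])
 have s4: "8 * B * N \<le> 112 * (Z * q)"
 proof -
  have "N \<le> 7 * K * B^3 * (2 * q)"
   by (rule order_trans[OF N_le mult_left_mono]) (use q(4) EKp B0 in \<open>auto simp: q_def mult.commute\<close>)
  then have "8 * B * N \<le> 8 * B * (7 * K * B^3 * (2 * q))" using B0 by (intro mult_left_mono) auto
  also have "\<dots> = 112 * ((K * B^4) * q)" by (simp add: power_eq_if)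
  also have "\<dots> \<le> 112 * (Z * q)" by (intro mult_left_mono mult_right_mono Z q) auto
  finally show ?thesis .
 qed
 have "cmod X * (2 * h / B) \<le> cmod X * cmod (2 * of_real h / tairy nu)" by (intro mult_left_mono nz) auto
 also have "\<dots> = cmod (?y + w 0 * (?m - 2 * \<i> * of_real h * eig_fun nu / tairy nu) + w 2 * ?p + ?u)"
  unfolding norm_mult[symmetric] X by (rule norm_minus_cancel)
 also have "\<dots> \<le> cmod ?y + a * cmod (?m - 2 * \<i> * of_real h * eig_fun nu / tairy nu) + b * cmod ?p + cmod ?u"
  unfolding norm_mult[symmetric] by (intro order_trans[OF norm_triangle_ineq] add_mono order_refl)
 also have "\<dots> \<le> th^6 * Y * (2 * l) + a * (4 * B^2 * th^8) + b * (4 * B^2 * th^12) + 8 * B * N"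
  by (intro add_mono mult_left_mono Y M P U) auto
 also have "\<dots> \<le> 120 * (Z * q) + 52 * (l * (Z * q))" using s1 s2 s3 s4 by linarith
 also have "\<dots> \<le> 120 * (Z * q) * (1 + l)"
 proof -
  have "0 \<le> l * (Z * q)" using Zq l by simp
  moreover have "120 * (Z * q) * (1 + l) = 120 * (Z * q) + 120 * (l * (Z * q))" by (simp add: algebra_simps)
  ultimately show ?thesis by linarith
 qed
 finally have "cmod X * (2 * h) \<le> 120 * (Z * q) * (1 + l) * B" using B0 by (simp add: divide_le_eq)
 then have "cmod X * h \<le> 60 * (Z * q) * (1 + l) * B" by (simp only: mult_ac)
 also have "\<dots> = (60 * Z * B * (1 + l) * th^2 * a) * h" by (simp add: q_def h_def flip: power_add)
 finally have "cmod X \<le> 60 * Z * B * (1 + l) * th^2 * a" using h by (simp only: mult_le_cancel_right_pos)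
 also have "\<dots> \<le> exit_K B * (1 + l) * th^2 * a"
 proof (intro mult_right_mono)
  have "60 * (E * K * B^5) \<le> 166 * (E * K * B^5)" using EKp B0 by (intro mult_right_mono) auto
  then show "60 * Z * B \<le> exit_K B" by (simp add: Z_def exit_K_def power_eq_if mult_ac)
 qed (use l in auto)
 finally show ?thesis by (simp add: X_def l_def)
qed

text \<open>Zero wall vorticity gives \<open>w 2 = 0\<close> by \<open>w2_le\<close> and then
  \<open>N = 0\<close>. This uniqueness makes the shooting determinant nonzero.\<close>

lemma eq_zero:
 assumes "u1 2 = 0" "w 0 = 0" "t \<in> {0..2}"
 shows "u t = 0"
proof -
 have "b \<le> 0" using w2_le[OF assms(1)] assms by simp
 then have "N \<le> 0" using N_le assms by simp
 then have "sqrt t * N \<le> 0" using assms by (intro mult_nonneg_nonpos) auto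
 then show ?thesis using layer.u_bound_left[OF assms(3)] by (simp add: order_trans norm_le_zero_iff[symmetric] del: norm_le_zero_iff)
qed

end

section \<open>Smooth functions and weak derivatives\<close>

text \<open>A complex-valued smooth function is represented together with all its derivatives,
  \<open>F k\<close> being the \<open>k\<close>-th one. Real parts of such a sequence give test
  functions in the sense of \<open>test_function_on\<close>.\<close>

definition smooth_seq :: "(nat \<Rightarrow> real \<Rightarrow> complex) \<Rightarrow> bool" where
 "smooth_seq F \<longleftrightarrow> (\<forall>k x. (F k has_vector_derivative F (Suc k) x) (at x))"

definition compactly_supported :: "real set \<Rightarrow> (real \<Rightarrow> complex) \<Rightarrow> bool" where
 "compactly_supported S f \<longleftrightarrow> (\<exists>K. compact K \<and> K \<subseteq> S \<and> (\<forall>x. x \<notin> K \<longrightarrow> f x = 0))"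

definition smooth :: "(real \<Rightarrow> complex) \<Rightarrow> bool" where "smooth f \<longleftrightarrow> (\<exists>F. smooth_seq F \<and> F 0 = f)"

lemma smooth_coinduct:
 assumes f: "f \<in> A" and A: "\<And>g. g \<in> A \<Longrightarrow> \<exists>g'\<in>A. \<forall>x. (g has_vector_derivative g' x) (at x)"
 shows "smooth f"
proof -
 obtain D where D: "\<And>g. g \<in> A \<Longrightarrow> D g \<in> A \<and> (\<forall>x. (g has_vector_derivative D g x) (at x))" using A by metis
 have "(D ^^ k) f \<in> A" for k by (induction k) (use f D in auto)
 then have "smooth_seq (\<lambda>k. (D ^^ k) f)" using D by (simp add: smooth_seq_def)
 then show ?thesis unfolding smooth_def by (metis funpow_0)
qed

text \<open>Smoothness of an explicit function follows from \<open>smooth_coinduct\<close>, applied to an algebra that is closed under derivation.\<close>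

inductive_set generated_algebra :: "(real \<Rightarrow> complex) set \<Rightarrow> (real \<Rightarrow> complex) set" for G where
 gen: "g \<in> G \<Longrightarrow> g \<in> generated_algebra G"
| const: "(\<lambda>x. c) \<in> generated_algebra G"
| add: "f \<in> generated_algebra G \<Longrightarrow> g \<in> generated_algebra G \<Longrightarrow> (\<lambda>x. f x + g x) \<in> generated_algebra G"
| mult: "f \<in> generated_algebra G \<Longrightarrow> g \<in> generated_algebra G \<Longrightarrow> (\<lambda>x. f x * g x) \<in> generated_algebra G"

lemma smooth_generated_algebra:
 assumes G: "\<And>g. g \<in> G \<Longrightarrow> \<exists>g'\<in>generated_algebra G. \<forall>x. (g has_vector_derivative g' x) (at x)"
  and f: "f \<in> generated_algebra G"
 shows "smooth f" using f
proof (rule smooth_coinduct)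
 fix g assume "g \<in> generated_algebra G"
 then show "\<exists>g'\<in>generated_algebra G. \<forall>x. (g has_vector_derivative g' x) (at x)"
 proof induction
  case (gen g) then show ?case by (rule G)
 next
  case (const c) show ?case by (rule bexI[OF _ generated_algebra.const[of 0]]) simp
 next
  case (add f g)
  then obtain f' g' where "f' \<in> generated_algebra G" "g' \<in> generated_algebra G"
   "\<And>x. (f has_vector_derivative f' x) (at x)" "\<And>x. (g has_vector_derivative g' x) (at x)" by blast
  then show ?case by (intro bexI[of _ "\<lambda>x. f' x + g' x"] generated_algebra.add allI has_vector_derivative_add)
 next
  case (mult f g)
  then obtain f' g' where "f' \<in> generated_algebra G" "g' \<in> generated_algebra G"
   "\<And>x. (f has_vector_derivative f' x) (at x)" "\<And>x. (g has_vector_derivative g' x) (at x)" by blast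
  then show ?case
   by (intro bexI[of _ "\<lambda>x. f x * g' x + f' x * g x"] generated_algebra.add generated_algebra.mult mult.hyps allI has_vector_derivative_mult)
 qed
qed

lemma smooth_add_mult:
 assumes "smooth f" "smooth g"
 shows "smooth (\<lambda>x. f x + g x)" "smooth (\<lambda>x. f x * g x)"
proof -
 obtain F H where F: "smooth_seq F" "F 0 = f" "smooth_seq H" "H 0 = g" using assms by (auto simp: smooth_def)
 let ?G = "range F \<union> range H"
 have d: "\<exists>g'\<in>generated_algebra ?G. \<forall>x. (g has_vector_derivative g' x) (at x)" if "g \<in> ?G" for g
 proof -
  from that have "(\<exists>k. g = F k) \<or> (\<exists>k. g = H k)" by auto
  then consider k where "g = F k" | k where "g = H k" by metis
  then show ?thesis
  proof cases
   case 1
   have "F (Suc k) \<in> generated_algebra ?G" by (intro generated_algebra.gen) auto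
   then show ?thesis using F(1) unfolding 1 smooth_seq_def by blast
  next
   case 2
   have "H (Suc k) \<in> generated_algebra ?G" by (intro generated_algebra.gen) auto
   then show ?thesis using F(3) unfolding 2 smooth_seq_def by blast
  qed
 qed
 have "f \<in> ?G" "g \<in> ?G" using F by auto
 then show "smooth (\<lambda>x. f x + g x)" "smooth (\<lambda>x. f x * g x)"
  by (auto intro!: smooth_generated_algebra[OF d] intro: generated_algebra.intros)
qed

lemma smooth_const: "smooth (\<lambda>x. c)"
 by (rule smooth_generated_algebra[of "{}"]) (auto intro: generated_algebra.const)

lemma smooth_power: "smooth f \<Longrightarrow> smooth (\<lambda>x. f x^n)"
 by (induction n) (simp_all add: smooth_const smooth_add_mult)

lemma smooth_seq_Suc: "smooth_seq F \<Longrightarrow> smooth_seq (\<lambda>k. F (Suc k))"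
 by (simp add: smooth_seq_def)

lemma smooth_deriv:
 assumes "smooth f" obtains f' where "smooth f'" "\<And>x. (f has_vector_derivative f' x) (at x)"
 using assms unfolding smooth_def by (metis smooth_seq_Suc smooth_seq_def)

lemma smooth_antiderivative:
 assumes "smooth f'" "\<And>x. (f has_vector_derivative f' x) (at x)"
 shows "smooth f"
proof -
 obtain F where F: "smooth_seq F" "F 0 = f'" using assms by (auto simp: smooth_def)
 have "smooth_seq (case_nat f F)" unfolding smooth_seq_def
 proof (intro allI)
  fix k x show "(case_nat f F k has_vector_derivative case_nat f F (Suc k) x) (at x)"
   using F assms(2) by (cases k) (auto simp: smooth_seq_def)
 qed
 then show ?thesis unfolding smooth_def by (intro exI[of _ "case_nat f F"]) simp
qed

section \<open>Bump functions and approximation of indicators\<close>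

definition flat :: "nat \<Rightarrow> real \<Rightarrow> real" where "flat k x = (if x > 0 then exp (- 1 / x) / x^k else 0)"

text \<open>The term of order \<open>k + 2\<close> in the series of \<open>exp (1 / x)\<close> alone
  beats \<open>1 / x^k\<close> with \<open>x^2\<close> to spare, so for every \<open>k\<close> the
  difference quotient at 0 tends to 0.\<close>

lemma flat_le: "\<bar>flat k x\<bar> \<le> fact (k + 2) * x^2"
proof (cases "x > 0")
 case True
 obtain C where C: "C = (fact (k + 2) :: real)" "C > 0" by simp
 have "(\<Sum>n\<in>{k + 2}. (1 / x)^n /\<^sub>R fact n) \<le> (\<Sum>n. (1 / x)^n /\<^sub>R fact n)"
  by (rule sum_le_suminf[OF summable_exp_generic]) (use True in auto)
 then have "(1 / x)^(k + 2) / fact (k + 2) \<le> exp (1 / x)" unfolding exp_def by (simp add: divide_inverse mult.commute)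
 then have "exp (- (1 / x)) * ((1 / x)^(k + 2) / fact (k + 2)) \<le> exp (- (1 / x)) * exp (1 / x)" by (rule mult_left_mono) simp
 also have "\<dots> = 1" by (simp add: exp_minus)
 finally have "exp (- (1 / x)) * ((1 / x)^(k + 2) / C) \<le> 1" unfolding C(1) .
 then show ?thesis unfolding C(1)[symmetric] using True C(2)
  by (simp add: flat_def power_divide field_simps flip: power_add)
qed (simp add: flat_def)

lemma flat_deriv: "(flat k has_real_derivative - real k * flat (k + 1) x + flat (k + 2) x) (at x)"
proof -
 consider "x > 0" | "x < 0" | "x = 0" by linarith
 then show ?thesis
 proof cases
  case 1
  have "((\<lambda>x. exp (- 1 / x) / x^k) has_real_derivative - real k * flat (k + 1) x + flat (k + 2) x) (at x)"
  proof (rule DERIV_cong)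
   show "((\<lambda>x. exp (- 1 / x) / x^k) has_real_derivative
    (exp (- 1 / x) * (1 / x^2) * x^k - exp (- 1 / x) * (real k * x^(k - 1))) / (x^k * x^k)) (at x)"
    using 1 by (auto intro!: derivative_eq_intros simp: power2_eq_square)
   show "(exp (- 1 / x) * (1 / x^2) * x^k - exp (- 1 / x) * (real k * x^(k - 1))) / (x^k * x^k)
    = - real k * flat (k + 1) x + flat (k + 2) x"
    using 1 by (cases k) (auto simp: flat_def field_simps power2_eq_square)
  qed
  moreover have "\<forall>\<^sub>F y in nhds x. flat k y = exp (- 1 / y) / y^k"
   using eventually_nhds_in_open[of "{0<..}" x] 1 by (auto elim!: eventually_mono simp: flat_def)
  ultimately show ?thesis by (simp add: DERIV_cong_ev)
 next
  case 2
  have "\<forall>\<^sub>F y in nhds x. flat k y = 0"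
   using eventually_nhds_in_open[of "{..<0}" x] 2 by (auto elim!: eventually_mono simp: flat_def)
  then have "(flat k has_real_derivative 0) (at x)" using DERIV_cong_ev[OF refl _ refl, of "flat k" "\<lambda>_. 0" x 0] by simp
  then show ?thesis using 2 by (simp add: flat_def)
 next
  case 3
  have "(flat k has_real_derivative 0) (at 0)" unfolding DERIV_def
  proof (rule Lim_null_comparison[where g = "\<lambda>h. fact (k + 2) * \<bar>h\<bar>"])
   show "\<forall>\<^sub>F h in at 0. norm ((flat k (0 + h) - flat k 0) / h) \<le> fact (k + 2) * \<bar>h\<bar>"
   proof (rule eventually_mono[OF eventually_neq_at_within[of 0]])
    fix h :: real assume "h \<noteq> 0"
    then show "norm ((flat k (0 + h) - flat k 0) / h) \<le> fact (k + 2) * \<bar>h\<bar>"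
     using flat_le[of k h] by (simp add: flat_def[of k 0] divide_le_eq power2_eq_square mult.assoc)
   qed
   show "((\<lambda>h. fact (k + 2) * \<bar>h\<bar>) \<longlongrightarrow> 0) (at (0::real))" by (auto intro!: tendsto_eq_intros)
  qed
  then show ?thesis using 3 by (simp add: flat_def)
 qed
qed

lemma smooth_flat: "smooth (\<lambda>x. of_real (flat 0 (a + c * x)))"
proof (rule smooth_generated_algebra)
 let ?G = "range (\<lambda>k x. of_real (flat k (a + c * x)) :: complex)"
 show "(\<lambda>x. of_real (flat 0 (a + c * x))) \<in> generated_algebra ?G" by (intro generated_algebra.gen) auto
 fix g assume "g \<in> ?G"
 then obtain k where g: "g = (\<lambda>x. of_real (flat k (a + c * x)))" by auto
 have m: "(\<lambda>x. of_real (flat j (a + c * x)) :: complex) \<in> generated_algebra ?G" for j by (intro generated_algebra.gen) auto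
 let ?h = "\<lambda>x. of_real (- real k * c) * of_real (flat (k + 1) (a + c * x)) + of_real c * of_real (flat (k + 2) (a + c * x)) :: complex"
 have "?h \<in> generated_algebra ?G" by (intro generated_algebra.add generated_algebra.mult generated_algebra.const m)
 moreover have "(g has_vector_derivative ?h x) (at x)" for x
 proof -
  have "((\<lambda>x. flat k (a + c * x)) has_real_derivative (- real k * flat (k + 1) (a + c * x) + flat (k + 2) (a + c * x)) * c) (at x)"
   by (rule DERIV_chain2[OF flat_deriv]) (auto intro!: derivative_eq_intros)
  from bounded_linear.has_vector_derivative[OF bounded_linear_of_real[where 'a = complex] this[unfolded has_real_derivative_iff_has_vector_derivative]]
  show ?thesis by (simp add: g algebra_simps)
 qed
 ultimately show "\<exists>g'\<in>generated_algebra ?G. \<forall>x. (g has_vector_derivative g' x) (at x)" by (intro bexI[of _ ?h] allI)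
qed

text \<open>For a bump \<open>B\<close> with values in the unit interval that is positive exactly
  inside, \<open>1 - (1 - B)^n\<close> is smooth, bounded by 1, zero outside and tends to 1 inside.
  A single bump thus approximates the indicator.\<close>

lemma interval_cutoffs:
 fixes a b :: real
 obtains \<phi> :: "nat \<Rightarrow> real \<Rightarrow> complex" where "\<And>n. smooth (\<phi> n)" "\<And>n x. x \<notin> {a<..<b} \<Longrightarrow> \<phi> n x = 0"
  "\<And>n x. cmod (\<phi> n x) \<le> 1" "\<And>x. x \<in> {a<..<b} \<Longrightarrow> (\<lambda>n. \<phi> n x) \<longlonglongrightarrow> 1"
proof -
 define B where "B x = flat 0 (- a + 1 * x) * flat 0 (b + (- 1) * x)" for x
 define \<phi> where "\<phi> n x = (1 + (- 1) * (1 + (- 1) * (of_real (flat 0 (- a + 1 * x)) * of_real (flat 0 (b + (- 1) * x))))^n :: complex)" for n x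
 have phi: "\<phi> n x = of_real (1 - (1 - B x)^n)" for n x by (simp add: \<phi>_def B_def)
 have f: "0 \<le> flat 0 y" "flat 0 y \<le> 1" "y \<le> 0 \<Longrightarrow> flat 0 y = 0" "y > 0 \<Longrightarrow> flat 0 y > 0" for y by (auto simp: flat_def)
 have B: "0 \<le> B x" "B x \<le> 1" for x unfolding B_def by (auto intro!: mult_nonneg_nonneg mult_le_one f)
 show ?thesis
 proof
  show "smooth (\<phi> n)" for n
   unfolding \<phi>_def[abs_def] by (intro smooth_add_mult smooth_const smooth_power smooth_flat)
  show "\<phi> n x = 0" if "x \<notin> {a<..<b}" for n x
  proof -
   have "B x = 0" using that f(3)[of "- a + 1 * x"] f(3)[of "b + (- 1) * x"] by (auto simp: B_def)
   then show ?thesis by (simp add: phi)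
  qed
  show "cmod (\<phi> n x) \<le> 1" for n x
  proof -
   have "0 \<le> (1 - B x)^n" "(1 - B x)^n \<le> 1" using B by (auto intro: power_le_one)
   then show ?thesis unfolding phi norm_of_real by simp
  qed
  show "(\<lambda>n. \<phi> n x) \<longlonglongrightarrow> 1" if "x \<in> {a<..<b}" for x
  proof -
   have "B x > 0" using that unfolding B_def by (intro mult_pos_pos f) auto
   then have "norm (1 - B x) < 1" using B(2)[of x] by (simp add: abs_less_iff)
   from LIMSEQ_power_zero[OF this] have "(\<lambda>n. (1 - B x)^n) \<longlonglongrightarrow> 0" .
   then have "(\<lambda>n. of_real (1 - (1 - B x)^n) :: complex) \<longlonglongrightarrow> of_real (1 - 0)" by (intro tendsto_of_real tendsto_diff tendsto_const)
   then show ?thesis by (simp add: phi)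
  qed
 qed
qed

section \<open>Weak derivatives and their test functions\<close>

lemma smooth_seq_continuous: "smooth_seq F \<Longrightarrow> continuous_on UNIV (F k)"
 unfolding continuous_on_eq_continuous_within smooth_seq_def using has_vector_derivative_continuous by blast

lemma smooth_continuous: "smooth f \<Longrightarrow> continuous_on UNIV f"
 unfolding smooth_def using smooth_seq_continuous by blast

lemma deriv_zero_off_support:
 fixes g :: "real \<Rightarrow> complex"
 assumes "compact K" "\<And>x. x \<notin> K \<Longrightarrow> g x = 0" "(g has_vector_derivative g') (at x)" "x \<notin> K"
 shows "g' = 0"
proof -
 have "open (- K)" using compact_imp_closed[OF assms(1)] by auto
 then have "((\<lambda>x. 0) has_vector_derivative g') (at x)"
  by (rule has_vector_derivative_transform_within_open[OF assms(3)]) (use assms in auto)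
 then show ?thesis using vector_derivative_unique_at[OF _ has_vector_derivative_const[of 0]] by blast
qed

lemma compactly_supported_seq:
 assumes "smooth_seq F" "compactly_supported S (F 0)"
 shows "compactly_supported S (F k)"
proof -
 obtain K where K: "compact K" "K \<subseteq> S" "\<forall>x. x \<notin> K \<longrightarrow> F 0 x = 0" using assms by (auto simp: compactly_supported_def)
 have "\<forall>x. x \<notin> K \<longrightarrow> F k x = 0"
 proof (induction k)
  case (Suc k) then show ?case using deriv_zero_off_support[OF K(1)] assms(1) unfolding smooth_seq_def by blast
 qed (rule K)
 then show ?thesis using K by (auto simp: compactly_supported_def)
qed

lemma set_lebesgue_switch:
 fixes f :: "real \<Rightarrow> complex"
 assumes "K \<subseteq> S" "\<And>x. x \<notin> K \<Longrightarrow> f x = 0"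
 shows "(LINT x:S|lebesgue. f x) = (LINT x:K|lebesgue. f x)" "set_integrable lebesgue S f = set_integrable lebesgue K f"
proof -
 have "(\<lambda>x. indicator S x *\<^sub>R f x) = (\<lambda>x. indicator K x *\<^sub>R f x)" using assms by (auto simp: indicator_def fun_eq_iff)
 then show "(LINT x:S|lebesgue. f x) = (LINT x:K|lebesgue. f x)" "set_integrable lebesgue S f = set_integrable lebesgue K f"
  by (simp_all add: set_lebesgue_integral_def set_integrable_def)
qed

lemma continuous_lebesgue_measurable:
 fixes f :: "real \<Rightarrow> complex" shows "continuous_on UNIV f \<Longrightarrow> f \<in> borel_measurable lebesgue"
 by (rule measurable_completion) (simp add: borel_measurable_continuous_onI)

lemma set_integrable_continuous_mult:
 assumes u: "set_integrable lebesgue K u" and f: "continuous_on UNIV (f :: real \<Rightarrow> complex)" and K: "bounded (f ` K)"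
 shows "set_integrable lebesgue K (\<lambda>x. f x * u x)"
proof -
 obtain M where M: "\<And>x. x \<in> K \<Longrightarrow> cmod (f x) \<le> M" "M > 0" using K by (auto simp: bounded_pos)
 have "set_integrable lebesgue K (\<lambda>x. of_real M * u x)" using u by simp
 then show ?thesis
 proof (rule set_integrable_bound)
  have "(\<lambda>x. indicator K x *\<^sub>R u x) \<in> borel_measurable lebesgue" using u unfolding set_integrable_def by (rule borel_measurable_integrable)
  from borel_measurable_times[OF continuous_lebesgue_measurable[OF f] this]
  show "set_borel_measurable lebesgue K (\<lambda>x. f x * u x)" by (simp add: set_borel_measurable_def mult.left_commute)
  show "AE x in lebesgue. x \<in> K \<longrightarrow> norm (f x * u x) \<le> norm (of_real M * u x)"
   using M by (auto simp: norm_mult intro!: mult_right_mono)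
 qed
qed

lemma set_integrable_supported:
 assumes "locally_integrable_on S u" "continuous_on UNIV f" "compactly_supported S f"
 shows "set_integrable lebesgue S (\<lambda>x. f x * u x)"
proof -
 obtain K where K: "compact K" "K \<subseteq> S" "\<And>x. x \<notin> K \<Longrightarrow> f x = 0" using assms by (auto simp: compactly_supported_def)
 have "set_integrable lebesgue K u" using assms K by (auto simp: locally_integrable_on_def)
 moreover have "bounded (f ` K)"
  by (rule compact_imp_bounded[OF compact_continuous_image[OF continuous_on_subset[OF assms(2)] K(1)]]) auto
 ultimately have "set_integrable lebesgue K (\<lambda>x. f x * u x)" using assms(2) by (intro set_integrable_continuous_mult)
 then show ?thesis using set_lebesgue_switch(2)[OF K(2), of "\<lambda>x. f x * u x"] K(3) by simp
qed

lemma test_function_Re: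
 assumes F: "smooth_seq F" and c: "compactly_supported S (F 0)"
 shows "test_function_on S (\<lambda>x. Re (F 0 x))" "(deriv ^^ k) (\<lambda>x. Re (F 0 x)) = (\<lambda>x. Re (F k x))"
proof -
 have d: "((\<lambda>x. Re (F k x)) has_real_derivative Re (F (Suc k) x)) (at x)" for k x
  using F bounded_linear.has_vector_derivative[OF bounded_linear_Re] unfolding smooth_seq_def has_real_derivative_iff_has_vector_derivative by blast
 have D: "(deriv ^^ k) (\<lambda>x. Re (F 0 x)) = (\<lambda>x. Re (F k x))" for k
 proof (induction k)
  case (Suc k)
  then have "(deriv ^^ Suc k) (\<lambda>x. Re (F 0 x)) = deriv (\<lambda>x. Re (F k x))" by simp
  also have "\<dots> = (\<lambda>x. Re (F (Suc k) x))" by (rule ext, rule DERIV_imp_deriv[OF d])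
  finally show ?case .
 qed simp
 show "(deriv ^^ k) (\<lambda>x. Re (F 0 x)) = (\<lambda>x. Re (F k x))" by (rule D)
 show "test_function_on S (\<lambda>x. Re (F 0 x))"
  unfolding test_function_on_def D using d c by (auto simp: field_differentiable_def compactly_supported_def)
qed

lemma test_function_smooth:
 assumes "test_function_on S \<phi>"
 shows "smooth_seq (\<lambda>k x. of_real ((deriv ^^ k) \<phi> x))" "compactly_supported S (\<lambda>x. of_real (\<phi> x))"
proof -
 show "compactly_supported S (\<lambda>x. of_real (\<phi> x))" using assms by (auto simp: test_function_on_def compactly_supported_def)
 show "smooth_seq (\<lambda>k x. of_real ((deriv ^^ k) \<phi> x))" unfolding smooth_seq_def
 proof (intro allI)
  fix k x
  have "((deriv ^^ k) \<phi> has_real_derivative (deriv ^^ Suc k) \<phi> x) (at x)"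
   using assms by (auto simp: test_function_on_def dest!: spec[of _ k] intro: DERIV_deriv_iff_field_differentiable[THEN iffD2])
  from bounded_linear.has_vector_derivative[OF bounded_linear_of_real[where 'a = complex] this[unfolded has_real_derivative_iff_has_vector_derivative]]
  show "((\<lambda>x. of_real ((deriv ^^ k) \<phi> x) :: complex) has_vector_derivative of_real ((deriv ^^ Suc k) \<phi> x)) (at x)" .
 qed
qed

text \<open>Weak derivatives are defined by real test functions. Splitting
  \<open>f = Re f + \<i> * Re (- \<i> * f)\<close> admits complex ones, such as products with
  solutions of Airy's equation.\<close>

lemma weak_deriv_complex_test:
 assumes w: "is_weak_deriv S n u v" and F: "smooth_seq F" "compactly_supported S (F 0)"
 shows "(LINT x:S|lebesgue. F n x * u x) = (- 1)^n * (LINT x:S|lebesgue. F 0 x * v x)"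
proof -
 have li: "locally_integrable_on S u" "locally_integrable_on S v" using w by (auto simp: is_weak_deriv_def)
 have re: "(LINT x:S|lebesgue. Re (F n x) *\<^sub>R u x) = (- 1)^n * (LINT x:S|lebesgue. Re (F 0 x) *\<^sub>R v x)"
  if "smooth_seq F" "compactly_supported S (F 0)" for F
  using w[unfolded is_weak_deriv_def, THEN conjunct2, THEN conjunct2, rule_format, OF test_function_Re(1)[OF that]]
  by (simp only: test_function_Re(2)[OF that])
 have G: "smooth_seq (\<lambda>k x. - \<i> * F k x)" "compactly_supported S (\<lambda>x. - \<i> * F 0 x)"
 proof -
  show "smooth_seq (\<lambda>k x. - \<i> * F k x)"
   using F(1) unfolding smooth_seq_def by (intro allI has_vector_derivative_mult_right) blast
  show "compactly_supported S (\<lambda>x. - \<i> * F 0 x)" using F(2) by (auto simp: compactly_supported_def)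
 qed
 have sp: "(LINT x:S|lebesgue. f x * g x) = (LINT x:S|lebesgue. Re (f x) *\<^sub>R g x) + \<i> * (LINT x:S|lebesgue. Re (- \<i> * f x) *\<^sub>R g x)"
  if "continuous_on UNIV f" "compactly_supported S f" "locally_integrable_on S g" for f g
 proof -
  have s: "compactly_supported S (\<lambda>x. of_real (Re (f x)))" "compactly_supported S (\<lambda>x. of_real (Re (- \<i> * f x)))"
   using that(2) by (auto simp: compactly_supported_def)
  have c: "continuous_on UNIV (\<lambda>x. of_real (Re (f x)) :: complex)" "continuous_on UNIV (\<lambda>x. of_real (Re (- \<i> * f x)) :: complex)"
   by (intro continuous_intros that(1))+
  note i = set_integrable_supported[OF that(3) c(1) s(1)] set_integrable_supported[OF that(3) c(2) s(2)]
  have "(LINT x:S|lebesgue. f x * g x) = (LINT x:S|lebesgue. of_real (Re (f x)) * g x + \<i> * (of_real (Re (- \<i> * f x)) * g x))"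
  proof (intro arg_cong[where f = "set_lebesgue_integral lebesgue S"] ext)
   fix x
   have "f x = of_real (Re (f x)) + \<i> * of_real (Re (- \<i> * f x))" by (simp add: complex_eq_iff)
   then show "f x * g x = of_real (Re (f x)) * g x + \<i> * (of_real (Re (- \<i> * f x)) * g x)" by (metis distrib_right mult.assoc)
  qed
  also have "\<dots> = (LINT x:S|lebesgue. of_real (Re (f x)) * g x) + \<i> * (LINT x:S|lebesgue. of_real (Re (- \<i> * f x)) * g x)"
   by (subst set_integral_add(2)[OF i(1) set_integrable_mult_right[OF i(2)]]) (simp only: set_integral_mult_right)
  finally show ?thesis by (simp only: scaleR_conv_of_real)
 qed
 have "(LINT x:S|lebesgue. F n x * u x) = (- 1)^n * (LINT x:S|lebesgue. Re (F 0 x) *\<^sub>R v x)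
   + \<i> * ((- 1)^n * (LINT x:S|lebesgue. Re (- \<i> * F 0 x) *\<^sub>R v x))"
  using sp[OF smooth_seq_continuous[OF F(1)] compactly_supported_seq[OF F] li(1), of n] re[OF F] re[OF G] by (simp only:)
 also have "\<dots> = (- 1)^n * (LINT x:S|lebesgue. F 0 x * v x)"
  using sp[OF smooth_seq_continuous[OF F(1)] F(2) li(2)] by (simp only: distrib_left mult.left_commute)
 finally show ?thesis .
qed

lemma integration_by_parts_supported:
 fixes g g' f f' :: "real \<Rightarrow> complex"
 assumes S: "is_interval S" and g: "\<And>x. (g has_vector_derivative g' x) (at x)" "continuous_on UNIV g'" "compactly_supported S g"
  and f: "\<And>x. x \<in> S \<Longrightarrow> (f has_vector_derivative f' x) (at x)" "continuous_on S f'"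
 shows "(LINT x:S|lebesgue. g' x * f x) = - (LINT x:S|lebesgue. g x * f' x)"
proof -
 obtain K where K: "compact K" "K \<subseteq> S" "\<And>x. x \<notin> K \<Longrightarrow> g x = 0" using g(3) by (auto simp: compactly_supported_def)
 show ?thesis
 proof (cases "K = {}")
  case True
  then have "g x = 0" "g' x = 0" for x using K deriv_zero_off_support[OF K(1,3) g(1)] by auto
  then show ?thesis by simp
 next
  case False
  obtain a where a: "a \<in> K" "\<And>x. x \<in> K \<Longrightarrow> a \<le> x" using compact_attains_inf[OF K(1) False] by auto
  obtain b where b: "b \<in> K" "\<And>x. x \<in> K \<Longrightarrow> x \<le> b" using compact_attains_sup[OF K(1) False] by auto
  have ab: "a \<le> b" using a b by auto
  have sub: "{a..b} \<subseteq> S"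
  proof
   fix x assume "x \<in> {a..b}"
   then show "x \<in> S" using mem_is_interval_1_I[OF S, of a b x] a(1) b(1) K(2) by auto
  qed
  have o: "g x = 0" "g' x = 0" if "x \<notin> {a..b}" for x
  proof -
   have "x \<notin> K" using that a b by auto
   then show "g x = 0" "g' x = 0" using K(3) deriv_zero_off_support[OF K(1,3) g(1)] by auto
  qed
  have cont: "isCont g x" for x using has_vector_derivative_continuous[OF g(1)[of x]] .
  have l: "(g \<longlongrightarrow> g x) (at x within T)" for x T
   using cont[of x] by (simp add: isCont_def tendsto_within_subset[OF _ subset_UNIV])
  \<comment> \<open>The end points belong to the support set \<open>K\<close>, so \<open>g\<close>
    vanishes there only as a limit from outside the interval.\<close>
  have za: "(g \<longlongrightarrow> 0) (at_left a)" by (rule tendsto_eventually) (use o(1) in \<open>simp add: eventually_at_filter\<close>)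
  have zb: "(g \<longlongrightarrow> 0) (at_right b)" by (rule tendsto_eventually) (use o(1) in \<open>simp add: eventually_at_filter\<close>)
  have g0: "g a = 0" "g b = 0" using tendsto_unique[OF _ l za] tendsto_unique[OF _ l zb] by simp_all
  have cg: "continuous_on {a..b} g" using cont by (auto intro: continuous_at_imp_continuous_on)
  have cf: "continuous_on {a..b} f"
  proof (rule continuous_at_imp_continuous_on, rule ballI)
   fix x assume "x \<in> {a..b}"
   then show "isCont f x" using sub by (intro has_vector_derivative_continuous[OF f(1)]) auto
  qed
  have cg': "continuous_on {a..b} g'" "continuous_on {a..b} f'" using g(2) f(2) sub by (auto intro: continuous_on_subset)
  have i: "set_integrable lebesgue {a..b} (\<lambda>x. g' x * f x)" "set_integrable lebesgue {a..b} (\<lambda>x. g x * f' x)"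
   by (intro absolutely_integrable_continuous_real continuous_intros cg cf cg')+
  have 1: "(LINT x:S|lebesgue. g' x * f x) = integral {a..b} (\<lambda>x. g' x * f x)"
   using set_lebesgue_switch(1)[OF sub, of "\<lambda>x. g' x * f x"] o set_lebesgue_integral_eq_integral(2)[OF i(1)] by simp
  have 2: "(LINT x:S|lebesgue. g x * f' x) = integral {a..b} (\<lambda>x. g x * f' x)"
   using set_lebesgue_switch(1)[OF sub, of "\<lambda>x. g x * f' x"] o set_lebesgue_integral_eq_integral(2)[OF i(2)] by simp
  have "integral {a..b} (\<lambda>x. g x * f' x + g' x * f x) = g b * f b - g a * f a"
  proof (rule vector_FTC[OF ab])
   fix x assume "x \<in> {a..b}"
   then have "x \<in> S" using sub by auto
   then show "((\<lambda>x. g x * f x) has_vector_derivative g x * f' x + g' x * f x) (at x within {a..b})"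
    by (intro has_vector_derivative_at_within[OF has_vector_derivative_mult] g f)
  qed
  moreover have "integral {a..b} (\<lambda>x. g x * f' x + g' x * f x) = integral {a..b} (\<lambda>x. g x * f' x) + integral {a..b} (\<lambda>x. g' x * f x)"
   by (intro Henstock_Kurzweil_Integration.integral_add integrable_continuous_real continuous_intros cg cf cg')
  ultimately show ?thesis unfolding 1 2 g0 by (simp add: eq_neg_iff_add_eq_0 add.commute)
 qed
qed

lemma continuous_imp_locally_integrable:
 assumes "continuous_on S f" shows "locally_integrable_on S f" unfolding locally_integrable_on_def
proof (intro allI impI, elim conjE)
 fix K assume K: "compact K" "K \<subseteq> S"
 have c: "continuous_on K f" by (rule continuous_on_subset[OF assms K(2)])
 have m: "(\<lambda>x. indicator K x *\<^sub>R f x) \<in> borel_measurable borel"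
  using K c by (intro borel_measurable_continuous_on_indicator) (auto intro: borel_compact)
 have "integrable lborel (\<lambda>x. indicator K x *\<^sub>R f x)" by (rule borel_integrable_compact[OF K(1) c])
 then show "set_integrable lebesgue K f"
  unfolding set_integrable_def by (rule iffD2[OF integrable_completion, rotated]) (use m in simp)
qed

lemma is_weak_deriv_classical:
 assumes S: "is_interval S"
  and d: "\<And>k x. k < n \<Longrightarrow> x \<in> S \<Longrightarrow> (f k has_vector_derivative f (Suc k) x) (at x)"
  and c: "\<And>k. k \<le> n \<Longrightarrow> continuous_on S (f k)"
 shows "is_weak_deriv S n (f 0) (f n)"
proof -
 have main: "(LINT x:S|lebesgue. F m x * f 0 x) = (- 1)^m * (LINT x:S|lebesgue. F 0 x * f m x)"
  if F: "smooth_seq F" "compactly_supported S (F 0)" and m: "m \<le> n" for m F using m F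
 proof (induction m arbitrary: F)
  case 0 then show ?case by simp
 next
  case (Suc m)
  have G: "smooth_seq (\<lambda>k. F (Suc k))" "compactly_supported S (F (Suc 0))"
   using smooth_seq_Suc compactly_supported_seq Suc.prems by auto
  have "(LINT x:S|lebesgue. F (Suc m) x * f 0 x) = (- 1)^m * (LINT x:S|lebesgue. F (Suc 0) x * f m x)"
   using Suc.IH[OF _ G] Suc.prems by simp
  also have "(LINT x:S|lebesgue. F (Suc 0) x * f m x) = - (LINT x:S|lebesgue. F 0 x * f (Suc m) x)"
   by (rule integration_by_parts_supported[OF S])
    (use Suc.prems d c smooth_seq_continuous in \<open>auto simp: smooth_seq_def\<close>)
  finally show ?case by simp
 qed
 show ?thesis unfolding is_weak_deriv_def
 proof (intro conjI allI impI)
  show "locally_integrable_on S (f 0)" "locally_integrable_on S (f n)"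
   using c by (auto intro: continuous_imp_locally_integrable)
  fix \<phi> assume "test_function_on S \<phi>"
  then show "(LINT x:S|lebesgue. (deriv ^^ n) \<phi> x *\<^sub>R f 0 x) = (- 1)^n * (LINT x:S|lebesgue. \<phi> x *\<^sub>R f n x)"
   using main[of "\<lambda>k x. of_real ((deriv ^^ k) \<phi> x)" n] test_function_smooth by (simp add: scaleR_conv_of_real)
 qed
qed

section \<open>The fundamental lemma of the calculus of variations\<close>

lemma ae_zero_of_interval_integrals:
 fixes f :: "real \<Rightarrow> real"
 assumes f: "integrable lebesgue f" and z: "(LINT x|lebesgue. f x) = 0"
  and i: "\<And>c d. (LINT x:{c<..<d}|lebesgue. f x) = 0"
 shows "AE x in lebesgue. f x = 0"
proof -
 let ?G = "range (\<lambda>(a, b). box a b :: real set)"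
 have fs: "set_integrable lebesgue A f" if "A \<in> sets lebesgue" for A
  unfolding set_integrable_def using integrable_mult_indicator[OF that f] by simp
 have sb: "sets borel = sigma_sets UNIV ?G" by (subst borel_eq_box) simp
 \<comment> \<open>Dynkin's argument: open boxes generate the Borel sets and are stable under
   intersection, and the vanishing total integral handles complements.\<close>
 have B: "(LINT x:A|lebesgue. f x) = 0" if "A \<in> sets borel" for A
 proof -
  have st: "Int_stable ?G"
  proof (rule Int_stableI)
   fix a b assume "a \<in> ?G" "b \<in> ?G"
   then obtain p q r s where "a = {p<..<q}" "b = {r<..<s}" by (auto simp: box_real)
   then have "a \<inter> b = box (max p r) (min q s)" by (auto simp: box_real)
   then show "a \<inter> b \<in> ?G" by auto
  qed
  have "?G \<subseteq> Pow UNIV" "A \<in> sigma_sets UNIV ?G" using that sb by simp_all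
  with st show ?thesis
  proof (induction rule: sigma_sets_induct_disjoint)
   case (basic A) then show ?case using i by (auto simp: box_real)
  next
   case (compl A)
   then have A: "A \<in> sets lebesgue" using sb by auto
   have "(LINT x:UNIV|lebesgue. f x) = (LINT x:A \<union> (UNIV - A)|lebesgue. f x)" by (simp add: Un_absorb1)
   also have "\<dots> = (LINT x:A|lebesgue. f x) + (LINT x:UNIV - A|lebesgue. f x)"
    by (rule set_integral_Un[OF _ fs[OF A] fs]) (use A in \<open>auto intro: sets.Diff\<close>)
   finally show ?case using z compl by (simp add: set_lebesgue_integral_def)
  next
   case (union A)
   then have "A i \<in> sets borel" for i unfolding sb by blast
   then have A: "A i \<in> sets lebesgue" for i by auto
   then have "(LINT x:(\<Union>i. A i)|lebesgue. f x) = (\<Sum>i. (LINT x:(A i)|lebesgue. f x))"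
    using union by (intro lebesgue_integral_countable_add fs) (auto simp: disjoint_family_on_def)
   then show ?case using union by simp
  qed (auto simp: set_lebesgue_integral_def)
 qed
 have L: "(LINT x:A|lebesgue. f x) = 0" if AL: "A \<in> sets lebesgue" for A
 proof -
  obtain S N N' where A: "A = S \<union> N" "N \<subseteq> N'" "N' \<in> null_sets lborel" "S \<in> sets lborel"
   using AL by (rule sets_completionE)
  have "N' \<in> null_sets lebesgue" using A(3) by (rule null_sets_completionI)
  then have "AE x in lebesgue. x \<in> A \<longleftrightarrow> x \<in> S" using A by (auto simp: AE_not_in elim!: eventually_mono[OF AE_not_in])
  then have "(LINT x:A|lebesgue. f x) = (LINT x:S|lebesgue. f x)"
   unfolding set_lebesgue_integral_def using fs[OF AL] fs[of S] A(4)
   by (intro integral_cong_AE) (auto simp: set_integrable_def borel_measurable_integrable indicator_def elim!: eventually_mono)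
  then show ?thesis using B[of S] A(4) by simp
 qed
 \<comment> \<open>All set integrals of \<open>f\<close> now agree with those of 0, and an
   integrable density is determined almost everywhere by its set integrals.\<close>
 show ?thesis using density_unique_real[of lebesgue f "\<lambda>_. 0"] f L by simp
qed

text \<open>The cutoffs converge boundedly to the indicator of an interval, so dominated convergence
  turns vanishing test integrals into vanishing interval integrals. Real and imaginary parts are
  then treated separately.\<close>

lemma ae_zero_of_test_integrals:
 assumes S: "open S" and k: "locally_integrable_on S k"
  and t: "\<And>f. smooth f \<Longrightarrow> compactly_supported S f \<Longrightarrow> (LINT x:S|lebesgue. f x * k x) = 0"
 shows "ae_eq_on S k (\<lambda>x. 0)"
proof -
 have int: "(LINT x:{a<..<b}|lebesgue. k x) = 0" if ab: "{a..b} \<subseteq> S" for a b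
 proof -
  obtain \<phi> where \<phi>: "\<And>n. smooth (\<phi> n)" "\<And>n x. x \<notin> {a<..<b} \<Longrightarrow> \<phi> n x = 0"
   "\<And>n x. cmod (\<phi> n x) \<le> 1" "\<And>x. x \<in> {a<..<b} \<Longrightarrow> (\<lambda>n. \<phi> n x) \<longlonglongrightarrow> 1" using interval_cutoffs[of a b] by metis
  have kab: "set_integrable lebesgue {a..b} k" using k ab by (auto simp: locally_integrable_on_def)
  have s0: "(LINT x:{a..b}|lebesgue. \<phi> n x * k x) = 0" for n
  proof -
   have "compactly_supported S (\<phi> n)"
    unfolding compactly_supported_def using ab \<phi>(2) by (intro exI[of _ "{a..b}"]) auto
   from t[OF \<phi>(1) this] show ?thesis
    using set_lebesgue_switch(1)[OF ab, of "\<lambda>x. \<phi> n x * k x"] \<phi>(2)[of _ n] by fastforce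
  qed
  have m: "(\<lambda>x. indicator {a..b} x *\<^sub>R k x) \<in> borel_measurable lebesgue"
   using kab unfolding set_integrable_def by (rule borel_measurable_integrable)
  have "(\<lambda>n. LINT x|lebesgue. indicator {a..b} x *\<^sub>R (\<phi> n x * k x)) \<longlonglongrightarrow> (LINT x|lebesgue. indicator {a<..<b} x *\<^sub>R k x)"
  proof (rule integral_dominated_convergence[where w = "\<lambda>x. norm (indicator {a..b} x *\<^sub>R k x)"])
   have "(\<lambda>x. indicator {a<..<b} x *\<^sub>R (indicator {a..b} x *\<^sub>R k x)) \<in> borel_measurable lebesgue"
    by (rule borel_measurable_scaleR[OF borel_measurable_indicator m]) simp
   moreover have "(\<lambda>x. indicator {a<..<b} x *\<^sub>R (indicator {a..b} x *\<^sub>R k x)) = (\<lambda>x. indicator {a<..<b} x *\<^sub>R k x)"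
    by (auto simp: indicator_def fun_eq_iff)
   ultimately show "(\<lambda>x. indicator {a<..<b} x *\<^sub>R k x) \<in> borel_measurable lebesgue" by simp
   fix n
   have "(\<lambda>x. \<phi> n x * (indicator {a..b} x *\<^sub>R k x)) \<in> borel_measurable lebesgue"
    by (rule borel_measurable_times[OF continuous_lebesgue_measurable[OF smooth_continuous[OF \<phi>(1)]] m])
   then show "(\<lambda>x. indicator {a..b} x *\<^sub>R (\<phi> n x * k x)) \<in> borel_measurable lebesgue" by (simp add: mult.left_commute)
   show "integrable lebesgue (\<lambda>x. norm (indicator {a..b} x *\<^sub>R k x))" using kab unfolding set_integrable_def by (rule integrable_norm)
   show "AE x in lebesgue. (\<lambda>n. indicator {a..b} x *\<^sub>R (\<phi> n x * k x)) \<longlonglongrightarrow> indicator {a<..<b} x *\<^sub>R k x"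
   proof (rule AE_I2)
    fix x
    show "(\<lambda>n. indicator {a..b} x *\<^sub>R (\<phi> n x * k x)) \<longlonglongrightarrow> indicator {a<..<b} x *\<^sub>R k x"
    proof (cases "x \<in> {a<..<b}")
     case True
     have "(\<lambda>n. \<phi> n x * k x) \<longlonglongrightarrow> 1 * k x" by (intro tendsto_mult \<phi>(4)[OF True] tendsto_const)
     then show ?thesis using True by simp
    next
     case False then show ?thesis using \<phi>(2)[OF False] by simp
    qed
   qed
   show "AE x in lebesgue. norm (indicator {a..b} x *\<^sub>R (\<phi> n x * k x)) \<le> norm (indicator {a..b} x *\<^sub>R k x)"
    using \<phi>(3)[of n] by (auto simp: norm_mult indicator_def intro!: mult_left_le_one_le)
  qed
  then have "(\<lambda>n. 0) \<longlonglongrightarrow> (LINT x|lebesgue. indicator {a<..<b} x *\<^sub>R k x)"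
   using s0 by (simp add: set_lebesgue_integral_def)
  then show ?thesis unfolding set_lebesgue_integral_def by (simp add: LIMSEQ_const_iff)
 qed
 have loc: "AE x in lebesgue. x \<in> {p<..<q} \<longrightarrow> k x = 0" if pq: "{p..q} \<subseteq> S" for p q
 proof -
  have "set_integrable lebesgue {p..q} k" using k pq by (auto simp: locally_integrable_on_def)
  then have "set_integrable lebesgue {p<..<q} k" by (rule set_integrable_subset) auto
  then have I: "integrable lebesgue (\<lambda>x. indicator {p<..<q} x *\<^sub>R k x)" by (simp add: set_integrable_def)
  have zero: "(LINT x:A|lebesgue. indicator {p<..<q} x *\<^sub>R k x) = 0"
   if A: "A = UNIV \<or> (\<exists>c d. A = {c<..<d})" for A
  proof -
   obtain c d where "A \<inter> {p<..<q} = {c<..<d}" "{c..d} \<subseteq> S"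
   proof -
    from A show thesis
    proof (elim disjE exE)
     assume "A = UNIV" then show thesis using pq by (intro that[of p q]) auto
    next
     fix c d assume "A = {c<..<d}"
     then show thesis using pq by (intro that[of "max c p" "min d q"]) auto
    qed
   qed
   then have "(LINT x:A \<inter> {p<..<q}|lebesgue. k x) = 0" using int by simp
   moreover have "(\<lambda>x. indicator A x *\<^sub>R (indicator {p<..<q} x *\<^sub>R k x)) = (\<lambda>x. indicator (A \<inter> {p<..<q}) x *\<^sub>R k x)"
    by (auto simp: indicator_def fun_eq_iff)
   ultimately show ?thesis by (simp add: set_lebesgue_integral_def)
  qed
  define g where "g x = indicator {p<..<q} x *\<^sub>R k x" for x
  note I = I[folded g_def] and zero = zero[folded g_def]
  have part: "AE x in lebesgue. T (g x) = 0" if T: "bounded_linear T" for T :: "complex \<Rightarrow> real"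
  proof (rule ae_zero_of_interval_integrals)
   have TI: "T (LINT x:A|lebesgue. g x) = (LINT x:A|lebesgue. T (g x))"
    if "A \<in> sets lebesgue" for A
   proof -
    have "integrable lebesgue (\<lambda>x. indicator A x *\<^sub>R (g x))" by (rule integrable_mult_indicator[OF that I])
    from integral_bounded_linear[OF T this] show ?thesis
     by (simp add: set_lebesgue_integral_def linear_simps[OF T])
   qed
   show "integrable lebesgue (\<lambda>x. T (g x))" by (rule integrable_bounded_linear[OF T I])
   show "(LINT x|lebesgue. T (g x)) = 0"
    using TI[of UNIV] zero[of UNIV] linear_simps(3)[OF T] by (simp add: set_lebesgue_integral_def)
   show "(LINT x:{c<..<d}|lebesgue. T (g x)) = 0" for c d
    using TI[of "{c<..<d}"] zero[OF disjI2, OF exI, OF exI, OF refl, of c d] linear_simps(3)[OF T] by auto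
  qed
  show ?thesis using part[OF bounded_linear_Re] part[OF bounded_linear_Im]
   by eventually_elim (auto simp: complex_eq_iff g_def)
 qed
 \<comment> \<open>Only countably many exceptional null sets may be united, hence the covering of
   \<open>S\<close> by intervals with rational end points.\<close>
 have "AE x in lebesgue. \<forall>(p, q) \<in> {(p, q). p \<in> \<rat> \<and> q \<in> \<rat> \<and> {p..q} \<subseteq> S}. x \<in> {p<..<q} \<longrightarrow> k x = 0"
 proof (subst AE_ball_countable)
  have "countable (\<rat> \<times> \<rat> :: (real \<times> real) set)" by (simp add: countable_rat)
  then show "countable {(p, q). p \<in> \<rat> \<and> q \<in> \<rat> \<and> {p..q} \<subseteq> S}" by (rule countable_subset[rotated]) auto
 qed (use loc in auto)
 then show ?thesis unfolding ae_eq_on_def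
 proof eventually_elim
  case (elim x)
  show ?case
  proof
   assume x: "x \<in> S"
   then obtain e where e: "e > 0" "ball x e \<subseteq> S" using S by (meson openE)
   obtain p where p: "p \<in> \<rat>" "x - e < p" "p < x" using Rats_dense_in_real[of "x - e" x] e by auto
   obtain q where q: "q \<in> \<rat>" "x < q" "q < x + e" using Rats_dense_in_real[of x "x + e"] e by auto
   have "{p..q} \<subseteq> ball x e" using p q by (auto simp: dist_real_def)
   then have "(p, q) \<in> {(p, q). p \<in> \<rat> \<and> q \<in> \<rat> \<and> {p..q} \<subseteq> S}" using p q e by auto
   with elim p q show "k x = 0" by fastforce
  qed
 qed
qed

lemma locally_integrable_diff:
 "locally_integrable_on S u \<Longrightarrow> locally_integrable_on S v \<Longrightarrow> locally_integrable_on S (\<lambda>x. u x - v x)"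
 by (auto simp: locally_integrable_on_def)

lemma is_weak_deriv_unique:
 assumes "open S" "is_weak_deriv S n u v" "is_weak_deriv S n u v'"
 shows "ae_eq_on S v v'"
proof -
 have li: "locally_integrable_on S v" "locally_integrable_on S v'" using assms by (auto simp: is_weak_deriv_def)
 have "ae_eq_on S (\<lambda>x. v x - v' x) (\<lambda>x. 0)"
 proof (rule ae_zero_of_test_integrals[OF assms(1) locally_integrable_diff[OF li]])
  fix f assume f: "smooth f" "compactly_supported S f"
  then obtain F where F: "smooth_seq F" "F 0 = f" by (auto simp: smooth_def)
  have eq: "(- 1)^n * (LINT x:S|lebesgue. f x * v x) = (- 1)^n * (LINT x:S|lebesgue. f x * v' x)"
   using weak_deriv_complex_test[OF assms(2) F(1)] weak_deriv_complex_test[OF assms(3) F(1)] F f by simp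
  note i = set_integrable_supported[OF li(1) smooth_continuous[OF f(1)] f(2)] set_integrable_supported[OF li(2) smooth_continuous[OF f(1)] f(2)]
  show "(LINT x:S|lebesgue. f x * (v x - v' x)) = 0" using set_integral_diff(2)[OF i] eq by (simp add: right_diff_distrib)
 qed
 then show ?thesis by (simp add: ae_eq_on_def)
qed

lemma weak_deriv_ae:
 assumes "open S" "is_weak_deriv S n u v"
 shows "is_weak_deriv S n u (weak_deriv S n u)" "ae_eq_on S (weak_deriv S n u) v"
proof -
 show 1: "is_weak_deriv S n u (weak_deriv S n u)" unfolding weak_deriv_def by (rule someI[of "is_weak_deriv S n u", OF assms(2)])
 show "ae_eq_on S (weak_deriv S n u) v" by (rule is_weak_deriv_unique[OF assms(1) 1 assms(2)])
qed

lemma test_integral_cong_ae: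
 assumes ae: "ae_eq_on S u u'" and li: "locally_integrable_on S u" "locally_integrable_on S u'"
  and f: "continuous_on UNIV f" "compactly_supported S f"
 shows "(LINT x:S|lebesgue. f x * u x) = (LINT x:S|lebesgue. f x * u' x)"
 unfolding set_lebesgue_integral_def
proof (rule integral_cong_AE)
 show "(\<lambda>x. indicator S x *\<^sub>R (f x * u x)) \<in> borel_measurable lebesgue" "(\<lambda>x. indicator S x *\<^sub>R (f x * u' x)) \<in> borel_measurable lebesgue"
  using set_integrable_supported[OF li(1) f] set_integrable_supported[OF li(2) f] by (simp_all only: set_integrable_def borel_measurable_integrable)
 show "AE x in lebesgue. indicator S x *\<^sub>R (f x * u x) = indicator S x *\<^sub>R (f x * u' x)"
  using ae unfolding ae_eq_on_def by eventually_elim (auto simp: indicator_def)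
qed

text \<open>\<open>weak_deriv\<close> returns an arbitrary representative. A function built from it
  equals a classical one only up to a null set, and its weak derivatives have to be transferred, as
  in the second differentiation inside \<open>OS_op\<close>.\<close>

lemma is_weak_deriv_cong_ae:
 assumes ae: "ae_eq_on S u u'" and li: "locally_integrable_on S u" and w: "is_weak_deriv S n u' v"
 shows "is_weak_deriv S n u v" unfolding is_weak_deriv_def
proof (intro conjI allI impI)
 show "locally_integrable_on S v" using w by (simp add: is_weak_deriv_def)
 have li': "locally_integrable_on S u'" using w by (simp add: is_weak_deriv_def)
 fix \<phi> assume t: "test_function_on S \<phi>"
 let ?f = "\<lambda>x. of_real ((deriv ^^ n) \<phi> x) :: complex"
 have f: "continuous_on UNIV ?f" "compactly_supported S ?f"
  using smooth_seq_continuous[OF test_function_smooth(1)[OF t], of n] compactly_supported_seq[OF test_function_smooth(1)[OF t], of S n] test_function_smooth(2)[OF t] by simp_all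
 show "(LINT x:S|lebesgue. (deriv ^^ n) \<phi> x *\<^sub>R u x) = (- 1)^n * (LINT x:S|lebesgue. \<phi> x *\<^sub>R v x)"
  using test_integral_cong_ae[OF ae li li' f] w t by (simp add: is_weak_deriv_def scaleR_conv_of_real)
qed (rule li)

lemma continuous_ae_zero:
 fixes f :: "real \<Rightarrow> complex"
 assumes S: "open S" and c: "continuous_on S f" and ae: "ae_eq_on S f (\<lambda>x. 0)" and x: "x \<in> S"
 shows "f x = 0"
proof (rule ccontr)
 assume "f x \<noteq> 0"
 let ?T = "{x \<in> S. f x \<noteq> 0}"
 have "open (S \<inter> f -` (- {0}))" using continuous_open_preimage[OF c S] by auto
 moreover have "S \<inter> f -` (- {0}) = ?T" by auto
 ultimately have T: "open ?T" "?T \<noteq> {}" using x \<open>f x \<noteq> 0\<close> by auto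
 have "AE x in lebesgue. x \<notin> ?T" using ae unfolding ae_eq_on_def by eventually_elim auto
 then have "?T \<in> null_sets lebesgue" using T(1) by (subst AE_iff_null_sets) auto
 then show False using open_not_negligible[OF T] by (simp add: negligible_iff_null_sets)
qed

section \<open>The model operator on the half-line\<close>

lemma exp_decay_integrable:
 fixes c :: real
 assumes c: "c > 0"
 shows "set_integrable lebesgue {-1<..} (\<lambda>x. exp (- (c * (x + 1))))"
proof -
 have "(\<lambda>x. exp (- c * x)) absolutely_integrable_on {-1..}"
  by (intro nonnegative_absolutely_integrable_1 integrable_on_exp_minus_to_infinity c) simp
 then have "set_integrable lebesgue {-1<..} (\<lambda>x. exp (- c) * exp (- c * x))"
  by (intro set_integrable_mult_right set_integrable_subset[where A = "{-1..}" and B = "{-1<..}"]) auto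
 moreover have "(\<lambda>x. exp (- c) * exp (- c * x)) = (\<lambda>x. exp (- (c * (x + 1))))" by (simp add: algebra_simps flip: exp_add)
 ultimately show ?thesis by (simp only:)
qed

lemma continuous_set_borel_measurable:
 fixes f :: "real \<Rightarrow> complex"
 assumes "continuous_on UNIV f" "S \<in> sets lebesgue"
 shows "set_borel_measurable lebesgue S f" unfolding set_borel_measurable_def
 by (rule borel_measurable_scaleR[OF borel_measurable_indicator[OF assms(2)] continuous_lebesgue_measurable[OF assms(1)]])

lemma exp_decay_L2:
 fixes f :: "real \<Rightarrow> complex" and c :: real
 assumes f: "continuous_on UNIV f" and b: "\<And>x. x > -1 \<Longrightarrow> cmod (f x) \<le> C * exp (- (c * (x + 1)))" and c: "c > 0"
 shows "f \<in> L2_on {-1<..}" "set_integrable lebesgue {-1<..} f"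
proof -
 have m: "set_borel_measurable lebesgue {-1<..} f" by (rule continuous_set_borel_measurable[OF f]) simp
 have m2: "set_borel_measurable lebesgue {-1<..} (\<lambda>x. (cmod (f x))^2)"
 proof -
  have "(\<lambda>x. (cmod (indicat_real {-1<..} x *\<^sub>R f x))^2) \<in> borel_measurable lebesgue"
   by (rule borel_measurable_power, rule measurable_compose[OF m[unfolded set_borel_measurable_def]]) simp
  moreover have "(\<lambda>x. (cmod (indicat_real {-1<..} x *\<^sub>R f x))^2) = (\<lambda>x. indicator {-1<..} x *\<^sub>R (cmod (f x))^2)"
   by (auto simp: indicator_def fun_eq_iff)
  ultimately show ?thesis by (simp add: set_borel_measurable_def)
 qed
 have C: "C \<ge> 0" using order_trans[OF norm_ge_zero b[of 0]] by (simp add: zero_le_mult_iff)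
 show "set_integrable lebesgue {-1<..} f"
  by (rule set_integrable_bound[OF set_integrable_mult_right[OF exp_decay_integrable[OF c], of C] m])
   (use b C in auto)
 have "set_integrable lebesgue {-1<..} (\<lambda>x. (cmod (f x))^2)"
 proof (rule set_integrable_bound[OF set_integrable_mult_right[OF exp_decay_integrable[of "2 * c"], of "C^2"] m2])
  have "(cmod (f x))^2 \<le> C^2 * exp (- (2 * c * (x + 1)))" if "x > -1" for x
  proof -
   have "(cmod (f x))^2 \<le> (C * exp (- (c * (x + 1))))^2" by (rule power_mono[OF b[OF that]]) simp
   also have "\<dots> = C^2 * exp (- (2 * c * (x + 1)))" by (simp add: power_mult_distrib flip: exp_double)
   finally show ?thesis .
  qed
  then show "AE x in lebesgue. x \<in> {-1<..} \<longrightarrow> norm ((cmod (f x))^2) \<le> norm (C^2 * exp (- (2 * c * (x + 1))))" by auto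
 qed (use c in auto)
 then show "f \<in> L2_on {-1<..}" using m by (simp add: L2_on_def)
qed

lemma improper_FTC:
 fixes f F :: "real \<Rightarrow> complex"
 assumes F: "\<And>x. (F has_vector_derivative f x) (at x)" and c: "continuous_on UNIV f"
  and i: "set_integrable lebesgue {a<..} f" and l: "(F \<longlongrightarrow> 0) at_top"
 shows "(LINT x:{a<..}|lebesgue. f x) = - F a"
proof -
 have e: "set_integrable lebesgue {a..} f = set_integrable lebesgue {a<..} f" "(LINT x:{a..}|lebesgue. f x) = (LINT x:{a<..}|lebesgue. f x)"
  by (rule set_integrable_discrete_difference[of "{a}"] set_integral_discrete_difference[of "{a}"]; auto)+
 have "((\<lambda>b. LINT x:{a..b}|lebesgue. f x) \<longlongrightarrow> (LINT x:{a..}|lebesgue. f x)) at_top"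
  by (rule tendsto_set_lebesgue_integral_at_top) (use i e in auto)
 moreover have "\<forall>\<^sub>F b in at_top. (LINT x:{a..b}|lebesgue. f x) = F b - F a"
  using eventually_ge_at_top[of a]
 proof eventually_elim
  case (elim b)
  have "set_integrable lebesgue {a..b} f"
   by (rule absolutely_integrable_continuous_real[OF continuous_on_subset[OF c]]) auto
  then show ?case using vector_FTC[OF elim has_vector_derivative_at_within[OF F]] set_lebesgue_integral_eq_integral(2) by metis
 qed
 ultimately have "((\<lambda>b. F b - F a) \<longlongrightarrow> (LINT x:{a..}|lebesgue. f x)) at_top" by (rule Lim_transform_eventually)
 moreover have "((\<lambda>b. F b - F a) \<longlongrightarrow> 0 - F a) at_top" by (intro tendsto_diff l tendsto_const)
 ultimately show ?thesis using tendsto_unique[of at_top] e by force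
qed

text \<open>The scaling is \<open>\<beta> = 1 / h^3\<close> and \<open>x + 1 = h * s\<close>. It
  turns the spectral parameter \<open>nu / h^2\<close> into a shift by \<open>nu\<close> of the Airy
  argument, so that \<open>m\<close> is \<open>tairy\<close> along the ray
  \<open>nu - \<i> * s\<close>.\<close>

locale half_line =
 fixes nu :: complex and h :: real
 assumes h: "h > 0"
begin

definition arg where "arg x = nu - \<i> * of_real ((x + 1) / h)"
definition m where "m x = tairy (arg x)"
definition m1 where "m1 x = (1 / h) *\<^sub>R (- \<i> * tairy' (arg x))"
definition q where "q x = \<i> * of_real (1 / h^3) * of_real (1 + x) - nu / of_real (h^2)"
definition m2 where "m2 x = q x * m x"

lemma dline:
 assumes "\<And>s. (f has_vector_derivative f' s) (at s)"
 shows "((\<lambda>x. f ((x + 1) / h)) has_vector_derivative (1 / h) *\<^sub>R f' ((x + 1) / h)) (at x)"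
proof -
 have "((\<lambda>x. (x + 1) / h) has_real_derivative 1 / h) (at x)"
  by (rule DERIV_cdivide) (auto intro!: derivative_eq_intros)
 from vector_diff_chain_at[OF this[unfolded has_real_derivative_iff_has_vector_derivative] assms] show ?thesis by (simp add: o_def)
qed

lemma dm: "(m has_vector_derivative m1 x) (at x)"
 using dline[OF tairy_along_line(1)] unfolding m_def[abs_def] m1_def arg_def .

lemma q_eq: "of_real (1 / h) * (of_real (1 / h) * (\<i> * of_real ((x + 1) / h) - nu)) = q x"
 using h by (simp add: q_def field_simps power2_eq_square power3_eq_cube)

lemma dm1: "(m1 has_vector_derivative m2 x) (at x)"
proof -
 have "(m1 has_vector_derivative (1 / h) *\<^sub>R ((1 / h) *\<^sub>R ((\<i> * of_real ((x + 1) / h) - nu) * m x))) (at x)"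
  unfolding m1_def[abs_def] m_def arg_def
  by (intro bounded_linear.has_vector_derivative[OF bounded_linear_scaleR_right] dline tairy_along_line(2))
 then show ?thesis by (simp only: m2_def q_eq[symmetric] scaleR_conv_of_real mult.assoc)
qed

lemma cont: "continuous_on UNIV m" "continuous_on UNIV m1" "continuous_on UNIV q" "continuous_on UNIV m2"
proof -
 show 1: "continuous_on UNIV m" "continuous_on UNIV m1"
  using dm dm1 by (auto intro!: continuous_at_imp_continuous_on has_vector_derivative_continuous)
 show 2: "continuous_on UNIV q" unfolding q_def by (intro continuous_intros)
 show "continuous_on UNIV m2" unfolding m2_def by (intro continuous_intros 1 2)
qed

lemma decay:
 obtains C where "\<And>x. x > -1 \<Longrightarrow> cmod (m x) \<le> C * exp (- (2 / h * (x + 1)))"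
  "\<And>x. x > -1 \<Longrightarrow> cmod (m1 x) \<le> C * exp (- (2 / h * (x + 1)))"
proof
 fix x :: real assume x: "x > -1"
 let ?C = "tdecay (cmod nu) * (1 + 1 / h)" and ?e = "exp (- (2 * ((x + 1) / h)))"
 have b: "cmod (m x) \<le> tdecay (cmod nu) * ?e" "cmod (tairy' (arg x)) \<le> tdecay (cmod nu) * ?e"
  using tairy_decay[OF order_refl, of "(x + 1) / h" nu] x h by (simp_all add: m_def arg_def)
 have t: "tdecay (cmod nu) * ?e \<ge> 0" using order_trans[OF norm_ge_zero b(1)] .
 have e: "exp (- (2 / h * (x + 1))) = ?e" by simp
 have C: "?C * ?e = tdecay (cmod nu) * ?e + (1 / h) * (tdecay (cmod nu) * ?e)" by (simp add: algebra_simps)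
 have p: "(1 / h) * (tdecay (cmod nu) * ?e) \<ge> 0" by (rule mult_nonneg_nonneg) (use h t in auto)
 show "cmod (m x) \<le> ?C * exp (- (2 / h * (x + 1)))" unfolding e C using b p by linarith
 have "cmod (m1 x) = (1 / h) * cmod (tairy' (arg x))" using h by (simp add: m1_def norm_mult)
 also have "\<dots> \<le> (1 / h) * (tdecay (cmod nu) * ?e)" using h by (intro mult_left_mono b) auto
 finally show "cmod (m1 x) \<le> ?C * exp (- (2 / h * (x + 1)))" unfolding e C using t by linarith
qed

lemma weighted_L2:
 assumes p: "continuous_on UNIV p" "\<And>x. x > -1 \<Longrightarrow> cmod (p x) \<le> D * (1 + (x + 1))"
 shows "(\<lambda>x. p x * m x) \<in> L2_on {-1<..}"
proof -
 obtain C where C: "\<And>x. x > -1 \<Longrightarrow> cmod (m x) \<le> C * exp (- (2 / h * (x + 1)))" using decay by blast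
 have C0: "C \<ge> 0" using order_trans[OF norm_ge_zero C[of 0]] by (simp add: zero_le_mult_iff)
 have D0: "D \<ge> 0" using order_trans[OF norm_ge_zero p(2)[of 0]] by simp
 show ?thesis
 proof (rule exp_decay_L2(1))
  show "continuous_on UNIV (\<lambda>x. p x * m x)" by (intro continuous_intros p cont)
  show "1 / h > 0" using h by simp
  fix x :: real assume x: "x > -1"
  have "(1 + (x + 1)) * exp (- (2 / h * (x + 1))) \<le> (1 + h) * exp (- (1 / h * (x + 1)))"
  proof -
   have "2 / (2 / h) = h" "2 / h / 2 = 1 / h" using h by simp_all
   then have "(x + 1) * exp (- (2 / h * (x + 1))) \<le> h * exp (- (1 / h * (x + 1)))"
    using mult_exp_le_right[of "2 / h" "x + 1"] h by (simp only: zero_less_divide_iff) simp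
   moreover have "exp (- (2 / h * (x + 1))) \<le> exp (- (1 / h * (x + 1)))"
    unfolding exp_le_cancel_iff using h x by (simp add: divide_right_mono)
   ultimately show ?thesis unfolding distrib_right[of 1] by linarith
  qed
  then have "D * C * ((1 + (x + 1)) * exp (- (2 / h * (x + 1)))) \<le> D * C * ((1 + h) * exp (- (1 / h * (x + 1))))"
   using C0 D0 by (intro mult_left_mono) auto
  moreover have "cmod (p x * m x) \<le> (D * (1 + (x + 1))) * (C * exp (- (2 / h * (x + 1))))"
   unfolding norm_mult by (intro mult_mono p(2) C) (use x D0 in auto)
  ultimately show "cmod (p x * m x) \<le> (D * C * (1 + h)) * exp (- (1 / h * (x + 1)))" by (simp add: mult_ac)
 qed
qed

lemma m_L2: "m \<in> L2_on {-1<..}" "m1 \<in> L2_on {-1<..}" "set_integrable lebesgue {-1<..} m"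
 "m2 \<in> L2_on {-1<..}" "(\<lambda>x. of_real (1 + x) * m x) \<in> L2_on {-1<..}"
proof -
 obtain C where C: "\<And>x. x > -1 \<Longrightarrow> cmod (m x) \<le> C * exp (- (2 / h * (x + 1)))"
  "\<And>x. x > -1 \<Longrightarrow> cmod (m1 x) \<le> C * exp (- (2 / h * (x + 1)))" using decay by blast
 have h2: "2 / h > 0" using h by simp
 show "m \<in> L2_on {-1<..}" "set_integrable lebesgue {-1<..} m" using exp_decay_L2[OF cont(1) C(1) h2] by auto
 show "m1 \<in> L2_on {-1<..}" by (rule exp_decay_L2[OF cont(2) C(2) h2])
 show "(\<lambda>x. of_real (1 + x) * m x) \<in> L2_on {-1<..}"
 proof (rule weighted_L2)
  show "cmod (of_real (1 + x)) \<le> 1 * (1 + (x + 1))" if "x > -1" for x unfolding norm_of_real using that by simp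
 qed (intro continuous_intros)
 have "(\<lambda>x. q x * m x) \<in> L2_on {-1<..}"
 proof (rule weighted_L2[OF cont(3)])
  fix x :: real assume x: "x > -1"
  let ?A = "1 / h^3" and ?M = "cmod (nu / of_real (h^2))"
  have "cmod (\<i> * of_real ?A * of_real (1 + x)) = ?A * (x + 1)" unfolding norm_mult norm_of_real using x h by simp
  then have "cmod (q x) \<le> ?A * (x + 1) + ?M"
   unfolding q_def using norm_triangle_ineq4[of "\<i> * of_real ?A * of_real (1 + x)" "nu / of_real (h^2)"] by simp
  also have "\<dots> \<le> (?A + ?M) * (1 + (x + 1))"
  proof -
   have "?M * (x + 1) \<ge> 0" "?A \<ge> 0" using x h by auto
   then show ?thesis by (simp only: distrib_left distrib_right)
  qed
  finally show "cmod (q x) \<le> (?A + ?M) * (1 + (x + 1))" .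
 qed
 then show "m2 \<in> L2_on {-1<..}" by (simp add: m2_def[abs_def])
qed

text \<open>\<open>eig_fun\<close> is an antiderivative that vanishes at the far end of the ray, so
  the mean of \<open>m\<close> is its value at the wall. This translates the integral condition of
  \<open>L0_dom\<close> into \<open>eig_fun nu = 0\<close>.\<close>

lemma integral_m: "(LINT x:{-1<..}|lebesgue. m x) = \<i> * of_real h * eig_fun nu"
proof -
 let ?F = "\<lambda>x. of_real h * (\<i> * (- eig_fun (arg x)))"
 have d: "(?F has_vector_derivative m x) (at x)" for x
 proof -
  have "((\<lambda>x. of_real h * (\<i> * (- eig_fun (nu - \<i> * of_real ((x + 1) / h))))) has_vector_derivative
   of_real h * ((1 / h) *\<^sub>R tairy (nu - \<i> * of_real ((x + 1) / h)))) (at x)"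
   by (intro has_vector_derivative_mult_right dline tairy_along_line(3))
  then show ?thesis using h by (simp add: m_def arg_def scaleR_conv_of_real)
 qed
 have l: "(?F \<longlongrightarrow> 0) at_top"
 proof (rule Lim_null_comparison)
  let ?C = "h * (2 * tdecay (cmod nu) * exp ((cmod nu + 2)^2 + 1))"
  show "\<forall>\<^sub>F x in at_top. norm (?F x) \<le> ?C * exp (- (2 * ((x + 1) / h)))"
   using eventually_ge_at_top[of 0]
  proof eventually_elim
   case (elim x)
   have "cmod (eig_fun (arg x)) \<le> 2 * tdecay (cmod nu) * exp ((cmod nu + 2)^2 + 1) * exp (- (2 * ((x + 1) / h)))"
    unfolding arg_def by (rule eig_fun_decay) (use elim h in auto)
   from mult_left_mono[OF this, of h] show ?case using h by (simp add: norm_mult mult_ac)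
  qed
  have "((\<lambda>x. exp (- (2 * ((x + 1) / h)))) \<longlongrightarrow> 0) at_top" using h by real_asymp
  from tendsto_mult_right_zero[OF this, of ?C] show "((\<lambda>x. ?C * exp (- (2 * ((x + 1) / h)))) \<longlongrightarrow> 0) at_top" .
 qed
 have "(LINT x:{-1<..}|lebesgue. m x) = - ?F (-1)" by (rule improper_FTC[OF d cont(1) m_L2(3) l])
 then show ?thesis by (simp add: arg_def)
qed

lemma m_nontrivial: "\<not> ae_eq_on {-1<..} m (\<lambda>x. 0)"
proof
 assume "ae_eq_on {-1<..} m (\<lambda>x. 0)"
 then have z: "m x = 0" if "x > -1" for x
  using continuous_ae_zero[of "{-1<..}" m x] continuous_on_subset[OF cont(1)] that by auto
 have "(m has_vector_derivative 0) (at 0)"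
  by (rule has_vector_derivative_transform_within_open[OF has_vector_derivative_const[of 0], of "{-1<..}"]) (use z in auto)
 then have "m1 0 = 0" by (rule vector_derivative_unique_at[OF dm])
 then show False using z[of 0] tairy_nontrivial[of "arg 0"] h by (simp add: m_def m1_def)
qed

lemma weak_m: "is_weak_deriv {-1<..} 0 m m" "is_weak_deriv {-1<..} 1 m m1" "is_weak_deriv {-1<..} 2 m m2"
proof -
 let ?f = "\<lambda>k::nat. if k = 0 then m else if k = 1 then m1 else m2"
 have "is_weak_deriv {-1<..} n (?f 0) (?f n)" if "n \<le> 2" for n
 proof (rule is_weak_deriv_classical)
  show "(?f k has_vector_derivative ?f (Suc k) x) (at x)" if "k < n" for k x
  proof -
   have "k = 0 \<or> k = 1" using that \<open>n \<le> 2\<close> by auto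
   then show ?thesis using dm dm1 by auto
  qed
  show "continuous_on {-1<..} (?f k)" for k using cont by (auto intro: continuous_on_subset)
 qed (simp add: is_interval_oi)
 from this[of 0] this[of 1] this[of 2]
 show "is_weak_deriv {-1<..} 0 m m" "is_weak_deriv {-1<..} 1 m m1" "is_weak_deriv {-1<..} 2 m m2" by auto
qed

lemma eigenvalue_if_zero:
 assumes "eig_fun nu = 0"
 shows "is_eigenvalue {-1<..} L0_dom (L0_op (1 / h^3)) (nu / of_real (h^2))"
proof -
 have "\<exists>v\<in>L2_on {-1<..}. is_weak_deriv {-1<..} k m v" if "k \<le> 2" for k
 proof -
  have "k = 0 \<or> k = 1 \<or> k = 2" using that by auto
  then show ?thesis using weak_m m_L2 by auto
 qed
 then have dom: "m \<in> L0_dom" using m_L2 integral_m assms by (simp add: L0_dom_def sobolev_H_def)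
 have "ae_eq_on {-1<..} (weak_deriv {-1<..} 2 m) m2" by (rule weak_deriv_ae(2)[OF _ weak_m(3)]) simp
 then have "ae_eq_on {-1<..} (\<lambda>x. L0_op (1 / h^3) m x - nu / of_real (h^2) * m x) (\<lambda>x. 0)"
  unfolding ae_eq_on_def by eventually_elim (auto simp: L0_op_def m2_def q_def algebra_simps)
 then show ?thesis unfolding is_eigenvalue_def nontrivial_kernel_def using dom m_nontrivial by blast
qed

end

section \<open>Weak solutions are determined by their Wronskians\<close>

lemma smooth_primitive:
 assumes z: "smooth \<zeta>" "compactly_supported {c<..} \<zeta>" and I: "(LINT x:{c<..}|lebesgue. \<zeta> x) = 0"
 shows "\<exists>g. smooth g \<and> compactly_supported {c<..} g \<and> (\<forall>x. (g has_vector_derivative \<zeta> x) (at x))"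
proof -
 obtain K where K: "compact K" "K \<subseteq> {c<..}" "\<And>x. x \<notin> K \<Longrightarrow> \<zeta> x = 0" using z by (auto simp: compactly_supported_def)
 obtain a b where ab: "c < a" "K \<subseteq> {a..b}"
 proof (cases "K = {}")
  case True then show ?thesis using that[of "c + 1" "c + 1"] by auto
 next
  case False
  obtain a where "a \<in> K" "\<And>x. x \<in> K \<Longrightarrow> a \<le> x" using compact_attains_inf[OF K(1) False] by auto
  moreover obtain b where "b \<in> K" "\<And>x. x \<in> K \<Longrightarrow> x \<le> b" using compact_attains_sup[OF K(1) False] by auto
  ultimately have "c < a" "K \<subseteq> {a..b}" using K(2) by auto
  then show ?thesis by (rule that)
 qed
 have o: "\<zeta> x = 0" if "x \<notin> {a..b}" for x using K(3) ab(2) that by blast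
 have cz: "continuous_on S \<zeta>" for S using continuous_on_subset[OF smooth_continuous[OF z(1)]] by simp
 define g where "g x = integral {c..x} \<zeta>" for x
 have ga: "g x = 0" if "x < a" for x
 proof -
  have "integral {c..x} \<zeta> = integral {c..x} (\<lambda>x. 0)" by (rule integral_cong) (use that o in auto)
  then show ?thesis by (simp add: g_def)
 qed
 have gb: "g x = 0" if "x > b" for x
 proof (cases "x < a")
  case False
  have "set_integrable lebesgue {c..x} \<zeta>" by (rule absolutely_integrable_continuous_real[OF cz])
  from set_lebesgue_integral_eq_integral(2)[OF this] have "g x = (LINT x:{c..x}|lebesgue. \<zeta> x)" by (simp add: g_def)
  also have "\<dots> = (LINT x:{a..b}|lebesgue. \<zeta> x)" by (rule set_lebesgue_switch(1)) (use o that ab in auto)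
  also have "\<dots> = (LINT x:{c<..}|lebesgue. \<zeta> x)" by (rule set_lebesgue_switch(1)[symmetric]) (use o that ab in auto)
  finally show ?thesis using I by simp
 qed (rule ga)
 have d: "(g has_vector_derivative \<zeta> x) (at x)" for x
 proof (cases "x < a")
  case True
  have "(g has_vector_derivative 0) (at x)"
   by (rule has_vector_derivative_transform_within_open[OF has_vector_derivative_const[of 0], of "{..<a}"]) (use ga True in auto)
  then show ?thesis using o[of x] True by simp
 next
  case False
  have "(g has_vector_derivative \<zeta> x) (at x within {c..x + 1})"
   unfolding g_def[abs_def] by (rule integral_has_vector_derivative[OF cz]) (use False ab in auto)
  moreover have "at x within {c..x + 1} = at x" by (rule at_within_interior) (use False ab in auto)
  ultimately show ?thesis by simp
 qed
 have "compactly_supported {c<..} g"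
  unfolding compactly_supported_def using ga gb ab by (intro exI[of _ "{a..b}"]) (auto simp: not_le)
 then show ?thesis using d smooth_antiderivative[OF z(1) d] by blast
qed

text \<open>The lemma of du Bois-Reymond. A test function minus a multiple of a fixed
  \<open>\<eta>\<close> of nonzero mean has mean zero, hence is the derivative of a compactly
  supported function; what remains is the pairing with \<open>\<eta>\<close>, and that fixes the
  constant.\<close>

lemma ae_const_of_deriv_tests:
 assumes k: "locally_integrable_on {c<..} k"
  and t: "\<And>f f'. smooth f \<Longrightarrow> compactly_supported {c<..} f \<Longrightarrow> (\<And>x. (f has_vector_derivative f' x) (at x)) \<Longrightarrow>
   (LINT x:{c<..}|lebesgue. f' x * k x) = 0"
 shows "\<exists>C. ae_eq_on {c<..} k (\<lambda>_. C)"
proof -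
 let ?S = "{c<..}"
 have l1: "locally_integrable_on ?S (\<lambda>_. C)" for C by (intro continuous_imp_locally_integrable continuous_intros)
 \<comment> \<open>If all test functions had mean zero, the fundamental lemma would make the
   constant 1 vanish almost everywhere.\<close>
 obtain \<eta> where \<eta>: "smooth \<eta>" "compactly_supported ?S \<eta>" "(LINT x:?S|lebesgue. \<eta> x * 1) \<noteq> 0"
 proof (rule ccontr)
  assume "\<not> thesis"
  then have "\<And>f. smooth f \<Longrightarrow> compactly_supported ?S f \<Longrightarrow> (LINT x:?S|lebesgue. f x * 1) = 0" using that by blast
  then have "ae_eq_on ?S (\<lambda>_. 1) (\<lambda>_. 0)" by (intro ae_zero_of_test_integrals l1) auto
  from continuous_ae_zero[OF _ _ this, of "c + 1"] show False by simp
 qed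
 define J where "J f = (LINT x:?S|lebesgue. f x * 1)" for f :: "real \<Rightarrow> complex"
 define P where "P f = (LINT x:?S|lebesgue. f x * k x)" for f
 define C where "C = P \<eta> / J \<eta>"
 have J: "J \<eta> \<noteq> 0" using \<eta>(3) by (simp add: J_def)
 have "ae_eq_on ?S (\<lambda>x. k x - C) (\<lambda>_. 0)"
 proof (rule ae_zero_of_test_integrals[OF _ locally_integrable_diff[OF k l1]])
  fix f assume f: "smooth f" "compactly_supported ?S f"
  note if1 = set_integrable_supported[OF l1 smooth_continuous[OF f(1)] f(2)] and ifk = set_integrable_supported[OF k smooth_continuous[OF f(1)] f(2)]
  note ie1 = set_integrable_supported[OF l1 smooth_continuous[OF \<eta>(1)] \<eta>(2)] and iek = set_integrable_supported[OF k smooth_continuous[OF \<eta>(1)] \<eta>(2)]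
  define r where "r = J f / J \<eta>"
  define \<zeta> where "\<zeta> x = f x + (- r) * \<eta> x" for x
  have lin: "(LINT x:?S|lebesgue. \<zeta> x * w x) = (LINT x:?S|lebesgue. f x * w x) - r * (LINT x:?S|lebesgue. \<eta> x * w x)"
   if "set_integrable lebesgue ?S (\<lambda>x. f x * w x)" "set_integrable lebesgue ?S (\<lambda>x. \<eta> x * w x)" for w
  proof -
   have "(LINT x:?S|lebesgue. f x * w x - r * (\<eta> x * w x)) = (LINT x:?S|lebesgue. f x * w x) - (LINT x:?S|lebesgue. r * (\<eta> x * w x))"
    by (rule set_integral_diff(2)[OF that(1) set_integrable_mult_right[OF that(2)]])
   then show ?thesis by (simp add: \<zeta>_def algebra_simps)
  qed
  have z: "smooth \<zeta>" unfolding \<zeta>_def[abs_def] by (intro smooth_add_mult smooth_const f \<eta>)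
  obtain K1 K2 where "compact K1" "K1 \<subseteq> ?S" "\<forall>x. x \<notin> K1 \<longrightarrow> f x = 0" "compact K2" "K2 \<subseteq> ?S" "\<forall>x. x \<notin> K2 \<longrightarrow> \<eta> x = 0"
   using f(2) \<eta>(2) by (auto simp: compactly_supported_def)
  then have zc: "compactly_supported ?S \<zeta>"
   unfolding compactly_supported_def by (intro exI[of _ "K1 \<union> K2"]) (auto simp: \<zeta>_def)
  have "(LINT x:?S|lebesgue. \<zeta> x) = 0" using lin[OF if1[of 1] ie1[of 1]] J by (simp add: J_def r_def)
  from smooth_primitive[OF z zc this] obtain g where "smooth g" "compactly_supported ?S g" "\<And>x. (g has_vector_derivative \<zeta> x) (at x)" by blast
  from t[OF this] have P: "P f = r * P \<eta>" using lin[OF ifk iek] by (simp add: P_def)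
  have "(LINT x:?S|lebesgue. f x * (k x - C)) = P f - C * J f"
   using set_integral_diff(2)[OF ifk if1[of C]] by (simp add: P_def J_def right_diff_distrib mult.commute)
  also have "\<dots> = 0" using J by (simp add: P C_def r_def)
  finally show "(LINT x:?S|lebesgue. f x * (k x - C)) = 0" .
 qed simp
 then show ?thesis by (auto simp: ae_eq_on_def intro!: exI[of _ C])
qed

lemma locally_integrable_mult:
 assumes "continuous_on UNIV f" "locally_integrable_on S u"
 shows "locally_integrable_on S (\<lambda>x. f x * u x)" unfolding locally_integrable_on_def
proof (intro allI impI, elim conjE)
 fix K assume K: "compact K" "K \<subseteq> S"
 have "bounded (f ` K)"
  by (rule compact_imp_bounded[OF compact_continuous_image[OF continuous_on_subset[OF assms(1)] K(1)]]) auto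
 then show "set_integrable lebesgue K (\<lambda>x. f x * u x)"
  using assms(2) K by (intro set_integrable_continuous_mult assms(1)) (auto simp: locally_integrable_on_def)
qed

lemma compactly_supported_mult: "compactly_supported S f \<Longrightarrow> compactly_supported S (\<lambda>x. f x * g x)"
 by (auto simp: compactly_supported_def)

lemma weak_deriv_test1:
 assumes w: "is_weak_deriv S 1 u v" and f: "smooth f" "compactly_supported S f" "\<And>x. (f has_vector_derivative f' x) (at x)"
 shows "(LINT x:S|lebesgue. f' x * u x) = - (LINT x:S|lebesgue. f x * v x)"
proof -
 obtain F where F: "smooth_seq F" "F 0 = f" using f by (auto simp: smooth_def)
 have "F 1 = f'" using F f(3) vector_derivative_unique_at unfolding smooth_seq_def by (metis One_nat_def ext)
 then show ?thesis using weak_deriv_complex_test[OF w F(1)] F f(2) by simp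
qed

lemma weak_deriv_test2:
 assumes w: "is_weak_deriv S 1 u v" "is_weak_deriv S 2 u v2"
  and f: "smooth f" "compactly_supported S f" "\<And>x. (f has_vector_derivative f' x) (at x)"
 shows "(LINT x:S|lebesgue. f' x * v x) = - (LINT x:S|lebesgue. f x * v2 x)"
proof -
 obtain F where F: "smooth_seq F" "F 0 = f" using f by (auto simp: smooth_def)
 have F1: "F (Suc 0) = f'" using F f(3) vector_derivative_unique_at unfolding smooth_seq_def by (metis ext)
 have "compactly_supported S (F (Suc 0))" using compactly_supported_seq[OF F(1)] F f(2) by simp
 from weak_deriv_complex_test[OF w(1) smooth_seq_Suc[OF F(1)] this]
 have "(LINT x:S|lebesgue. F 2 x * u x) = - (LINT x:S|lebesgue. f' x * v x)" by (simp add: F1 numeral_2_eq_2)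
 moreover have "(LINT x:S|lebesgue. F 2 x * u x) = (LINT x:S|lebesgue. f x * v2 x)"
  using weak_deriv_complex_test[OF w(2) F(1)] F f(2) by simp
 ultimately show ?thesis by simp
qed

text \<open>Testing against \<open>f * p\<close> and \<open>f * p1\<close> for classical solutions \<open>p\<close> replaces elliptic regularity for the weak solution \<open>u\<close>.\<close>

lemma weak_wronskian_const:
 assumes w: "is_weak_deriv {c<..} 1 u v" "is_weak_deriv {c<..} 2 u v2" and ae: "ae_eq_on {c<..} v2 (\<lambda>x. q x * u x)"
  and p: "smooth p" "smooth p1" "\<And>x. (p has_vector_derivative p1 x) (at x)" "\<And>x. (p1 has_vector_derivative q x * p x) (at x)"
  and q: "continuous_on UNIV q"
 shows "\<exists>C. ae_eq_on {c<..} (\<lambda>x. p1 x * u x - p x * v x) (\<lambda>_. C)"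
proof (rule ae_const_of_deriv_tests)
 let ?S = "{c<..}"
 have li: "locally_integrable_on ?S u" "locally_integrable_on ?S v" "locally_integrable_on ?S v2" using w by (auto simp: is_weak_deriv_def)
 have cp: "continuous_on UNIV p" "continuous_on UNIV p1" using p smooth_continuous by auto
 show "locally_integrable_on ?S (\<lambda>x. p1 x * u x - p x * v x)" by (intro locally_integrable_diff locally_integrable_mult cp li)
 fix g g' assume g: "smooth g" "compactly_supported ?S g" and dg: "\<And>x. (g has_vector_derivative g' x) (at x)"
 obtain g'' where g'': "smooth g''" "\<And>x. (g has_vector_derivative g'' x) (at x)" using smooth_deriv[OF g(1)] by blast
 have "g'' = g'" using g''(2) dg vector_derivative_unique_at by blast
 then have g': "smooth g'" using g'' by simp
 have sg': "compactly_supported ?S g'"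
  using g(2) deriv_zero_off_support[OF _ _ dg] unfolding compactly_supported_def by metis
 have cg: "continuous_on UNIV g" "continuous_on UNIV g'" using g g' smooth_continuous by auto
 let ?I = "\<lambda>a b r. (LINT x:?S|lebesgue. (a x * b x) * r x)"
 have i: "set_integrable lebesgue ?S (\<lambda>x. (a x * b x) * r x)"
  if "continuous_on UNIV a" "compactly_supported ?S a" "continuous_on UNIV b" "locally_integrable_on ?S r" for a b r
  using that by (intro set_integrable_supported compactly_supported_mult continuous_intros)
 have cqp: "continuous_on UNIV (\<lambda>x. q x * p x)" by (intro continuous_intros q cp)
 have A: "?I g (\<lambda>x. q x * p x) u + ?I g' p1 u = - ?I g p1 v"
 proof -
  have "((\<lambda>x. g x * p1 x) has_vector_derivative g x * (q x * p x) + g' x * p1 x) (at x)" for x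
   by (intro has_vector_derivative_mult dg p)
  from weak_deriv_test1[OF w(1) smooth_add_mult(2)[OF g(1) p(2)] compactly_supported_mult[OF g(2)] this]
  have "(LINT x:?S|lebesgue. (g x * (q x * p x)) * u x + (g' x * p1 x) * u x) = - ?I g p1 v" by (simp only: distrib_right)
  then show ?thesis
   using set_integral_add(2)[OF i[OF cg(1) g(2) cqp li(1)] i[OF cg(2) sg' cp(2) li(1)]] by simp
 qed
 have B: "?I g p1 v + ?I g' p v = - ?I g p v2"
 proof -
  have "((\<lambda>x. g x * p x) has_vector_derivative g x * p1 x + g' x * p x) (at x)" for x
   by (intro has_vector_derivative_mult dg p)
  from weak_deriv_test2[OF w smooth_add_mult(2)[OF g(1) p(1)] compactly_supported_mult[OF g(2)] this]
  have "(LINT x:?S|lebesgue. (g x * p1 x) * v x + (g' x * p x) * v x) = - ?I g p v2" by (simp only: distrib_right)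
  then show ?thesis
   using set_integral_add(2)[OF i[OF cg(1) g(2) cp(2) li(2)] i[OF cg(2) sg' cp(1) li(2)]] by simp
 qed
 have D: "?I g p v2 = ?I g (\<lambda>x. q x * p x) u"
 proof -
  have "?I g p v2 = ?I g p (\<lambda>x. q x * u x)" by (rule test_integral_cong_ae[OF ae li(3)])
    (auto intro!: locally_integrable_mult q li compactly_supported_mult g continuous_intros cg cp)
  then show ?thesis by (simp add: mult_ac)
 qed
 have "(LINT x:?S|lebesgue. (g' x * p1 x) * u x - (g' x * p x) * v x) = ?I g' p1 u - ?I g' p v"
  by (rule set_integral_diff(2)[OF i[OF cg(2) sg' cp(2) li(1)] i[OF cg(2) sg' cp(1) li(2)]])
 also have "\<dots> = 0"
 proof -
  have "a - b = 0" if "d + a = - e" "e + b = - f" "f = d" for a b d e f :: complex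
   using that by algebra
  from this[OF A B D] show ?thesis .
 qed
 finally show "(LINT x:?S|lebesgue. g' x * (p1 x * u x - p x * v x)) = 0" by (simp add: right_diff_distrib mult.assoc)
qed

context half_line
begin

text \<open>Every entire solution of Airy's equation restricts to a solution of
  \<open>p'' = q * p\<close>. Since \<open>q\<close> is affine, \<open>p\<close>, its derivative and
  the identity generate an algebra closed under derivation, which yields smoothness.\<close>

lemma entire_solution:
 assumes "\<And>z. (f has_field_derivative g z) (at z)" "\<And>z. (g has_field_derivative z * f z) (at z)"
 defines "p \<equiv> \<lambda>x. f (arg x)" and "p1 \<equiv> \<lambda>x. (1 / h) *\<^sub>R (- \<i> * g (arg x))"
 shows "(p has_vector_derivative p1 x) (at x)" "(p1 has_vector_derivative q x * p x) (at x)" "smooth p" "smooth p1"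
proof -
 have l1: "((\<lambda>s. f (nu - \<i> * of_real s)) has_vector_derivative - \<i> * g (nu - \<i> * of_real s)) (at s)" for s
  using DERIV_along_line[OF assms(1), of nu "- \<i>" s UNIV] by simp
 have l2: "((\<lambda>s. - \<i> * g (nu - \<i> * of_real s)) has_vector_derivative - \<i> * (- \<i> * ((nu - \<i> * of_real s) * f (nu - \<i> * of_real s)))) (at s)" for s
  using has_vector_derivative_mult_right[OF DERIV_along_line[OF assms(2), of nu "- \<i>" s UNIV], of "- \<i>"] by simp
 have d: "(p has_vector_derivative p1 x) (at x)" for x
  using dline[OF l1] unfolding p_def p1_def arg_def .
 have "(p1 has_vector_derivative (1 / h) *\<^sub>R ((1 / h) *\<^sub>R (- \<i> * (- \<i> * (arg x * p x))))) (at x)" for x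
  unfolding p1_def p_def arg_def
  by (rule bounded_linear.has_vector_derivative[OF bounded_linear_scaleR_right dline[OF l2]])
 moreover have "(1 / h) *\<^sub>R ((1 / h) *\<^sub>R (- \<i> * (- \<i> * (arg x * p x)))) = q x * p x" for x
 proof -
  have "- \<i> * (- \<i> * X) = - X" for X by (simp flip: mult.assoc)
  then show ?thesis unfolding q_eq[symmetric] scaleR_conv_of_real arg_def by (simp only: minus_mult_left minus_diff_eq mult.assoc)
 qed
 ultimately have d1: "(p1 has_vector_derivative q x * p x) (at x)" for x by simp
 show "(p has_vector_derivative p1 x) (at x)" "(p1 has_vector_derivative q x * p x) (at x)" by (rule d, rule d1)
 let ?G = "{p, p1, of_real}"
 have m: "p \<in> generated_algebra ?G" "p1 \<in> generated_algebra ?G" "(\<lambda>x. of_real x) \<in> generated_algebra ?G"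
  by (auto intro: generated_algebra.gen)
 have qe: "q x = (\<i> * of_real (1 / h^3) - nu / of_real (h^2)) + \<i> * of_real (1 / h^3) * of_real x" for x
  by (simp add: q_def algebra_simps add_divide_distrib)
 have "(\<lambda>x. q x * p x) \<in> generated_algebra ?G"
  unfolding qe by (intro generated_algebra.mult generated_algebra.add generated_algebra.const m)
 then have sm: "\<exists>g'\<in>generated_algebra ?G. \<forall>x. (g has_vector_derivative g' x) (at x)" if "g \<in> ?G" for g
 proof -
  assume q: "(\<lambda>x. q x * p x) \<in> generated_algebra ?G"
  have "g = p \<or> g = p1 \<or> g = of_real" using that by simp
  then consider "g = p" | "g = p1" | "g = of_real" by blast
  then show ?thesis
  proof cases
   case 1 show ?thesis unfolding 1 using d by (intro bexI[OF _ m(2)] allI)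
  next
   case 2 show ?thesis unfolding 2 using d1 by (intro bexI[OF _ q] allI)
  next
   case 3
   have "((\<lambda>x. of_real x :: complex) has_vector_derivative of_real 1) (at x)" for x
    by (rule bounded_linear.has_vector_derivative[OF bounded_linear_of_real[where 'a = complex] has_vector_derivative_id])
   then show ?thesis unfolding 3 by (intro bexI[OF _ generated_algebra.const[of 1]] allI) simp
  qed
 qed
 show "smooth p" "smooth p1" using smooth_generated_algebra[OF sm] m by auto
qed

text \<open>The Wronskians of \<open>u\<close> with \<open>m\<close> and with the companion are
  constants \<open>c\<close> and \<open>d\<close>. Once \<open>c = 0\<close>, these are two linear
  equations for \<open>u\<close> and its weak derivative with determinant \<open>w'\<close>, and
  they give \<open>u = d / w' * m\<close>. The mean-zero condition then passes from \<open>u\<close>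
  to \<open>m\<close>.\<close>

lemma zero_if_eigenvalue:
 assumes "is_eigenvalue {-1<..} L0_dom (L0_op (1 / h^3)) (nu / of_real (h^2))"
 shows "eig_fun nu = 0"
proof -
 let ?S = "{-1<..} :: real set"
 obtain u where u: "u \<in> L0_dom" "ae_eq_on ?S (\<lambda>x. L0_op (1 / h^3) u x - nu / of_real (h^2) * u x) (\<lambda>x. 0)"
  and nz: "\<not> ae_eq_on ?S u (\<lambda>x. 0)"
  using assms unfolding is_eigenvalue_def nontrivial_kernel_def by blast
 have L2u: "u \<in> L2_on ?S" and Iu: "(LINT x:?S|lebesgue. u x) = 0" using u(1) by (auto simp: L0_dom_def sobolev_H_def)
 have "\<exists>v\<in>L2_on ?S. is_weak_deriv ?S k u v" if "k \<le> 2" for k using u(1) that by (auto simp: L0_dom_def sobolev_H_def)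
 from this[of 1] this[of 2] obtain v v2 where v: "v \<in> L2_on ?S" "is_weak_deriv ?S 1 u v" "is_weak_deriv ?S 2 u v2" by auto
 have ae: "ae_eq_on ?S v2 (\<lambda>x. q x * u x)"
  using weak_deriv_ae(2)[OF open_greaterThan v(3)] u(2) unfolding ae_eq_on_def
 proof eventually_elim
  case (elim x)
  have z: "z = a - b" if "- z + a - b = 0" for z a b :: complex using that by algebra
  show ?case
  proof
   assume "x \<in> ?S"
   then have "- v2 x + \<i> * of_real (1 / h^3) * of_real (1 + x) * u x - nu / of_real (h^2) * u x = 0"
    using elim by (simp only: L0_op_def)
   from z[OF this] show "v2 x = q x * u x" by (simp only: q_def left_diff_distrib)
  qed
 qed
 have W: "\<exists>C. ae_eq_on ?S (\<lambda>x. ((1 / h) *\<^sub>R (- \<i> * g (arg x))) * u x - f (arg x) * v x) (\<lambda>_. C)"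
  if "\<And>z. (f has_field_derivative g z) (at z)" "\<And>z. (g has_field_derivative z * f z) (at z)" for f g
  by (rule weak_wronskian_const[OF v(2,3) ae entire_solution(3,4,1,2)[OF that] cont(3)])
 obtain c where c: "ae_eq_on ?S (\<lambda>x. m1 x * u x - m x * v x) (\<lambda>_. c)"
  using W[OF tairy_deriv tairy'_deriv] by (auto simp: m_def m1_def)
 \<comment> \<open>\<open>m\<close> and its derivative are bounded, so a nonzero constant would
   bound \<open>(cmod u)^2 + (cmod v)^2\<close> from below almost everywhere, and its integral over
   an interval of length \<open>n\<close> would grow with \<open>n\<close>.\<close>
 have c0: "c = 0"
 proof (rule ccontr)
  assume "c \<noteq> 0"
  obtain M where M: "\<And>x. x > -1 \<Longrightarrow> cmod (m x) \<le> M * exp (- (2 / h * (x + 1)))"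
   "\<And>x. x > -1 \<Longrightarrow> cmod (m1 x) \<le> M * exp (- (2 / h * (x + 1)))" using decay by blast
  have M0: "M \<ge> 0" using order_trans[OF norm_ge_zero M(1)[of 0]] by (simp add: zero_le_mult_iff)
  have Mb: "cmod (m x) \<le> M" "cmod (m1 x) \<le> M" if "x > -1" for x
  proof -
   have "M * exp (- (2 / h * (x + 1))) \<le> M * 1" using M0 h that by (intro mult_left_mono) auto
   then show "cmod (m x) \<le> M" "cmod (m1 x) \<le> M" using M[OF that] by auto
  qed
  define I where "I = (LINT x:?S|lebesgue. 2 * M^2 * ((cmod (u x))^2 + (cmod (v x))^2))"
  have int: "set_integrable lebesgue ?S (\<lambda>x. 2 * M^2 * ((cmod (u x))^2 + (cmod (v x))^2))"
   using L2u v(1) by (intro set_integrable_mult_right set_integral_add) (auto simp: L2_on_def)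
  have bd: "AE x\<in>?S in lebesgue. (cmod c)^2 \<le> 2 * M^2 * ((cmod (u x))^2 + (cmod (v x))^2)"
   using c unfolding ae_eq_on_def
  proof eventually_elim
   case (elim x)
   show ?case
   proof
    assume x: "x \<in> ?S"
    have "cmod c \<le> cmod (m1 x) * cmod (u x) + cmod (m x) * cmod (v x)"
     using elim x norm_triangle_ineq4[of "m1 x * u x" "m x * v x"] by (simp add: norm_mult)
    also have "\<dots> \<le> M * cmod (u x) + M * cmod (v x)" using x by (intro add_mono mult_right_mono Mb) auto
    finally have "(cmod c)^2 \<le> (M * (cmod (u x) + cmod (v x)))^2" by (intro power_mono) (auto simp: distrib_left)
    also have "\<dots> = M^2 * (cmod (u x) + cmod (v x))^2" by (simp add: power_mult_distrib)
    also have "\<dots> \<le> M^2 * (2 * ((cmod (u x))^2 + (cmod (v x))^2))"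
     using sum_squares_bound[of "cmod (u x)" "cmod (v x)"] by (intro mult_left_mono) (auto simp: power2_sum)
    finally show "(cmod c)^2 \<le> 2 * M^2 * ((cmod (u x))^2 + (cmod (v x))^2)" by (simp only: mult_ac)
   qed
  qed
  have "real n * (cmod c)^2 \<le> I" for n
  proof -
   have "real n * (cmod c)^2 = (LINT x:{0<..<real n}|lebesgue. (cmod c)^2)" by (simp add: set_lebesgue_integral_def)
   also have "\<dots> \<le> (LINT x:{0<..<real n}|lebesgue. 2 * M^2 * ((cmod (u x))^2 + (cmod (v x))^2))"
    by (rule set_integral_mono_AE[OF _ set_integrable_subset[OF int]])
     (use bd in \<open>auto simp: set_integrable_def elim!: eventually_mono\<close>)
   also have "\<dots> \<le> I" unfolding I_def set_lebesgue_integral_def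
   proof (rule integral_mono)
    show "integrable lebesgue (\<lambda>x. indicat_real {0<..<real n} x *\<^sub>R (2 * M^2 * ((cmod (u x))^2 + (cmod (v x))^2)))"
     using set_integrable_subset[OF int, of "{0<..<real n}"] unfolding set_integrable_def by force
   qed (use int in \<open>auto simp: set_integrable_def indicator_def\<close>)
   finally show ?thesis .
  qed
  moreover have "(cmod c)^2 > 0" using \<open>c \<noteq> 0\<close> by simp
  ultimately show False using ex_less_of_nat_mult[of "(cmod c)^2" I] by (meson not_less)
 qed
 define p where "p x = airy 1 om (arg x)" for x
 define p1 where "p1 x = (1 / h) *\<^sub>R (- \<i> * airy' 1 om (arg x))" for x
 have "\<And>z. (airy' 1 om has_field_derivative z * airy 1 om z) (at z)" by (rule airy'_deriv) (simp_all add: om3)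
 from W[OF airy_deriv this] obtain d where d: "ae_eq_on ?S (\<lambda>x. p1 x * u x - p x * v x) (\<lambda>_. d)"
  by (auto simp: p_def p1_def)
 obtain w where w: "w \<noteq> 0" "\<And>nu. tairy nu * airy' 1 om nu - tairy' nu * airy 1 om nu = w" using tairy_wronskian by blast
 define w' where "w' = of_real (1 / h) * (- \<i>) * w"
 have w0: "w' \<noteq> 0" using w(1) h by (simp add: w'_def)
 have w': "m x * p1 x - m1 x * p x = w'" for x
  unfolding w'_def w(2)[of "arg x", symmetric] m_def m1_def p_def p1_def scaleR_conv_of_real by (simp add: algebra_simps)
 have um: "ae_eq_on ?S u (\<lambda>x. d / w' * m x)" using c d unfolding ae_eq_on_def c0
 proof eventually_elim
  case (elim x)
  show ?case
  proof
   assume x: "x \<in> ?S"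
   have "w' * u x = m x * (p1 x * u x - p x * v x) - p x * (m1 x * u x - m x * v x)"
    unfolding w'[of x, symmetric] by (simp add: algebra_simps)
   also have "\<dots> = m x * d" using elim x by simp
   finally show "u x = d / w' * m x" using w0 by (simp add: field_simps)
  qed
 qed
 have d0: "d \<noteq> 0"
 proof
  assume "d = 0"
  then show False using um nz by simp
 qed
 have "(LINT x:?S|lebesgue. u x) = (LINT x:?S|lebesgue. d / w' * m x)"
  unfolding set_lebesgue_integral_def
 proof (rule integral_cong_AE)
  show "(\<lambda>x. indicator ?S x *\<^sub>R u x) \<in> borel_measurable lebesgue" using L2u by (simp add: L2_on_def set_borel_measurable_def)
  have "set_integrable lebesgue ?S (\<lambda>x. d / w' * m x)" using m_L2(3) by (intro set_integrable_mult_right)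
  then show "(\<lambda>x. indicator ?S x *\<^sub>R (d / w' * m x)) \<in> borel_measurable lebesgue"
   unfolding set_integrable_def by (rule borel_measurable_integrable)
  show "AE x in lebesgue. indicator ?S x *\<^sub>R u x = indicator ?S x *\<^sub>R (d / w' * m x)"
   using um unfolding ae_eq_on_def by eventually_elim (auto simp: indicator_def)
 qed
 also have "\<dots> = d / w' * (\<i> * of_real h * eig_fun nu)" by (simp only: set_integral_mult_right integral_m)
 finally show ?thesis using Iu d0 w0 h by simp
qed

end

section \<open>The leftmost eigenvalue in scaled variables\<close>

lemma eigenvalue_iff_zero:
 assumes "h > 0"
 shows "is_eigenvalue {-1<..} L0_dom (L0_op (1 / h^3)) \<mu> \<longleftrightarrow> eig_fun (of_real (h^2) * \<mu>) = 0"
proof -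
 interpret half_line "of_real (h^2) * \<mu>" h using assms by unfold_locales
 show ?thesis using eigenvalue_if_zero zero_if_eigenvalue assms by auto
qed

text \<open>A set, because several zeros may share the least real part;
  \<open>leftmost_eigenvalue\<close> then denotes an unspecified one of the corresponding
  eigenvalues.\<close>

definition leftmost_zeros :: "complex set" where
 "leftmost_zeros = {nu. eig_fun nu = 0 \<and> (\<forall>\<mu>. eig_fun \<mu> = 0 \<longrightarrow> Re nu \<le> Re \<mu>)}"

lemma finite_leftmost_zeros: "finite leftmost_zeros"
proof -
 obtain nu where "eig_fun nu = 0" using eig_fun_has_zero by blast
 then have "leftmost_zeros \<subseteq> {\<mu>. eig_fun \<mu> = 0 \<and> Re \<mu> \<le> Re nu}" by (auto simp: leftmost_zeros_def)
 then show ?thesis using finite_eig_fun_zeros finite_subset by blast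
qed

text \<open>Homogeneity: an eigenvalue \<open>nu / h^2\<close> divided by
  \<open>\<beta> = 1 / h^3\<close> is \<open>h * nu\<close>. The zero \<open>nu\<close> is obtained
  for the given \<open>h\<close> and may vary with it.\<close>

lemma lambda0_eq:
 assumes h: "h > 0"
 obtains nu where "nu \<in> leftmost_zeros" "lambda0 (1 / h^3) = of_real h * nu"
proof -
 let ?P = "is_eigenvalue {-1<..} L0_dom (L0_op (1 / h^3))" and ?\<mu> = "leftmost_eigenvalue (1 / h^3)"
 have "\<exists>x. is_arg_min Re ?P x"
 proof -
  obtain nu where nu: "eig_fun nu = 0" "\<And>\<mu>. eig_fun \<mu> = 0 \<Longrightarrow> Re nu \<le> Re \<mu>" using eig_fun_leftmost_zero by blast
  have "Re (nu / of_real (h^2)) \<le> Re \<mu>" if "?P \<mu>" for \<mu>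
  proof -
   have "Re nu \<le> Re (of_real (h^2) * \<mu>)" using nu(2) that eigenvalue_iff_zero[OF h] by blast
   then have "Re nu \<le> h^2 * Re \<mu>" by (simp only: Re_complex_of_real Im_complex_of_real times_complex.sel mult_zero_left diff_0_right)
   moreover have "Re (nu / of_real (h^2)) = Re nu / h^2" by (rule Re_divide_of_real)
   ultimately show ?thesis using h by (simp add: divide_le_eq mult.commute)
  qed
  moreover have "?P (nu / of_real (h^2))" using eigenvalue_iff_zero[OF h] nu(1) h by simp
  ultimately show ?thesis unfolding is_arg_min_def by (meson not_less)
 qed
 then have "is_arg_min Re ?P ?\<mu>" unfolding leftmost_eigenvalue_def arg_min_def by (rule someI_ex)
 then have m: "?P ?\<mu>" "\<And>\<mu>. ?P \<mu> \<Longrightarrow> Re ?\<mu> \<le> Re \<mu>" by (auto simp: is_arg_min_def not_less)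
 have "of_real (h^2) * ?\<mu> \<in> leftmost_zeros" unfolding leftmost_zeros_def
 proof (intro CollectI conjI allI impI)
  show "eig_fun (of_real (h^2) * ?\<mu>) = 0" using m(1) eigenvalue_iff_zero[OF h] by blast
  fix \<mu> assume "eig_fun \<mu> = 0"
  then have "?P (\<mu> / of_real (h^2))" using eigenvalue_iff_zero[OF h] h by simp
  from m(2)[OF this] have "Re ?\<mu> \<le> Re \<mu> / h^2" by (simp only: Re_divide_of_real)
  then have "h^2 * Re ?\<mu> \<le> Re \<mu>" using h by (simp add: le_divide_eq mult.commute)
  then show "Re (of_real (h^2) * ?\<mu>) \<le> Re \<mu>"
   by (simp only: Re_complex_of_real Im_complex_of_real times_complex.sel mult_zero_left diff_0_right)
 qed
 moreover have "lambda0 (1 / h^3) = of_real h * (of_real (h^2) * ?\<mu>)"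
  unfolding lambda0_def using h by (simp add: field_simps power2_eq_square power3_eq_cube)
 ultimately show thesis using that by blast
qed

section \<open>Shooting\<close>

context wall_profile
begin

definition os_coeff :: "complex \<Rightarrow> real \<Rightarrow> complex" where
 "os_coeff nu t = \<i> * of_real (V t / th^12) - nu / of_real (th^8)"

definition os_system :: "complex \<Rightarrow> real \<Rightarrow> (real \<Rightarrow> complex) \<Rightarrow> (real \<Rightarrow> complex) \<Rightarrow> (real \<Rightarrow> complex) \<Rightarrow> (real \<Rightarrow> complex) \<Rightarrow> bool" where
 "os_system nu \<alpha> u u1 w w1 \<longleftrightarrow> (\<forall>t\<in>{0..2}.
   (u has_vector_derivative u1 t) (at t within {0..2}) \<and>
   (u1 has_vector_derivative w t + of_real (\<alpha>^2) * u t) (at t within {0..2}) \<and>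
   (w has_vector_derivative w1 t) (at t within {0..2}) \<and>
   (w1 has_vector_derivative os_coeff nu t * w t - \<i> * of_real (V2 t / th^12) * u t) (at t within {0..2}))"

definition os_field :: "complex \<Rightarrow> real \<Rightarrow> real \<Rightarrow> complex \<times> complex \<times> complex \<times> complex \<Rightarrow> complex \<times> complex \<times> complex \<times> complex" where
 "os_field nu \<alpha> t z = (fst (snd z), fst (snd (snd z)) + of_real (\<alpha>^2) * fst z, snd (snd (snd z)),
   os_coeff nu t * fst (snd (snd z)) - \<i> * of_real (V2 t / th^12) * fst z)"

text \<open>It depends on \<open>nu\<close> only through the modulus, monotonically, so one constant
  serves a whole neighbourhood of a parameter.\<close>

definition os_lip :: "complex \<Rightarrow> real \<Rightarrow> real" where
 "os_lip nu \<alpha> = 3 + \<alpha>^2 + (2 * B / th^12 + cmod nu / th^8) + B / th^12"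

lemma os_lip_nonneg: "os_lip nu \<alpha> \<ge> 0"
 unfolding os_lip_def using th B0 by (intro add_nonneg_nonneg) auto

lemma os_field_norm:
 assumes t: "t \<in> {0..2}"
 shows "norm (os_field nu \<alpha> t z) \<le> os_lip nu \<alpha> * norm z"
proof -
 obtain a b c d where z: "z = (a, b, c, d)" by (metis surj_pair)
 have n4: "norm (p, q, r, s) \<le> norm p + norm q + norm r + norm s" for p q r s :: complex
  using norm_Pair_le[of p "(q, r, s)"] norm_Pair_le[of q "(r, s)"] norm_Pair_le[of r s] by linarith
 have c4: "norm a \<le> norm z" "norm b \<le> norm z" "norm c \<le> norm z" "norm d \<le> norm z"
 proof -
  have "norm (b, c, d) \<le> norm z" unfolding z by (rule norm_snd_le)
  moreover have "norm (c, d) \<le> norm (b, c, d)" by (rule norm_snd_le)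
  ultimately show "norm a \<le> norm z" "norm b \<le> norm z" "norm c \<le> norm z" "norm d \<le> norm z"
   using norm_fst_le[of a "(b, c, d)"] norm_fst_le[of b "(c, d)"] norm_fst_le[of c d] norm_snd_le[of d c] unfolding z by linarith+
 qed
 have P: "cmod (os_coeff nu t) \<le> 2 * B / th^12 + cmod nu / th^8"
 proof -
  have "0 \<le> t / B" using t B0 by auto
  then have "0 \<le> V t" using Vlow[OF t] by linarith
  moreover have "B * t \<le> B * 2" using t B0 by (intro mult_left_mono) auto
  ultimately have "\<bar>V t\<bar> \<le> 2 * B" using Vup[OF t] by linarith
  then have "\<bar>V t\<bar> / th^12 \<le> 2 * B / th^12" using th by (intro divide_right_mono) auto
  moreover have "cmod (\<i> * of_real (V t / th^12)) = \<bar>V t\<bar> / th^12" using th by (simp only: norm_mult norm_of_real) simp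
  moreover have "cmod (nu / of_real (th^8)) = cmod nu / th^8" using th by (simp add: norm_divide norm_power)
  ultimately show ?thesis
   unfolding os_coeff_def using norm_triangle_ineq4[of "\<i> * of_real (V t / th^12)" "nu / of_real (th^8)"] by linarith
 qed
 have Q: "cmod (\<i> * of_real (V2 t / th^12)) \<le> B / th^12"
 proof -
  have "cmod (\<i> * of_real (V2 t / th^12)) = \<bar>V2 t\<bar> / th^12" using th by (simp only: norm_mult norm_of_real) simp
  then show ?thesis using V2b[OF t] th by (simp add: divide_right_mono)
 qed
 have "norm (os_field nu \<alpha> t z) \<le> cmod b + cmod (c + of_real (\<alpha>^2) * a) + cmod d + cmod (os_coeff nu t * c - \<i> * of_real (V2 t / th^12) * a)"
  unfolding os_field_def z fst_conv snd_conv by (rule n4)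
 also have "\<dots> \<le> norm z + (norm z + \<alpha>^2 * norm z) + norm z + ((2 * B / th^12 + cmod nu / th^8) * norm z + B / th^12 * norm z)"
 proof (intro add_mono c4)
  have "cmod (of_real (\<alpha>^2) * a) = \<alpha>^2 * cmod a" by (simp add: norm_mult norm_power)
  also have "\<dots> \<le> \<alpha>^2 * norm z" by (rule mult_left_mono[OF c4(1)]) simp
  finally show "cmod (c + of_real (\<alpha>^2) * a) \<le> norm z + \<alpha>^2 * norm z"
   using norm_triangle_ineq[of c "of_real (\<alpha>^2) * a"] c4(3) by linarith
  have "cmod (os_coeff nu t * c) \<le> (2 * B / th^12 + cmod nu / th^8) * norm z"
   unfolding norm_mult by (rule mult_mono[OF P c4(3)]) (use order_trans[OF norm_ge_zero P] in auto)
  moreover have "cmod (\<i> * of_real (V2 t / th^12) * a) \<le> B / th^12 * norm z"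
   unfolding norm_mult[of _ a] by (rule mult_mono[OF Q c4(1)]) (use order_trans[OF norm_ge_zero Q] in auto)
  ultimately show "cmod (os_coeff nu t * c - \<i> * of_real (V2 t / th^12) * a) \<le> (2 * B / th^12 + cmod nu / th^8) * norm z + B / th^12 * norm z"
   using norm_triangle_ineq4[of "os_coeff nu t * c" "\<i> * of_real (V2 t / th^12) * a"] by linarith
 qed
 also have "\<dots> = os_lip nu \<alpha> * norm z" by (simp add: os_lip_def distrib_right)
 finally show ?thesis .
qed

lemma os_field_diff: "os_field nu \<alpha> t x - os_field nu \<alpha> t y = os_field nu \<alpha> t (x - y)"
 by (simp add: os_field_def algebra_simps add_divide_distrib diff_divide_distrib)

lemma os_field_nu: "os_field nu \<alpha> t x - os_field \<mu> \<alpha> t x = (0, 0, 0, - ((nu - \<mu>) / of_real (th^8) * fst (snd (snd x))))"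
 by (simp add: os_field_def os_coeff_def diff_divide_distrib algebra_simps)

lemma os_exists:
 obtains u u1 w w1 where "os_system nu \<alpha> u u1 w w1" "u 0 = a" "u1 0 = b" "w 0 = c" "w1 0 = d"
proof -
 obtain z where z: "z 0 = (a, b, c, d)" "\<And>t. t \<in> {0..2} \<Longrightarrow> (z has_vector_derivative os_field nu \<alpha> t (z t)) (at t within {0..2})"
 proof (rule lipschitz_ode_solution[of 2 "os_field nu \<alpha>" "os_lip nu \<alpha>" "(a, b, c, d)"])
  show "continuous_on {0..2} (\<lambda>t. os_field nu \<alpha> t (y t))" if "continuous_on {0..2} y" for y
   unfolding os_field_def os_coeff_def using th by (intro continuous_intros that cV cV2) auto
  show "norm (os_field nu \<alpha> t x - os_field nu \<alpha> t y) \<le> os_lip nu \<alpha> * norm (x - y)" if "t \<in> {0..2}" for t x y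
   unfolding os_field_diff by (rule os_field_norm[OF that])
 qed (use os_lip_nonneg in auto)
 have s: "((\<lambda>t. snd (z t)) has_vector_derivative snd (os_field nu \<alpha> t (z t))) (at t within {0..2})" if "t \<in> {0..2}" for t
  by (rule bounded_linear.has_vector_derivative[OF bounded_linear_snd z(2)[OF that]])
 have ss: "((\<lambda>t. snd (snd (z t))) has_vector_derivative snd (snd (os_field nu \<alpha> t (z t)))) (at t within {0..2})" if "t \<in> {0..2}" for t
  by (rule bounded_linear.has_vector_derivative[OF bounded_linear_snd s[OF that]])
 have "os_system nu \<alpha> (\<lambda>t. fst (z t)) (\<lambda>t. fst (snd (z t))) (\<lambda>t. fst (snd (snd (z t)))) (\<lambda>t. snd (snd (snd (z t))))"
  unfolding os_system_def
 proof (intro ballI conjI)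
  fix t :: real assume t: "t \<in> {0..2}"
  show "((\<lambda>t. fst (z t)) has_vector_derivative fst (snd (z t))) (at t within {0..2})"
   using bounded_linear.has_vector_derivative[OF bounded_linear_fst z(2)[OF t]] by (simp add: os_field_def)
  show "((\<lambda>t. fst (snd (z t))) has_vector_derivative fst (snd (snd (z t))) + of_real (\<alpha>^2) * fst (z t)) (at t within {0..2})"
   using bounded_linear.has_vector_derivative[OF bounded_linear_fst s[OF t]] by (simp add: os_field_def)
  show "((\<lambda>t. fst (snd (snd (z t)))) has_vector_derivative snd (snd (snd (z t)))) (at t within {0..2})"
   using bounded_linear.has_vector_derivative[OF bounded_linear_fst ss[OF t]] by (simp add: os_field_def)
  show "((\<lambda>t. snd (snd (snd (z t)))) has_vector_derivative os_coeff nu t * fst (snd (snd (z t))) - \<i> * of_real (V2 t / th^12) * fst (z t)) (at t within {0..2})"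
   using bounded_linear.has_vector_derivative[OF bounded_linear_snd ss[OF t]] by (simp add: os_field_def)
 qed
 then show thesis by (rule that) (simp_all add: z(1))
qed

lemma os_lincomb:
 assumes "os_system nu \<alpha> u u1 w w1" "os_system nu \<alpha> v v1 x x1"
 shows "os_system nu \<alpha> (\<lambda>t. c * u t + d * v t) (\<lambda>t. c * u1 t + d * v1 t) (\<lambda>t. c * w t + d * x t) (\<lambda>t. c * w1 t + d * x1 t)"
 unfolding os_system_def
proof (intro ballI conjI)
 fix t :: real assume t: "t \<in> {0..2}"
 have l: "((\<lambda>t. c * f t + d * g t) has_vector_derivative c * f' + d * g') (at t within {0..2})"
  if "(f has_vector_derivative f') (at t within {0..2})" "(g has_vector_derivative g') (at t within {0..2})" for f g f' g'
  by (intro has_vector_derivative_add has_vector_derivative_mult_right that)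
 note A = assms[unfolded os_system_def, THEN bspec, OF t]
 show "((\<lambda>t. c * u t + d * v t) has_vector_derivative c * u1 t + d * v1 t) (at t within {0..2})"
  "((\<lambda>t. c * w t + d * x t) has_vector_derivative c * w1 t + d * x1 t) (at t within {0..2})" using A l by blast+
 have "((\<lambda>t. c * u1 t + d * v1 t) has_vector_derivative c * (w t + of_real (\<alpha>^2) * u t) + d * (x t + of_real (\<alpha>^2) * v t)) (at t within {0..2})"
  using A l by blast
 moreover have "c * (w t + of_real (\<alpha>^2) * u t) + d * (x t + of_real (\<alpha>^2) * v t) = c * w t + d * x t + of_real (\<alpha>^2) * (c * u t + d * v t)"
  by (simp only: algebra_simps)
 ultimately show "((\<lambda>t. c * u1 t + d * v1 t) has_vector_derivative c * w t + d * x t + of_real (\<alpha>^2) * (c * u t + d * v t)) (at t within {0..2})" by (simp only:)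
 let ?Q = "\<i> * of_real (V2 t / th^12)"
 have "((\<lambda>t. c * w1 t + d * x1 t) has_vector_derivative c * (os_coeff nu t * w t - ?Q * u t) + d * (os_coeff nu t * x t - ?Q * v t)) (at t within {0..2})"
  using A l by blast
 moreover have "c * (os_coeff nu t * w t - ?Q * u t) + d * (os_coeff nu t * x t - ?Q * v t) = os_coeff nu t * (c * w t + d * x t) - ?Q * (c * u t + d * v t)"
  by (simp only: algebra_simps)
 ultimately show "((\<lambda>t. c * w1 t + d * x1 t) has_vector_derivative os_coeff nu t * (c * w t + d * x t) - ?Q * (c * u t + d * v t)) (at t within {0..2})" by (simp only:)
qed

lemma os_system_continuous:
 assumes "os_system nu \<alpha> u u1 w w1"
 shows "continuous_on {0..2} u" "continuous_on {0..2} u1" "continuous_on {0..2} w" "continuous_on {0..2} w1"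
 using assms has_vector_derivative_continuous unfolding continuous_on_eq_continuous_within os_system_def by blast+

text \<open>The initial data are fixed and \<open>nu\<close> occurs only in the last component of
  the field, multiplied by \<open>w\<close>. On the unit disc around \<open>\<mu>\<close> the
  Lipschitz constant is uniform and the perturbation is proportional to
  \<open>cmod (nu - \<mu>)\<close>.\<close>

lemma os_parameter_continuous:
 assumes s: "\<And>nu. os_system nu \<alpha> (u nu) (u1 nu) (w nu) (w1 nu)"
  and i: "\<And>nu. u nu 0 = a" "\<And>nu. u1 nu 0 = b" "\<And>nu. w nu 0 = c" "\<And>nu. w1 nu 0 = d"
 shows "continuous_on UNIV (\<lambda>nu. u nu 2)" "continuous_on UNIV (\<lambda>nu. u1 nu 2)"
proof -
 define z where "z nu t = (u nu t, u1 nu t, w nu t, w1 nu t)" for nu t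
 have dz: "(z nu has_vector_derivative os_field nu \<alpha> t (z nu t)) (at t within {0..2})" if "t \<in> {0..2}" for nu t
  unfolding z_def os_field_def fst_conv snd_conv
  using s[of nu, unfolded os_system_def, THEN bspec, OF that] by (intro has_vector_derivative_Pair) auto
 have "isCont (\<lambda>nu. z nu 2) \<mu>" for \<mu>
 proof -
  have "compact (w \<mu> ` {0..2})" by (rule compact_continuous_image[OF os_system_continuous(3)[OF s]]) simp
  then obtain M where M: "\<And>t. t \<in> {0..2} \<Longrightarrow> cmod (w \<mu> t) \<le> M" "M > 0"
   using compact_imp_bounded bounded_pos by (metis image_eqI)
  define L where "L = os_lip (of_real (cmod \<mu> + 1)) \<alpha>"
  define C where "C = M / th^8 * 2 * exp (L * 2)"
  have bd: "norm (z nu 2 - z \<mu> 2) \<le> cmod (nu - \<mu>) * C" if nu: "cmod (nu - \<mu>) < 1" for nu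
  proof -
   have "norm (z nu 2 - z \<mu> 2) \<le> (0 + cmod (nu - \<mu>) / th^8 * M * 2) * exp (L * 2)"
   proof (rule ode_dependence[OF dz dz])
    fix t :: real assume t: "t \<in> {0..2}"
    have nL: "os_lip nu \<alpha> \<le> L"
    proof -
     have "cmod nu \<le> cmod \<mu> + 1" using nu norm_triangle_ineq2[of nu \<mu>] by linarith
     then have "cmod nu / th^8 \<le> cmod (of_real (cmod \<mu> + 1) :: complex) / th^8"
      unfolding norm_of_real using th by (intro divide_right_mono) auto
     then show ?thesis by (simp only: L_def os_lip_def)
    qed
    have "os_field nu \<alpha> t (z nu t) - os_field \<mu> \<alpha> t (z \<mu> t)
     = os_field nu \<alpha> t (z nu t - z \<mu> t) + (0, 0, 0, - ((nu - \<mu>) / of_real (th^8) * w \<mu> t))"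
    proof -
     have e: "fst (snd (snd (z \<mu> t))) = w \<mu> t" by (simp add: z_def)
     have "os_field nu \<alpha> t (z nu t) - os_field \<mu> \<alpha> t (z \<mu> t)
      = (os_field nu \<alpha> t (z nu t) - os_field nu \<alpha> t (z \<mu> t)) + (os_field nu \<alpha> t (z \<mu> t) - os_field \<mu> \<alpha> t (z \<mu> t))" by simp
     then show ?thesis by (simp only: os_field_diff os_field_nu e)
    qed
    then have "norm (os_field nu \<alpha> t (z nu t) - os_field \<mu> \<alpha> t (z \<mu> t))
     \<le> norm (os_field nu \<alpha> t (z nu t - z \<mu> t)) + norm ((0, 0, 0, - ((nu - \<mu>) / of_real (th^8) * w \<mu> t)) :: complex \<times> complex \<times> complex \<times> complex)"
     by (simp only: norm_triangle_ineq)
    also have "\<dots> \<le> L * norm (z nu t - z \<mu> t) + cmod (nu - \<mu>) / th^8 * M"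
    proof (rule add_mono)
     show "norm (os_field nu \<alpha> t (z nu t - z \<mu> t)) \<le> L * norm (z nu t - z \<mu> t)"
      by (rule order_trans[OF os_field_norm[OF t] mult_right_mono[OF nL norm_ge_zero]])
     have "norm ((0, 0, 0, - ((nu - \<mu>) / of_real (th^8) * w \<mu> t)) :: complex \<times> complex \<times> complex \<times> complex) = cmod (nu - \<mu>) / th^8 * cmod (w \<mu> t)"
      using th by (simp add: norm_Pair norm_mult norm_divide norm_power)
     also have "\<dots> \<le> cmod (nu - \<mu>) / th^8 * M" using th by (intro mult_left_mono M t) auto
     finally show "norm ((0, 0, 0, - ((nu - \<mu>) / of_real (th^8) * w \<mu> t)) :: complex \<times> complex \<times> complex \<times> complex) \<le> cmod (nu - \<mu>) / th^8 * M" .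
    qed
    finally show "norm (os_field nu \<alpha> t (z nu t) - os_field \<mu> \<alpha> t (z \<mu> t)) \<le> L * norm (z nu t - z \<mu> t) + cmod (nu - \<mu>) / th^8 * M" .
   qed (use M th i os_lip_nonneg in \<open>auto simp: L_def z_def\<close>)
   then show ?thesis by (simp add: C_def mult_ac)
  qed
  have "((\<lambda>nu. z nu 2 - z \<mu> 2) \<longlongrightarrow> 0) (at \<mu>)"
  proof (rule Lim_null_comparison)
   show "\<forall>\<^sub>F nu in at \<mu>. norm (z nu 2 - z \<mu> 2) \<le> cmod (nu - \<mu>) * C"
    unfolding eventually_at using bd by (intro exI[of _ 1]) (auto simp: dist_norm)
   show "((\<lambda>nu. cmod (nu - \<mu>) * C) \<longlongrightarrow> 0) (at \<mu>)" by (auto intro!: tendsto_eq_intros)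
  qed
  then show ?thesis unfolding isCont_def by (simp add: LIM_zero_iff)
 qed
 then have c: "continuous_on UNIV (\<lambda>nu. z nu 2)" by (auto intro: continuous_at_imp_continuous_on)
 show "continuous_on UNIV (\<lambda>nu. u nu 2)" "continuous_on UNIV (\<lambda>nu. u1 nu 2)"
  using continuous_on_fst[OF c] continuous_on_fst[OF continuous_on_snd[OF c]] by (simp_all add: z_def)
qed

end

section \<open>The boundary conditions at both ends, and Brouwer's theorem\<close>

locale shooting = wall_profile +
 fixes nu0 :: complex and \<delta> \<alpha> :: real
 assumes nuB: "\<And>nu. nu \<in> cball nu0 \<delta> \<Longrightarrow> cmod nu \<le> B"
  and W: "\<And>nu s. nu \<in> cball nu0 \<delta> \<Longrightarrow> s \<ge> 0 \<Longrightarrow> cmod (tairy (nu - \<i> * of_real s)) \<le> B * exp (- (2 * s))"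
   "\<And>nu s. nu \<in> cball nu0 \<delta> \<Longrightarrow> s \<ge> 0 \<Longrightarrow> cmod (tairy' (nu - \<i> * of_real s)) \<le> B * exp (- (2 * s))"
   "\<And>nu s. nu \<in> cball nu0 \<delta> \<Longrightarrow> s \<ge> 0 \<Longrightarrow> cmod (eig_fun (nu - \<i> * of_real s)) \<le> B * exp (- (2 * s))"
  and Wlow: "\<And>nu. nu \<in> cball nu0 \<delta> \<Longrightarrow> cmod (tairy nu) \<ge> 1 / B" and al: "\<alpha>^2 \<le> B"
  and lin: "\<And>nu. nu \<in> cball nu0 \<delta> \<Longrightarrow> cmod (eig_fun nu + tairy nu0 * (nu - nu0)) \<le> cmod (tairy nu0) / 2 * cmod (nu - nu0)"
  and sm: "small_at B th" and sm4: "4 * B * th^6 \<le> 1" and smM: "exit_K B * th \<le> 1 / 2"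
  and rad: "2 * B * (exit_K B * (1 + sqrt (ln ((2 + th^4) / th^4))) * th^2) \<le> \<delta>"
begin

lemma small_os_solution:
 assumes "nu \<in> cball nu0 \<delta>" "os_system nu \<alpha> u u1 w w1" "u 0 = 0" "u 2 = 0"
 shows "small_os_solution V V1 V2 B th nu u u1 w w1 \<alpha>"
proof -
 note eg = W(3)[OF assms(1)]
 interpret airy_layer V V1 V2 B th nu
  using nuB[OF assms(1)] W[OF assms(1)] Wlow[OF assms(1)] by unfold_locales
 show ?thesis using assms(2) eg al sm sm4 smM assms(3,4)
  by unfold_locales (auto simp: os_system_def os_coeff_def pp_def simp del: of_real_power of_real_divide)
qed

text \<open>\<open>d\<close> and \<open>p\<close> span the solutions with \<open>u 0 = 0\<close> and
  zero wall vorticity; Cramer's rule adds the combination of them to \<open>a\<close> that achieves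
  \<open>u 2 = u' 2 = 0\<close>. Then \<open>w 0 = 1\<close>, and \<open>D nu\<close> is the
  resulting slope at the wall, whose zero is sought.\<close>

lemma shooting:
 defines "\<rho> \<equiv> 2 * B * (exit_K B * (1 + sqrt (ln ((2 + th^4) / th^4))) * th^2)"
 shows "\<exists>nu\<in>cball nu0 \<rho>. \<exists>u u1 w w1. os_system nu \<alpha> u u1 w w1 \<and> u 0 = 0 \<and> u1 0 = 0 \<and> u 2 = 0 \<and> u1 2 = 0 \<and> w 0 = 1"
proof -
 have ex: "\<exists>u u1 w w1. os_system nu \<alpha> u u1 w w1 \<and> u 0 = a \<and> u1 0 = b \<and> w 0 = c \<and> w1 0 = d" for nu a b c d
  using os_exists[of nu \<alpha> a b c d] by metis
 obtain d d1 dw dw1 where d: "\<And>nu. os_system nu \<alpha> (d nu) (d1 nu) (dw nu) (dw1 nu)"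
  "\<And>nu. d nu 0 = 0" "\<And>nu. d1 nu 0 = 1" "\<And>nu. dw nu 0 = 0" "\<And>nu. dw1 nu 0 = 0" using ex[of _ 0 1 0 0] by metis
 obtain a a1 aw aw1 where a: "\<And>nu. os_system nu \<alpha> (a nu) (a1 nu) (aw nu) (aw1 nu)"
  "\<And>nu. a nu 0 = 0" "\<And>nu. a1 nu 0 = 0" "\<And>nu. aw nu 0 = 1" "\<And>nu. aw1 nu 0 = 0" using ex[of _ 0 0 1 0] by metis
 obtain p p1 pw pw1 where p: "\<And>nu. os_system nu \<alpha> (p nu) (p1 nu) (pw nu) (pw1 nu)"
  "\<And>nu. p nu 0 = 0" "\<And>nu. p1 nu 0 = 0" "\<And>nu. pw nu 0 = 0" "\<And>nu. pw1 nu 0 = 1" using ex[of _ 0 0 0 1] by metis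
 define \<Delta> where "\<Delta> nu = d nu 2 * p1 nu 2 - p nu 2 * d1 nu 2" for nu
 define D where "D nu = (p nu 2 * a1 nu 2 - a nu 2 * p1 nu 2) / \<Delta> nu" for nu
 define P where "P nu = (a nu 2 * d1 nu 2 - d nu 2 * a1 nu 2) / \<Delta> nu" for nu
 have unique: "u1 0 = 0 \<and> w1 0 = 0" if nu: "nu \<in> cball nu0 \<delta>" and s: "os_system nu \<alpha> u u1 w w1"
  and z: "u 0 = 0" "u 2 = 0" "u1 2 = 0" "w 0 = 0" for nu u u1 w w1
 proof -
  interpret S: small_os_solution V V1 V2 B th nu u u1 w w1 \<alpha> by (rule small_os_solution[OF nu s z(1,2)])
  have zd: "f' = 0" if "(f has_vector_derivative f') (at t within {0..2})" "t \<in> {0..2}" "\<And>s. s \<in> {0..2} \<Longrightarrow> f s = 0" for f :: "real \<Rightarrow> complex" and f' t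
  proof -
   have "((\<lambda>_. 0) has_vector_derivative f') (at t within {0..2})"
    by (rule has_vector_derivative_transform[OF that(2) _ that(1)]) (use that(3) in auto)
   then show ?thesis using vector_derivative_unique_within_closed_interval[of 0 2 t "\<lambda>_. 0 :: complex" f' 0] that(2) by simp
  qed
  have u: "u t = 0" if "t \<in> {0..2}" for t by (rule S.eq_zero[OF z(3,4) that])
  have u1: "u1 t = 0" if "t \<in> {0..2}" for t by (rule zd[OF _ that u]) (use s that in \<open>auto simp: os_system_def\<close>)
  have "w t + of_real (\<alpha>^2) * u t = 0" if "t \<in> {0..2}" for t
   by (rule zd[OF _ that u1]) (use s that in \<open>auto simp: os_system_def\<close>)
  then have w: "w t = 0" if "t \<in> {0..2}" for t using u that by force
  have "w1 0 = 0" by (rule zd[OF _ _ w]) (use s in \<open>auto simp: os_system_def\<close>)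
  then show ?thesis using u1[of 0] by simp
 qed
 \<comment> \<open>If the determinant were zero, the combinations of \<open>d\<close> and
   \<open>p\<close> with coefficients taken from their values and then from their slopes at 2 would
   satisfy all conditions at 2. Uniqueness kills the coefficients, so \<open>d\<close> itself would
   satisfy them, against \<open>d1 nu 0 = 1\<close>.\<close>
 have \<Delta>: "\<Delta> nu \<noteq> 0" if nu: "nu \<in> cball nu0 \<delta>" for nu
 proof
  assume z: "\<Delta> nu = 0"
  have 1: "p nu 2 = 0 \<and> d nu 2 = 0"
   using unique[OF nu os_lincomb[OF d(1) p(1), of nu "p nu 2" "- d nu 2"]] z by (simp add: d p \<Delta>_def mult.commute)
  have 2: "p1 nu 2 = 0 \<and> d1 nu 2 = 0"
   using unique[OF nu os_lincomb[OF d(1) p(1), of nu "p1 nu 2" "- d1 nu 2"]] 1 by (simp add: d p mult.commute)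
  show False using unique[OF nu d(1)] 1 2 d by simp
 qed
 define u where "u nu t = 1 * (D nu * d nu t + P nu * p nu t) + 1 * a nu t" for nu t
 define u1 where "u1 nu t = 1 * (D nu * d1 nu t + P nu * p1 nu t) + 1 * a1 nu t" for nu t
 define w where "w nu t = 1 * (D nu * dw nu t + P nu * pw nu t) + 1 * aw nu t" for nu t
 define w1 where "w1 nu t = 1 * (D nu * dw1 nu t + P nu * pw1 nu t) + 1 * aw1 nu t" for nu t
 have sys: "os_system nu \<alpha> (u nu) (u1 nu) (w nu) (w1 nu)" for nu
  unfolding u_def u1_def w_def w1_def by (intro os_lincomb d p a)
 have init: "u nu 0 = 0" "u1 nu 0 = D nu" "w nu 0 = 1" for nu by (simp_all add: u_def u1_def w_def d p a)
 have fin: "u nu 2 = 0" "u1 nu 2 = 0" if "nu \<in> cball nu0 \<delta>" for nu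
 proof -
  have "D nu * \<Delta> nu = p nu 2 * a1 nu 2 - a nu 2 * p1 nu 2" "P nu * \<Delta> nu = a nu 2 * d1 nu 2 - d nu 2 * a1 nu 2"
   using \<Delta>[OF that] by (simp_all add: D_def P_def)
  then have "u nu 2 * \<Delta> nu = 0" "u1 nu 2 * \<Delta> nu = 0" unfolding u_def u1_def \<Delta>_def by algebra+
  then show "u nu 2 = 0" "u1 nu 2 = 0" using \<Delta>[OF that] by auto
 qed
 define \<eta> where "\<eta> = exit_K B * (1 + sqrt (ln ((2 + th^4) / th^4))) * th^2"
 have \<rho>: "\<rho> = 2 * B * \<eta>" "\<rho> \<le> \<delta>" "\<eta> > 0" "\<rho> > 0"
 proof -
  show r: "\<rho> = 2 * B * \<eta>" "\<rho> \<le> \<delta>" using rad by (simp_all add: \<rho>_def \<eta>_def)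
  have "exit_K B > 0" using energy_K_ge1[OF B1] solve_K_ge1[OF B1] B0 by (simp add: exit_K_def)
  moreover have "sqrt (ln ((2 + th^4) / th^4)) \<ge> 0" using th by (intro real_sqrt_ge_zero ln_ge_zero) auto
  ultimately show e: "\<eta> > 0" using th unfolding \<eta>_def by (intro mult_pos_pos add_pos_nonneg) auto
  show "\<rho> > 0" using r e B0 by simp
 qed
 have sub: "nu \<in> cball nu0 \<delta>" if "nu \<in> cball nu0 \<rho>" for nu using that \<rho> by auto
 have nu0: "nu0 \<in> cball nu0 \<delta>" using \<rho> by auto
 have tn: "tairy nu \<noteq> 0" if "nu \<in> cball nu0 \<delta>" for nu
  using Wlow[OF that] B0 by (metis divide_pos_pos linorder_not_le norm_zero zero_less_one)
 \<comment> \<open>A simplified Newton map whose fixed points are the zeros of \<open>D\<close>. By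
   the wall estimate the correction is \<open>(eig_fun nu + O(\<eta>)) / tairy nu0\<close>, so
   \<open>T nu - nu0\<close> is the linearisation error of \<open>eig_fun\<close> plus
   \<open>O(\<eta>)\<close>, divided by \<open>tairy nu0\<close>: at most
   \<open>\<rho> / 2 + B * \<eta>\<close>. This is \<open>\<rho>\<close> exactly for the radius
   \<open>2 * B * \<eta>\<close>.\<close>
 define T where "T nu = nu + \<i> * (D nu * tairy nu / of_real h) / tairy nu0" for nu
 have est: "cmod (D nu * tairy nu / of_real h + \<i> * eig_fun nu) \<le> \<eta>" if "nu \<in> cball nu0 \<delta>" for nu
 proof -
  interpret S: small_os_solution V V1 V2 B th nu "u nu" "u1 nu" "w nu" "w1 nu" \<alpha>
   by (rule small_os_solution[OF that sys init(1) fin(1)[OF that]])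
  show ?thesis using S.wall_derivative_estimate[OF fin(2)[OF that]] unfolding init \<eta>_def h_def by simp
 qed
 obtain nu where nu: "nu \<in> cball nu0 \<rho>" "T nu = nu"
 proof (rule brouwer_ball[OF \<rho>(4)])
  note c = os_parameter_continuous[OF d] os_parameter_continuous[OF a] os_parameter_continuous[OF p]
  have ct: "continuous_on (cball nu0 \<rho>) tairy"
   using tairy_deriv DERIV_isCont by (blast intro: continuous_at_imp_continuous_on)
  have cD: "continuous_on (cball nu0 \<rho>) D"
   unfolding D_def[abs_def] using \<Delta>[OF sub] unfolding \<Delta>_def
   by (intro continuous_intros c[THEN continuous_on_subset]) auto
  show "continuous_on (cball nu0 \<rho>) T"
   unfolding T_def[abs_def] using h tn[OF nu0] by (intro continuous_intros cD ct) auto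
  show "T \<in> cball nu0 \<rho> \<rightarrow> cball nu0 \<rho>"
  proof
   fix nu assume nu: "nu \<in> cball nu0 \<rho>"
   define z where "z = T nu"
   define X where "X = D nu * tairy nu / of_real h + \<i> * eig_fun nu"
   have X: "cmod X \<le> \<eta>" unfolding X_def by (rule est[OF sub[OF nu]])
   have "(n + \<i> * r / s - n0) * s = (e + s * (n - n0)) + \<i> * (r + \<i> * e)" if "s \<noteq> 0" for n n0 r s e :: complex
   proof -
    have "(n + \<i> * r / s - n0) * s = s * (n - n0) + \<i> * r" using that by (simp add: field_simps)
    moreover have "\<i> * (r + \<i> * e) = \<i> * r - e" by (simp add: distrib_left flip: mult.assoc)
    ultimately show ?thesis by simp
   qed
   from this[OF tn[OF nu0]] have "(z - nu0) * tairy nu0 = (eig_fun nu + tairy nu0 * (nu - nu0)) + \<i> * X"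
    unfolding z_def T_def X_def .
   then have "cmod (z - nu0) * cmod (tairy nu0) \<le> cmod (eig_fun nu + tairy nu0 * (nu - nu0)) + cmod (\<i> * X)"
    by (metis norm_mult norm_triangle_ineq)
   also have "\<dots> \<le> cmod (tairy nu0) / 2 * \<rho> + cmod (tairy nu0) * (B * \<eta>)"
   proof (rule add_mono)
    have "cmod (nu - nu0) \<le> \<rho>" using nu by (simp add: dist_norm norm_minus_commute)
    then have "cmod (tairy nu0) / 2 * cmod (nu - nu0) \<le> cmod (tairy nu0) / 2 * \<rho>" by (intro mult_left_mono) auto
    then show "cmod (eig_fun nu + tairy nu0 * (nu - nu0)) \<le> cmod (tairy nu0) / 2 * \<rho>" using lin[OF sub[OF nu]] by linarith
    have "1 \<le> cmod (tairy nu0) * B" using Wlow[OF nu0] B0 by (simp add: divide_le_eq)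
    then have "1 * \<eta> \<le> cmod (tairy nu0) * B * \<eta>" using \<rho>(3) by (intro mult_right_mono) auto
    then show "cmod (\<i> * X) \<le> cmod (tairy nu0) * (B * \<eta>)" using X by (simp add: norm_mult mult.assoc)
   qed
   also have "\<dots> = \<rho> * cmod (tairy nu0)" by (simp add: \<rho>(1))
   finally have "cmod (z - nu0) \<le> \<rho>" using tn[OF nu0] by simp
   then show "T nu \<in> cball nu0 \<rho>" by (simp add: z_def dist_norm norm_minus_commute)
  qed
 qed
 have "D nu = 0" using nu(2) tn[OF nu0] tn[OF sub[OF nu(1)]] h by (simp add: T_def)
 then show ?thesis using nu(1) sys[of nu] init[of nu] fin[OF sub[OF nu(1)]] by metis
qed

end

section \<open>From solutions of the system to the kernel of the Orr-Sommerfeld operator\<close>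

lemma continuous_Icc_L2:
 fixes g :: "real \<Rightarrow> complex"
 assumes c: "continuous_on {a..b} g" shows "g \<in> L2_on {a<..<b}"
proof -
 have "(\<lambda>x. indicator {a<..<b} x *\<^sub>R g x) \<in> borel_measurable borel"
  by (rule borel_measurable_continuous_on_indicator[OF _ continuous_on_subset[OF c]]) auto
 then have "set_borel_measurable lebesgue {a<..<b} g" unfolding set_borel_measurable_def by (intro measurable_completion) simp
 moreover have "set_integrable lebesgue {a..b} (\<lambda>x. (cmod (g x))^2)"
  by (intro absolutely_integrable_continuous_real continuous_intros c)
 then have "set_integrable lebesgue {a<..<b} (\<lambda>x. (cmod (g x))^2)" by (rule set_integrable_subset) auto
 ultimately show ?thesis by (simp add: L2_on_def)
qed

lemma has_vector_derivative_shift: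
 assumes "(F has_vector_derivative F') (at t within {0..2})" "t \<in> {0<..<2}" "x + 1 = t"
 shows "((\<lambda>x. F (x + 1)) has_vector_derivative F') (at x)"
proof -
 have "at t within {0..2} = at t" by (rule at_within_interior) (use assms(2) in auto)
 then have F: "(F has_vector_derivative F') (at (x + 1))" using assms by simp
 have "((\<lambda>x. x + 1) has_vector_derivative 1) (at x)"
  by (auto intro!: derivative_eq_intros simp: has_real_derivative_iff_has_vector_derivative[symmetric])
 from vector_diff_chain_at[OF this F] show ?thesis by (simp add: o_def)
qed

context wall_profile
begin

text \<open>The system makes \<open>u\<close> four times continuously differentiable up to the end
  points, so the classical derivatives are weak derivatives and supply the boundary values.\<close>

lemma os_eigenfunction:
 assumes s: "os_system nu \<alpha> u u1 w w1" and z: "u 0 = 0" "u1 0 = 0" "u 2 = 0" "u1 2 = 0" "w 0 = 1"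
  and UV: "\<And>x. x \<in> {-1<..<1} \<Longrightarrow> U x = U (-1) + V (x + 1)"
   "\<And>x. x \<in> {-1<..<1} \<Longrightarrow> (deriv_within {-1..1} ^^ 2) U x = V2 (x + 1)"
 shows "nontrivial_kernel {-1<..<1} OS_dom (OS_op U (\<i> * of_real (U (-1)) + of_real (th^4) * nu) \<alpha> (1 / th^12))"
proof -
 let ?S = "{-1<..<1} :: real set"
 define w2 where "w2 t = os_coeff nu t * w t - \<i> * of_real (V2 t / th^12) * u t" for t
 note c = os_system_continuous[OF s]
 have cw2: "continuous_on {0..2} w2"
  unfolding w2_def os_coeff_def using th by (intro continuous_intros c cV cV2) auto
 define g where "g k = (if k = 0 then (\<lambda>x. u (x + 1)) else if k = 1 then (\<lambda>x. u1 (x + 1))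
   else if k = 2 then (\<lambda>x. w (x + 1) + of_real (\<alpha>^2) * u (x + 1))
   else if k = 3 then (\<lambda>x. w1 (x + 1) + of_real (\<alpha>^2) * u1 (x + 1))
   else (\<lambda>x. w2 (x + 1) + of_real (\<alpha>^2) * (w (x + 1) + of_real (\<alpha>^2) * u (x + 1))))" for k :: nat
 define wk where "wk k = (if k = 0 then (\<lambda>x. w (x + 1)) else if k = 1 then (\<lambda>x. w1 (x + 1)) else (\<lambda>x. w2 (x + 1)))" for k :: nat
 have sh: "continuous_on {-1..1} (\<lambda>x. F (x + 1))" if "continuous_on {0..2} F" for F :: "real \<Rightarrow> complex"
  by (rule continuous_on_compose2[OF that]) (auto intro!: continuous_intros)
 have cg: "continuous_on {-1..1} (g k)" for k
  unfolding g_def by (auto intro!: continuous_intros sh c cw2)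
 have cwk: "continuous_on {-1..1} (wk k)" for k unfolding wk_def by (auto intro!: sh c cw2)
 have d: "((\<lambda>x. u (x + 1)) has_vector_derivative u1 (x + 1)) (at x)"
  "((\<lambda>x. u1 (x + 1)) has_vector_derivative w (x + 1) + of_real (\<alpha>^2) * u (x + 1)) (at x)"
  "((\<lambda>x. w (x + 1)) has_vector_derivative w1 (x + 1)) (at x)"
  "((\<lambda>x. w1 (x + 1)) has_vector_derivative w2 (x + 1)) (at x)" if "x \<in> ?S" for x
  using s[unfolded os_system_def, THEN bspec, of "x + 1"] that
  by (auto intro!: has_vector_derivative_shift[of _ _ "x + 1"] simp: w2_def)
 have dg: "(g k has_vector_derivative g (Suc k) x) (at x)" if "k < 4" "x \<in> ?S" for k x
 proof -
  have "k = 0 \<or> k = 1 \<or> k = 2 \<or> k = 3" using that by auto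
  moreover have "((\<lambda>x. w (x + 1) + of_real (\<alpha>^2) * u (x + 1)) has_vector_derivative w1 (x + 1) + of_real (\<alpha>^2) * u1 (x + 1)) (at x)"
   "((\<lambda>x. w1 (x + 1) + of_real (\<alpha>^2) * u1 (x + 1)) has_vector_derivative w2 (x + 1) + of_real (\<alpha>^2) * (w (x + 1) + of_real (\<alpha>^2) * u (x + 1))) (at x)"
   by (intro has_vector_derivative_add has_vector_derivative_mult_right d that)+
  ultimately show ?thesis using d[OF that(2)] by (auto simp: g_def simp del: of_real_power)
 qed
 have cS: "continuous_on ?S f" if "continuous_on {-1..1} f" for f :: "real \<Rightarrow> complex"
  by (rule continuous_on_subset[OF that]) auto
 have wg: "is_weak_deriv ?S k (g 0) (g k)" if "k \<le> 4" for k
  by (rule is_weak_deriv_classical) (use dg cg cS that in \<open>auto simp: is_interval_oo\<close>)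
 have ww: "is_weak_deriv ?S 2 (wk 0) (wk 2)"
 proof (rule is_weak_deriv_classical)
  show "(wk k has_vector_derivative wk (Suc k) x) (at x)" if "k < 2" "x \<in> ?S" for k x
  proof -
   have "k = 0 \<or> k = 1" using that by auto
   then show ?thesis using d[OF that(2)] by (auto simp: wk_def)
  qed
 qed (use cwk cS in \<open>auto simp: is_interval_oo\<close>)
 have ae: "ae_eq_on ?S (weak_deriv ?S k (g 0)) (g k)" "is_weak_deriv ?S k (g 0) (weak_deriv ?S k (g 0))" if "k \<le> 4" for k
  using weak_deriv_ae[OF _ wg[OF that]] by auto
 have cl: "closure ?S = {-1..1}" by simp
 have dom: "g 0 \<in> OS_dom" unfolding OS_dom_def sobolev_H_def
 proof (intro CollectI conjI allI impI ballI)
  show "g 0 \<in> L2_on ?S" by (rule continuous_Icc_L2[OF cg])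
  show "\<exists>v\<in>L2_on ?S. is_weak_deriv ?S k (g 0) v" if "k \<le> 4" for k
   using wg[OF that] continuous_Icc_L2[OF cg] by blast
  fix p :: real assume "p \<in> {-1, 1}"
  then have p: "g 0 p = 0" "g 1 p = 0" using z by (auto simp: g_def)
  show "has_boundary_value ?S (g 0) p 0"
   unfolding has_boundary_value_def cl using cg[of 0] p by (intro exI[of _ "g 0"]) (auto simp: ae_eq_on_def)
  show "has_boundary_value ?S (weak_deriv ?S 1 (g 0)) p 0"
   unfolding has_boundary_value_def cl using cg[of 1] ae(1)[of 1] p by (intro exI[of _ "g 1"]) auto
 qed
 \<comment> \<open>\<open>W\<close> is formed with the representative that \<open>weak_deriv\<close>
   picks, and \<open>OS_op\<close> differentiates it again; it is therefore compared almost
   everywhere with the classical vorticity first.\<close>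
 define W where "W x = weak_deriv ?S 2 (g 0) x - of_real (\<alpha>^2) * g 0 x" for x
 have aeW: "ae_eq_on ?S W (wk 0)"
  using ae(1)[of 2] unfolding ae_eq_on_def by (auto simp: W_def g_def wk_def elim!: eventually_mono)
 have liW: "locally_integrable_on ?S W" unfolding W_def using ae(2)[of 2]
  by (intro locally_integrable_diff locally_integrable_mult continuous_intros) (auto simp: is_weak_deriv_def)
 have aeW2: "ae_eq_on ?S (weak_deriv ?S 2 W) (wk 2)"
  by (rule weak_deriv_ae(2)[OF _ is_weak_deriv_cong_ae[OF aeW liW ww]]) simp
 have ker: "ae_eq_on ?S (OS_op U (\<i> * of_real (U (-1)) + of_real (th^4) * nu) \<alpha> (1 / th^12) (g 0)) (\<lambda>x. 0)"
  using aeW aeW2 unfolding ae_eq_on_def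
 proof eventually_elim
  case (elim x)
  show ?case
  proof
   assume x: "x \<in> ?S"
   \<comment> \<open>With \<open>\<beta> = 1 / th^12\<close> the part \<open>th^4 * nu\<close> of
     the spectral parameter becomes \<open>nu / th^8\<close>, while the part
     \<open>\<i> * U (-1)\<close> cancels against \<open>U = U (-1) + V\<close>.\<close>
   have t: "of_real (1 / th^12) * (of_real (th^4) * nu) = nu / of_real (th^8)"
    using th by (simp add: field_simps flip: power_add)
   have "OS_op U (\<i> * of_real (U (-1)) + of_real (th^4) * nu) \<alpha> (1 / th^12) (g 0) x
    = - weak_deriv ?S 2 W x + (\<i> * of_real (1 / th^12) * of_real (U x)
      - of_real (1 / th^12) * (\<i> * of_real (U (-1)) + of_real (th^4) * nu)) * W x
     - \<i> * of_real (1 / th^12) * of_real ((deriv_within {-1..1} ^^ 2) U x) * g 0 x"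
    unfolding OS_op_def Let_def W_def[symmetric, abs_def] by simp
   also have "\<dots> = - w2 (x + 1) + (\<i> * of_real (1 / th^12) * of_real (U (-1) + V (x + 1))
      - of_real (1 / th^12) * (\<i> * of_real (U (-1)) + of_real (th^4) * nu)) * w (x + 1)
     - \<i> * of_real (1 / th^12) * of_real (V2 (x + 1)) * u (x + 1)"
    using elim x by (simp only: UV[OF x]) (simp add: wk_def g_def)
   also have "\<dots> = - w2 (x + 1) + (\<i> * of_real (1 / th^12) * of_real (V (x + 1)) - of_real (1 / th^12) * (of_real (th^4) * nu)) * w (x + 1)
     - \<i> * of_real (1 / th^12) * of_real (V2 (x + 1)) * u (x + 1)"
    by (simp only: of_real_add distrib_left) (simp add: algebra_simps)
   also have "\<dots> = 0" unfolding t w2_def os_coeff_def by simp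
   finally show "OS_op U (\<i> * of_real (U (-1)) + of_real (th^4) * nu) \<alpha> (1 / th^12) (g 0) x = 0" .
  qed
 qed
 \<comment> \<open>Nontriviality comes from \<open>w 0 = 1\<close>: a null function would be
   identically zero in the interior with all its derivatives, and the vorticity would vanish up to
   the end point by continuity.\<close>
 have nz: "\<not> ae_eq_on ?S (g 0) (\<lambda>x. 0)"
 proof
  assume a: "ae_eq_on ?S (g 0) (\<lambda>x. 0)"
  have g0: "g 0 x = 0" if "x \<in> ?S" for x
   by (rule continuous_ae_zero[OF _ cS[OF cg] a that]) simp
  have zero: "f' = 0" if "(f has_vector_derivative f') (at x)" "\<And>x. x \<in> ?S \<Longrightarrow> f x = 0" "x \<in> ?S" for f :: "real \<Rightarrow> complex" and f' x
  proof -
   have "(f has_vector_derivative 0) (at x)"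
    by (rule has_vector_derivative_transform_within_open[OF has_vector_derivative_const[of 0], of ?S]) (use that in auto)
   then show ?thesis using vector_derivative_unique_at that(1) by blast
  qed
  have g1: "g 1 x = 0" if "x \<in> ?S" for x using zero[OF dg[of 0, OF _ that] g0 that] by simp
  have g2: "g 2 x = 0" if "x \<in> ?S" for x using zero[OF dg[of 1, OF _ that] g1 that] by (simp add: numeral_2_eq_2)
  have "wk 0 x = 0" if "x \<in> ?S" for x using g0[OF that] g2[OF that] by (simp add: g_def wk_def)
  moreover have "continuous_on (closure ?S) (wk 0)" unfolding cl by (rule cwk)
  ultimately have "wk 0 (-1) = 0" by (intro continuous_constant_on_closure[of ?S "wk 0" 0 "-1"]) auto
  then show False using z by (simp add: wk_def)
 qed
 show ?thesis unfolding nontrivial_kernel_def using dom ker nz by blast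
qed

end

section \<open>Choice of the constants and of the threshold\<close>

lemma profile_exists:
 fixes U :: "real \<Rightarrow> real"
 assumes C: "C_class_on 4 {-1..1} U" and pos: "\<forall>x\<in>{-1<..1}. U x > U (-1)" and one: "deriv_within {-1..1} U (-1) = 1"
 defines "V \<equiv> \<lambda>t. U (t - 1) - U (-1)" and "V1 \<equiv> \<lambda>t. deriv_within {-1..1} U (t - 1)"
  and "V2 \<equiv> \<lambda>t. (deriv_within {-1..1} ^^ 2) U (t - 1)"
 obtains B0 where "\<And>B th. B0 \<le> B \<Longrightarrow> 0 < th \<Longrightarrow> th \<le> 1 \<Longrightarrow> wall_profile V V1 V2 B th"
proof -
 let ?D = "\<lambda>k. (deriv_within {-1..1} ^^ k) U"
 have D: "(?D k has_vector_derivative ?D (Suc k) x) (at x within {-1..1})" if "k < 4" "x \<in> {-1..1}" for k x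
 proof -
  have "?D k differentiable (at x within {-1..1})" using C that by (auto simp: C_class_on_def differentiable_on_def)
  then have "(?D k has_vector_derivative vector_derivative (?D k) (at x within {-1..1})) (at x within {-1..1})"
   by (simp add: vector_derivative_works)
  then show ?thesis by (simp add: deriv_within_def)
 qed
 have sh: "((\<lambda>t. F (t - 1)) has_real_derivative F' (t - 1)) (at t within {0..2})"
  if "\<And>x. x \<in> {-1..1} \<Longrightarrow> (F has_vector_derivative F' x) (at x within {-1..1})" "t \<in> {0..2}" for F F' :: "real \<Rightarrow> real" and t
 proof -
  have "((\<lambda>t. t - 1) has_vector_derivative 1) (at t within {0..2})"
   by (auto intro!: derivative_eq_intros simp: has_real_derivative_iff_has_vector_derivative[symmetric])
  moreover have "(\<lambda>t. t - 1) ` {0..2} = {-1..1::real}" by (auto intro!: image_eqI[of _ _ "_ + 1"])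
  ultimately have "(F \<circ> (\<lambda>t. t - 1) has_vector_derivative 1 *\<^sub>R F' (t - 1)) (at t within {0..2})"
   using vector_diff_chain_within[of "\<lambda>t. t - 1" 1 t "{0..2}" F "F' (t - 1)"] that by simp
  then show ?thesis by (simp add: o_def has_real_derivative_iff_has_vector_derivative)
 qed
 have dV: "(V has_real_derivative V1 t) (at t within {0..2})" if "t \<in> {0..2}" for t
  using DERIV_diff[OF sh[OF D[of 0] that] DERIV_const[of "U (-1)"]] by (simp add: V_def V1_def)
 have dV1: "(V1 has_real_derivative V2 t) (at t within {0..2})" if "t \<in> {0..2}" for t
  using sh[OF D[of 1] that] by (simp add: V1_def V2_def numeral_2_eq_2)
 have dV2: "(V2 has_real_derivative ?D 3 (t - 1)) (at t within {0..2})" if "t \<in> {0..2}" for t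
  using sh[OF D[of 2] that] by (simp add: V2_def numeral_3_eq_3 numeral_2_eq_2)
 have cV: "continuous_on {0..2} V" "continuous_on {0..2} V1" "continuous_on {0..2} V2"
  unfolding continuous_on_eq_continuous_within using dV dV1 dV2 DERIV_continuous by blast+
 have bd: "\<exists>M. \<forall>t\<in>{0..2}. \<bar>F t\<bar> \<le> M" if "continuous_on {0..2} F" for F :: "real \<Rightarrow> real"
  using compact_imp_bounded[OF compact_continuous_image[OF that compact_Icc]] by (auto simp: bounded_iff)
 obtain M1 M2 where M12: "\<And>t. t \<in> {0..2} \<Longrightarrow> \<bar>V1 t\<bar> \<le> M1" "\<And>t. t \<in> {0..2} \<Longrightarrow> \<bar>V2 t\<bar> \<le> M2"
  using bd[OF cV(2)] bd[OF cV(3)] by metis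
 define M where "M = max 1 (max M1 M2)"
 have M: "M \<ge> 1" "\<And>t. t \<in> {0..2} \<Longrightarrow> \<bar>V1 t\<bar> \<le> M" "\<And>t. t \<in> {0..2} \<Longrightarrow> \<bar>V2 t\<bar> \<le> M"
  using M12 by (auto simp: M_def le_max_iff_disj)
 have mvt: "\<bar>F s - F t\<bar> \<le> K * \<bar>s - t\<bar>"
  if A: "\<And>x. x \<in> {0..r} \<Longrightarrow> (F has_real_derivative F' x) (at x within {0..2})" "\<And>x. x \<in> {0..r} \<Longrightarrow> \<bar>F' x\<bar> \<le> K"
   "s \<in> {0..r}" "t \<in> {0..r}" "r \<le> 2" for F F' :: "real \<Rightarrow> real" and K r s t
 proof -
  have "norm (F s - F t) \<le> K * norm (s - t)"
  proof (rule field_differentiable_bound[of "{0..r}" F F'])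
   show "(F has_real_derivative F' x) (at x within {0..r})" if "x \<in> {0..r}" for x
    by (rule DERIV_subset[OF A(1)[OF that]]) (use A(5) in auto)
  qed (use A in auto)
  then show ?thesis by simp
 qed
 have V0: "V 0 = 0" and V10: "V1 0 = 1" using one by (auto simp: V_def V1_def)
 have Vlip: "\<bar>V s - V t\<bar> \<le> M * \<bar>s - t\<bar>" if "s \<in> {0..2}" "t \<in> {0..2}" for s t
  by (rule mvt[of 2 V V1]) (use dV M that in auto)
 have Vlin: "\<bar>V t - t\<bar> \<le> M * t^2" if t: "t \<in> {0..2}" for t
 proof -
  have "\<bar>(V t - t) - (V 0 - 0)\<bar> \<le> (M * t) * \<bar>t - 0\<bar>"
  proof (rule mvt[of t "\<lambda>t. V t - t" "\<lambda>t. V1 t - 1"])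
   fix x assume x: "x \<in> {0..t}"
   then have x2: "x \<in> {0..2}" using t by auto
   show "((\<lambda>t. V t - t) has_real_derivative V1 x - 1) (at x within {0..2})" by (intro DERIV_diff dV x2 DERIV_ident)
   have "\<bar>V1 x - V1 0\<bar> \<le> M * \<bar>x - 0\<bar>" by (rule mvt[of 2 V1 V2]) (use dV1 M x2 in auto)
   also have "\<dots> \<le> M * t" using x M(1) by (intro mult_left_mono) auto
   finally show "\<bar>V1 x - 1\<bar> \<le> M * t" by (simp add: V10)
  qed (use t in auto)
  then show ?thesis using t V0 by (simp add: power2_eq_square mult.assoc)
 qed
 \<comment> \<open>Up to distance \<open>r\<close> the Taylor bound gives
   \<open>V t \<ge> t - M * t^2 \<ge> t / 2\<close>. Beyond it \<open>V\<close> has a positive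
   minimum \<open>V t0\<close>, and \<open>t \<le> 2\<close> leads to the entry
   \<open>2 / V t0\<close> of \<open>B0\<close>.\<close>
 define r where "r = 1 / (2 * M)"
 have r: "0 < r" "r \<le> 2" using M(1) by (auto simp: r_def divide_le_eq)
 obtain t0 where t0: "t0 \<in> {r..2}" "\<And>t. t \<in> {r..2} \<Longrightarrow> V t0 \<le> V t"
  using continuous_attains_inf[of "{r..2}" V] continuous_on_subset[OF cV(1), of "{r..2}"] r by auto
 have m: "V t0 > 0" using pos t0(1) r by (auto simp: V_def)
 define B0 where "B0 = max M (max 2 (2 / V t0))"
 have "wall_profile V V1 V2 B th" if B: "B0 \<le> B" and th: "0 < th" "th \<le> 1" for B th
 proof
  have B': "M \<le> B" "2 \<le> B" "2 / V t0 \<le> B" using B by (auto simp: B0_def)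
  then show "1 \<le> B" by simp
  fix t :: real assume t: "t \<in> {0..2}"
  show "t / B \<le> V t"
  proof (cases "t \<le> r")
   case True
   have "M * t \<le> M * r" using True M by (intro mult_left_mono) auto
   then have "M * t \<le> 1 / 2" using M by (simp add: r_def)
   then have "M * t * t \<le> 1 / 2 * t" using t by (intro mult_right_mono) auto
   then have "t / 2 \<le> V t" using Vlin[OF t] by (simp add: power2_eq_square mult.assoc abs_le_iff)
   moreover have "t / B \<le> t / 2" using B' t by (intro divide_left_mono) auto
   ultimately show ?thesis by linarith
  next
   case False
   have "t / B \<le> 2 / B" using B' t by (intro divide_right_mono) auto
   also have "\<dots> \<le> V t0" using B' m by (simp add: divide_le_eq mult.commute)
   also have "\<dots> \<le> V t" using False t by (intro t0) auto
   finally show ?thesis .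
  qed
  have "M * t \<le> B * t" using B' t by (intro mult_right_mono) auto
  then show "V t \<le> B * t" using Vlip[OF t, of 0] t V0 by simp
  show "\<bar>V t - t\<bar> \<le> B * t^2" using Vlin[OF t] B'(1) mult_right_mono[of M B "t^2"] by simp
  show "\<bar>V t - V 2\<bar> \<le> B * (2 - t)" using Vlip[OF t, of 2] t B'(1) mult_right_mono[of M B "2 - t"] by simp
  show "\<bar>V1 t\<bar> \<le> B" "\<bar>V2 t\<bar> \<le> B" using M(2,3)[OF t] B' by auto
 qed (use th dV dV1 cV V0 in auto)
 then show thesis by (rule that)
qed

text \<open>All constants are fixed from \<open>U\<close>, \<open>nu0\<close> and the range of
  \<open>\<alpha>\<close> before \<open>th\<close> is chosen; after that finitely many conditions
  hold for small \<open>th\<close>, uniformly in \<open>\<alpha>\<close>.\<close>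

lemma kernel_near_leftmost_zero:
 fixes U :: "real \<Rightarrow> real"
 assumes C: "C_class_on 4 {-1..1} U" and pos: "\<forall>x\<in>{-1<..1}. U x > U (-1)" and one: "deriv_within {-1..1} U (-1) = 1"
  and nu0: "nu0 \<in> leftmost_zeros" and \<epsilon>: "\<epsilon> > 0"
 shows "\<exists>th0>0. \<forall>th. 0 < th \<longrightarrow> th \<le> th0 \<longrightarrow> (\<forall>\<alpha>\<in>{0..\<alpha>0}. \<exists>\<Lambda>.
  cmod (\<Lambda> - of_real (th^4) * nu0 - \<i> * of_real (U (-1))) \<le> (1 / th^12) powr (- 1/2 + \<epsilon>) \<and>
  nontrivial_kernel {-1<..<1} OS_dom (OS_op U \<Lambda> \<alpha> (1 / th^12)))"
proof -
 define V where "V = (\<lambda>t. U (t - 1) - U (-1))"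
 define V1 where "V1 = (\<lambda>t. deriv_within {-1..1} U (t - 1))"
 define V2 where "V2 = (\<lambda>t. (deriv_within {-1..1} ^^ 2) U (t - 1))"
 obtain B0 where B0: "\<And>B th. B0 \<le> B \<Longrightarrow> 0 < th \<Longrightarrow> th \<le> 1 \<Longrightarrow> wall_profile V V1 V2 B th"
  using profile_exists[OF C pos one] unfolding V_def V1_def V2_def by metis
 have e0: "eig_fun nu0 = 0" using nu0 by (simp add: leftmost_zeros_def)
 define \<tau> where "\<tau> = cmod (tairy nu0)"
 have \<tau>: "\<tau> > 0" using eig_fun_simple[OF e0] by (simp add: \<tau>_def)
 have "(eig_fun has_derivative (*) (- tairy nu0)) (at nu0)" using eig_fun_deriv[of nu0] by (simp add: has_field_derivative_def)
 then obtain d1 where d1: "d1 > 0"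
  "\<And>nu. cmod (nu - nu0) < d1 \<Longrightarrow> cmod (eig_fun nu - eig_fun nu0 - (- tairy nu0) * (nu - nu0)) \<le> \<tau> / 2 * cmod (nu - nu0)"
  unfolding has_derivative_at_alt using \<tau> by (metis half_gt_zero)
 have "isCont tairy nu0" by (rule DERIV_isCont[OF tairy_deriv])
 then obtain d2 where d2: "d2 > 0" "\<And>nu. cmod (nu - nu0) < d2 \<Longrightarrow> cmod (tairy nu - tairy nu0) < \<tau> / 2"
  unfolding continuous_at_eps_delta dist_norm using \<tau> half_gt_zero by metis
 define \<delta> where "\<delta> = min d1 d2 / 2"
 have \<delta>: "\<delta> > 0" "\<delta> < d1" "\<delta> < d2" using d1(1) d2(1) by (auto simp: \<delta>_def min_def)
 have near: "cmod (nu - nu0) \<le> \<delta>" if "nu \<in> cball nu0 \<delta>" for nu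
  using that by (simp add: dist_norm norm_minus_commute)
 define R where "R = cmod nu0 + \<delta>"
 \<comment> \<open>One constant serves every hypothesis: \<open>R\<close> bounds the parameters in
   the ball, \<open>tdecay R\<close> and the next entry the decay of the Airy functions there,
   \<open>2 / \<tau>\<close> the inverse of \<open>tairy\<close> near its nonzero value, and the
   last entry \<open>\<alpha>^2\<close>.\<close>
 define B where "B = Max {1, B0, R, tdecay R, 2 * tdecay R * exp ((R + 2)^2 + 1), 2 / \<tau>, \<alpha>0^2}"
 have B: "1 \<le> B" "B0 \<le> B" "R \<le> B" "tdecay R \<le> B" "2 * tdecay R * exp ((R + 2)^2 + 1) \<le> B" "2 / \<tau> \<le> B" "\<alpha>0^2 \<le> B"
  unfolding B_def by (rule Max_ge; simp)+
 define \<rho> where "\<rho> th = 2 * B * (exit_K B * (1 + sqrt (ln ((2 + th^4) / th^4))) * th^2)" for th :: real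
 \<comment> \<open>The last condition is where \<open>\<epsilon>\<close> is spent:
   \<open>th powr (12 * \<epsilon>) = \<beta> powr (- \<epsilon>)\<close> outweighs the constants
   and the root of the logarithm.\<close>
 have ev: "\<forall>\<^sub>F th in at_right 0. th < (1::real)" "\<forall>\<^sub>F th in at_right 0. layer_S B * th^4 < 2"
  "\<forall>\<^sub>F th in at_right 0. 24 * B^2 * exp (layer_S B) * (layer_K B)^2 * th^8 < 1"
  "\<forall>\<^sub>F th in at_right 0. 288 * B^7 * energy_K B * th^2 < 1"
  "\<forall>\<^sub>F th in at_right 0. 4 * B * th^6 < 1" "\<forall>\<^sub>F th in at_right 0. exit_K B * th < 1 / 2"
  "\<forall>\<^sub>F th in at_right 0. \<rho> th < \<delta>"
  "\<forall>\<^sub>F th in at_right 0. 2 * B * exit_K B * (1 + sqrt (ln ((2 + th^4) / th^4))) * th powr (12 * \<epsilon>) < 1"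
 proof -
  have t: "((\<lambda>th::real. c * th^k) \<longlongrightarrow> 0) (at_right 0)" if "k > 0" for c and k :: nat
   using that by (auto intro!: tendsto_eq_intros)
  have lt: "\<forall>\<^sub>F th in at_right 0. f th < r" if "(f \<longlongrightarrow> 0) (at_right 0)" "r > 0" for f :: "real \<Rightarrow> real" and r
   by (rule order_tendstoD(2)[OF that])
  show "\<forall>\<^sub>F th in at_right 0. th < (1::real)" using lt[OF t[of 1 1]] by simp
  show "\<forall>\<^sub>F th in at_right 0. layer_S B * th^4 < 2"
   "\<forall>\<^sub>F th in at_right 0. 24 * B^2 * exp (layer_S B) * (layer_K B)^2 * th^8 < 1"
   "\<forall>\<^sub>F th in at_right 0. 288 * B^7 * energy_K B * th^2 < 1"
   "\<forall>\<^sub>F th in at_right 0. 4 * B * th^6 < 1" by (rule lt[OF t]; simp)+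
  show "\<forall>\<^sub>F th in at_right 0. exit_K B * th < 1 / 2" using lt[OF t[of 1 "exit_K B"], of "1 / 2"] by simp
  have "(\<rho> \<longlongrightarrow> 0) (at_right 0)" unfolding \<rho>_def[abs_def] by real_asymp
  from lt[OF this \<delta>(1)] show "\<forall>\<^sub>F th in at_right 0. \<rho> th < \<delta>" .
  have "((\<lambda>th. 2 * B * exit_K B * (1 + sqrt (ln ((2 + th^4) / th^4))) * th powr (12 * \<epsilon>)) \<longlongrightarrow> 0) (at_right 0)"
   using \<epsilon> by real_asymp
  from lt[OF this] show "\<forall>\<^sub>F th in at_right 0. 2 * B * exit_K B * (1 + sqrt (ln ((2 + th^4) / th^4))) * th powr (12 * \<epsilon>) < 1" by simp
 qed
 have "\<forall>\<^sub>F th in at_right 0. th < 1 \<and> small_at B th \<and> 4 * B * th^6 \<le> 1 \<and> exit_K B * th \<le> 1 / 2 \<and> \<rho> th \<le> \<delta> \<and>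
   2 * B * exit_K B * (1 + sqrt (ln ((2 + th^4) / th^4))) * th powr (12 * \<epsilon>) \<le> 1"
  using ev by eventually_elim (simp add: small_at_def)
 then obtain b where b: "b > 0" "\<And>th. 0 < th \<Longrightarrow> th < b \<Longrightarrow> th < 1 \<and> small_at B th \<and> 4 * B * th^6 \<le> 1 \<and> exit_K B * th \<le> 1 / 2 \<and> \<rho> th \<le> \<delta> \<and>
   2 * B * exit_K B * (1 + sqrt (ln ((2 + th^4) / th^4))) * th powr (12 * \<epsilon>) \<le> 1"
  unfolding eventually_at_right_field by blast
 show ?thesis
 proof (intro exI[of _ "b / 2"] conjI allI impI ballI)
  show "b / 2 > 0" using b(1) by simp
  fix th \<alpha> :: real assume th: "0 < th" "th \<le> b / 2" and \<alpha>: "\<alpha> \<in> {0..\<alpha>0}"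
  have c: "th < 1" "small_at B th" "4 * B * th^6 \<le> 1" "exit_K B * th \<le> 1 / 2" "\<rho> th \<le> \<delta>"
   "2 * B * exit_K B * (1 + sqrt (ln ((2 + th^4) / th^4))) * th powr (12 * \<epsilon>) \<le> 1"
   using b(2)[of th] th b(1) by auto
  interpret wall_profile V V1 V2 B th by (rule B0) (use B c th in auto)
  interpret shooting V V1 V2 B th nu0 \<delta> \<alpha>
  proof
   fix nu assume nu: "nu \<in> cball nu0 \<delta>"
   show "cmod nu \<le> B" if "nu \<in> cball nu0 \<delta>"
    using near[OF nu] norm_triangle_ineq2[of nu nu0] B(3) by (simp add: R_def)
   have nR: "cmod nu \<le> R" using near[OF nu] norm_triangle_ineq2[of nu nu0] by (simp add: R_def)
   have le: "x \<le> B * exp (- (2 * s))" if "x \<le> K * exp (- (2 * s))" "K \<le> B" for x K s :: real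
    by (rule order_trans[OF that(1) mult_right_mono[OF that(2)]]) simp
   show "cmod (tairy (nu - \<i> * of_real s)) \<le> B * exp (- (2 * s))" "cmod (tairy' (nu - \<i> * of_real s)) \<le> B * exp (- (2 * s))"
    "cmod (eig_fun (nu - \<i> * of_real s)) \<le> B * exp (- (2 * s))" if "s \<ge> 0" for s
    by (rule le[OF tairy_decay(1)[OF nR that] B(4)], rule le[OF tairy_decay(2)[OF nR that] B(4)], rule le[OF eig_fun_decay[OF nR that] B(5)])
   have "cmod (tairy nu - tairy nu0) < \<tau> / 2" by (rule d2(2)) (use near[OF nu] \<delta> in auto)
   then have "cmod (tairy nu) \<ge> \<tau> / 2" using norm_triangle_ineq2[of "tairy nu0" "tairy nu"] by (simp add: \<tau>_def norm_minus_commute)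
   moreover have "1 / B \<le> \<tau> / 2" using B(6) B(1) \<tau> by (simp add: field_simps)
   ultimately show "1 / B \<le> cmod (tairy nu)" by linarith
   have "cmod (eig_fun nu - eig_fun nu0 - (- tairy nu0) * (nu - nu0)) \<le> \<tau> / 2 * cmod (nu - nu0)"
    by (rule d1(2)) (use near[OF nu] \<delta> in auto)
   then show "cmod (eig_fun nu + tairy nu0 * (nu - nu0)) \<le> cmod (tairy nu0) / 2 * cmod (nu - nu0)" by (simp add: e0 \<tau>_def)
  next
   have "\<alpha>^2 \<le> \<alpha>0^2" using \<alpha> by (intro power_mono) auto
   then show "\<alpha>^2 \<le> B" using B(7) by linarith
   show "2 * B * (exit_K B * (1 + sqrt (ln ((2 + th^4) / th^4))) * th^2) \<le> \<delta>" using c(5) by (simp add: \<rho>_def)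
  qed (use c in auto)
  obtain nu u u1 w w1 where nu: "nu \<in> cball nu0 (\<rho> th)"
   and s: "os_system nu \<alpha> u u1 w w1" "u 0 = 0" "u1 0 = 0" "u 2 = 0" "u1 2 = 0" "w 0 = 1"
   using shooting unfolding \<rho>_def by blast
  define \<Lambda> where "\<Lambda> = \<i> * of_real (U (-1)) + of_real (th^4) * nu"
  have "nontrivial_kernel {-1<..<1} OS_dom (OS_op U \<Lambda> \<alpha> (1 / th^12))"
   unfolding \<Lambda>_def by (rule os_eigenfunction[OF s]) (simp_all add: V_def V2_def)
  moreover have "cmod (\<Lambda> - of_real (th^4) * nu0 - \<i> * of_real (U (-1))) \<le> (1 / th^12) powr (- 1/2 + \<epsilon>)"
  proof -
   have "\<Lambda> - of_real (th^4) * nu0 - \<i> * of_real (U (-1)) = of_real (th^4) * (nu - nu0)"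
    by (simp add: \<Lambda>_def right_diff_distrib)
   then have "cmod (\<Lambda> - of_real (th^4) * nu0 - \<i> * of_real (U (-1))) = th^4 * cmod (nu - nu0)"
    using th by (simp add: norm_mult norm_power)
   also have "\<dots> \<le> th^4 * \<rho> th"
    using nu th by (intro mult_left_mono) (auto simp: dist_norm norm_minus_commute)
   also have "\<dots> = 2 * B * exit_K B * (1 + sqrt (ln ((2 + th^4) / th^4))) * th^6"
    by (simp add: \<rho>_def mult_ac flip: power_add)
   \<comment> \<open>\<open>th^4\<close> times the radius is of order
     \<open>th^6 = \<beta> powr (-1/2)\<close> up to the logarithm. Splitting off
     \<open>th powr (12 * \<epsilon>)\<close> isolates the factor that is at most 1.\<close>
   also have "\<dots> = (2 * B * exit_K B * (1 + sqrt (ln ((2 + th^4) / th^4))) * th powr (12 * \<epsilon>)) * th powr (6 - 12 * \<epsilon>)"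
   proof -
    have "th powr (12 * \<epsilon>) * th powr (6 - 12 * \<epsilon>) = th powr 6" by (simp flip: powr_add)
    also have "\<dots> = th^6" using th by simp
    finally show ?thesis by (simp only: mult.assoc)
   qed
   also have "\<dots> \<le> 1 * th powr (6 - 12 * \<epsilon>)" by (rule mult_right_mono[OF c(6)]) simp
   also have "\<dots> = (1 / th^12) powr (- 1/2 + \<epsilon>)"
   proof -
    have "1 / th^12 = th powr (- 12)" using th by (simp add: powr_minus inverse_eq_divide)
    then have "(1 / th^12) powr (- 1/2 + \<epsilon>) = th powr (- 12 * (- 1/2 + \<epsilon>))" by (simp only: powr_powr)
    also have "- 12 * (- 1/2 + \<epsilon>) = 6 - 12 * \<epsilon>" by simp
    finally show ?thesis by simp
   qed
   finally show ?thesis .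
  qed
  ultimately show "\<exists>\<Lambda>. cmod (\<Lambda> - of_real (th^4) * nu0 - \<i> * of_real (U (-1))) \<le> (1 / th^12) powr (- 1/2 + \<epsilon>) \<and>
   nontrivial_kernel {-1<..<1} OS_dom (OS_op U \<Lambda> \<alpha> (1 / th^12))" by blast
 qed
qed

theorem theorem1p1:
  fixes U :: "real \<Rightarrow> real"
  assumes "C_class_on 4 {-1..1} U"
    and "\<forall>x\<in>{-1<..1}. U x > U (-1)"
    and "deriv_within {-1..1} U (-1) = 1"
  shows "\<forall>\<alpha>\<^sub>0>0. \<forall>\<epsilon>>0. \<exists>\<beta>\<^sub>0>0. \<forall>\<beta>\<ge>\<beta>\<^sub>0. \<forall>\<alpha>\<in>{0..\<alpha>\<^sub>0}. \<exists>\<Lambda>::complex.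
           cmod (\<Lambda> - lambda0 \<beta> - \<i> * of_real (U (-1))) \<le> \<beta> powr (- 1/2 + \<epsilon>) \<and>
           nontrivial_kernel {-1<..<1} OS_dom (OS_op U \<Lambda> \<alpha> \<beta>)"
proof (intro allI impI)
 fix \<alpha>0 \<epsilon> :: real assume \<epsilon>: "\<epsilon> > 0"
 obtain \<Theta> where \<Theta>: "\<And>nu. nu \<in> leftmost_zeros \<Longrightarrow> \<Theta> nu > 0"
  "\<And>nu th \<alpha>. nu \<in> leftmost_zeros \<Longrightarrow> 0 < th \<Longrightarrow> th \<le> \<Theta> nu \<Longrightarrow> \<alpha> \<in> {0..\<alpha>0} \<Longrightarrow> \<exists>\<Lambda>.
   cmod (\<Lambda> - of_real (th^4) * nu - \<i> * of_real (U (-1))) \<le> (1 / th^12) powr (- 1/2 + \<epsilon>) \<and>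
   nontrivial_kernel {-1<..<1} OS_dom (OS_op U \<Lambda> \<alpha> (1 / th^12))"
  using kernel_near_leftmost_zero[OF assms _ \<epsilon>, of _ \<alpha>0] by metis
 \<comment> \<open>The zero that belongs to \<open>lambda0 \<beta>\<close> may change with
   \<open>\<beta>\<close>; a minimum over the finite set gives one threshold for all of them, and
   the inserted 1 makes the set visibly nonempty.\<close>
 define m where "m = Min (insert 1 (\<Theta> ` leftmost_zeros))"
 have fin: "finite (insert 1 (\<Theta> ` leftmost_zeros))" using finite_leftmost_zeros by simp
 have "m \<in> insert 1 (\<Theta> ` leftmost_zeros)" unfolding m_def by (rule Min_in[OF fin]) simp
 then have m0: "m > 0" using \<Theta>(1) by auto
 have m: "m \<le> \<Theta> nu" if "nu \<in> leftmost_zeros" for nu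
  unfolding m_def by (rule Min_le[OF fin]) (use that in auto)
 show "\<exists>\<beta>0>0. \<forall>\<beta>\<ge>\<beta>0. \<forall>\<alpha>\<in>{0..\<alpha>0}. \<exists>\<Lambda>::complex.
      cmod (\<Lambda> - lambda0 \<beta> - \<i> * of_real (U (-1))) \<le> \<beta> powr (- 1/2 + \<epsilon>) \<and>
      nontrivial_kernel {-1<..<1} OS_dom (OS_op U \<Lambda> \<alpha> \<beta>)"
 proof (intro exI[of _ "1 / m^12"] conjI allI impI ballI)
  show "1 / m^12 > 0" using m0 by simp
  fix \<beta> \<alpha> :: real assume \<beta>: "\<beta> \<ge> 1 / m^12" and \<alpha>: "\<alpha> \<in> {0..\<alpha>0}"
  have \<beta>0: "\<beta> > 0" using \<beta> m0 by (meson less_le_trans zero_less_divide_1_iff zero_less_power)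
  \<comment> \<open>The twelfth root makes \<open>h = th^4\<close> the cube root of
    \<open>1 / \<beta>\<close> and \<open>th^6\<close> its square root, so every layer width is an
    integer power; \<open>\<beta> \<ge> 1 / m^12\<close> says \<open>th \<le> m\<close>.\<close>
  define th where "th = root 12 (1 / \<beta>)"
  have th: "th > 0" "th^12 = 1 / \<beta>" using \<beta>0 by (simp_all add: th_def)
  have "th^12 \<le> m^12" using \<beta> \<beta>0 m0 by (simp add: th field_simps)
  then have tm: "th \<le> m" by (rule power_le_imp_le_base[of _ 11, simplified]) (use m0 in auto)
  have b12: "1 / th^12 = \<beta>" using th by simp
  have b4: "1 / (th^4)^3 = \<beta>" using b12 by (simp flip: power_mult)
  obtain nu where nu: "nu \<in> leftmost_zeros" "lambda0 \<beta> = of_real (th^4) * nu"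
   using lambda0_eq[of "th^4"] th unfolding b4 by auto
  show "\<exists>\<Lambda>::complex. cmod (\<Lambda> - lambda0 \<beta> - \<i> * of_real (U (-1))) \<le> \<beta> powr (- 1/2 + \<epsilon>) \<and>
      nontrivial_kernel {-1<..<1} OS_dom (OS_op U \<Lambda> \<alpha> \<beta>)"
   using \<Theta>(2)[OF nu(1) th(1) order_trans[OF tm m[OF nu(1)]] \<alpha>] unfolding b12 nu(2) .
 qed
qed

end
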